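(* Let $\Bbbk$ be a field of characteristic zero, let $A$ be a noetherian Artin–Schelter (AS) regular domain over $\Bbbk$ generated in degree 1, let $G$ be a finite group coacting on $A$ inner faithfully as a dual reflection group, and let $H=\Bbbk^G$. Let $\{f_g\}_{g\in G}$, $\Re$, $m$ and $\mathfrak{p}(t)$ be as described in the context, and let $A^{cov\,H}:=A/((A^H)_{\ge1})$ be the covariant ring. (1) The covariant ring $A^{cov\,H}$ is Frobenius of dimension $|G|$. (2) The Hilbert series of $A^{cov\,H}$ is $\mathfrak{p}(t)$. As a consequence, the coefficients of $\mathfrak{p}(t)$ are positive and the coefficient of the leading term of $\mathfrak{p}(t)$ is 1. (3) Let $\overline{f}_g$ be the image of $f_g$ in $A^{cov\,H}$ for each $g\in G$. Then $\{\overline{f}_g\mid g\in G\}$ is a $\Bbbk$-linear basis of $A^{cov\,H}$ and the graded Nakayama automorphism of $A^{cov\,H}$ is of the form $$\mu_{A^{cov\,H}}:\ \overline{f}_g\mapsto\beta(g)\,\overline{f}_{mgm^{-1}}\quad\text{for all }g\in G,$$ where $\{\beta(g)\}_{g\in G}$ are some nonzero scalars in $\Bbbk$. (4) The scalars in part (3) satisfy $\beta(m)=1$, and if $m$ commutes with $g$ and $h$ and $l_{\Re}(gh)=l_{\Re}(g)+l_{\Re}(h)$, then $\beta(gh)=\beta(g)\beta(h)$.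
   Context: All vector spaces and algebras are over $\Bbbk$. $A$ is connected graded if $A=\Bbbk\oplus A_1\oplus A_2\oplus\cdots$ with $A_iA_j\subseteq A_{i+j}$; $H_A(t)=\sum_i(\dim_\Bbbk A_i)t^i$ is its Hilbert series. A connected graded $A$ is AS Gorenstein if it has finite injective dimension $d$ on both sides, $\mathrm{Ext}^i_A({}_A\Bbbk,{}_AA)=\mathrm{Ext}^i_A(\Bbbk_A,A_A)=0$ for $i\ne d$, and $\mathrm{Ext}^d_A({}_A\Bbbk,{}_AA)\cong\mathrm{Ext}^d_A(\Bbbk_A,A_A)\cong\Bbbk(\mathfrak{l})$ for some integer $\mathfrak{l}$. It is AS regular if moreover it has finite global dimension and finite Gelfand–Kirillov dimension. $\Bbbk^G=\bigoplus_{g\in G}\Bbbk p_g$ is the Hopf algebra dual to $\Bbbk G$, with $p_gp_h=\delta_{g,h}p_g$, $1=\sum_gp_g$, $\Delta(p_g)=\sum_hp_h\otimes p_{h^{-1}g}$, $\epsilon(p_g)=\delta_{e,g}$, $e$ the unit of $G$. A homogeneous action of $\Bbbk^G$ on $A$ (equivalently a homogeneous $\Bbbk G$-coaction) is the same as a $G$-grading $A=\bigoplus_gA_g$ compatible with the $\mathbb{N}$-grading, with $A_g=p_g\cdot A$; the fixed subring is $A^{\Bbbk^G}=A_e$. It is inner faithful if no nonzero Hopf ideal of $\Bbbk^G$ annihilates $A$ (equivalently, $\{g:A_g\ne0\}$ generates $G$). $G$ coacts on $A$ as a dual reflection group if $\Bbbk^G$ acts homogeneously and inner faithfully on the noetherian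 AS regular domain $A$ generated in degree 1 and $A^{\Bbbk^G}$ is AS regular. Mass element $m$: with $d$ the injective dimension of $A$, the one-dimensional space $\mathrm{Ext}^d_A({}_A\Bbbk,A)$ (computed with $\mathbb{Z}\times G$-graded modules, a homomorphism $f:M\to N$ of left modules having $G$-degree $k$ if $f(M_h)\subseteq N_{hk}$ for all $h$) is spanned by a $G$-homogeneous element $u$; the homological codeterminant $D\in G$ satisfies $\deg_G(u)=D^{-1}$, and $m:=D^{-1}$. Notation: $\{f_g\mid g\in G\}\subseteq A$ is a set of homogeneous elements with $f_e=1$ and $A_g=f_gA^H=A^Hf_g$ for all $g$; $\Re$ is the generating subset of $G$ with $e\notin\Re$ and $A_1=\bigoplus_{g\in\Re}\Bbbk f_g\oplus(A_1\cap A^H)$ (such $f_g$ and $\Re$ exist in this setting); $l_\Re(g)=\min\{n\mid g=v_1\cdots v_n,\ v_i\in\Re\}$, $l_\Re(e)=0$; $\mathfrak{p}(t)=H_A(t)H_{A^H}(t)^{-1}$, a polynomial. $((A^H)_{\ge1})$ is the two-sided ideal of $A$ generated by homogeneous elements of $A^H$ of positive degree. A finite-dimensional connected graded algebra $C$ is Frobenius if it has a nondegenerate associative bilinear form $\langle-,-\rangle:C\times C\to\Bbbk$, graded of some degree $-\mathfrak{l}$; its (unique) graded Nakayama automorphism $\mu_C$ is the graded algebra automorphism with $\langle a,b\rangle=\langle\mu_C(b),a\rangle$ for all $a,b\in C$. *)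

theory Defs
  imports
    "HOL-Algebra.Elementary_Groups"
    "HOL-Algebra.Generated_Groups"
    "HOL-Algebra.QuotRing"
    "HOL-Algebra.Subrings"
    "Jordan_Normal_Form.Missing_VectorSpace"
    "HOL-Computational_Algebra.Polynomial_FPS"
    "HOL-Library.Extended_Real"
begin

section \<open>Algebras over a field\<close>

definition k_algebra :: "'k ring \<Rightarrow> ('k, 'a) module \<Rightarrow> bool" where
  "k_algebra K A \<longleftrightarrow> vectorspace K A \<and> ring A \<and>
     (\<forall>c\<in>carrier K. \<forall>x\<in>carrier A. \<forall>y\<in>carrier A.
        (c \<odot>\<^bsub>A\<^esub> x) \<otimes>\<^bsub>A\<^esub> y = c \<odot>\<^bsub>A\<^esub> (x \<otimes>\<^bsub>A\<^esub> y) \<and>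
        x \<otimes>\<^bsub>A\<^esub> (c \<odot>\<^bsub>A\<^esub> y) = c \<odot>\<^bsub>A\<^esub> (x \<otimes>\<^bsub>A\<^esub> y))"

text \<open>Right modules, right ideals etc. over \<open>A\<close> are treated as left ones over the opposite algebra.\<close>

definition opposite :: "('k, 'a) module \<Rightarrow> ('k, 'a) module" where
  "opposite A = A\<lparr>monoid.mult := (\<lambda>x y. y \<otimes>\<^bsub>A\<^esub> x)\<rparr>"

text \<open>The quotient of a vector space or algebra \<open>V\<close> by \<open>W\<close>; its ring part is \<open>V Quot W\<close>.\<close>

definition quotient :: "('k, 'v) module \<Rightarrow> 'v set \<Rightarrow> ('k, 'v set) module" where
  "quotient V W =
     \<lparr>carrier = a_rcosets\<^bsub>V\<^esub> W, monoid.mult = rcoset_mult V W, one = W +>\<^bsub>V\<^esub> \<one>\<^bsub>V\<^esub>,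
      zero = W, add = set_add V, module.smult = (\<lambda>c X. \<Union>x\<in>X. W +>\<^bsub>V\<^esub> (c \<odot>\<^bsub>V\<^esub> x))\<rparr>"

definition vs_iso :: "'k ring \<Rightarrow> ('k, 'v) module \<Rightarrow> ('k, 'w) module \<Rightarrow> bool" where
  "vs_iso K V W \<longleftrightarrow> (\<exists>f \<in> LinearCombinations.module_hom K V W. bij_betw f (carrier V) (carrier W))"

definition decomposes ::
    "('k, 'v) module \<Rightarrow> 'i set \<Rightarrow> ('i \<Rightarrow> 'v set) \<Rightarrow> 'v \<Rightarrow> ('i \<Rightarrow> 'v) \<Rightarrow> bool" where
  "decomposes V I W v a \<longleftrightarrow> a \<in> (\<Pi>\<^sub>E i\<in>I. W i) \<and> finite {i \<in> I. a i \<noteq> \<zero>\<^bsub>V\<^esub>} \<and>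
     v = (\<Oplus>\<^bsub>V\<^esub>i\<in>{i \<in> I. a i \<noteq> \<zero>\<^bsub>V\<^esub>}. a i)"

definition internal_direct_sum ::
    "'k ring \<Rightarrow> ('k, 'v) module \<Rightarrow> 'i set \<Rightarrow> ('i \<Rightarrow> 'v set) \<Rightarrow> bool" where
  "internal_direct_sum K V I W \<longleftrightarrow> (\<forall>i\<in>I. VectorSpace.subspace K (W i) V) \<and>
     (\<forall>v\<in>carrier V. \<exists>!a. decomposes V I W v a)"

definition component ::
    "('k, 'v) module \<Rightarrow> 'i set \<Rightarrow> ('i \<Rightarrow> 'v set) \<Rightarrow> 'v \<Rightarrow> 'i \<Rightarrow> 'v" where
  "component V I W v = (THE a. decomposes V I W v a)"

definition connected_graded :: "'k ring \<Rightarrow> ('k, 'a) module \<Rightarrow> (nat \<Rightarrow> 'a set) \<Rightarrow> bool" where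
  "connected_graded K A Adeg \<longleftrightarrow> k_algebra K A \<and> \<one>\<^bsub>A\<^esub> \<noteq> \<zero>\<^bsub>A\<^esub> \<and>
     internal_direct_sum K A UNIV Adeg \<and>
     (\<forall>i j. \<forall>x\<in>Adeg i. \<forall>y\<in>Adeg j. x \<otimes>\<^bsub>A\<^esub> y \<in> Adeg (i + j)) \<and>
     Adeg 0 = {c \<odot>\<^bsub>A\<^esub> \<one>\<^bsub>A\<^esub> | c. c \<in> carrier K}"

definition hilbert_series :: "'k ring \<Rightarrow> ('k, 'a) module \<Rightarrow> (nat \<Rightarrow> 'a set) \<Rightarrow> rat fps" where
  "hilbert_series K A Adeg = Abs_fps (\<lambda>i. of_nat (vectorspace.dim K (A\<lparr>carrier := Adeg i\<rparr>)))"

definition generated_in_degree_1 ::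
    "'k ring \<Rightarrow> ('k, 'a) module \<Rightarrow> (nat \<Rightarrow> 'a set) \<Rightarrow> bool" where
  "generated_in_degree_1 K A Adeg \<longleftrightarrow>
     (\<forall>S. subring S A \<and> VectorSpace.subspace K S A \<and> Adeg 1 \<subseteq> S \<longrightarrow> S = carrier A)"

definition nc_domain :: "('k, 'a) module \<Rightarrow> bool" where
  "nc_domain A \<longleftrightarrow> ring A \<and> \<one>\<^bsub>A\<^esub> \<noteq> \<zero>\<^bsub>A\<^esub> \<and>
     (\<forall>x\<in>carrier A. \<forall>y\<in>carrier A. x \<otimes>\<^bsub>A\<^esub> y = \<zero>\<^bsub>A\<^esub> \<longrightarrow> x = \<zero>\<^bsub>A\<^esub> \<or> y = \<zero>\<^bsub>A\<^esub>)"

definition left_ideal :: "('k, 'a) module \<Rightarrow> 'a set \<Rightarrow> bool" where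
  "left_ideal A I \<longleftrightarrow> additive_subgroup I A \<and> (\<forall>a\<in>carrier A. \<forall>x\<in>I. a \<otimes>\<^bsub>A\<^esub> x \<in> I)"

definition left_noetherian :: "('k, 'a) module \<Rightarrow> bool" where
  "left_noetherian A \<longleftrightarrow> (\<forall>I. left_ideal A I \<longrightarrow>
     (\<exists>S. finite S \<and> S \<subseteq> carrier A \<and> I = \<Inter>{J. left_ideal A J \<and> S \<subseteq> J}))"

definition nc_noetherian :: "('k, 'a) module \<Rightarrow> bool" where
  "nc_noetherian A \<longleftrightarrow> left_noetherian A \<and> left_noetherian (opposite A)"

text \<open>\<open>sup\<^sub>V limsup\<^sub>n log\<^sub>n dim (\<Sum>\<^bsub>i\<le>n\<^esub> V\<^sup>i)\<close> over the finite-dimensional subspaces \<open>V\<close>.\<close>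

definition gk_dim :: "'k ring \<Rightarrow> ('k, 'a) module \<Rightarrow> ereal" where
  "gk_dim K A =
     (SUP V \<in> {V. VectorSpace.subspace K V A \<and> vectorspace.fin_dim K (A\<lparr>carrier := V\<rparr>)}.
        limsup (\<lambda>n. ereal (log (real n) (real (vectorspace.dim K (A\<lparr>carrier :=
          LinearCombinations.module.span K A {foldr (\<otimes>\<^bsub>A\<^esub>) vs \<one>\<^bsub>A\<^esub> | vs. set vs \<subseteq> V \<and> length vs \<le> n}\<rparr>))))))"


section \<open>Modules and homological dimensions\<close>

definition left_module :: "('a, 'r) ring_scheme \<Rightarrow> ('a, 'b) module \<Rightarrow> bool" where
  "left_module A M \<longleftrightarrow> ring A \<and> abelian_group M \<and>
     (\<forall>a\<in>carrier A. \<forall>x\<in>carrier M. a \<odot>\<^bsub>M\<^esub> x \<in> carrier M) \<and>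
     (\<forall>a\<in>carrier A. \<forall>b\<in>carrier A. \<forall>x\<in>carrier M.
        (a \<oplus>\<^bsub>A\<^esub> b) \<odot>\<^bsub>M\<^esub> x = a \<odot>\<^bsub>M\<^esub> x \<oplus>\<^bsub>M\<^esub> b \<odot>\<^bsub>M\<^esub> x) \<and>
     (\<forall>a\<in>carrier A. \<forall>x\<in>carrier M. \<forall>y\<in>carrier M.
        a \<odot>\<^bsub>M\<^esub> (x \<oplus>\<^bsub>M\<^esub> y) = a \<odot>\<^bsub>M\<^esub> x \<oplus>\<^bsub>M\<^esub> a \<odot>\<^bsub>M\<^esub> y) \<and>
     (\<forall>a\<in>carrier A. \<forall>b\<in>carrier A. \<forall>x\<in>carrier M.
        (a \<otimes>\<^bsub>A\<^esub> b) \<odot>\<^bsub>M\<^esub> x = a \<odot>\<^bsub>M\<^esub> (b \<odot>\<^bsub>M\<^esub> x)) \<and>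
     (\<forall>x\<in>carrier M. \<one>\<^bsub>A\<^esub> \<odot>\<^bsub>M\<^esub> x = x)"

definition left_submodule :: "('a, 'r) ring_scheme \<Rightarrow> 'b set \<Rightarrow> ('a, 'b) module \<Rightarrow> bool" where
  "left_submodule A L M \<longleftrightarrow> additive_subgroup L M \<and> (\<forall>a\<in>carrier A. \<forall>x\<in>L. a \<odot>\<^bsub>M\<^esub> x \<in> L)"

definition regular_module :: "('a, 'r) ring_scheme \<Rightarrow> ('a, 'a) module" where
  "regular_module A = \<lparr>carrier = carrier A, monoid.mult = (\<otimes>\<^bsub>A\<^esub>), one = \<one>\<^bsub>A\<^esub>,
     zero = \<zero>\<^bsub>A\<^esub>, add = (\<oplus>\<^bsub>A\<^esub>), module.smult = (\<otimes>\<^bsub>A\<^esub>)\<rparr>"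

text \<open>
  Quantification over modules needs a fixed carrier type. For infinite \<open>A\<close> every \<open>A\<close>-module of
  cardinality at most \<open>2^2^|A|\<close> is isomorphic to one in the following type. It is therefore closed
  under free covers of its members, contains all cyclic modules, and contains an injective
  resolution of \<open>A\<close> (the terms \<open>Hom\<^sub>K (A\<^bsup>\<otimes>n\<^esup>, A)\<close> and their subquotients). By the criteria of Baer
  and Auslander, injectivity and injective dimension of \<open>A\<close>, projectivity, and global dimension
  relative to this type are the absolute ones.
\<close>

type_synonym 'a small_module = "('a, ('a \<Rightarrow> 'a) set) module"

definition injective_module :: "('a, 'r) ring_scheme \<Rightarrow> 'a small_module \<Rightarrow> bool" where
  "injective_module A E \<longleftrightarrow> left_module A E \<and>
     (\<forall>(M :: 'a small_module) L f. left_module A M \<and> left_submodule A L M \<and>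
        f \<in> LinearCombinations.module_hom A (M\<lparr>carrier := L\<rparr>) E \<longrightarrow>
        (\<exists>h \<in> LinearCombinations.module_hom A M E. \<forall>x\<in>L. h x = f x))"

definition projective_module :: "('a, 'r) ring_scheme \<Rightarrow> 'a small_module \<Rightarrow> bool" where
  "projective_module A P \<longleftrightarrow> left_module A P \<and>
     (\<forall>(M :: 'a small_module) (N :: 'a small_module) p f.
        left_module A M \<and> left_module A N \<and> p \<in> LinearCombinations.module_hom A M N \<and>
        p ` carrier M = carrier N \<and> f \<in> LinearCombinations.module_hom A P N \<longrightarrow>
        (\<exists>h \<in> LinearCombinations.module_hom A P M. \<forall>x\<in>carrier P. p (h x) = f x))"

definition hom_kernel :: "('a, 'b) module \<Rightarrow> ('a, 'c) module \<Rightarrow> ('b \<Rightarrow> 'c) \<Rightarrow> 'b set" where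
  "hom_kernel M N f = {x \<in> carrier M. f x = \<zero>\<^bsub>N\<^esub>}"

text \<open>\<open>0 \<rightarrow> N \<rightarrow> E 0 \<rightarrow> E 1 \<rightarrow> \<dots>\<close> exact.\<close>

definition injective_resolution ::
    "('a, 'r) ring_scheme \<Rightarrow> ('a, 'b) module \<Rightarrow> (nat \<Rightarrow> 'a small_module) \<Rightarrow>
     ('b \<Rightarrow> ('a \<Rightarrow> 'a) set) \<Rightarrow> (nat \<Rightarrow> ('a \<Rightarrow> 'a) set \<Rightarrow> ('a \<Rightarrow> 'a) set) \<Rightarrow> bool" where
  "injective_resolution A N E \<eta> d \<longleftrightarrow>
     (\<forall>i. injective_module A (E i) \<and> d i \<in> LinearCombinations.module_hom A (E i) (E (Suc i))) \<and>
     \<eta> \<in> LinearCombinations.module_hom A N (E 0) \<and> inj_on \<eta> (carrier N) \<and>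
     \<eta> ` carrier N = hom_kernel (E 0) (E 1) (d 0) \<and>
     (\<forall>i. d i ` carrier (E i) = hom_kernel (E (Suc i)) (E (Suc (Suc i))) (d (Suc i)))"

text \<open>\<open>\<dots> \<rightarrow> P 1 \<rightarrow> P 0 \<rightarrow> M \<rightarrow> 0\<close> exact.\<close>

definition projective_resolution ::
    "('a, 'r) ring_scheme \<Rightarrow> ('a, 'b) module \<Rightarrow> (nat \<Rightarrow> 'a small_module) \<Rightarrow>
     (('a \<Rightarrow> 'a) set \<Rightarrow> 'b) \<Rightarrow> (nat \<Rightarrow> ('a \<Rightarrow> 'a) set \<Rightarrow> ('a \<Rightarrow> 'a) set) \<Rightarrow> bool" where
  "projective_resolution A M P \<epsilon> d \<longleftrightarrow>
     (\<forall>i. projective_module A (P i) \<and> d i \<in> LinearCombinations.module_hom A (P (Suc i)) (P i)) \<and>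
     \<epsilon> \<in> LinearCombinations.module_hom A (P 0) M \<and> \<epsilon> ` carrier (P 0) = carrier M \<and>
     d 0 ` carrier (P 1) = hom_kernel (P 0) M \<epsilon> \<and>
     (\<forall>i. d (Suc i) ` carrier (P (Suc (Suc i))) = hom_kernel (P (Suc i)) (P i) (d i))"

definition inj_dim :: "('a, 'r) ring_scheme \<Rightarrow> ('a, 'b) module \<Rightarrow> enat" where
  "inj_dim A N = (INF n \<in> {n. \<exists>E \<eta> d. injective_resolution A N E \<eta> d \<and>
     (\<forall>i>n. carrier (E i) = {\<zero>\<^bsub>E i\<^esub>})}. enat n)"

definition proj_dim :: "('a, 'r) ring_scheme \<Rightarrow> ('a, 'b) module \<Rightarrow> enat" where
  "proj_dim A M = (INF n \<in> {n. \<exists>P \<epsilon> d. projective_resolution A M P \<epsilon> d \<and>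
     (\<forall>i>n. carrier (P i) = {\<zero>\<^bsub>P i\<^esub>})}. enat n)"

definition left_global_dim :: "('a, 'r) ring_scheme \<Rightarrow> enat" where
  "left_global_dim A = (SUP M \<in> {M :: 'a small_module. left_module A M}. proj_dim A M)"


section \<open>Graded Ext\<close>

text \<open>
  Ext over a \<open>K\<close>-algebra \<open>A\<close> is computed with the bar resolution of \<open>M\<close>, whose \<open>n\<close>-th term is the
  free module \<open>A \<otimes> A\<^bsup>\<otimes>n\<^esup> \<otimes> M\<close> (tensor products over the field \<open>K\<close>). Under
  \<open>Hom\<^sub>A (A \<otimes> A\<^bsup>\<otimes>n\<^esup> \<otimes> M, N) = Hom\<^sub>K (A\<^bsup>\<otimes>n\<^esup> \<otimes> M, N)\<close> an \<open>n\<close>-cochain is a \<open>K\<close>-multilinear function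
  of \<open>([a\<^sub>1, \<dots>, a\<^sub>n], m)\<close>. The field acts on modules through \<open>c \<mapsto> c 1\<^sub>A\<close>.
\<close>

definition bar_domain :: "('k, 'a) module \<Rightarrow> ('a, 'b) module \<Rightarrow> nat \<Rightarrow> ('a list \<times> 'b) set" where
  "bar_domain A M n = {as. set as \<subseteq> carrier A \<and> length as = n} \<times> carrier M"

definition scal :: "('k, 'a) module \<Rightarrow> ('a, 'b) module \<Rightarrow> 'k \<Rightarrow> 'b \<Rightarrow> 'b" where
  "scal A M c x = (c \<odot>\<^bsub>A\<^esub> \<one>\<^bsub>A\<^esub>) \<odot>\<^bsub>M\<^esub> x"

definition bar_cochains ::
    "'k ring \<Rightarrow> ('k, 'a) module \<Rightarrow> ('a, 'b) module \<Rightarrow> ('a, 'c) module \<Rightarrow> nat \<Rightarrow>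
     ('a list \<times> 'b \<Rightarrow> 'c) set" where
  "bar_cochains K A M N n = {\<phi> \<in> bar_domain A M n \<rightarrow>\<^sub>E carrier N.
     \<forall>(as, m) \<in> bar_domain A M n.
       (\<forall>i<n. \<forall>a\<in>carrier A. \<forall>b\<in>carrier A.
          \<phi> (as[i := a \<oplus>\<^bsub>A\<^esub> b], m) = \<phi> (as[i := a], m) \<oplus>\<^bsub>N\<^esub> \<phi> (as[i := b], m)) \<and>
       (\<forall>i<n. \<forall>a\<in>carrier A. \<forall>c\<in>carrier K.
          \<phi> (as[i := c \<odot>\<^bsub>A\<^esub> a], m) = scal A N c (\<phi> (as[i := a], m))) \<and>
       (\<forall>m'\<in>carrier M. \<phi> (as, m \<oplus>\<^bsub>M\<^esub> m') = \<phi> (as, m) \<oplus>\<^bsub>N\<^esub> \<phi> (as, m')) \<and>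
       (\<forall>c\<in>carrier K. \<phi> (as, scal A M c m) = scal A N c (\<phi> (as, m)))}"

definition signed :: "('a, 'c) module \<Rightarrow> nat \<Rightarrow> 'c \<Rightarrow> 'c" where
  "signed N i x = (if even i then x else \<ominus>\<^bsub>N\<^esub> x)"

text \<open>\<open>a\<^sub>0 \<phi>(a\<^sub>1,\<dots>,a\<^sub>n; m) + \<Sum>\<^bsub>1\<le>i\<le>n\<^esub> (-1)\<^sup>i \<phi>(a\<^sub>0,\<dots>,a\<^bsub>i-1\<^esub>a\<^sub>i,\<dots>,a\<^sub>n; m) + (-1)\<^bsup>n+1\<^esup> \<phi>(a\<^sub>0,\<dots>,a\<^bsub>n-1\<^esub>; a\<^sub>n m)\<close>\<close>

definition bar_differential ::
    "('k, 'a) module \<Rightarrow> ('a, 'b) module \<Rightarrow> ('a, 'c) module \<Rightarrow> nat \<Rightarrow>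
     ('a list \<times> 'b \<Rightarrow> 'c) \<Rightarrow> ('a list \<times> 'b \<Rightarrow> 'c)" where
  "bar_differential A M N n \<phi> = (\<lambda>(as, m) \<in> bar_domain A M (Suc n).
     (hd as \<odot>\<^bsub>N\<^esub> \<phi> (tl as, m))
     \<oplus>\<^bsub>N\<^esub> (\<Oplus>\<^bsub>N\<^esub>i\<in>{1..n}. signed N i
            (\<phi> (take (i - 1) as @ [as ! (i - 1) \<otimes>\<^bsub>A\<^esub> as ! i] @ drop (i + 1) as, m)))
     \<oplus>\<^bsub>N\<^esub> signed N (Suc n) (\<phi> (butlast as, last as \<odot>\<^bsub>M\<^esub> m)))"

text \<open>
  Let \<open>A\<close>, \<open>M\<close>, \<open>N\<close> be graded by a group \<open>\<Gamma>\<close>, with components \<open>dA\<close>, \<open>dM\<close>, \<open>dN\<close>. A homomorphism \<open>f\<close>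
  of left modules has degree \<open>\<kappa>\<close> if it maps the component of degree \<open>h\<close> into that of degree \<open>h \<kappa>\<close>;
  in the bar resolution, \<open>a\<^sub>1 \<otimes> \<dots> \<otimes> a\<^sub>n \<otimes> m\<close> has the product of the degrees, in this order.
\<close>

definition homogeneous_cochains ::
    "'k ring \<Rightarrow> ('k, 'a) module \<Rightarrow> ('g, 's) monoid_scheme \<Rightarrow> ('g \<Rightarrow> 'a set) \<Rightarrow>
     ('a, 'b) module \<Rightarrow> ('g \<Rightarrow> 'b set) \<Rightarrow> ('a, 'c) module \<Rightarrow> ('g \<Rightarrow> 'c set) \<Rightarrow>
     nat \<Rightarrow> 'g \<Rightarrow> ('a list \<times> 'b \<Rightarrow> 'c) set" where
  "homogeneous_cochains K A \<Gamma> dA M dM N dN n \<kappa> = {\<phi> \<in> bar_cochains K A M N n.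
     \<forall>\<gamma>s as h m. length as = n \<and> list_all2 (\<lambda>\<gamma> a. \<gamma> \<in> carrier \<Gamma> \<and> a \<in> dA \<gamma>) \<gamma>s as \<and>
       h \<in> carrier \<Gamma> \<and> m \<in> dM h \<longrightarrow> \<phi> (as, m) \<in> dN (foldr (\<otimes>\<^bsub>\<Gamma>\<^esub>) \<gamma>s (h \<otimes>\<^bsub>\<Gamma>\<^esub> \<kappa>))}"

definition zero_cochain ::
    "('k, 'a) module \<Rightarrow> ('a, 'b) module \<Rightarrow> ('a, 'c) module \<Rightarrow> nat \<Rightarrow> ('a list \<times> 'b \<Rightarrow> 'c)" where
  "zero_cochain A M N n = (\<lambda>_ \<in> bar_domain A M n. \<zero>\<^bsub>N\<^esub>)"

text \<open>The multiplicative fields of this vector space are irrelevant.\<close>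

definition cochain_space ::
    "('k, 'a) module \<Rightarrow> ('a, 'b) module \<Rightarrow> ('a, 'c) module \<Rightarrow> nat \<Rightarrow>
     ('a list \<times> 'b \<Rightarrow> 'c) set \<Rightarrow> ('k, 'a list \<times> 'b \<Rightarrow> 'c) module" where
  "cochain_space A M N n S = \<lparr>carrier = S,
     monoid.mult = (\<lambda>_ _. zero_cochain A M N n), one = zero_cochain A M N n,
     zero = zero_cochain A M N n,
     add = (\<lambda>\<phi> \<psi>. \<lambda>x \<in> bar_domain A M n. \<phi> x \<oplus>\<^bsub>N\<^esub> \<psi> x),
     module.smult = (\<lambda>c \<phi>. \<lambda>x \<in> bar_domain A M n. scal A N c (\<phi> x))\<rparr>"

definition graded_Ext ::
    "'k ring \<Rightarrow> ('k, 'a) module \<Rightarrow> ('g, 's) monoid_scheme \<Rightarrow> ('g \<Rightarrow> 'a set) \<Rightarrow>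
     ('a, 'b) module \<Rightarrow> ('g \<Rightarrow> 'b set) \<Rightarrow> ('a, 'c) module \<Rightarrow> ('g \<Rightarrow> 'c set) \<Rightarrow>
     nat \<Rightarrow> 'g \<Rightarrow> ('k, ('a list \<times> 'b \<Rightarrow> 'c) set) module" where
  "graded_Ext K A \<Gamma> dA M dM N dN n \<kappa> =
     (let C = (\<lambda>i. homogeneous_cochains K A \<Gamma> dA M dM N dN i \<kappa>);
          Z = {\<phi> \<in> C n. bar_differential A M N n \<phi> = zero_cochain A M N (Suc n)};
          B = (case n of 0 \<Rightarrow> {zero_cochain A M N 0} | Suc i \<Rightarrow> bar_differential A M N i ` C i)
      in quotient (cochain_space A M N n Z) B)"

definition augmentation :: "'k ring \<Rightarrow> ('k, 'a) module \<Rightarrow> (nat \<Rightarrow> 'a set) \<Rightarrow> 'a \<Rightarrow> 'k" where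
  "augmentation K A Adeg a =
     (THE c. c \<in> carrier K \<and> component A UNIV Adeg a 0 = c \<odot>\<^bsub>A\<^esub> \<one>\<^bsub>A\<^esub>)"

definition trivial_module ::
    "'k ring \<Rightarrow> ('k, 'a) module \<Rightarrow> (nat \<Rightarrow> 'a set) \<Rightarrow> ('a, 'k) module" where
  "trivial_module K A Adeg = \<lparr>carrier = carrier K, monoid.mult = (\<otimes>\<^bsub>K\<^esub>), one = \<one>\<^bsub>K\<^esub>,
     zero = \<zero>\<^bsub>K\<^esub>, add = (\<oplus>\<^bsub>K\<^esub>), module.smult = (\<lambda>a c. augmentation K A Adeg a \<otimes>\<^bsub>K\<^esub> c)\<rparr>"

definition concentrated :: "'k ring \<Rightarrow> 'g \<Rightarrow> 'g \<Rightarrow> 'k set" where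
  "concentrated K h g = (if g = h then carrier K else {\<zero>\<^bsub>K\<^esub>})"

definition int_grading :: "('k, 'a) module \<Rightarrow> (nat \<Rightarrow> 'a set) \<Rightarrow> int \<Rightarrow> 'a set" where
  "int_grading A Adeg j = (if 0 \<le> j then Adeg (nat j) else {\<zero>\<^bsub>A\<^esub>})"

text \<open>The component of degree \<open>j\<close> of \<open>Ext\<^sup>i(\<^sub>AK, \<^sub>AA)\<close>.\<close>

definition Ext_trivial ::
    "'k ring \<Rightarrow> ('k, 'a) module \<Rightarrow> (nat \<Rightarrow> 'a set) \<Rightarrow> nat \<Rightarrow> int \<Rightarrow>
     ('k, ('a list \<times> 'k \<Rightarrow> 'a) set) module" where
  "Ext_trivial K A Adeg i j = graded_Ext K A integer_group (int_grading A Adeg)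
     (trivial_module K A Adeg) (concentrated K 0) (regular_module A) (int_grading A Adeg) i j"


section \<open>AS regular algebras\<close>

text \<open>\<open>K(l)\<^sub>j = K\<^bsub>l+j\<^esub>\<close>\<close>

definition shifted_field :: "'k ring \<Rightarrow> int \<Rightarrow> int \<Rightarrow> ('k, 'k) module" where
  "shifted_field K l j = regular_module K\<lparr>carrier := concentrated K 0 (l + j)\<rparr>"

definition AS_Gorenstein ::
    "'k ring \<Rightarrow> ('k, 'a) module \<Rightarrow> (nat \<Rightarrow> 'a set) \<Rightarrow> nat \<Rightarrow> int \<Rightarrow> bool" where
  "AS_Gorenstein K A Adeg d l \<longleftrightarrow> connected_graded K A Adeg \<and>
     (\<forall>R \<in> {A, opposite A}. inj_dim R (regular_module R) = enat d \<and>
        (\<forall>i j. i \<noteq> d \<longrightarrow> carrier (Ext_trivial K R Adeg i j) = {\<zero>\<^bsub>Ext_trivial K R Adeg i j\<^esub>}) \<and>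
        (\<forall>j. vs_iso K (Ext_trivial K R Adeg d j) (shifted_field K l j)))"

definition AS_regular :: "'k ring \<Rightarrow> ('k, 'a) module \<Rightarrow> (nat \<Rightarrow> 'a set) \<Rightarrow> bool" where
  "AS_regular K A Adeg \<longleftrightarrow> (\<exists>d l. AS_Gorenstein K A Adeg d l) \<and>
     left_global_dim A < \<infinity> \<and> left_global_dim (opposite A) < \<infinity> \<and> gk_dim K A < \<infinity>"


section \<open>Coactions of finite groups\<close>

text \<open>The Hopf algebra \<open>K\<^sup>G\<close>: functions on \<open>G\<close>, with \<open>p\<^sub>g\<close> the indicator function of \<open>g\<close>.\<close>

definition dual_group_algebra :: "'k ring \<Rightarrow> 'g monoid \<Rightarrow> ('g \<Rightarrow> 'k) set" where
  "dual_group_algebra K G = carrier G \<rightarrow>\<^sub>E carrier K"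

text \<open>
  The counit is evaluation at \<open>1\<close>, the antipode is \<open>S(\<phi>)(x) = \<phi>(x\<inverse>)\<close>, and \<open>\<Delta>(\<phi>)(x,y) = \<phi>(x y)\<close> as a
  function on \<open>G \<times> G\<close>. The last clause says \<open>\<Delta>(\<phi>) \<in> J \<otimes> K\<^sup>G + K\<^sup>G \<otimes> J\<close>.
\<close>

definition hopf_ideal :: "'k ring \<Rightarrow> 'g monoid \<Rightarrow> ('g \<Rightarrow> 'k) set \<Rightarrow> bool" where
  "hopf_ideal K G J \<longleftrightarrow> J \<subseteq> dual_group_algebra K G \<and> (\<lambda>_ \<in> carrier G. \<zero>\<^bsub>K\<^esub>) \<in> J \<and>
     (\<forall>\<phi>\<in>J. \<forall>\<psi>\<in>J. (\<lambda>x \<in> carrier G. \<phi> x \<oplus>\<^bsub>K\<^esub> \<psi> x) \<in> J) \<and>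
     (\<forall>\<phi>\<in>J. \<forall>\<psi>\<in>dual_group_algebra K G. (\<lambda>x \<in> carrier G. \<psi> x \<otimes>\<^bsub>K\<^esub> \<phi> x) \<in> J) \<and>
     (\<forall>\<phi>\<in>J. \<phi> \<one>\<^bsub>G\<^esub> = \<zero>\<^bsub>K\<^esub>) \<and>
     (\<forall>\<phi>\<in>J. (\<lambda>x \<in> carrier G. \<phi> (inv\<^bsub>G\<^esub> x)) \<in> J) \<and>
     (\<forall>\<phi>\<in>J. \<exists>(n::nat) a b.
        (\<forall>i<n. a i \<in> dual_group_algebra K G \<and> b i \<in> dual_group_algebra K G \<and>
           (a i \<in> J \<or> b i \<in> J)) \<and>
        (\<forall>x\<in>carrier G. \<forall>y\<in>carrier G.
           \<phi> (x \<otimes>\<^bsub>G\<^esub> y) = (\<Oplus>\<^bsub>K\<^esub>i\<in>{..<n}. a i x \<otimes>\<^bsub>K\<^esub> b i y)))"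

text \<open>
  A homogeneous \<open>K\<^sup>G\<close>-action on \<open>A\<close> is given by the \<open>G\<close>-grading \<open>gr g = p\<^sub>g \<cdot> A\<close>, whose components
  are graded subspaces.
\<close>

definition homogeneous_coaction ::
    "'k ring \<Rightarrow> ('k, 'a) module \<Rightarrow> (nat \<Rightarrow> 'a set) \<Rightarrow> 'g monoid \<Rightarrow> ('g \<Rightarrow> 'a set) \<Rightarrow> bool" where
  "homogeneous_coaction K A Adeg G gr \<longleftrightarrow>
     internal_direct_sum K A (carrier G) gr \<and>
     (\<forall>g\<in>carrier G. \<forall>h\<in>carrier G. \<forall>x\<in>gr g. \<forall>y\<in>gr h. x \<otimes>\<^bsub>A\<^esub> y \<in> gr (g \<otimes>\<^bsub>G\<^esub> h)) \<and>
     (\<forall>i. internal_direct_sum K (A\<lparr>carrier := Adeg i\<rparr>) (carrier G) (\<lambda>g. Adeg i \<inter> gr g))"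

definition dual_action ::
    "('k, 'a) module \<Rightarrow> 'g monoid \<Rightarrow> ('g \<Rightarrow> 'a set) \<Rightarrow> ('g \<Rightarrow> 'k) \<Rightarrow> 'a \<Rightarrow> 'a" where
  "dual_action A G gr \<phi> a =
     (\<Oplus>\<^bsub>A\<^esub>g\<in>carrier G. \<phi> g \<odot>\<^bsub>A\<^esub> component A (carrier G) gr a g)"

definition inner_faithful ::
    "'k ring \<Rightarrow> ('k, 'a) module \<Rightarrow> 'g monoid \<Rightarrow> ('g \<Rightarrow> 'a set) \<Rightarrow> bool" where
  "inner_faithful K A G gr \<longleftrightarrow>
     (\<forall>J. hopf_ideal K G J \<and> (\<forall>\<phi>\<in>J. \<forall>a\<in>carrier A. dual_action A G gr \<phi> a = \<zero>\<^bsub>A\<^esub>) \<longrightarrow>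
        J = {\<lambda>_ \<in> carrier G. \<zero>\<^bsub>K\<^esub>})"

text \<open>\<open>A\<^sup>H = A\<^sub>1\<close> (the component of the unit of \<open>G\<close>) for \<open>H = K\<^sup>G\<close>\<close>

definition fixed_ring ::
    "('k, 'a) module \<Rightarrow> 'g monoid \<Rightarrow> ('g \<Rightarrow> 'a set) \<Rightarrow> ('k, 'a) module" where
  "fixed_ring A G gr = A\<lparr>carrier := gr \<one>\<^bsub>G\<^esub>\<rparr>"

definition fixed_deg ::
    "(nat \<Rightarrow> 'a set) \<Rightarrow> 'g monoid \<Rightarrow> ('g \<Rightarrow> 'a set) \<Rightarrow> nat \<Rightarrow> 'a set" where
  "fixed_deg Adeg G gr i = Adeg i \<inter> gr \<one>\<^bsub>G\<^esub>"

definition dual_reflection_group ::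
    "'k ring \<Rightarrow> ('k, 'a) module \<Rightarrow> (nat \<Rightarrow> 'a set) \<Rightarrow> 'g monoid \<Rightarrow> ('g \<Rightarrow> 'a set) \<Rightarrow> bool" where
  "dual_reflection_group K A Adeg G gr \<longleftrightarrow>
     AS_regular K A Adeg \<and> nc_noetherian A \<and> nc_domain A \<and> generated_in_degree_1 K A Adeg \<and>
     homogeneous_coaction K A Adeg G gr \<and> inner_faithful K A G gr \<and>
     AS_regular K (fixed_ring A G gr) (fixed_deg Adeg G gr)"

definition Ext_trivial_G ::
    "'k ring \<Rightarrow> ('k, 'a) module \<Rightarrow> (nat \<Rightarrow> 'a set) \<Rightarrow> 'g monoid \<Rightarrow> ('g \<Rightarrow> 'a set) \<Rightarrow>
     nat \<Rightarrow> int \<times> 'g \<Rightarrow> ('k, ('a list \<times> 'k \<Rightarrow> 'a) set) module" where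
  "Ext_trivial_G K A Adeg G gr i \<kappa> =
     (let dA = (\<lambda>(j, g). int_grading A Adeg j \<inter> gr g)
      in graded_Ext K A (integer_group \<times>\<times> G) dA
           (trivial_module K A Adeg) (concentrated K (0, \<one>\<^bsub>G\<^esub>)) (regular_module A) dA i \<kappa>)"

text \<open>\<open>Ext\<^sup>d(\<^sub>AK, A)\<close> is spanned by a nonzero homogeneous \<open>u\<close> of \<open>G\<close>-degree \<open>D\<inverse>\<close>.\<close>

definition homological_codeterminant ::
    "'k ring \<Rightarrow> ('k, 'a) module \<Rightarrow> (nat \<Rightarrow> 'a set) \<Rightarrow> 'g monoid \<Rightarrow> ('g \<Rightarrow> 'a set) \<Rightarrow> 'g \<Rightarrow> bool" where
  "homological_codeterminant K A Adeg G gr D \<longleftrightarrow> D \<in> carrier G \<and>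
     (\<exists>d j u. inj_dim A (regular_module A) = enat d \<and>
        (let E = Ext_trivial_G K A Adeg G gr d; \<kappa> = (j, inv\<^bsub>G\<^esub> D)
         in u \<in> carrier (E \<kappa>) \<and> u \<noteq> \<zero>\<^bsub>E \<kappa>\<^esub> \<and>
            carrier (E \<kappa>) = {c \<odot>\<^bsub>E \<kappa>\<^esub> u | c. c \<in> carrier K} \<and>
            (\<forall>\<kappa>' \<in> UNIV \<times> carrier G. \<kappa>' \<noteq> \<kappa> \<longrightarrow> carrier (E \<kappa>') = {\<zero>\<^bsub>E \<kappa>'\<^esub>})))"

definition word_length :: "'g monoid \<Rightarrow> 'g set \<Rightarrow> 'g \<Rightarrow> nat" where
  "word_length G R g =
     (LEAST n. \<exists>vs. length vs = n \<and> set vs \<subseteq> R \<and> g = foldr (\<otimes>\<^bsub>G\<^esub>) vs \<one>\<^bsub>G\<^esub>)"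

definition covariant_ideal ::
    "('k, 'a) module \<Rightarrow> (nat \<Rightarrow> 'a set) \<Rightarrow> 'g monoid \<Rightarrow> ('g \<Rightarrow> 'a set) \<Rightarrow> 'a set" where
  "covariant_ideal A Adeg G gr = Idl\<^bsub>A\<^esub> (\<Union>i\<in>{1..}. fixed_deg Adeg G gr i)"

definition covariant_ring ::
    "('k, 'a) module \<Rightarrow> (nat \<Rightarrow> 'a set) \<Rightarrow> 'g monoid \<Rightarrow> ('g \<Rightarrow> 'a set) \<Rightarrow> ('k, 'a set) module" where
  "covariant_ring A Adeg G gr = quotient A (covariant_ideal A Adeg G gr)"

definition covariant_image ::
    "('k, 'a) module \<Rightarrow> (nat \<Rightarrow> 'a set) \<Rightarrow> 'g monoid \<Rightarrow> ('g \<Rightarrow> 'a set) \<Rightarrow> 'a \<Rightarrow> 'a set" where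
  "covariant_image A Adeg G gr x = covariant_ideal A Adeg G gr +>\<^bsub>A\<^esub> x"

definition covariant_deg ::
    "('k, 'a) module \<Rightarrow> (nat \<Rightarrow> 'a set) \<Rightarrow> 'g monoid \<Rightarrow> ('g \<Rightarrow> 'a set) \<Rightarrow> nat \<Rightarrow> 'a set set" where
  "covariant_deg A Adeg G gr i = covariant_image A Adeg G gr ` Adeg i"


section \<open>Frobenius algebras\<close>

definition frobenius_form ::
    "'k ring \<Rightarrow> ('k, 'c) module \<Rightarrow> (nat \<Rightarrow> 'c set) \<Rightarrow> ('c \<Rightarrow> 'c \<Rightarrow> 'k) \<Rightarrow> int \<Rightarrow> bool" where
  "frobenius_form K C Adeg B l \<longleftrightarrow>
     (\<forall>x\<in>carrier C. B x \<in> LinearCombinations.module_hom K C (regular_module K)) \<and>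
     (\<forall>y\<in>carrier C. (\<lambda>x. B x y) \<in> LinearCombinations.module_hom K C (regular_module K)) \<and>
     (\<forall>x\<in>carrier C. \<forall>y\<in>carrier C. \<forall>z\<in>carrier C. B (x \<otimes>\<^bsub>C\<^esub> y) z = B x (y \<otimes>\<^bsub>C\<^esub> z)) \<and>
     (\<forall>x\<in>carrier C. (\<forall>y\<in>carrier C. B x y = \<zero>\<^bsub>K\<^esub>) \<longrightarrow> x = \<zero>\<^bsub>C\<^esub>) \<and>
     (\<forall>y\<in>carrier C. (\<forall>x\<in>carrier C. B x y = \<zero>\<^bsub>K\<^esub>) \<longrightarrow> y = \<zero>\<^bsub>C\<^esub>) \<and>
     (\<forall>i j. \<forall>x\<in>Adeg i. \<forall>y\<in>Adeg j. int i + int j \<noteq> l \<longrightarrow> B x y = \<zero>\<^bsub>K\<^esub>)"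

definition frobenius_algebra :: "'k ring \<Rightarrow> ('k, 'c) module \<Rightarrow> (nat \<Rightarrow> 'c set) \<Rightarrow> bool" where
  "frobenius_algebra K C Adeg \<longleftrightarrow> connected_graded K C Adeg \<and> vectorspace.fin_dim K C \<and>
     (\<exists>B l. frobenius_form K C Adeg B l)"

definition nakayama_automorphism ::
    "'k ring \<Rightarrow> ('k, 'c) module \<Rightarrow> (nat \<Rightarrow> 'c set) \<Rightarrow> ('c \<Rightarrow> 'c) \<Rightarrow> bool" where
  "nakayama_automorphism K C Adeg \<mu> \<longleftrightarrow>
     \<mu> \<in> ring_iso C C \<and> \<mu> \<in> LinearCombinations.module_hom K C C \<and> (\<forall>i. \<mu> ` Adeg i = Adeg i) \<and>
     (\<exists>B l. frobenius_form K C Adeg B l \<and>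
        (\<forall>a\<in>carrier C. \<forall>b\<in>carrier C. B a b = B (\<mu> b) a))"

end

theory Submission
 imports Defs
begin

text \<open>Let B be the component of the unit of G, that is, the fixed ring. On either side A is free over B
on the f_g, so every product f_g f_h is f_gh times an element of B. The covariant ring kills the
elements of B of positive degree; it therefore has the images of the f_g as a basis, with structure
constants c(g,h) in K, and c(g,h) is nonzero exactly when deg f_gh = deg f_g + deg f_h (lemma
cc_nonzero_iff). As A is generated in degree 1, deg f_g is the word length of g (word_length_dg), and
the freeness gives the Hilbert series (hilbert_quotient).

All the rest follows from one numerical identity: deg f_g + deg f_h = deg f_m whenever gh = m
(degree_pairing). It makes the coefficient of f_m a nondegenerate form on the covariant ring
(form_frobenius). In a product of two basis elements that coefficient is nonzero only if the group
elements multiply to m, and writing m = hg = (m g m^-1) h shows that the Nakayama automorphism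
exchanges g for its conjugate by m; the scalars are quotients of structure constants.

The identity is homological. The A-module M = A/AB_+ has the basis f_g, and the degree of f_g
filters it with one-dimensional layers. Because A is free over B, Ext_A(M,A) is a sum, over k in G, of
copies of Ext_B(K,B) shifted by deg f_k, hence vanishes outside one degree for each k
(restriction_detects_boundaries, family_acyclic). On the other hand Ext_A(K,A) lives in a single
cohomological degree d, so that a layer of M cannot hide its Ext^d in Ext^d(M,A) (acyclic_layer).
The layer of g contributes Ext^d_A(K,A), of G-degree m, at k = g^-1 m, and comparing the two
internal degrees gives the identity. All this is done with bar cochains on homogeneous elements,
which compute the graded Ext groups (acyclic_of_Ext, Ext_of_acyclic).\<close>

text \<open>The structure of an operation is also written as a plain subscript.\<close>
syntax "_index" :: "logic => index" ("\<^sub>_" [1000] 1000)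

section \<open>The bar complex of a graded algebra on homogeneous elements\<close>

text \<open>The letters of a word are pairs of a degree and an element of that degree, because zero lies in
every degree. The set X stands for a basis of a module on which a homogeneous element acts as a
permutation of X followed by the scalar lam.\<close>
locale graded_actor =
 fixes K :: "'k ring" and A :: "('k, 'a) module" and GG :: "('t, 's) monoid_scheme"
  and dA :: "'t => 'a set" and X :: "'x set" and act :: "'t => 'x => 'x"
  and lam :: "'t \<times> 'a => 'x => 'k"
 assumes field_K: "field K" and alg: "k_algebra K A" and group_GG: "group GG"
  and dA_sub: "!!t. t \<in> carrier GG ==> VectorSpace.subspace K (dA t) A"
  and dA_mult: "!!s t a b. [|s \<in> carrier GG; t \<in> carrier GG; a \<in> dA s; b \<in> dA t|] ==>
   a \<otimes>\<^sub>A b \<in> dA (s \<otimes>\<^sub>GG t)"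
  and act_closed: "!!t x. [|t \<in> carrier GG; x \<in> X|] ==> act t x \<in> X"
  and act_mult: "!!s t x. [|s \<in> carrier GG; t \<in> carrier GG; x \<in> X|] ==>
   act (s \<otimes>\<^sub>GG t) x = act s (act t x)"
  and lam_closed: "!!t a x. [|t \<in> carrier GG; a \<in> dA t; x \<in> X|] ==> lam (t, a) x \<in> carrier K"
  and lam_linear: "!!t a b c x. [|t \<in> carrier GG; a \<in> dA t; b \<in> dA t; c \<in> carrier K; x \<in> X|] ==>
   lam (t, c \<odot>\<^sub>A a \<oplus>\<^sub>A b) x = c \<otimes>\<^sub>K lam (t, a) x \<oplus>\<^sub>K lam (t, b) x"
  and lam_mult: "!!s t a b x. [|s \<in> carrier GG; t \<in> carrier GG; a \<in> dA s; b \<in> dA t; x \<in> X|] ==>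
   lam (s \<otimes>\<^sub>GG t, a \<otimes>\<^sub>A b) x = lam (s, a) (act t x) \<otimes>\<^sub>K lam (t, b) x"
begin

sublocale field K by (rule field_K)
sublocale A: ring A using alg by (simp add: k_algebra_def)
sublocale V: vectorspace K A using alg by (simp add: k_algebra_def)
sublocale Gr: group GG by (rule group_GG)

lemma smult_assoc_l: "[|c \<in> carrier K; x \<in> carrier A; y \<in> carrier A|] ==>
  (c \<odot>\<^sub>A x) \<otimes>\<^sub>A y = c \<odot>\<^sub>A (x \<otimes>\<^sub>A y)"
 and smult_assoc_r: "[|c \<in> carrier K; x \<in> carrier A; y \<in> carrier A|] ==>
  x \<otimes>\<^sub>A (c \<odot>\<^sub>A y) = c \<odot>\<^sub>A (x \<otimes>\<^sub>A y)"
 using alg by (auto simp: k_algebra_def)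

lemma dA_carrier: "t \<in> carrier GG ==> a \<in> dA t ==> a \<in> carrier A"
 using dA_sub[of t] by (auto simp: subspace_def submodule_def)

lemma dA_add: "[|t \<in> carrier GG; a \<in> dA t; b \<in> dA t|] ==> a \<oplus>\<^sub>A b \<in> dA t"
 and dA_smult: "[|t \<in> carrier GG; a \<in> dA t; c \<in> carrier K|] ==> c \<odot>\<^sub>A a \<in> dA t"
 and dA_zero: "t \<in> carrier GG ==> \<zero>\<^sub>A \<in> dA t"
 using dA_sub[of t] by (auto simp: subspace_def submodule_def)

lemma smult_minus_one: "x \<in> carrier A ==> (\<ominus>\<^sub>K \<one>\<^sub>K) \<odot>\<^sub>A x = \<ominus>\<^sub>A x"
 by (simp add: V.smult_l_minus)

lemma dA_uminus: assumes "t \<in> carrier GG" "a \<in> dA t" shows "\<ominus>\<^sub>A a \<in> dA t"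
 using dA_smult[OF assms, of "\<ominus>\<^sub>K \<one>\<^sub>K"] dA_carrier[OF assms] by (simp add: smult_minus_one)

lemma dA_minus: "[|t \<in> carrier GG; a \<in> dA t; b \<in> dA t|] ==> a \<ominus>\<^sub>A b \<in> dA t"
 by (simp add: a_minus_def dA_add dA_uminus)

definition hom_el :: "'t \<times> 'a => bool" where
 "hom_el p \<longleftrightarrow> fst p \<in> carrier GG \<and> snd p \<in> dA (fst p)"

definition pm :: "'t \<times> 'a => 't \<times> 'a => 't \<times> 'a" where
 "pm p q = (fst p \<otimes>\<^sub>GG fst q, snd p \<otimes>\<^sub>A snd q)"

definition words :: "nat => ('t \<times> 'a) list set" where
 "words n = {as. length as = n \<and> (\<forall>p\<in>set as. hom_el p)}"

definition tot :: "('t \<times> 'a) list => 't" where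
 "tot as = foldr (\<lambda>p. (\<otimes>\<^sub>GG) (fst p)) as \<one>\<^sub>GG"

definition shift :: "'t \<times> 'a => (('t \<times> 'a) list => 'b) => ('t \<times> 'a) list => 'b" where
 "shift p ph as = ph (p # as)"

fun bar_inner :: "(('t \<times> 'a) list => 'x => 'a) => ('t \<times> 'a) list => 'x => 'a" where
 "bar_inner ph [] x = \<zero>\<^sub>A"
| "bar_inner ph [p] x = lam p x \<odot>\<^sub>A ph [] (act (fst p) x)"
| "bar_inner ph (p # q # as) x = ph (pm p q # as) x \<ominus>\<^sub>A bar_inner (shift p ph) (q # as) x"

definition bar_diff :: "(('t \<times> 'a) list => 'x => 'a) => ('t \<times> 'a) list => 'x => 'a" where
 "bar_diff ph as x = snd (hd as) \<otimes>\<^sub>A ph (tl as) x \<ominus>\<^sub>A bar_inner ph as x"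

definition vals :: "nat => (('t \<times> 'a) list => 'x => 'a) => bool" where
 "vals n ph \<longleftrightarrow> (\<forall>as\<in>words n. \<forall>x\<in>X. ph as x \<in> carrier A)"

definition agree :: "nat => (('t \<times> 'a) list => 'x => 'a) => (('t \<times> 'a) list => 'x => 'a) => bool" where
 "agree n ph ps \<longleftrightarrow> (\<forall>as\<in>words n. \<forall>x\<in>X. ph as x = ps as x)"

definition multilin :: "nat => (('t \<times> 'a) list => 'x => 'a) => bool" where
 "multilin n ph \<longleftrightarrow> vals n ph \<and>
  (\<forall>us vs t a b c x. length us + length vs + 1 = n --> us \<in> words (length us) --> vs \<in> words (length vs)
   --> t \<in> carrier GG --> a \<in> dA t --> b \<in> dA t --> c \<in> carrier K --> x \<in> X -->
   ph (us @ (t, c \<odot>\<^sub>A a \<oplus>\<^sub>A b) # vs) x = c \<odot>\<^sub>A ph (us @ (t, a) # vs) x \<oplus>\<^sub>A ph (us @ (t, b) # vs) x)"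

definition homog :: "'t => ('x => 't) => nat => (('t \<times> 'a) list => 'x => 'a) => bool" where
 "homog l w n ph \<longleftrightarrow> (\<forall>as\<in>words n. \<forall>x\<in>X. ph as x \<in> dA (l \<otimes>\<^sub>GG (tot as \<otimes>\<^sub>GG w x)))"

lemma words_0 [simp]: "words 0 = {[]}" by (auto simp: words_def)

lemma words_Nil [simp]: "[] \<in> words i \<longleftrightarrow> i = 0" by (auto simp: words_def)

lemma words_Suc: "as \<in> words (Suc n) \<longleftrightarrow> (\<exists>p bs. as = p # bs \<and> hom_el p \<and> bs \<in> words n)"
 by (cases as) (auto simp: words_def)

lemma words_Cons [simp]: "p # bs \<in> words (Suc n) \<longleftrightarrow> hom_el p \<and> bs \<in> words n"
 by (auto simp: words_def)

lemma words_app: "us @ vs \<in> words n \<longleftrightarrow> us \<in> words (length us) \<and> vs \<in> words (length vs) \<and> n = length us + length vs"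
 by (auto simp: words_def)

lemma words_length: "as \<in> words n ==> length as = n" by (simp add: words_def)

lemma hom_el_pair [simp]: "hom_el (t, a) \<longleftrightarrow> t \<in> carrier GG \<and> a \<in> dA t"
 by (simp add: hom_el_def)

lemma hom_pm [simp]: "hom_el p ==> hom_el q ==> hom_el (pm p q)"
 by (auto simp: hom_el_def pm_def intro: dA_mult)

lemma hom_elD: "hom_el p ==> fst p \<in> carrier GG" "hom_el p ==> snd p \<in> carrier A" "hom_el p ==> snd p \<in> dA (fst p)"
 by (auto simp: hom_el_def dA_carrier)

lemma pm_assoc: "hom_el p ==> hom_el q ==> hom_el r ==> pm (pm p q) r = pm p (pm q r)"
 by (auto simp: pm_def hom_elD A.m_assoc Gr.m_assoc)

lemma tot_simps [simp]: "tot [] = \<one>\<^sub>GG" "tot (p # as) = fst p \<otimes>\<^sub>GG tot as"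
 by (auto simp: tot_def)

lemma tot_closed: "as \<in> words n ==> tot as \<in> carrier GG"
 by (induction n arbitrary: as) (auto simp: words_Suc hom_elD)

lemma lam_cl: "hom_el p ==> x \<in> X ==> lam p x \<in> carrier K"
 by (cases p) (auto simp: hom_el_def lam_closed)

lemma act_cl: "hom_el p ==> x \<in> X ==> act (fst p) x \<in> X"
 by (auto simp: hom_el_def act_closed)

lemma lam_pm: "hom_el p ==> hom_el q ==> x \<in> X ==> lam (pm p q) x = lam p (act (fst q) x) \<otimes>\<^sub>K lam q x"
 by (cases p, cases q) (auto simp: hom_el_def pm_def lam_mult)

lemma vals_D: "vals n ph ==> as \<in> words n ==> x \<in> X ==> ph as x \<in> carrier A"
 by (auto simp: vals_def)

lemma vals_shift: "vals (Suc n) ph ==> hom_el p ==> vals n (shift p ph)"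
 by (auto simp: vals_def shift_def)

lemma bar_inner_closed:
 "as \<in> words (Suc n) ==> vals n ph ==> x \<in> X ==> bar_inner ph as x \<in> carrier A"
proof (induction n arbitrary: as ph)
 case 0
 then show ?case by (auto simp: words_Suc vals_def act_closed lam_closed)
next
 case (Suc n)
 then obtain p q bs where as: "as = p # q # bs" "hom_el p" "hom_el q" "bs \<in> words n" by (auto simp: words_Suc)
 have "bar_inner (shift p ph) (q # bs) x \<in> carrier A"
  using Suc as by (intro Suc.IH) (auto intro: vals_shift)
 with Suc.prems as show ?case by (auto simp: vals_def)
qed

lemma vals_inner: "vals n ph ==> vals (Suc n) (bar_inner ph)"
 using bar_inner_closed by (auto simp: vals_def[of "Suc n"])

lemma vals_diff: "vals n ph ==> vals (Suc n) (bar_diff ph)"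
 by (auto simp: vals_def[of "Suc n"] bar_diff_def bar_inner_closed words_Suc dA_carrier vals_D)

lemma bar_inner_cong:
 "as \<in> words (Suc n) ==> agree n ph ps ==> x \<in> X ==> bar_inner ph as x = bar_inner ps as x"
proof (induction n arbitrary: as ph ps)
 case 0
 then show ?case by (auto simp: words_Suc agree_def act_closed)
next
 case (Suc n)
 then obtain p q bs where as: "as = p # q # bs" "hom_el p" "hom_el q" "bs \<in> words n" by (auto simp: words_Suc)
 have "bar_inner (shift p ph) (q # bs) x = bar_inner (shift p ps) (q # bs) x"
  using Suc as by (intro Suc.IH) (auto simp: agree_def shift_def)
 with Suc.prems as show ?case by (auto simp: agree_def)
qed

lemma bar_diff_cong: "agree n ph ps ==> agree (Suc n) (bar_diff ph) (bar_diff ps)"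
 using bar_inner_cong[of _ n ph ps]
 by (auto simp: agree_def[of "Suc n"] bar_diff_def words_Suc) (auto simp: agree_def)

definition comb :: "'k => (('t \<times> 'a) list => 'x => 'a) => (('t \<times> 'a) list => 'x => 'a) => ('t \<times> 'a) list => 'x => 'a" where
 "comb c ph ps as x = c \<odot>\<^sub>A ph as x \<oplus>\<^sub>A ps as x"

lemma vals_comb: "vals n ph ==> vals n ps ==> c \<in> carrier K ==> vals n (comb c ph ps)"
 by (auto simp: vals_def comb_def)

lemma shift_comb: "shift p (comb c ph ps) = comb c (shift p ph) (shift p ps)"
 by (auto simp: shift_def comb_def fun_eq_iff)

lemma comb_minus: assumes "a \<in> carrier A" "b \<in> carrier A" "a' \<in> carrier A" "b' \<in> carrier A" "c \<in> carrier K"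
 shows "(c \<odot>\<^sub>A a \<oplus>\<^sub>A b) \<ominus>\<^sub>A (c \<odot>\<^sub>A a' \<oplus>\<^sub>A b') = c \<odot>\<^sub>A (a \<ominus>\<^sub>A a') \<oplus>\<^sub>A (b \<ominus>\<^sub>A b')"
proof -
 have "c \<odot>\<^sub>A (a \<ominus>\<^sub>A a') = c \<odot>\<^sub>A a \<ominus>\<^sub>A c \<odot>\<^sub>A a'"
  using assms by (simp add: a_minus_def V.smult_r_distr V.smult_r_minus)
 then show ?thesis using assms by (simp add: a_minus_def A.minus_add A.a_ac)
qed

lemma bar_inner_comb:
 "as \<in> words (Suc n) ==> vals n ph ==> vals n ps ==> x \<in> X ==> c \<in> carrier K ==>
  bar_inner (comb c ph ps) as x = c \<odot>\<^sub>A bar_inner ph as x \<oplus>\<^sub>A bar_inner ps as x"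
proof (induction n arbitrary: as ph ps)
 case 0
 then obtain p where p: "as = [p]" "hom_el p" by (auto simp: words_Suc)
 show ?case using 0 p vals_D[OF 0(2), of "[]" "act (fst p) x"] vals_D[OF 0(3), of "[]" "act (fst p) x"] lam_cl[of p x]
  by (simp add: comb_def act_cl V.smult_r_distr flip: V.smult_assoc1) (simp add: m_comm)
next
 case (Suc n)
 then obtain p q bs where as: "as = p # q # bs" "hom_el p" "hom_el q" "bs \<in> words n" by (auto simp: words_Suc)
 have "bar_inner (shift p (comb c ph ps)) (q # bs) x =
   c \<odot>\<^sub>A bar_inner (shift p ph) (q # bs) x \<oplus>\<^sub>A bar_inner (shift p ps) (q # bs) x"
  unfolding shift_comb using Suc as by (intro Suc.IH) (auto intro: vals_shift)
 moreover have "bar_inner (shift p ph) (q # bs) x \<in> carrier A" "bar_inner (shift p ps) (q # bs) x \<in> carrier A"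
  using Suc.prems as by (auto intro!: bar_inner_closed vals_shift)
 moreover have "bar_inner (comb c ph ps) as x =
   comb c ph ps (pm p q # bs) x \<ominus>\<^sub>A bar_inner (shift p (comb c ph ps)) (q # bs) x" by (simp add: as)
 ultimately show ?case using Suc.prems as by (simp add: comb_minus vals_D) (simp add: comb_def comb_minus vals_D)
qed

lemma bar_diff_comb:
 assumes "vals n ph" "vals n ps" "c \<in> carrier K"
 shows "agree (Suc n) (bar_diff (comb c ph ps)) (comb c (bar_diff ph) (bar_diff ps))"
 unfolding agree_def
proof (intro ballI)
 fix as x assume as: "as \<in> words (Suc n)" and x: "x \<in> X"
 then obtain p bs where p: "as = p # bs" "hom_el p" "bs \<in> words n" by (auto simp: words_Suc)
 have "bar_diff (comb c ph ps) as x = (c \<odot>\<^sub>A (snd p \<otimes>\<^sub>A ph bs x) \<oplus>\<^sub>A snd p \<otimes>\<^sub>A ps bs x) \<ominus>\<^sub>A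
   (c \<odot>\<^sub>A bar_inner ph as x \<oplus>\<^sub>A bar_inner ps as x)"
  using assms p x as bar_inner_comb[OF as assms(1,2) x assms(3)]
  by (simp add: bar_diff_def comb_def vals_D hom_elD A.r_distr smult_assoc_r)
 also have "\<dots> = comb c (bar_diff ph) (bar_diff ps) as x"
  using assms p x as bar_inner_closed[OF as]
  by (subst comb_minus) (auto simp: bar_diff_def comb_def vals_D hom_elD)
 finally show "bar_diff (comb c ph ps) as x = comb c (bar_diff ph) (bar_diff ps) as x" .
qed

lemma bar_inner_sub:
 assumes "as \<in> words (Suc n)" "vals n ph" "vals n ps" "x \<in> X"
 shows "bar_inner (\<lambda>as x. ph as x \<ominus>\<^sub>A ps as x) as x = bar_inner ph as x \<ominus>\<^sub>A bar_inner ps as x"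
proof -
 have "agree n (\<lambda>as x. ph as x \<ominus>\<^sub>A ps as x) (comb (\<ominus>\<^sub>K \<one>\<^sub>K) ps ph)"
  using assms by (auto simp: agree_def comb_def vals_D smult_minus_one a_minus_def A.a_ac)
 from bar_inner_cong[OF assms(1) this assms(4)] bar_inner_comb[OF assms(1,3,2,4), of "\<ominus>\<^sub>K \<one>\<^sub>K"]
 show ?thesis using bar_inner_closed[OF assms(1,2,4)] bar_inner_closed[OF assms(1,3,4)]
  by (simp add: smult_minus_one a_minus_def A.a_ac)
qed

lemma bar_inner_twice:
 "[|hom_el p; hom_el q; bs \<in> words n; vals n' ph; n' = Suc n - 1; x \<in> X|] ==>
  bar_inner (shift p (bar_inner ph)) (q # bs) x = bar_inner ph (pm p q # bs) x"
proof (induction n arbitrary: n' ph p q bs)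
 case 0
 have "bar_inner (shift p (bar_inner ph)) [q] x = (lam p (act (fst q) x) \<otimes>\<^sub>K lam q x) \<odot>\<^sub>A ph [] (act (fst p) (act (fst q) x))"
  using 0 by (auto simp: shift_def act_cl lam_cl vals_D m_comm simp flip: V.smult_assoc1)
 also have "\<dots> = bar_inner ph [pm p q] x"
  using 0 by (simp add: lam_pm) (simp add: pm_def act_mult hom_elD)
 finally show ?case using 0 by simp
next
 case (Suc n)
 then obtain r cs where bs: "bs = r # cs" "hom_el r" "cs \<in> words n" by (auto simp: words_Suc)
 have n': "n' = Suc n" using Suc.prems by simp
 have vs: "vals n (shift p ph)" "vals n (shift (pm p q) ph)" "vals n (shift q ph)" using Suc.prems by (auto intro!: vals_shift simp: n')
 have ag: "agree (Suc n) (shift q (shift p (bar_inner ph)))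
   (\<lambda>as x. shift (pm p q) ph as x \<ominus>\<^sub>A shift q (bar_inner (shift p ph)) as x)"
  by (auto simp: agree_def shift_def)
 have "bar_inner (shift p (bar_inner ph)) (q # bs) x =
   bar_inner ph (p # pm q r # cs) x \<ominus>\<^sub>A bar_inner (shift q (shift p (bar_inner ph))) (r # cs) x"
  by (simp add: bs shift_def)
 also have "bar_inner (shift q (shift p (bar_inner ph))) (r # cs) x =
   bar_inner (\<lambda>as x. shift (pm p q) ph as x \<ominus>\<^sub>A shift q (bar_inner (shift p ph)) as x) (r # cs) x"
  using Suc.prems bs by (intro bar_inner_cong[of _ "n"]) (auto simp: agree_def shift_def)
 also have "\<dots> = bar_inner (shift (pm p q) ph) (r # cs) x \<ominus>\<^sub>A bar_inner (shift q (bar_inner (shift p ph))) (r # cs) x"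
  using Suc.prems bs vs by (intro bar_inner_sub[of _ n]) (auto intro!: vals_shift vals_inner)
 also have "bar_inner (shift q (bar_inner (shift p ph))) (r # cs) x = bar_inner (shift p ph) (pm q r # cs) x"
  using Suc.prems bs vs by (intro Suc.IH) auto
 finally show ?case
  using Suc.prems bs vs bar_inner_closed[of "r # cs" n "shift (pm p q) ph" x] bar_inner_closed[of "pm q r # cs" n "shift p ph" x]
  apply (simp add: n' pm_assoc)
  apply (subgoal_tac "ph (pm p (pm q r) # cs) x \<in> carrier A")
  subgoal by algebra
  by (auto intro: vals_D)
qed


lemma bar_inner_lmult:
 "as \<in> words (Suc n) ==> vals n ph ==> x \<in> X ==> c \<in> carrier A ==>
  bar_inner (\<lambda>as x. c \<otimes>\<^sub>A ph as x) as x = c \<otimes>\<^sub>A bar_inner ph as x"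
proof (induction n arbitrary: as ph)
 case 0
 then show ?case by (auto simp: words_Suc act_closed lam_closed smult_assoc_r vals_D)
next
 case (Suc n)
 then obtain p q bs where as: "as = p # q # bs" "hom_el p" "hom_el q" "bs \<in> words n" by (auto simp: words_Suc)
 have "shift p (\<lambda>as x. c \<otimes>\<^sub>A ph as x) = (\<lambda>as x. c \<otimes>\<^sub>A shift p ph as x)"
  by (simp add: shift_def fun_eq_iff)
 then have "bar_inner (shift p (\<lambda>as x. c \<otimes>\<^sub>A ph as x)) (q # bs) x = c \<otimes>\<^sub>A bar_inner (shift p ph) (q # bs) x"
  using Suc as by (simp only:) (intro Suc.IH, auto intro: vals_shift)
 moreover have "bar_inner (shift p ph) (q # bs) x \<in> carrier A"
  using Suc.prems as by (auto intro!: bar_inner_closed vals_shift)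
 ultimately show ?case using Suc.prems as by (simp add: A.r_minus A.r_distr a_minus_def vals_D)
qed

lemma bar_diff_twice:
 assumes "vals n ph" "as \<in> words (Suc (Suc n))" "x \<in> X"
 shows "bar_diff (bar_diff ph) as x = \<zero>\<^sub>A"
proof -
 obtain p q bs where as: "as = p # q # bs" "hom_el p" "hom_el q" "bs \<in> words n"
  using assms(2) by (auto simp: words_Suc)
 let ?P = "\<lambda>as x. snd p \<otimes>\<^sub>A ph as x"
 have vP: "vals n ?P" using assms as by (auto simp: vals_def hom_elD)
 have "bar_inner (shift p (bar_diff ph)) (q # bs) x =
   bar_inner (\<lambda>as x. ?P as x \<ominus>\<^sub>A shift p (bar_inner ph) as x) (q # bs) x"
  using assms as by (intro bar_inner_cong[of _ n]) (auto simp: agree_def shift_def bar_diff_def)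
 also have "\<dots> = bar_inner ?P (q # bs) x \<ominus>\<^sub>A bar_inner (shift p (bar_inner ph)) (q # bs) x"
  using assms as vP by (intro bar_inner_sub[of _ n]) (auto intro: vals_shift vals_inner)
 also have "bar_inner ?P (q # bs) x = snd p \<otimes>\<^sub>A bar_inner ph (q # bs) x"
  using assms as by (intro bar_inner_lmult[of _ n]) (auto simp: hom_elD)
 also have "bar_inner (shift p (bar_inner ph)) (q # bs) x = bar_inner ph (pm p q # bs) x"
  using assms as by (intro bar_inner_twice[of _ _ _ n n]) auto
 finally have 1: "bar_inner (shift p (bar_diff ph)) (q # bs) x =
   snd p \<otimes>\<^sub>A bar_inner ph (q # bs) x \<ominus>\<^sub>A bar_inner ph (pm p q # bs) x" .
 have c: "ph bs x \<in> carrier A" "bar_inner ph (q # bs) x \<in> carrier A" "bar_inner ph (pm p q # bs) x \<in> carrier A"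
  "snd p \<in> carrier A" "snd q \<in> carrier A"
  using assms as bar_inner_closed[of _ n ph x] by (auto simp: hom_elD vals_D)
 show ?thesis using c
  by (simp add: bar_diff_def[of "bar_diff ph"] as 1) (simp add: bar_diff_def pm_def, algebra)
qed

lemma multilin_vals: "multilin n ph ==> vals n ph" by (simp add: multilin_def)

lemma multilinD:
 assumes "multilin n ph" "us \<in> words i" "vs \<in> words j" "i + j + 1 = n"
  "t \<in> carrier GG" "a \<in> dA t" "b \<in> dA t" "c \<in> carrier K" "x \<in> X"
 shows "ph (us @ (t, c \<odot>\<^sub>A a \<oplus>\<^sub>A b) # vs) x = c \<odot>\<^sub>A ph (us @ (t, a) # vs) x \<oplus>\<^sub>A ph (us @ (t, b) # vs) x"
proof -
 have "length us = i" "length vs = j" using assms by (auto simp: words_length)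
 then show ?thesis using assms unfolding multilin_def by blast
qed

lemma multilinI:
 assumes "vals n ph"
  and "!!us vs i j t a b c x. [|us \<in> words i; vs \<in> words j; i + j + 1 = n; t \<in> carrier GG; a \<in> dA t; b \<in> dA t;
   c \<in> carrier K; x \<in> X|] ==>
   ph (us @ (t, c \<odot>\<^sub>A a \<oplus>\<^sub>A b) # vs) x = c \<odot>\<^sub>A ph (us @ (t, a) # vs) x \<oplus>\<^sub>A ph (us @ (t, b) # vs) x"
 shows "multilin n ph"
 unfolding multilin_def using assms by blast

lemma multilin_cong: assumes "agree n ph ps" "multilin n ph" shows "multilin n ps"
proof (rule multilinI)
 show "vals n ps" using assms by (auto simp: vals_def agree_def dest: multilin_vals)
 fix us vs i j t a b c x
 assume h: "us \<in> words i" "vs \<in> words j" "i + j + 1 = n" "t \<in> carrier GG" "a \<in> dA t" "b \<in> dA t" "c \<in> carrier K" "x \<in> X"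
 then have "us @ (t, d) # vs \<in> words n" if "d \<in> dA t" for d using that by (auto simp: words_def)
 then show "ps (us @ (t, c \<odot>\<^sub>A a \<oplus>\<^sub>A b) # vs) x = c \<odot>\<^sub>A ps (us @ (t, a) # vs) x \<oplus>\<^sub>A ps (us @ (t, b) # vs) x"
  using multilinD[OF assms(2) h] assms(1) h by (simp add: agree_def dA_add dA_smult)
qed

lemma multilin_shift: assumes "multilin (Suc n) ph" "hom_el p" shows "multilin n (shift p ph)"
proof (rule multilinI)
 show "vals n (shift p ph)" using assms by (auto intro: vals_shift multilin_vals)
 fix us vs i j t a b c x
 assume h: "us \<in> words i" "vs \<in> words j" "i + j + 1 = n" "t \<in> carrier GG" "a \<in> dA t" "b \<in> dA t" "c \<in> carrier K" "x \<in> X"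
 then show "shift p ph (us @ (t, c \<odot>\<^sub>A a \<oplus>\<^sub>A b) # vs) x =
   c \<odot>\<^sub>A shift p ph (us @ (t, a) # vs) x \<oplus>\<^sub>A shift p ph (us @ (t, b) # vs) x"
  using multilinD[OF assms(1), of "p # us" "Suc i" vs j t a b c x] assms(2) by (simp add: shift_def)
qed

lemma pm_linear:
 assumes "hom_el p" "t \<in> carrier GG" "a \<in> dA t" "b \<in> dA t" "c \<in> carrier K"
 shows "pm p (t, c \<odot>\<^sub>A a \<oplus>\<^sub>A b) = (fst p \<otimes>\<^sub>GG t, c \<odot>\<^sub>A (snd p \<otimes>\<^sub>A a) \<oplus>\<^sub>A snd p \<otimes>\<^sub>A b)"
  and "pm (t, c \<odot>\<^sub>A a \<oplus>\<^sub>A b) p = (t \<otimes>\<^sub>GG fst p, c \<odot>\<^sub>A (a \<otimes>\<^sub>A snd p) \<oplus>\<^sub>A b \<otimes>\<^sub>A snd p)"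
 using assms by (auto simp: pm_def hom_elD dA_carrier A.r_distr A.l_distr smult_assoc_r smult_assoc_l)

lemma bar_inner_linear:
 "multilin n ph ==> us \<in> words i ==> vs \<in> words j ==> i + j = n ==> t \<in> carrier GG ==> a \<in> dA t ==> b \<in> dA t ==>
  c \<in> carrier K ==> x \<in> X ==>
  bar_inner ph (us @ (t, c \<odot>\<^sub>A a \<oplus>\<^sub>A b) # vs) x =
   c \<odot>\<^sub>A bar_inner ph (us @ (t, a) # vs) x \<oplus>\<^sub>A bar_inner ph (us @ (t, b) # vs) x"
proof (induction i arbitrary: us n ph)
 case 0
 then have us: "us = []" by simp
 have el: "c \<odot>\<^sub>A a \<oplus>\<^sub>A b \<in> dA t" using 0 by (simp add: dA_add dA_smult)
 show ?case
 proof (cases vs)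
  case Nil
  then have "ph [] (act t x) \<in> carrier A" using 0 by (auto intro!: vals_D multilin_vals simp: act_closed)
  then show ?thesis using 0 us Nil el lam_closed[of t] by (simp add: lam_linear V.smult_l_distr V.smult_assoc1)
 next
  case (Cons q ws)
  then obtain k where k: "j = Suc k" "hom_el q" "ws \<in> words k" using 0 by (cases j) auto
  have n: "n = Suc k" using 0 k by simp
  have m: "multilin k (shift (t, d) ph)" if "d \<in> dA t" for d
   using multilin_shift[of k ph "(t, d)"] 0 that by (simp add: n)
  have v: "vals k (shift (t, d) ph)" if "d \<in> dA t" for d using m that by (auto intro: multilin_vals)
  have "agree k (shift (t, c \<odot>\<^sub>A a \<oplus>\<^sub>A b) ph) (comb c (shift (t, a) ph) (shift (t, b) ph))"
   unfolding agree_def shift_def comb_def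
   using multilinD[of "Suc k" ph "[]" 0 _ k t a b c] 0 by (auto simp: n)
  from bar_inner_cong[OF _ this, of "q # ws" x] bar_inner_comb[of "q # ws" k "shift (t, a) ph" "shift (t, b) ph" x c]
  have "bar_inner (shift (t, c \<odot>\<^sub>A a \<oplus>\<^sub>A b) ph) (q # ws) x =
   c \<odot>\<^sub>A bar_inner (shift (t, a) ph) (q # ws) x \<oplus>\<^sub>A bar_inner (shift (t, b) ph) (q # ws) x"
   using 0 k v by simp
  moreover have "bar_inner (shift (t, d) ph) (q # ws) x \<in> carrier A" if "d \<in> dA t" for d
   using 0 k v that by (auto intro!: bar_inner_closed)
  moreover have "ph (pm (t, d) q # ws) x \<in> carrier A" if "d \<in> dA t" for d
   using 0 k that by (intro vals_D[of n]) (auto intro: multilin_vals simp: n)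
  moreover have "ph (pm (t, c \<odot>\<^sub>A a \<oplus>\<^sub>A b) q # ws) x = c \<odot>\<^sub>A ph (pm (t, a) q # ws) x \<oplus>\<^sub>A ph (pm (t, b) q # ws) x"
   using multilinD[of "Suc k" ph "[]" 0 ws k "t \<otimes>\<^sub>GG fst q" "a \<otimes>\<^sub>A snd q" "b \<otimes>\<^sub>A snd q" c x] 0 k
   by (simp add: pm_linear n dA_mult hom_elD) (simp add: pm_def)
  ultimately show ?thesis using 0 by (simp add: us Cons comb_minus)
 qed
next
 case (Suc i)
 then obtain p ws where us: "us = p # ws" "hom_el p" "ws \<in> words i" by (auto simp: words_Suc)
 obtain k where n: "n = Suc k" using Suc.prems by (cases n) auto
 have m: "multilin k (shift p ph)" using Suc us by (auto intro: multilin_shift simp: n)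
 have IH: "bar_inner (shift p ph) (ws @ (t, c \<odot>\<^sub>A a \<oplus>\<^sub>A b) # vs) x =
   c \<odot>\<^sub>A bar_inner (shift p ph) (ws @ (t, a) # vs) x \<oplus>\<^sub>A bar_inner (shift p ph) (ws @ (t, b) # vs) x"
  using Suc us by (intro Suc.IH[OF m]) (auto simp: n)
 have cl: "bar_inner (shift p ph) (ws @ (t, d) # vs) x \<in> carrier A" if "d \<in> dA t" for d
  using Suc.prems us that m by (intro bar_inner_closed[of _ k]) (auto intro: multilin_vals simp: words_def n)
 show ?case
 proof (cases ws)
  case Nil
  have "ph (pm p (t, d) # vs) x \<in> carrier A" if "d \<in> dA t" for d
   using Suc.prems us that Nil by (intro vals_D[of n]) (auto intro: multilin_vals simp: n)
  moreover have "ph (pm p (t, c \<odot>\<^sub>A a \<oplus>\<^sub>A b) # vs) x = c \<odot>\<^sub>A ph (pm p (t, a) # vs) x \<oplus>\<^sub>A ph (pm p (t, b) # vs) x"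
   using multilinD[of n ph "[]" 0 vs j "fst p \<otimes>\<^sub>GG t" "snd p \<otimes>\<^sub>A a" "snd p \<otimes>\<^sub>A b" c x] Suc.prems us Nil
   by (simp add: pm_linear dA_mult hom_elD) (simp add: pm_def)
  ultimately show ?thesis using Suc.prems us Nil IH cl by (simp add: comb_minus)
 next
  case (Cons q zs)
  then obtain l where l: "i = Suc l" "hom_el q" "zs \<in> words l" using us by (cases i) auto
  have "ph (pm p q # zs @ (t, d) # vs) x \<in> carrier A" if "d \<in> dA t" for d
   using Suc.prems us that Cons l by (intro vals_D[of n]) (auto intro: multilin_vals simp: n words_def)
  moreover have "ph (pm p q # zs @ (t, c \<odot>\<^sub>A a \<oplus>\<^sub>A b) # vs) x =
    c \<odot>\<^sub>A ph (pm p q # zs @ (t, a) # vs) x \<oplus>\<^sub>A ph (pm p q # zs @ (t, b) # vs) x"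
   using multilinD[of n ph "pm p q # zs" i vs j t a b c x] Suc.prems us Cons l by simp
  ultimately show ?thesis using Suc.prems us Cons IH cl by (simp add: comb_minus)
 qed
qed

lemma multilin_inner: assumes "multilin n ph" shows "multilin (Suc n) (bar_inner ph)"
proof (rule multilinI)
 show "vals (Suc n) (bar_inner ph)" using assms by (intro vals_inner multilin_vals)
qed (rule bar_inner_linear[OF assms], auto)

lemma multilin_comb: assumes "multilin n ph" "multilin n ps" "d \<in> carrier K" shows "multilin n (comb d ph ps)"
proof (rule multilinI)
 show "vals n (comb d ph ps)" using assms by (auto intro: vals_comb multilin_vals)
 fix us vs i j t a b c x
 assume h: "us \<in> words i" "vs \<in> words j" "i + j + 1 = n" "t \<in> carrier GG" "a \<in> dA t" "b \<in> dA t" "c \<in> carrier K" "x \<in> X"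
 have w: "us @ (t, e) # vs \<in> words n" if "e \<in> dA t" for e using h that by (auto simp: words_def)
 have c: "ph (us @ (t, e) # vs) x \<in> carrier A" "ps (us @ (t, e) # vs) x \<in> carrier A" if "e \<in> dA t" for e
  using w[OF that] assms h by (auto intro: vals_D multilin_vals)
 show "comb d ph ps (us @ (t, c \<odot>\<^sub>A a \<oplus>\<^sub>A b) # vs) x =
   c \<odot>\<^sub>A comb d ph ps (us @ (t, a) # vs) x \<oplus>\<^sub>A comb d ph ps (us @ (t, b) # vs) x"
  unfolding comb_def multilinD[OF assms(1) h] multilinD[OF assms(2) h]
  using h c[of a] c[of b] assms(3)
  by (simp add: V.smult_r_distr A.a_ac flip: V.smult_assoc1) (simp add: m_comm)
qed

lemma multilin_zero: "multilin n (\<lambda>_ _. \<zero>\<^sub>A)"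
 by (rule multilinI) (auto simp: vals_def V.smult_r_null)

lemma multilin_lmult: assumes "multilin n ph" shows "multilin (Suc n) (\<lambda>as x. snd (hd as) \<otimes>\<^sub>A ph (tl as) x)"
proof (rule multilinI)
 show "vals (Suc n) (\<lambda>as x. snd (hd as) \<otimes>\<^sub>A ph (tl as) x)"
  using multilin_vals[OF assms] by (auto simp: vals_def words_Suc dA_carrier)
 fix us vs i j t a b c x
 assume h: "us \<in> words i" "vs \<in> words j" "i + j + 1 = Suc n" "t \<in> carrier GG" "a \<in> dA t" "b \<in> dA t" "c \<in> carrier K" "x \<in> X"
 show "snd (hd (us @ (t, c \<odot>\<^sub>A a \<oplus>\<^sub>A b) # vs)) \<otimes>\<^sub>A ph (tl (us @ (t, c \<odot>\<^sub>A a \<oplus>\<^sub>A b) # vs)) x =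
   c \<odot>\<^sub>A (snd (hd (us @ (t, a) # vs)) \<otimes>\<^sub>A ph (tl (us @ (t, a) # vs)) x) \<oplus>\<^sub>A
   snd (hd (us @ (t, b) # vs)) \<otimes>\<^sub>A ph (tl (us @ (t, b) # vs)) x"
 proof (cases us)
  case Nil
  then have "ph vs x \<in> carrier A" using h multilin_vals[OF assms] by (auto intro: vals_D)
  then show ?thesis using h Nil by (simp add: A.l_distr dA_carrier smult_assoc_l)
 next
  case (Cons p ws)
  then obtain k where k: "i = Suc k" "hom_el p" "ws \<in> words k" using h by (cases i) auto
  have c: "ph (ws @ (t, e) # vs) x \<in> carrier A" if "e \<in> dA t" for e
   using h k that multilin_vals[OF assms] by (auto intro!: vals_D[of n] simp: words_def)
  show ?thesis using h k Cons multilinD[OF assms, of ws k vs j t a b c x] c[of a] c[of b]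
   by (simp add: A.r_distr hom_elD smult_assoc_r)
 qed
qed

lemma multilin_diff: assumes "multilin n ph" shows "multilin (Suc n) (bar_diff ph)"
proof (rule multilin_cong)
 show "multilin (Suc n) (comb (\<ominus>\<^sub>K \<one>\<^sub>K) (bar_inner ph) (\<lambda>as x. snd (hd as) \<otimes>\<^sub>A ph (tl as) x))"
  using assms by (intro multilin_comb multilin_inner multilin_lmult) auto
 show "agree (Suc n) (comb (\<ominus>\<^sub>K \<one>\<^sub>K) (bar_inner ph) (\<lambda>as x. snd (hd as) \<otimes>\<^sub>A ph (tl as) x)) (bar_diff ph)"
  using multilin_vals[OF multilin_inner[OF assms]] multilin_vals[OF multilin_lmult[OF assms]]
  by (auto simp: agree_def comb_def bar_diff_def vals_def smult_minus_one a_minus_def A.a_ac)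
qed

definition weight :: "('x => 't) => bool" where
 "weight w \<longleftrightarrow> (\<forall>x\<in>X. w x \<in> carrier GG \<and>
   (\<forall>p. hom_el p --> lam p x ~= \<zero>\<^sub>K --> w (act (fst p) x) = fst p \<otimes>\<^sub>GG w x))"

lemma homogD: "homog l w n ph ==> as \<in> words n ==> x \<in> X ==> ph as x \<in> dA (l \<otimes>\<^sub>GG (tot as \<otimes>\<^sub>GG w x))"
 by (simp add: homog_def)

lemma weightD: "weight w ==> x \<in> X ==> w x \<in> carrier GG"
 "weight w ==> x \<in> X ==> hom_el p ==> lam p x ~= \<zero>\<^sub>K ==> w (act (fst p) x) = fst p \<otimes>\<^sub>GG w x"
 unfolding weight_def by blast+

lemma homog_shift:
 assumes "homog l w (Suc n) ph" "hom_el p" "weight w" "l \<in> carrier GG"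
 shows "homog (l \<otimes>\<^sub>GG fst p) w n (shift p ph)"
 unfolding homog_def shift_def
proof (intro ballI)
 fix as x assume as: "as \<in> words n" "x \<in> X"
 then have "ph (p # as) x \<in> dA (l \<otimes>\<^sub>GG (tot (p # as) \<otimes>\<^sub>GG w x))" using assms by (intro homogD[of _ _ "Suc n"]) auto
 then show "ph (p # as) x \<in> dA (l \<otimes>\<^sub>GG fst p \<otimes>\<^sub>GG (tot as \<otimes>\<^sub>GG w x))"
  using assms as tot_closed[OF as(1)] by (auto simp: hom_elD weight_def Gr.m_assoc)
qed

lemma homog_inner:
 "homog l w n ph ==> weight w ==> l \<in> carrier GG ==> as \<in> words (Suc n) ==> x \<in> X ==>
  bar_inner ph as x \<in> dA (l \<otimes>\<^sub>GG (tot as \<otimes>\<^sub>GG w x))"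
proof (induction n arbitrary: as l ph)
 case 0
 then obtain p where p: "as = [p]" "hom_el p" by (auto simp: words_Suc)
 have g: "ph [] (act (fst p) x) \<in> dA (l \<otimes>\<^sub>GG w (act (fst p) x))" "w (act (fst p) x) \<in> carrier GG" "w x \<in> carrier GG"
  using 0 p by (auto simp: homog_def act_cl weight_def)
 show ?case
 proof (cases "lam p x = \<zero>\<^sub>K")
  case True
  then show ?thesis using 0 p g dA_carrier[OF _ g(1)] by (auto simp: V.smult_l_null intro!: dA_zero hom_elD)
 next
  case False
  then have "w (act (fst p) x) = fst p \<otimes>\<^sub>GG w x" using 0 p by (intro weightD(2)) auto
  then show ?thesis using 0 p g by (simp add: hom_elD lam_cl dA_smult)
 qed
next
 case (Suc n)
 then obtain p q bs where as: "as = p # q # bs" "hom_el p" "hom_el q" "bs \<in> words n" by (auto simp: words_Suc)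
 have w: "w x \<in> carrier GG" "tot bs \<in> carrier GG" using Suc as by (auto simp: weight_def intro: tot_closed)
 have "bar_inner (shift p ph) (q # bs) x \<in> dA (l \<otimes>\<^sub>GG fst p \<otimes>\<^sub>GG (tot (q # bs) \<otimes>\<^sub>GG w x))"
  using Suc as by (intro Suc.IH) (auto intro: homog_shift hom_elD)
 moreover have "ph (pm p q # bs) x \<in> dA (l \<otimes>\<^sub>GG (tot (pm p q # bs) \<otimes>\<^sub>GG w x))"
  using Suc.prems as by (intro homogD[of _ _ "Suc n"]) auto
 ultimately show ?case using Suc.prems as w
  by (auto simp: pm_def hom_elD Gr.m_assoc intro!: dA_minus)
qed

lemma homog_diff:
 assumes "homog \<one>\<^sub>GG w n ph" "weight w"
 shows "homog \<one>\<^sub>GG w (Suc n) (bar_diff ph)"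
 unfolding homog_def
proof (intro ballI)
 fix as x assume as: "as \<in> words (Suc n)" and x: "x \<in> X"
 obtain p bs where p: "as = p # bs" "hom_el p" "bs \<in> words n" using as by (auto simp: words_Suc)
 have w: "w x \<in> carrier GG" "tot bs \<in> carrier GG" using assms p x by (auto simp: weight_def intro: tot_closed)
 have "bar_inner ph as x \<in> dA (\<one>\<^sub>GG \<otimes>\<^sub>GG (tot as \<otimes>\<^sub>GG w x))" using assms as x by (intro homog_inner) auto
 moreover have "ph bs x \<in> dA (tot bs \<otimes>\<^sub>GG w x)" using homogD[OF assms(1) p(3) x] p w by simp
 then have "snd p \<otimes>\<^sub>A ph bs x \<in> dA (fst p \<otimes>\<^sub>GG (tot bs \<otimes>\<^sub>GG w x))" using p w by (intro dA_mult) (auto simp: hom_elD)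
 ultimately show "bar_diff ph as x \<in> dA (\<one>\<^sub>GG \<otimes>\<^sub>GG (tot as \<otimes>\<^sub>GG w x))"
  using p w by (auto simp: bar_diff_def hom_elD Gr.m_assoc intro!: dA_minus)
qed


lemma homog_comb: "homog l w n ph ==> homog l w n ps ==> weight w ==> l \<in> carrier GG ==> c \<in> carrier K ==> homog l w n (comb c ph ps)"
 unfolding homog_def comb_def by (intro ballI dA_add dA_smult) (auto intro: tot_closed weightD)

definition cochain :: "('x => 't) => nat => (('t \<times> 'a) list => 'x => 'a) => bool" where
 "cochain w n ph \<longleftrightarrow> multilin n ph \<and> homog \<one>\<^sub>GG w n ph"

definition cocycle :: "('x => 't) => nat => (('t \<times> 'a) list => 'x => 'a) => bool" where
 "cocycle w n ph \<longleftrightarrow> cochain w n ph \<and> agree (Suc n) (bar_diff ph) (\<lambda>_ _. \<zero>\<^sub>A)"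

definition boundary :: "('x => 't) => nat => (('t \<times> 'a) list => 'x => 'a) => bool" where
 "boundary w n ph \<longleftrightarrow> (case n of 0 => agree 0 ph (\<lambda>_ _. \<zero>\<^sub>A)
   | Suc k => \<exists>ps. cochain w k ps \<and> agree (Suc k) (bar_diff ps) ph)"

definition acyclic :: "('x => 't) => nat => bool" where
 "acyclic w n \<longleftrightarrow> (\<forall>ph. cocycle w n ph --> boundary w n ph)"

lemma agreeD: "agree n ph ps ==> as \<in> words n ==> x \<in> X ==> ph as x = ps as x"
 by (simp add: agree_def)

lemma agree_trans: "agree n ph ps ==> agree n ps \<chi> ==> agree n ph \<chi>" and agree_sym: "agree n ph ps ==> agree n ps ph"
 by (simp_all add: agree_def)

lemma cochain_vals: "cochain w n ph ==> vals n ph" by (simp add: cochain_def multilin_vals)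

lemma cochain_comb: "cochain w n ph ==> cochain w n ps ==> weight w ==> c \<in> carrier K ==> cochain w n (comb c ph ps)"
 by (simp add: cochain_def multilin_comb homog_comb)

lemma cochain_diff: "cochain w n ph ==> weight w ==> cochain w (Suc n) (bar_diff ph)"
 by (simp add: cochain_def multilin_diff homog_diff)

lemma cochain_zero: "weight w ==> cochain w n (\<lambda>_ _. \<zero>\<^sub>A)"
 by (simp add: cochain_def multilin_zero homog_def dA_zero tot_closed weightD)

definition sub :: "(('t \<times> 'a) list => 'x => 'a) => (('t \<times> 'a) list => 'x => 'a) => ('t \<times> 'a) list => 'x => 'a" where
 "sub ph ps = comb (\<ominus>\<^sub>K \<one>\<^sub>K) ps ph"

lemma sub_apply: "vals n ph ==> vals n ps ==> as \<in> words n ==> x \<in> X ==> sub ph ps as x = ph as x \<ominus>\<^sub>A ps as x"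
 by (simp add: sub_def comb_def smult_minus_one vals_D a_minus_def A.a_ac)

lemma cochain_sub: "cochain w n ph ==> cochain w n ps ==> weight w ==> cochain w n (sub ph ps)"
 by (simp add: sub_def cochain_comb)

lemma bar_diff_sub:
 assumes "vals n ph" "vals n ps" "as \<in> words (Suc n)" "x \<in> X"
 shows "bar_diff (sub ph ps) as x = bar_diff ph as x \<ominus>\<^sub>A bar_diff ps as x"
 using agreeD[OF bar_diff_comb[OF assms(2,1), of "\<ominus>\<^sub>K \<one>\<^sub>K"] assms(3,4)] assms
  sub_apply[OF vals_diff[OF assms(1)] vals_diff[OF assms(2)] assms(3,4)]
 by (simp add: sub_def)

lemma bar_inner_zero: "bar_inner (\<lambda>_ _. \<zero>\<^sub>A) as x = \<zero>\<^sub>A" if "as \<in> words (Suc n)" "x \<in> X"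
 using that
proof (induction n arbitrary: as)
 case 0
 then show ?case by (auto simp: words_Suc V.smult_r_null lam_closed)
next
 case (Suc n)
 then obtain p q bs where as: "as = p # q # bs" "q # bs \<in> words (Suc n)" by (auto simp: words_Suc)
 show ?case using Suc.IH[OF as(2)] Suc.prems by (simp add: as shift_def[abs_def])
qed

lemma bar_diff_zero:
 assumes "agree n ph (\<lambda>_ _. \<zero>\<^sub>A)" shows "agree (Suc n) (bar_diff ph) (\<lambda>_ _. \<zero>\<^sub>A)"
 using bar_diff_cong[OF assms]
 by (auto simp: agree_def bar_diff_def bar_inner_zero words_Suc a_minus_def dA_carrier)

end

section \<open>Restriction to the coefficient subalgebra of a free extension\<close>

text \<open>The fel x are free generators of the algebra over a subalgebra with degrees in GG0, which fix x0:
moving a letter past a generator leaves the coefficient bel. The module is induced from the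
one-dimensional module of the subalgebra spanned by x0.\<close>
locale free_extension = graded_actor K A GG dA X act lam
 for K :: "'k ring" and A :: "('k, 'a) module" and GG :: "('t, 's) monoid_scheme"
  and dA :: "'t => 'a set" and X :: "'x set" and act :: "'t => 'x => 'x"
  and lam :: "'t \<times> 'a => 'x => 'k" +
 fixes fel :: "'x => 't \<times> 'a" and x0 :: 'x and GG0 :: "'t set"
  and bdeg :: "'t => 'x => 't" and bel :: "'t \<times> 'a => 'x => 'a"
 assumes x0 [simp]: "x0 \<in> X"
  and fel: "!!x. x \<in> X ==> hom_el (fel x)"
  and act_fel: "!!x. x \<in> X ==> act (fst (fel x)) x0 = x"
  and lam_fel: "!!x. x \<in> X ==> lam (fel x) x0 = \<one>\<^sub>K"
  and bdeg: "!!t x. t \<in> carrier GG ==> x \<in> X ==> bdeg t x \<in> GG0 \<inter> carrier GG"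
  and stab: "!!t. t \<in> GG0 ==> t \<in> carrier GG ==> act t x0 = x0"
  and bel: "!!t a x. t \<in> carrier GG ==> a \<in> dA t ==> x \<in> X ==> bel (t, a) x \<in> dA (bdeg t x)"
  and bel_fel: "!!p x. hom_el p ==> x \<in> X ==>
   pm p (fel x) = pm (fel (act (fst p) x)) (bdeg (fst p) x, bel p x)"
  and bel_linear: "!!t a b c x. [|t \<in> carrier GG; a \<in> dA t; b \<in> dA t; c \<in> carrier K; x \<in> X|] ==>
   bel (t, c \<odot>\<^sub>A a \<oplus>\<^sub>A b) x = c \<odot>\<^sub>A bel (t, a) x \<oplus>\<^sub>A bel (t, b) x"
  and bel_mult: "!!p q x. hom_el p ==> hom_el q ==> x \<in> X ==>
   (bdeg (fst (pm p q)) x, bel (pm p q) x) = pm (bdeg (fst p) (act (fst q) x), bel p (act (fst q) x)) (bdeg (fst q) x, bel q x)"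
  and lam_bel: "!!p x. hom_el p ==> x \<in> X ==> lam p x = lam (bdeg (fst p) x, bel p x) x0"
begin

definition beta :: "'t \<times> 'a => 'x => 't \<times> 'a" where
 "beta p x = (bdeg (fst p) x, bel p x)"

lemma beta: "hom_el p ==> x \<in> X ==> hom_el (beta p x)"
 using bdeg[of "fst p" x] bel[of "fst p" "snd p" x] by (simp add: beta_def hom_elD)

lemma beta_fel: "hom_el p ==> x \<in> X ==> pm p (fel x) = pm (fel (act (fst p) x)) (beta p x)"
 by (simp add: beta_def bel_fel)

lemma beta_mult: "hom_el p ==> hom_el q ==> x \<in> X ==> beta (pm p q) x = pm (beta p (act (fst q) x)) (beta q x)"
 by (simp add: beta_def bel_mult)

lemma lam_beta: "hom_el p ==> x \<in> X ==> lam (beta p x) x0 = lam p x"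
 by (simp add: beta_def lam_bel[symmetric])

definition words0 :: "nat => ('t \<times> 'a) list set" where
 "words0 n = {as \<in> words n. \<forall>p\<in>set as. fst p \<in> GG0}"

fun pend :: "('t \<times> 'a) list => 'x => 'x" where
 "pend [] x = x"
| "pend (p # as) x = act (fst p) (pend as x)"

fun pword :: "('t \<times> 'a) list => 'x => ('t \<times> 'a) list" where
 "pword [] x = []"
| "pword (p # as) x = beta p (pend as x) # pword as x"

fun htpy :: "(('t \<times> 'a) list => 'x => 'a) => ('t \<times> 'a) list => 'x => 'a" where
 "htpy ph [] x = ph [fel x] x0"
| "htpy ph (p # as) x = ph (fel (pend (p # as) x) # pword (p # as) x) x0 \<ominus>\<^sub>A htpy (shift p ph) as x"

definition induce :: "(('t \<times> 'a) list => 'x => 'a) => ('t \<times> 'a) list => 'x => 'a" where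
 "induce ps as x = snd (fel (pend as x)) \<otimes>\<^sub>A ps (pword as x) x0"

lemma pend_closed: "as \<in> words n ==> x \<in> X ==> pend as x \<in> X"
 by (induction n arbitrary: as) (auto simp: words_Suc act_closed)

lemma pword_closed: "as \<in> words n ==> x \<in> X ==> pword as x \<in> words n"
proof (induction n arbitrary: as)
 case (Suc n)
 then obtain p bs where "as = p # bs" "hom_el p" "bs \<in> words n" by (auto simp: words_Suc)
 then show ?case using Suc beta[of p "pend bs x"] by (simp add: pend_closed)
qed simp

lemma beta_stab: "hom_el p ==> x \<in> X ==> act (fst (beta p x)) x0 = x0"
 using bdeg[of "fst p" x] by (simp add: beta_def hom_elD stab)

lemma pword_words0: "as \<in> words n ==> x \<in> X ==> pword as x \<in> words0 n"
proof (induction n arbitrary: as)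
 case (Suc n)
 then obtain p bs where as: "as = p # bs" "hom_el p" "bs \<in> words n" by (auto simp: words_Suc)
 have "fst (beta p (pend bs x)) \<in> GG0" using as Suc.prems bdeg[of "fst p" "pend bs x"] by (auto simp: beta_def hom_elD pend_closed)
 then show ?case using Suc as by (auto simp: words0_def beta pend_closed)
qed (auto simp: words0_def)

lemma vals_htpy: "vals (Suc n) ph ==> vals n (htpy ph)"
proof (induction n arbitrary: ph)
 case 0
 then show ?case by (auto simp: vals_def fel)
next
 case (Suc n)
 show ?case unfolding vals_def
 proof (intro ballI)
  fix as x assume h: "as \<in> words (Suc n)" "x \<in> X"
  then obtain p bs where as: "as = p # bs" "hom_el p" "bs \<in> words n" by (auto simp: words_Suc)
  have "vals n (htpy (shift p ph))" using Suc as by (auto intro: vals_shift)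
  then have "htpy (shift p ph) bs x \<in> carrier A" using as h by (auto intro: vals_D)
  moreover have "ph (fel (pend as x) # pword as x) x0 \<in> carrier A"
   using h pend_closed[OF h] pword_closed[OF h] fel Suc.prems by (intro vals_D[of "Suc (Suc n)"]) auto
  ultimately show "htpy ph as x \<in> carrier A" by (simp add: as)
 qed
qed

lemma htpy_comb:
 "as \<in> words n ==> vals (Suc n) ph ==> vals (Suc n) ps ==> x \<in> X ==> c \<in> carrier K ==>
  htpy (comb c ph ps) as x = c \<odot>\<^sub>A htpy ph as x \<oplus>\<^sub>A htpy ps as x"
proof (induction n arbitrary: as ph ps)
 case 0
 then show ?case by (simp add: comb_def)
next
 case (Suc n)
 then obtain p bs where as: "as = p # bs" "hom_el p" "bs \<in> words n" by (auto simp: words_Suc)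
 have IH: "htpy (shift p (comb c ph ps)) bs x = c \<odot>\<^sub>A htpy (shift p ph) bs x \<oplus>\<^sub>A htpy (shift p ps) bs x"
  unfolding shift_comb using Suc as by (intro Suc.IH) (auto intro: vals_shift)
 have c: "htpy (shift p ph) bs x \<in> carrier A" "htpy (shift p ps) bs x \<in> carrier A"
  using Suc.prems as by (auto intro!: vals_D[of n] vals_htpy vals_shift)
 have w: "fel (pend as x) # pword as x \<in> words (Suc (Suc n))"
  using Suc.prems by (simp add: fel pend_closed pword_closed)
 then have "ph (fel (pend as x) # pword as x) x0 \<in> carrier A" "ps (fel (pend as x) # pword as x) x0 \<in> carrier A"
  using Suc.prems by (auto intro: vals_D)
 then show ?case using IH c Suc.prems by (simp add: as) (simp add: comb_def comb_minus)
qed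

lemma htpy_cong: "as \<in> words n ==> agree (Suc n) ph ps ==> x \<in> X ==> htpy ph as x = htpy ps as x"
proof (induction n arbitrary: as ph ps)
 case 0
 then show ?case by (simp add: agree_def fel)
next
 case (Suc n)
 then obtain p bs where as: "as = p # bs" "hom_el p" "bs \<in> words n" by (auto simp: words_Suc)
 have IH: "htpy (shift p ph) bs x = htpy (shift p ps) bs x"
  using Suc as by (intro Suc.IH) (auto simp: agree_def shift_def)
 have w: "fel (pend as x) # pword as x \<in> words (Suc (Suc n))"
  using Suc.prems by (simp add: fel pend_closed pword_closed)
 then have "ph (fel (pend as x) # pword as x) x0 = ps (fel (pend as x) # pword as x) x0"
  using Suc.prems x0 unfolding agree_def by blast
 then show ?case using IH by (simp add: as)
qed

lemma htpy_sub:
 assumes "as \<in> words n" "vals (Suc n) ph" "vals (Suc n) ps" "x \<in> X"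
 shows "htpy (\<lambda>as x. ph as x \<ominus>\<^sub>A ps as x) as x = htpy ph as x \<ominus>\<^sub>A htpy ps as x"
proof -
 have "agree (Suc n) (\<lambda>as x. ph as x \<ominus>\<^sub>A ps as x) (comb (\<ominus>\<^sub>K \<one>\<^sub>K) ps ph)"
  using assms by (auto simp: agree_def comb_def vals_D smult_minus_one a_minus_def A.a_ac)
 from htpy_cong[OF assms(1) this assms(4)] htpy_comb[OF assms(1,3,2,4), of "\<ominus>\<^sub>K \<one>\<^sub>K"]
 show ?thesis using vals_D[OF vals_htpy[OF assms(2)] assms(1,4)] vals_D[OF vals_htpy[OF assms(3)] assms(1,4)]
  by (simp add: smult_minus_one a_minus_def A.a_ac)
qed

lemma htpy_lmult:
 "as \<in> words n ==> vals (Suc n) ph ==> x \<in> X ==> c \<in> carrier A ==>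
  htpy (\<lambda>as x. c \<otimes>\<^sub>A ph as x) as x = c \<otimes>\<^sub>A htpy ph as x"
proof (induction n arbitrary: as ph)
 case 0
 then show ?case by simp
next
 case (Suc n)
 then obtain p bs where as: "as = p # bs" "hom_el p" "bs \<in> words n" by (auto simp: words_Suc)
 have "shift p (\<lambda>as x. c \<otimes>\<^sub>A ph as x) = (\<lambda>as x. c \<otimes>\<^sub>A shift p ph as x)"
  by (simp add: shift_def fun_eq_iff)
 then have IH: "htpy (shift p (\<lambda>as x. c \<otimes>\<^sub>A ph as x)) bs x = c \<otimes>\<^sub>A htpy (shift p ph) bs x"
  using Suc as by (simp only:) (intro Suc.IH, auto intro: vals_shift)
 have c: "htpy (shift p ph) bs x \<in> carrier A"
  using Suc.prems as by (auto intro!: vals_D[of n] vals_htpy vals_shift)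
 have w: "fel (pend as x) # pword as x \<in> words (Suc (Suc n))"
  using Suc.prems by (simp add: fel pend_closed pword_closed)
 then have "ph (fel (pend as x) # pword as x) x0 \<in> carrier A"
  using Suc.prems by (auto intro: vals_D)
 then show ?case using IH c Suc.prems by (simp add: as A.r_minus A.r_distr a_minus_def)
qed

lemma inner_transport:
 assumes "cs \<in> words n" "hom_el c" "x \<in> X"
 shows "bar_inner (\<lambda>as x. \<chi> (pend as x) (pword as x)) (c # cs) x =
  bar_inner (\<lambda>bs _. \<chi> (pend (c # cs) x) bs) (pword (c # cs) x) x0"
 using assms
proof (induction n arbitrary: cs c \<chi>)
 case 0
 then show ?case by (simp add: lam_beta)
next
 case (Suc n)
 then obtain d ds where cs: "cs = d # ds" "hom_el d" "ds \<in> words n" by (auto simp: words_Suc)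
 define \<chi>' where "\<chi>' y bs = \<chi> (act (fst c) y) (beta c y # bs)" for y bs
 have y: "pend ds x \<in> X" using cs Suc by (auto intro: pend_closed)
 have s: "shift c (\<lambda>as x. \<chi> (pend as x) (pword as x)) = (\<lambda>as x. \<chi>' (pend as x) (pword as x))"
  "shift (beta c (act (fst d) (pend ds x))) (\<lambda>bs _. \<chi> (act (fst c) (act (fst d) (pend ds x))) bs) = (\<lambda>bs _. \<chi>' (pend (d # ds) x) bs)"
  by (simp_all add: shift_def \<chi>'_def fun_eq_iff)
 have "bar_inner (\<lambda>as x. \<chi>' (pend as x) (pword as x)) (d # ds) x =
   bar_inner (\<lambda>bs _. \<chi>' (pend (d # ds) x) bs) (pword (d # ds) x) x0"
  using cs Suc by (intro Suc.IH) auto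
 moreover have "fst (pm c d) \<in> carrier GG" "act (fst (pm c d)) (pend ds x) = act (fst c) (act (fst d) (pend ds x))"
  using cs Suc y by (auto simp: pm_def hom_elD act_mult)
 ultimately show ?case using cs Suc.prems y by (simp add: s beta_mult)
qed

lemma bar_inner_x0:
 "bs \<in> words0 (Suc n) ==> bar_inner ph bs x0 = bar_inner (\<lambda>bs _. ph bs x0) bs x0"
proof (induction n arbitrary: bs ph)
 case 0
 then show ?case by (auto simp: words0_def words_Suc stab)
next
 case (Suc n)
 then obtain p q cs where bs: "bs = p # q # cs" "q # cs \<in> words0 (Suc n)" by (auto simp: words0_def words_Suc)
 have "shift p (\<lambda>bs (_::'x). ph bs x0) = (\<lambda>bs _. shift p ph bs x0)" by (simp add: shift_def fun_eq_iff)
 then show ?case using Suc.IH[OF bs(2), of "shift p ph"] by (simp add: bs)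
qed

lemma inner_htpy:
 assumes "as \<in> words n" "hom_el p" "x \<in> X" "vals (Suc n) ph"
 shows "bar_inner (htpy ph) (p # as) x \<oplus>\<^sub>A bar_inner ph (fel (pend (p # as) x) # pword (p # as) x) x0 =
  ph (p # as) x \<oplus>\<^sub>A htpy (shift p (bar_inner ph)) as x"
 using assms
proof (induction n arbitrary: as p ph)
 case 0
 have p: "pm (fel (act (fst p) x)) (beta p x) = pm p (fel x)" using 0 by (simp add: beta_fel)
 have y: "act (fst p) x \<in> X" using 0 by (simp add: act_cl)
 have c: "ph [pm p (fel x)] x0 \<in> carrier A" "ph [p] x \<in> carrier A" "ph [fel (act (fst p) x)] x0 \<in> carrier A"
  using 0 fel[OF y] fel[of x] by (auto intro!: vals_D[of "Suc 0"])
 have "bar_inner ph [fel (act (fst p) x), beta p x] x0 = ph [pm p (fel x)] x0 \<ominus>\<^sub>A lam p x \<odot>\<^sub>A ph [fel (act (fst p) x)] x0"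
  using 0 by (simp add: p lam_beta beta_stab) (simp add: shift_def)
 moreover have "bar_inner ph [p, fel x] x0 = ph [pm p (fel x)] x0 \<ominus>\<^sub>A ph [p] x"
  using 0 c by (simp add: lam_fel act_fel) (simp add: shift_def)
 moreover have "lam p x \<odot>\<^sub>A ph [fel (act (fst p) x)] x0 \<in> carrier A" using 0 c lam_cl by simp
 moreover have "as = []" using 0 by simp
 ultimately show ?case using c
  by (simp add: shift_def[of p "bar_inner ph"] del: bar_inner.simps(3)) (simp, algebra)
next
 case (Suc n)
 then obtain c cs where as: "as = c # cs" "hom_el c" "cs \<in> words n" by (auto simp: words_Suc)
 define y2 where "y2 = pend cs x"
 define y1 where "y1 = act (fst c) y2"
 define y where "y = act (fst p) y1"
 define b' where "b' = beta c y2"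
 define b where "b = beta p y1"
 define bs where "bs = pword cs x"
 have X: "y2 \<in> X" "y1 \<in> X" "y \<in> X" using Suc as by (auto simp: y2_def y1_def y_def intro!: pend_closed act_cl)
 have H: "hom_el b'" "hom_el b" "hom_el (fel y)" "hom_el (fel y1)" "bs \<in> words n" "b' # bs \<in> words0 (Suc n)"
  using Suc as X pword_words0[of "c # cs" "Suc n" x]
  by (auto simp: b'_def b_def bs_def y2_def intro!: beta fel pword_closed)
 have hpc: "hom_el (pm p c)" "act (fst (pm p c)) y2 = y" "beta (pm p c) y2 = pm b b'"
  using Suc as X by (auto simp: y_def y1_def b_def b'_def beta_mult) (simp add: pm_def act_mult hom_elD)
 have pf: "pm p (fel y1) = pm (fel y) b" using Suc X by (simp add: b_def y_def beta_fel)
 define \<chi> where "\<chi> z zs = ph (fel (act (fst p) z) # beta p z # zs) x0" for z zs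
 define T where "T = bar_inner (\<lambda>zs _. ph (fel y # b # zs) x0) (b' # bs) x0"
 have v: "vals (Suc n) (shift p ph)" "vals (Suc n) (shift (pm p c) ph)" "vals n (\<lambda>as x. \<chi> (pend as x) (pword as x))"
   "vals n (shift b (shift (fel y) ph))"
  using Suc.prems as hpc H apply (auto intro!: vals_shift)
  unfolding vals_def \<chi>_def
  by (intro ballI vals_D[OF Suc.prems(4)]) (auto simp: fel act_cl pend_closed beta pword_closed)
 note IH = Suc.IH[OF as(3,2) Suc.prems(3) v(1), folded b'_def bs_def y2_def y1_def]
 have e1: "bar_inner (shift p (htpy ph)) (c # cs) x = T \<ominus>\<^sub>A bar_inner (htpy (shift p ph)) (c # cs) x"
 proof -
  have "shift p (htpy ph) = (\<lambda>as x. \<chi> (pend as x) (pword as x) \<ominus>\<^sub>A htpy (shift p ph) as x)"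
   by (simp add: shift_def[of p "htpy ph"] \<chi>_def fun_eq_iff)
  then have "bar_inner (shift p (htpy ph)) (c # cs) x =
    bar_inner (\<lambda>as x. \<chi> (pend as x) (pword as x)) (c # cs) x \<ominus>\<^sub>A bar_inner (htpy (shift p ph)) (c # cs) x"
   using Suc.prems as v by (simp only:) (intro bar_inner_sub[of _ n], auto intro: vals_htpy)
  also have "bar_inner (\<lambda>as x. \<chi> (pend as x) (pword as x)) (c # cs) x = T"
   unfolding inner_transport[OF as(3,2) Suc.prems(3)] T_def
   by (simp add: \<chi>_def y_def y1_def y2_def b_def b'_def bs_def)
  finally show ?thesis .
 qed
 have e2: "bar_inner (shift b (shift (fel y) ph)) (b' # bs) x0 = T"
  unfolding T_def by (subst bar_inner_x0[OF H(6)]) (simp add: shift_def)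
 have e3: "htpy (shift c (shift p (bar_inner ph))) cs x =
   htpy (shift (pm p c) ph) cs x \<ominus>\<^sub>A htpy (shift c (bar_inner (shift p ph))) cs x"
 proof -
  have "shift c (shift p (bar_inner ph)) = (\<lambda>as x. shift (pm p c) ph as x \<ominus>\<^sub>A shift c (bar_inner (shift p ph)) as x)"
   by (simp add: shift_def fun_eq_iff)
  then show ?thesis using as Suc.prems v by (simp only:) (intro htpy_sub, auto intro!: vals_shift vals_inner)
 qed
 have cl: "ph (fel y # pm b b' # bs) x0 \<in> carrier A" "ph (pm (fel y) b # b' # bs) x0 \<in> carrier A" "ph (p # c # cs) x \<in> carrier A"
  using Suc.prems as H by (auto intro!: vals_D[OF Suc.prems(4)])
 have cl2: "T \<in> carrier A" "bar_inner (htpy (shift p ph)) (c # cs) x \<in> carrier A"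
   "bar_inner (shift p ph) (fel y1 # b' # bs) x0 \<in> carrier A"
  using Suc.prems as H v unfolding e2[symmetric] by (auto intro!: bar_inner_closed vals_htpy simp del: bar_inner.simps(3))
 have cl3: "htpy (shift (pm p c) ph) cs x \<in> carrier A" "htpy (shift c (bar_inner (shift p ph))) cs x \<in> carrier A"
  using Suc.prems as H v by (auto intro!: vals_D[OF vals_htpy] vals_shift vals_inner)
 have L1: "bar_inner (htpy ph) (p # as) x =
   (ph (fel y # pm b b' # bs) x0 \<ominus>\<^sub>A htpy (shift (pm p c) ph) cs x) \<ominus>\<^sub>A (T \<ominus>\<^sub>A bar_inner (htpy (shift p ph)) (c # cs) x)"
  by (simp add: as e1) (simp add: hpc flip: y2_def bs_def)
 have L2: "bar_inner ph (fel (pend (p # as) x) # pword (p # as) x) x0 =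
   ph (pm (fel y) b # b' # bs) x0 \<ominus>\<^sub>A (ph (fel y # pm b b' # bs) x0 \<ominus>\<^sub>A T)"
  by (simp add: as flip: y2_def bs_def) (simp add: e2 shift_def[of "fel y" ph "pm b b' # bs"] flip: y1_def y_def b_def b'_def)
 have R: "htpy (shift p (bar_inner ph)) as x =
   (ph (pm (fel y) b # b' # bs) x0 \<ominus>\<^sub>A bar_inner (shift p ph) (fel y1 # b' # bs) x0) \<ominus>\<^sub>A
   (htpy (shift (pm p c) ph) cs x \<ominus>\<^sub>A htpy (shift c (bar_inner (shift p ph))) cs x)"
  by (simp add: as e3 shift_def[of p "bar_inner ph"] pf del: bar_inner.simps(3) flip: y2_def bs_def y1_def b'_def) (simp add: pf)
 have IH': "bar_inner (htpy (shift p ph)) (c # cs) x =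
   ph (p # c # cs) x \<oplus>\<^sub>A htpy (shift c (bar_inner (shift p ph))) cs x \<ominus>\<^sub>A bar_inner (shift p ph) (fel y1 # b' # bs) x0"
  using IH cl cl2 cl3 by (simp add: shift_def[of p ph "c # cs"] as y1_def y2_def b'_def bs_def) (metis A.add.m_closed A.add.inv_solve_right a_minus_def)
 show ?case unfolding L1 L2 R IH' using cl cl2 cl3 by (simp add: as) algebra
qed



lemma diff_htpy:
 assumes "as \<in> words n" "hom_el p" "x \<in> X" "vals (Suc n) ph"
 shows "bar_diff (htpy ph) (p # as) x \<oplus>\<^sub>A htpy (bar_diff ph) (p # as) x = induce ph (p # as) x \<ominus>\<^sub>A ph (p # as) x"
proof -
 let ?y = "pend (p # as) x" and ?w = "pword (p # as) x"
 have P: "?y \<in> X" "?w \<in> words (Suc n)" using assms pend_closed[of "p # as" "Suc n" x] pword_closed[of "p # as" "Suc n" x] by auto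
 have fw: "fel ?y # ?w \<in> words (Suc (Suc n))" using P by (simp only: words_Cons fel simp_thms)
 have h1: "htpy (bar_diff ph) (p # as) x = (snd (fel ?y) \<otimes>\<^sub>A ph ?w x0 \<ominus>\<^sub>A bar_inner ph (fel ?y # ?w) x0) \<ominus>\<^sub>A htpy (shift p (bar_diff ph)) as x"
  by (simp only: htpy.simps bar_diff_def list.sel)
 have "shift p (bar_diff ph) = (\<lambda>as x. snd p \<otimes>\<^sub>A ph as x \<ominus>\<^sub>A shift p (bar_inner ph) as x)"
  by (simp add: shift_def bar_diff_def fun_eq_iff)
 then have "htpy (shift p (bar_diff ph)) as x = htpy (\<lambda>as x. snd p \<otimes>\<^sub>A ph as x) as x \<ominus>\<^sub>A htpy (shift p (bar_inner ph)) as x"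
  using assms by (simp only:) (intro htpy_sub vals_shift vals_inner, auto simp: vals_def hom_elD)
 also have "htpy (\<lambda>as x. snd p \<otimes>\<^sub>A ph as x) as x = snd p \<otimes>\<^sub>A htpy ph as x"
  using assms by (intro htpy_lmult) (auto simp: hom_elD)
 finally have h2: "htpy (shift p (bar_diff ph)) as x = snd p \<otimes>\<^sub>A htpy ph as x \<ominus>\<^sub>A htpy (shift p (bar_inner ph)) as x" .
 have cl: "snd p \<otimes>\<^sub>A htpy ph as x \<in> carrier A" "htpy (shift p (bar_inner ph)) as x \<in> carrier A"
   "snd (fel ?y) \<otimes>\<^sub>A ph ?w x0 \<in> carrier A" "bar_inner (htpy ph) (p # as) x \<in> carrier A"
   "bar_inner ph (fel ?y # ?w) x0 \<in> carrier A" "ph (p # as) x \<in> carrier A"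
  subgoal using assms by (auto intro!: vals_D[OF vals_htpy] hom_elD)
  subgoal using assms by (intro vals_D[OF vals_htpy]) (auto intro: vals_shift vals_inner)
  subgoal using assms P fel hom_elD vals_D[OF assms(4) P(2) x0] by blast
  subgoal using assms by (intro bar_inner_closed[of _ n] vals_htpy) auto
  subgoal using assms fw by (intro bar_inner_closed[of _ "Suc n"]) auto
  subgoal using assms by (intro vals_D[OF assms(4)]) auto
  done
 have L: "bar_inner (htpy ph) (p # as) x = ph (p # as) x \<oplus>\<^sub>A htpy (shift p (bar_inner ph)) as x \<ominus>\<^sub>A bar_inner ph (fel ?y # ?w) x0"
  using inner_htpy[OF assms] cl by (metis A.add.m_closed A.add.inv_solve_right a_minus_def)
 show ?thesis unfolding h1 h2 using cl
  by (simp only: bar_diff_def list.sel L induce_def) algebra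
qed

lemma diff_induce:
 assumes "as \<in> words n" "hom_el p" "x \<in> X" "vals n ps"
 shows "bar_diff (induce ps) (p # as) x = induce (bar_diff ps) (p # as) x"
proof -
 let ?y = "pend (p # as) x" and ?w = "pword (p # as) x"
 have P: "?y \<in> X" "?w \<in> words0 (Suc n)" "pend as x \<in> X" "pword as x \<in> words n"
  using assms pend_closed[of "p # as" "Suc n" x] pword_words0[of "p # as" "Suc n" x] pend_closed pword_closed by auto
 have W: "?w \<in> words (Suc n)" using P by (simp add: words0_def)
 have "bar_inner (induce ps) (p # as) x = bar_inner (\<lambda>bs _. snd (fel ?y) \<otimes>\<^sub>A ps bs x0) ?w x0"
  using inner_transport[OF assms(1-3), of "\<lambda>y bs. snd (fel y) \<otimes>\<^sub>A ps bs x0"] by (simp only: induce_def[abs_def])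
 also have "\<dots> = snd (fel ?y) \<otimes>\<^sub>A bar_inner (\<lambda>bs _. ps bs x0) ?w x0"
  using assms P W hom_elD fel by (intro bar_inner_lmult[of _ n]) (auto simp: vals_def)
 also have "bar_inner (\<lambda>bs _. ps bs x0) ?w x0 = bar_inner ps ?w x0" using bar_inner_x0[OF P(2)] by simp
 finally have 1: "bar_inner (induce ps) (p # as) x = snd (fel ?y) \<otimes>\<^sub>A bar_inner ps ?w x0" .
 have c: "ps (pword as x) x0 \<in> carrier A" "bar_inner ps ?w x0 \<in> carrier A" "snd (fel ?y) \<in> carrier A" "snd (fel (pend as x)) \<in> carrier A"
   "snd (beta p (pend as x)) \<in> carrier A"
  using assms P W vals_D[OF assms(4)] fel hom_elD beta bar_inner_closed by auto
 have "snd p \<otimes>\<^sub>A snd (fel (pend as x)) = snd (fel ?y) \<otimes>\<^sub>A snd (beta p (pend as x))"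
  using arg_cong[OF beta_fel[OF assms(2) P(3)], of snd] by (simp add: pm_def)
 then have "snd p \<otimes>\<^sub>A (snd (fel (pend as x)) \<otimes>\<^sub>A ps (pword as x) x0) =
   snd (fel ?y) \<otimes>\<^sub>A (snd (beta p (pend as x)) \<otimes>\<^sub>A ps (pword as x) x0)"
  using c hom_elD[OF assms(2)] by (simp flip: A.m_assoc)
 then show ?thesis using c 1 by (simp add: bar_diff_def) (simp add: induce_def A.r_distr a_minus_def A.r_minus bar_diff_def)
qed

lemma induce_cong0:
 assumes "as \<in> words n" "x \<in> X" "!!bs. bs \<in> words0 n ==> ph bs x0 = ps bs x0"
 shows "induce ph as x = induce ps as x"
 using assms pword_words0 by (simp add: induce_def)

lemma pend_app: "pend (us @ vs) x = pend us (pend vs x)" by (induction us) auto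

lemma pword_app: "pword (us @ vs) x = pword us (pend vs x) @ pword vs x"
 by (induction us) (auto simp: pend_app)

lemma beta_linear:
 assumes "t \<in> carrier GG" "a \<in> dA t" "b \<in> dA t" "c \<in> carrier K" "x \<in> X"
 shows "beta (t, c \<odot>\<^sub>A a \<oplus>\<^sub>A b) x = (bdeg t x, c \<odot>\<^sub>A bel (t, a) x \<oplus>\<^sub>A bel (t, b) x)"
 using assms by (simp add: beta_def bel_linear)

lemma pword_slot:
 assumes m: "multilin n ph" and h: "us \<in> words i" "vs \<in> words j" "t \<in> carrier GG" "a \<in> dA t" "b \<in> dA t" "c \<in> carrier K" "x \<in> X"
  and n: "k + (i + j + 1) = n" and ws: "ws \<in> words k"
 shows "ph (ws @ pword (us @ (t, c \<odot>\<^sub>A a \<oplus>\<^sub>A b) # vs) x) x0 =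
  c \<odot>\<^sub>A ph (ws @ pword (us @ (t, a) # vs) x) x0 \<oplus>\<^sub>A ph (ws @ pword (us @ (t, b) # vs) x) x0"
proof -
 let ?y = "pend vs x"
 have y: "?y \<in> X" "act t ?y \<in> X" using h by (auto intro: pend_closed act_closed)
 have "ws @ pword us (act t ?y) \<in> words (k + i)" using ws pword_closed[OF h(1) y(2)] by (auto simp: words_def)
 then have "ph ((ws @ pword us (act t ?y)) @ (bdeg t ?y, c \<odot>\<^sub>A bel (t, a) ?y \<oplus>\<^sub>A bel (t, b) ?y) # pword vs x) x0 =
   c \<odot>\<^sub>A ph ((ws @ pword us (act t ?y)) @ (bdeg t ?y, bel (t, a) ?y) # pword vs x) x0 \<oplus>\<^sub>A
   ph ((ws @ pword us (act t ?y)) @ (bdeg t ?y, bel (t, b) ?y) # pword vs x) x0"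
  using h y n bdeg[of t ?y] by (intro multilinD[OF m, of _ "k + i" _ j]) (auto intro: bel pword_closed)
 then show ?thesis using h y by (simp add: pword_app beta_linear) (simp add: beta_def)
qed

lemma multilin_induce: assumes "multilin n ps" shows "multilin n (induce ps)"
proof (rule multilinI)
 show "vals n (induce ps)"
  unfolding vals_def induce_def
  by (intro ballI A.m_closed hom_elD fel pend_closed vals_D[OF multilin_vals[OF assms]] pword_closed x0) auto
 fix us vs i j t a b c x
 assume h: "us \<in> words i" "vs \<in> words j" "i + j + 1 = n" "t \<in> carrier GG" "a \<in> dA t" "b \<in> dA t" "c \<in> carrier K" "x \<in> X"
 have w: "us @ (t, e) # vs \<in> words n" if "e \<in> dA t" for e using h that by (auto simp: words_def)
 let ?F = "snd (fel (pend us (act t (pend vs x))))"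
 have F: "?F \<in> carrier A" using h by (auto intro!: hom_elD fel pend_closed act_closed)
 have c: "ps (pword (us @ (t, e) # vs) x) x0 \<in> carrier A" if "e \<in> dA t" for e
  using w[OF that] h by (intro vals_D[OF multilin_vals[OF assms]] pword_closed) auto
 show "induce ps (us @ (t, c \<odot>\<^sub>A a \<oplus>\<^sub>A b) # vs) x = c \<odot>\<^sub>A induce ps (us @ (t, a) # vs) x \<oplus>\<^sub>A induce ps (us @ (t, b) # vs) x"
  using pword_slot[OF assms h(1,2,4-8), of 0 "[]"] h c[of a] c[of b] F
  by (simp add: induce_def pend_app A.r_distr smult_assoc_r)
qed

lemma htpy_linear:
 "multilin (Suc n) ph ==> us \<in> words i ==> vs \<in> words j ==> i + j + 1 = n ==> t \<in> carrier GG ==> a \<in> dA t ==> b \<in> dA t ==>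
  c \<in> carrier K ==> x \<in> X ==>
  htpy ph (us @ (t, c \<odot>\<^sub>A a \<oplus>\<^sub>A b) # vs) x = c \<odot>\<^sub>A htpy ph (us @ (t, a) # vs) x \<oplus>\<^sub>A htpy ph (us @ (t, b) # vs) x"
proof (induction i arbitrary: us n ph)
 case 0
 then have us: "us = []" and n: "n = Suc j" by auto
 let ?y = "act t (pend vs x)"
 have y: "?y \<in> X" using 0 by (auto intro!: act_closed pend_closed)
 have el: "c \<odot>\<^sub>A a \<oplus>\<^sub>A b \<in> dA t" using 0 by (simp add: dA_add dA_smult)
 have s: "ph ([fel ?y] @ pword ([] @ (t, c \<odot>\<^sub>A a \<oplus>\<^sub>A b) # vs) x) x0 =
  c \<odot>\<^sub>A ph ([fel ?y] @ pword ([] @ (t, a) # vs) x) x0 \<oplus>\<^sub>A ph ([fel ?y] @ pword ([] @ (t, b) # vs) x) x0"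
  using 0 fel[OF y] by (intro pword_slot[of "Suc n" _ _ 0 _ j _ _ _ _ _ 1]) auto
 have v: "vals (Suc j) (shift (t, d) ph)" if "d \<in> dA t" for d
  using multilin_vals[OF 0(1)] 0 that by (auto intro!: vals_shift simp: n)
 have "agree (Suc j) (shift (t, c \<odot>\<^sub>A a \<oplus>\<^sub>A b) ph) (comb c (shift (t, a) ph) (shift (t, b) ph))"
  unfolding agree_def shift_def comb_def
  using multilinD[of "Suc n" ph "[]" 0 _ "Suc j" t a b c] 0 by (auto simp: n)
 from htpy_cong[OF 0(3) this] htpy_comb[OF 0(3), of "shift (t, a) ph" "shift (t, b) ph" x c]
 have 2: "htpy (shift (t, c \<odot>\<^sub>A a \<oplus>\<^sub>A b) ph) vs x = c \<odot>\<^sub>A htpy (shift (t, a) ph) vs x \<oplus>\<^sub>A htpy (shift (t, b) ph) vs x"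
  using 0 v by simp
 have c1: "htpy (shift (t, d) ph) vs x \<in> carrier A" if "d \<in> dA t" for d
  using vals_D[OF vals_htpy[OF v[OF that]] 0(3)] 0 by simp
 have c2: "ph (fel ?y # beta (t, d) (pend vs x) # pword vs x) x0 \<in> carrier A" if "d \<in> dA t" for d
  using 0 that fel[OF y] n by (intro vals_D[OF multilin_vals]) (auto intro!: beta pend_closed pword_closed)
 show ?case using s 2 c1 c2 0 by (simp add: us comb_minus)
next
 case (Suc i)
 then obtain p ws where us: "us = p # ws" "hom_el p" "ws \<in> words i" by (auto simp: words_Suc)
 obtain k where n: "n = Suc k" using Suc.prems by (cases n) auto
 have m: "multilin (Suc k) (shift p ph)" using Suc us by (auto intro: multilin_shift simp: n)
 have IH: "htpy (shift p ph) (ws @ (t, c \<odot>\<^sub>A a \<oplus>\<^sub>A b) # vs) x =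
   c \<odot>\<^sub>A htpy (shift p ph) (ws @ (t, a) # vs) x \<oplus>\<^sub>A htpy (shift p ph) (ws @ (t, b) # vs) x"
  using Suc us by (intro Suc.IH[OF m]) (auto simp: n)
 have w: "ws @ (t, d) # vs \<in> words k" "us @ (t, d) # vs \<in> words n" if "d \<in> dA t" for d
  using Suc.prems us that by (auto simp: words_def n)
 have cl: "htpy (shift p ph) (ws @ (t, d) # vs) x \<in> carrier A" if "d \<in> dA t" for d
  using w[OF that] Suc.prems m by (intro vals_D[OF vals_htpy]) (auto intro: multilin_vals)
 let ?y = "act (fst p) (pend ws (act t (pend vs x)))"
 have y: "?y \<in> X" using Suc.prems us by (intro act_cl act_closed pend_closed) auto
 have s: "ph ([fel ?y] @ pword (us @ (t, c \<odot>\<^sub>A a \<oplus>\<^sub>A b) # vs) x) x0 =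
  c \<odot>\<^sub>A ph ([fel ?y] @ pword (us @ (t, a) # vs) x) x0 \<oplus>\<^sub>A ph ([fel ?y] @ pword (us @ (t, b) # vs) x) x0"
  using Suc.prems fel[OF y] by (intro pword_slot[of "Suc n" _ _ "Suc i" _ j _ _ _ _ _ 1]) auto
 have c2: "ph ([fel ?y] @ pword (us @ (t, d) # vs) x) x0 \<in> carrier A" if "d \<in> dA t" for d
  using Suc.prems(9) fel[OF y] pword_closed[OF w(2)[OF that]] by (intro vals_D[OF multilin_vals[OF Suc.prems(1)]]) auto
 show ?case using s IH cl c2 Suc.prems by (simp add: us pend_app comb_minus)
qed

lemma multilin_htpy: assumes "multilin (Suc n) ph" shows "multilin n (htpy ph)"
proof (rule multilinI)
 show "vals n (htpy ph)" using assms by (intro vals_htpy multilin_vals)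
qed (rule htpy_linear[OF assms], auto)

lemma weight_fel: assumes "weight w" "x \<in> X" shows "w x = fst (fel x) \<otimes>\<^sub>GG w x0"
 using weightD(2)[OF assms(1) x0 fel[OF assms(2)]] assms by (simp add: lam_fel act_fel)

lemma tot_path:
 assumes "as \<in> words n" "x \<in> X"
 shows "tot as \<otimes>\<^sub>GG fst (fel x) = fst (fel (pend as x)) \<otimes>\<^sub>GG tot (pword as x)"
 using assms
proof (induction n arbitrary: as)
 case 0
 then show ?case by (simp add: hom_elD fel)
next
 case (Suc n)
 then obtain p bs where as: "as = p # bs" "hom_el p" "bs \<in> words n" by (auto simp: words_Suc)
 have X: "pend bs x \<in> X" "act (fst p) (pend bs x) \<in> X" using as Suc by (auto intro!: pend_closed act_cl)
 have g: "fst p \<in> carrier GG" "tot bs \<in> carrier GG" "fst (fel x) \<in> carrier GG" "fst (fel (pend bs x)) \<in> carrier GG"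
  "fst (fel (act (fst p) (pend bs x))) \<in> carrier GG"
  "tot (pword bs x) \<in> carrier GG" "fst (beta p (pend bs x)) \<in> carrier GG"
  using as X Suc by (auto intro!: hom_elD fel beta tot_closed[of _ n] pword_closed)
 have "fst p \<otimes>\<^sub>GG fst (fel (pend bs x)) = fst (fel (act (fst p) (pend bs x))) \<otimes>\<^sub>GG fst (beta p (pend bs x))"
  using arg_cong[OF beta_fel[OF as(2) X(1)], of fst] by (simp add: pm_def)
 then show ?case using Suc.IH[OF as(3) Suc.prems(2)] g by (simp add: as Gr.m_assoc) (simp flip: Gr.m_assoc)
qed

lemma homog_induce: assumes "homog \<one>\<^sub>GG w n ps" "weight w" shows "homog \<one>\<^sub>GG w n (induce ps)"
 unfolding homog_def
proof (intro ballI)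
 fix as x assume h: "as \<in> words n" "x \<in> X"
 have g: "fst (fel (pend as x)) \<in> carrier GG" "fst (fel x) \<in> carrier GG" "tot (pword as x) \<in> carrier GG" "tot as \<in> carrier GG" "w x0 \<in> carrier GG"
  "w x \<in> carrier GG"
  using h assms by (auto intro!: hom_elD fel tot_closed[of _ n] pword_closed weightD pend_closed)
 have "ps (pword as x) x0 \<in> dA (tot (pword as x) \<otimes>\<^sub>GG w x0)"
  using homogD[OF assms(1) pword_closed[OF h] x0] g by simp
 then have "induce ps as x \<in> dA (fst (fel (pend as x)) \<otimes>\<^sub>GG (tot (pword as x) \<otimes>\<^sub>GG w x0))"
  unfolding induce_def using g h by (intro dA_mult) (auto intro: hom_elD fel pend_closed)
 also have "fst (fel (pend as x)) \<otimes>\<^sub>GG (tot (pword as x) \<otimes>\<^sub>GG w x0) = \<one>\<^sub>GG \<otimes>\<^sub>GG (tot as \<otimes>\<^sub>GG w x)"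
  using tot_path[OF h] weight_fel[OF assms(2) h(2)] g by (simp flip: Gr.m_assoc)
 finally show "induce ps as x \<in> dA (\<one>\<^sub>GG \<otimes>\<^sub>GG (tot as \<otimes>\<^sub>GG w x))" .
qed

lemma homog_htpy:
 "homog l w (Suc n) ph ==> weight w ==> l \<in> carrier GG ==> homog l w n (htpy ph)"
proof (induction n arbitrary: l ph)
 case 0
 show ?case unfolding homog_def
 proof (intro ballI)
  fix as x assume h: "as \<in> words 0" "x \<in> X"
  show "htpy ph as x \<in> dA (l \<otimes>\<^sub>GG (tot as \<otimes>\<^sub>GG w x))"
   using homogD[OF 0(1), of "[fel x]" x0] h weight_fel[OF 0(2) h(2)] fel[OF h(2)] weightD(1)[OF 0(2)] by (auto simp: hom_elD)
 qed
next
 case (Suc n)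
 show ?case unfolding homog_def
 proof (intro ballI)
  fix as x assume h: "as \<in> words (Suc n)" "x \<in> X"
  then obtain p bs where as: "as = p # bs" "hom_el p" "bs \<in> words n" by (auto simp: words_Suc)
  have g: "fst (fel (pend as x)) \<in> carrier GG" "fst (fel x) \<in> carrier GG" "tot (pword as x) \<in> carrier GG" "tot as \<in> carrier GG" "w x0 \<in> carrier GG"
   "w x \<in> carrier GG" "fst p \<in> carrier GG" "tot bs \<in> carrier GG"
   using h as Suc.prems pend_closed[OF h] tot_closed[OF h(1)] tot_closed[OF as(3)] tot_closed[OF pword_closed[OF h]]
    weightD(1)[OF Suc.prems(2)] fel hom_elD by auto
  have "fel (pend as x) # pword as x \<in> words (Suc (Suc n))" using h by (simp add: fel pend_closed pword_closed)
  then have "ph (fel (pend as x) # pword as x) x0 \<in> dA (l \<otimes>\<^sub>GG (tot (fel (pend as x) # pword as x) \<otimes>\<^sub>GG w x0))"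
   by (intro homogD[OF Suc.prems(1)]) auto
  also have "tot (fel (pend as x) # pword as x) \<otimes>\<^sub>GG w x0 = tot as \<otimes>\<^sub>GG w x"
   using tot_path[OF h] weight_fel[OF Suc.prems(2) h(2)] g by (simp flip: Gr.m_assoc)
  finally have 1: "ph (fel (pend as x) # pword as x) x0 \<in> dA (l \<otimes>\<^sub>GG (tot as \<otimes>\<^sub>GG w x))" .
  have "homog (l \<otimes>\<^sub>GG fst p) w n (htpy (shift p ph))"
   using Suc as g by (intro Suc.IH) (auto intro: homog_shift)
  from homogD[OF this as(3) h(2)] have "htpy (shift p ph) bs x \<in> dA (l \<otimes>\<^sub>GG (tot as \<otimes>\<^sub>GG w x))"
   using g Suc.prems by (simp add: as Gr.m_assoc)
  with 1 show "htpy ph as x \<in> dA (l \<otimes>\<^sub>GG (tot as \<otimes>\<^sub>GG w x))"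
   using g Suc.prems unfolding as by (simp add: dA_minus del: pend.simps pword.simps)
 qed
qed

lemma homog_sub: "homog l w n ph ==> homog l w n ps ==> weight w ==> l \<in> carrier GG ==> homog l w n (\<lambda>as x. ph as x \<ominus>\<^sub>A ps as x)"
 unfolding homog_def by (intro ballI dA_minus) (auto intro: tot_closed weightD)

text \<open>The homotopy that inserts a generator into a word, and turns the letters to its right into coefficients
in the subalgebra, joins a cochain to the one induced from its restriction. So a cocycle whose restriction is
the boundary of a cochain differs from the boundary of the induced cochain by a boundary.\<close>
theorem restriction_detects_boundaries:
 assumes m: "multilin (Suc k) ph" and h: "homog \<one>\<^sub>GG w (Suc k) ph" and w: "weight w"
  and Z: "!!as x. as \<in> words (Suc (Suc k)) ==> x \<in> X ==> bar_diff ph as x = \<zero>\<^sub>A"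
  and ps: "multilin k ps" "homog \<one>\<^sub>GG w k ps"
  and res: "!!bs. bs \<in> words0 (Suc k) ==> bar_diff ps bs x0 = ph bs x0"
 shows "\<exists>\<chi>. multilin k \<chi> \<and> homog \<one>\<^sub>GG w k \<chi> \<and> agree (Suc k) (bar_diff \<chi>) ph"
proof (intro exI conjI)
 let ?\<chi> = "comb (\<ominus>\<^sub>K \<one>\<^sub>K) (htpy ph) (induce ps)"
 show m1: "multilin k ?\<chi>" using m ps by (intro multilin_comb multilin_htpy multilin_induce) auto
 have v: "vals k (htpy ph)" "vals k (induce ps)" "vals (Suc k) ph" "vals k ps"
  using m ps by (auto intro!: multilin_vals multilin_htpy multilin_induce)
 have "homog \<one>\<^sub>GG w k (\<lambda>as x. induce ps as x \<ominus>\<^sub>A htpy ph as x)"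
  using h w ps by (intro homog_sub homog_induce homog_htpy) auto
 moreover have "induce ps as x \<ominus>\<^sub>A htpy ph as x = ?\<chi> as x" if "as \<in> words k" "x \<in> X" for as x
  using v that by (simp add: comb_def smult_minus_one vals_D a_minus_def A.a_ac)
 ultimately show "homog \<one>\<^sub>GG w k ?\<chi>" by (simp add: homog_def)
 show "agree (Suc k) (bar_diff ?\<chi>) ph" unfolding agree_def
 proof (intro ballI)
  fix as x assume as: "as \<in> words (Suc k)" and x: "x \<in> X"
  then obtain p bs where p: "as = p # bs" "hom_el p" "bs \<in> words k" by (auto simp: words_Suc)
  have d: "bar_diff ?\<chi> as x = comb (\<ominus>\<^sub>K \<one>\<^sub>K) (bar_diff (htpy ph)) (bar_diff (induce ps)) as x"
   using bar_diff_comb[OF v(1,2), of "\<ominus>\<^sub>K \<one>\<^sub>K"] as x by (simp add: agree_def)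
  have c: "bar_diff (htpy ph) as x \<in> carrier A" "bar_diff (induce ps) as x \<in> carrier A" "ph as x \<in> carrier A"
   using as x v by (auto intro: vals_D[OF vals_diff] vals_D)
  have i: "bar_diff (induce ps) as x = induce ph as x"
   unfolding p diff_induce[OF p(3,2) x v(4)] using as x p by (intro induce_cong0 res) auto
  have "htpy (bar_diff ph) as x = htpy (\<lambda>_ _. \<zero>\<^sub>A) as x"
   using Z as x by (intro htpy_cong[of _ "Suc k"]) (auto simp: agree_def)
  also have "\<dots> = \<zero>\<^sub>A"
  proof -
   have "htpy (\<lambda>_ _. \<zero>\<^sub>A) as x = \<zero>\<^sub>A" for as
    by (induction as) (simp_all add: shift_def[abs_def])
   then show ?thesis .
  qed
  finally have "bar_diff (htpy ph) as x = induce ph as x \<ominus>\<^sub>A ph as x"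
   using diff_htpy[OF p(3,2) x v(3)] c by (simp add: p)
  moreover have "induce ph as x \<in> carrier A" using c i by simp
  ultimately show "bar_diff ?\<chi> as x = ph as x"
   using c i d by (simp add: comb_def smult_minus_one) algebra
 qed
qed

theorem restriction_detects_zero:
 assumes "vals 0 ph" "!!as x. as \<in> words 1 ==> x \<in> X ==> bar_diff ph as x = \<zero>\<^sub>A" "ph [] x0 = \<zero>\<^sub>A" "x \<in> X"
 shows "ph [] x = \<zero>\<^sub>A"
proof -
 have "bar_diff ph [fel x] x0 = \<zero>\<^sub>A" using assms fel by (intro assms(2)) (auto simp: words_def)
 then show ?thesis using assms fel[OF assms(4)] vals_D[OF assms(1), of "[]" x]
  by (simp add: bar_diff_def lam_fel act_fel hom_elD a_minus_def)
qed

end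

section \<open>Filtered coefficient modules\<close>

text \<open>A letter either fixes x and acts by the augmentation, or moves x to a basis element of larger rank. The basis
elements of one rank thus span copies of the trivial module.\<close>
locale filtered_actor = graded_actor K A GG dA X act lam
 for K :: "'k ring" and A :: "('k, 'a) module" and GG :: "('t, 's) monoid_scheme"
  and dA :: "'t => 'a set" and X :: "'x set" and act :: "'t => 'x => 'x"
  and lam :: "'t \<times> 'a => 'x => 'k" +
 fixes eps :: "'t \<times> 'a => 'k" and rank :: "'x => nat" and N :: nat
 assumes rank_bound: "!!x. x \<in> X ==> rank x < N"
  and eps_closed: "!!p. hom_el p ==> eps p \<in> carrier K"
  and eps_linear: "!!t a b c. [|t \<in> carrier GG; a \<in> dA t; b \<in> dA t; c \<in> carrier K|] ==>
   eps (t, c \<odot>\<^sub>A a \<oplus>\<^sub>A b) = c \<otimes>\<^sub>K eps (t, a) \<oplus>\<^sub>K eps (t, b)"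
  and eps_mult: "!!p q. hom_el p ==> hom_el q ==> eps (pm p q) = eps p \<otimes>\<^sub>K eps q"
  and lam_rank: "!!p x. hom_el p ==> x \<in> X ==> act (fst p) x ~= x ==> lam p x ~= \<zero>\<^sub>K ==> rank x < rank (act (fst p) x)"
  and lam_eps: "!!p x. hom_el p ==> x \<in> X ==> act (fst p) x = x ==> lam p x = eps p"
  and eps_zero: "!!p x. hom_el p ==> x \<in> X ==> act (fst p) x ~= x ==> eps p = \<zero>\<^sub>K"
begin

sublocale T: graded_actor K A GG dA "{0::nat}" "\<lambda>_ x. x" "\<lambda>p _. eps p"
proof (rule graded_actor.intro)
 show "k_algebra K A" "field K" "group GG" by (rule alg field_K group_GG)+
 show "VectorSpace.subspace K (dA t) A" if "t \<in> carrier GG" for t using dA_sub[OF that] .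
 show "a \<otimes>\<^sub>A b \<in> dA (s \<otimes>\<^sub>GG t)" if "s \<in> carrier GG" "t \<in> carrier GG" "a \<in> dA s" "b \<in> dA t" for s t a b
  using dA_mult[OF that] .
 show "eps (t, a) \<in> carrier K" if "t \<in> carrier GG" "a \<in> dA t" for t a
  using that by (intro eps_closed) simp
 show "eps (t, c \<odot>\<^sub>A a \<oplus>\<^sub>A b) = c \<otimes>\<^sub>K eps (t, a) \<oplus>\<^sub>K eps (t, b)"
  if "t \<in> carrier GG" "a \<in> dA t" "b \<in> dA t" "c \<in> carrier K" for t a b c using eps_linear[OF that] .
 show "eps (s \<otimes>\<^sub>GG t, a \<otimes>\<^sub>A b) = eps (s, a) \<otimes>\<^sub>K eps (t, b)"
  if "s \<in> carrier GG" "t \<in> carrier GG" "a \<in> dA s" "b \<in> dA t" for s t a b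
  using eps_mult[of "(s, a)" "(t, b)"] that by (simp add: pm_def)
qed auto

lemma inner_top:
 assumes "as \<in> words (Suc n)" "x \<in> X" "vals n ph"
  and "!!bs y. bs \<in> words n ==> y \<in> X ==> rank x < rank y ==> ph bs y = \<zero>\<^sub>A"
 shows "bar_inner ph as x = T.bar_inner (\<lambda>bs _. ph bs x) as 0"
 using assms
proof (induction n arbitrary: as ph)
 case 0
 then obtain p where p: "as = [p]" "hom_el p" by (auto simp: words_Suc)
 show ?case
 proof (cases "act (fst p) x = x")
  case True
  then show ?thesis using p 0 by (simp add: lam_eps)
 next
  case False
  have y: "act (fst p) x \<in> X" using p 0 by (simp add: act_cl)
  have "lam p x \<odot>\<^sub>A ph [] (act (fst p) x) = \<zero>\<^sub>A"
  proof (cases "lam p x = \<zero>\<^sub>K")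
   case True
   then show ?thesis using vals_D[OF 0(3), of "[]"] y by (simp add: V.smult_l_null)
  next
   case h: False
   then show ?thesis using 0(4)[of "[]" "act (fst p) x"] lam_rank[OF p(2) 0(2) False h] y lam_cl[OF p(2) 0(2)]
    by (simp add: V.smult_r_null)
  qed
  then show ?thesis using p 0 False vals_D[OF 0(3), of "[]"] by (simp add: eps_zero[of p x] V.smult_l_null)
 qed
next
 case (Suc n)
 then obtain p q bs where as: "as = p # q # bs" "hom_el p" "hom_el q" "bs \<in> words n" by (auto simp: words_Suc)
 have "shift p (\<lambda>bs (_::nat). ph bs x) = (\<lambda>bs _. shift p ph bs x)" by (simp add: shift_def fun_eq_iff)
 moreover have "bar_inner (shift p ph) (q # bs) x = T.bar_inner (\<lambda>bs _. shift p ph bs x) (q # bs) 0"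
  using Suc.prems as by (intro Suc.IH vals_shift) (auto simp: shift_def)
 ultimately show ?case by (simp add: as)
qed

lemma diff_top:
 assumes "as \<in> words (Suc n)" "x \<in> X" "vals n ph"
  and "!!bs y. bs \<in> words n ==> y \<in> X ==> rank x < rank y ==> ph bs y = \<zero>\<^sub>A"
 shows "bar_diff ph as x = T.bar_diff (\<lambda>bs _. ph bs x) as 0"
 using inner_top[OF assms] by (simp add: bar_diff_def T.bar_diff_def)

lemma cochain_component: "cochain w n ph ==> x \<in> X ==> T.cochain (\<lambda>_. w x) n (\<lambda>as _. ph as x)"
 by (auto simp: cochain_def T.cochain_def multilin_def T.multilin_def vals_def T.vals_def homog_def T.homog_def)

lemma cochain_family: "(!!x. x \<in> X ==> T.cochain (\<lambda>_. w x) n (c x)) ==> cochain w n (\<lambda>as x. c x as 0)"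
 by (auto simp: cochain_def T.cochain_def multilin_def T.multilin_def vals_def T.vals_def homog_def T.homog_def)

definition below :: "nat => nat => (('t \<times> 'a) list => 'x => 'a) => bool" where
 "below r n ph \<longleftrightarrow> (\<forall>as\<in>words n. \<forall>x\<in>X. r \<le> rank x --> ph as x = \<zero>\<^sub>A)"

lemma belowD: "below r n ph ==> as \<in> words n ==> x \<in> X ==> r \<le> rank x ==> ph as x = \<zero>\<^sub>A"
 by (simp add: below_def)

lemma T_zero: "T.cochain (\<lambda>_. c) n (\<lambda>_ _. \<zero>\<^sub>A)" if "c \<in> carrier GG"
 using that by (simp add: T.cochain_def T.multilin_zero T.homog_def dA_zero T.tot_closed)


definition layer :: "nat => ('x => ('t \<times> 'a) list => nat => 'a) => ('t \<times> 'a) list => 'x => 'a" where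
 "layer r c as x = (if rank x = r then c x as 0 else \<zero>\<^sub>A)"

lemma cochain_layer:
 assumes "weight w" "!!x. x \<in> X ==> rank x = r ==> T.cochain (\<lambda>_. w x) n (c x)"
 shows "cochain w n (layer r c)"
proof -
 have "cochain w n (\<lambda>as x. (if rank x = r then c x else (\<lambda>_ _. \<zero>\<^sub>A)) as 0)"
  using assms by (intro cochain_family) (auto intro!: T_zero weightD)
 then show ?thesis by (simp add: layer_def[abs_def] if_distrib if_distribR cong: if_cong)
qed

lemma diff_layer:
 assumes "cochain w n (layer r c)" "as \<in> words (Suc n)" "x \<in> X"
 shows "rank x = r ==> bar_diff (layer r c) as x = T.bar_diff (c x) as 0"
  and "r < rank x ==> bar_diff (layer r c) as x = \<zero>\<^sub>A"
proof -
 note d = diff_top[OF assms(2,3) cochain_vals[OF assms(1)]]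
 show "bar_diff (layer r c) as x = T.bar_diff (c x) as 0" if "rank x = r"
 proof -
  have "T.agree n (\<lambda>bs _. layer r c bs x) (c x)" using that by (auto simp: layer_def T.agree_def)
  from T.agreeD[OF T.bar_diff_cong[OF this] assms(2)] show ?thesis using d that by (simp add: layer_def)
 qed
 show "bar_diff (layer r c) as x = \<zero>\<^sub>A" if "r < rank x"
 proof -
  have "T.bar_diff (\<lambda>bs _. layer r c bs x) as 0 = \<zero>\<^sub>A"
   using T.bar_diff_zero[of n "\<lambda>bs _. layer r c bs x"] that assms by (auto simp: T.agree_def layer_def)
  then show ?thesis using d that by (simp add: layer_def)
 qed
qed

lemma cocycle_vals: "cocycle w n ph ==> vals n ph" by (auto simp: cocycle_def intro: cochain_vals)

lemma solve_below:
 assumes w: "weight w" and ac: "!!x. x \<in> X ==> rank x < q ==> T.acyclic (\<lambda>_. w x) (Suc d)"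
 shows "r \<le> q ==> cocycle w (Suc d) ph ==> below r (Suc d) ph ==>
  \<exists>ps. cochain w d ps \<and> below r d ps \<and> agree (Suc d) (bar_diff ps) ph"
proof (induction r arbitrary: ph)
 case 0
 show ?case
 proof (intro exI conjI)
  show "cochain w d (\<lambda>_ _. \<zero>\<^sub>A)" using w by (rule cochain_zero)
  show "agree (Suc d) (bar_diff (\<lambda>_ _. \<zero>\<^sub>A)) ph"
   using bar_diff_zero[of d "\<lambda>_ _. \<zero>\<^sub>A"] 0 by (auto simp: agree_def below_def)
 qed (simp add: below_def)
next
 case (Suc r)
 have coc: "cochain w (Suc d) ph" and Z: "agree (Suc (Suc d)) (bar_diff ph) (\<lambda>_ _. \<zero>\<^sub>A)" using Suc.prems by (auto simp: cocycle_def)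
 have "\<exists>c. T.cochain (\<lambda>_. w x) d c \<and> T.agree (Suc d) (T.bar_diff c) (\<lambda>as _. ph as x)" if x: "x \<in> X" "rank x = r" for x
 proof -
  have "T.agree (Suc (Suc d)) (T.bar_diff (\<lambda>as _. ph as x)) (\<lambda>_ _. \<zero>\<^sub>A)"
   unfolding T.agree_def using diff_top[OF _ x(1) cochain_vals[OF coc]] Z x Suc.prems(3) by (auto simp: agree_def below_def)
  then have "T.boundary (\<lambda>_. w x) (Suc d) (\<lambda>as _. ph as x)"
   using ac[of x] x Suc.prems cochain_component[OF coc x(1)] by (auto simp: T.acyclic_def T.cocycle_def)
  then show ?thesis by (simp add: T.boundary_def)
 qed
 then obtain c where c: "!!x. x \<in> X ==> rank x = r ==> T.cochain (\<lambda>_. w x) d (c x) \<and> T.agree (Suc d) (T.bar_diff (c x)) (\<lambda>as _. ph as x)"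
  by metis
 let ?l = "layer r c"
 have l: "cochain w d ?l" using w c by (intro cochain_layer) auto
 let ?f = "sub ph (bar_diff ?l)"
 have fa: "?f as x = ph as x \<ominus>\<^sub>A bar_diff ?l as x" if "as \<in> words (Suc d)" "x \<in> X" for as x
  using sub_apply[OF cochain_vals[OF coc] vals_diff[OF cochain_vals[OF l]] that] .
 have "cocycle w (Suc d) ?f" unfolding cocycle_def
 proof
  show "cochain w (Suc d) ?f" using coc l w by (intro cochain_sub cochain_diff)
  show "agree (Suc (Suc d)) (bar_diff ?f) (\<lambda>_ _. \<zero>\<^sub>A)" unfolding agree_def
   using bar_diff_sub[OF cochain_vals[OF coc] vals_diff[OF cochain_vals[OF l]]] bar_diff_twice[OF cochain_vals[OF l]] Z
   by (simp add: agree_def a_minus_def)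
 qed
 moreover have "below r (Suc d) ?f" unfolding below_def
 proof (intro ballI impI)
  fix as x assume h: "as \<in> words (Suc d)" "x \<in> X" "r \<le> rank x"
  show "?f as x = \<zero>\<^sub>A"
  proof (cases "rank x = r")
   case True
   then show ?thesis using fa[OF h(1,2)] diff_layer(1)[OF l h(1,2) True] c[OF h(2) True] h vals_D[OF cochain_vals[OF coc] h(1,2)]
    by (simp add: T.agree_def a_minus_def A.r_neg)
  next
   case False
   then show ?thesis using fa[OF h(1,2)] diff_layer(2)[OF l h(1,2)] belowD[OF Suc.prems(3) h(1,2)] h by (simp add: a_minus_def)
  qed
 qed
 ultimately obtain ps where ps: "cochain w d ps" "below r d ps" "agree (Suc d) (bar_diff ps) ?f" using Suc by fastforce
 show ?case
 proof (intro exI conjI)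
  let ?g = "sub ps (sub (\<lambda>_ _. \<zero>\<^sub>A) ?l)"
  have s0: "cochain w d (sub (\<lambda>_ _. \<zero>\<^sub>A) ?l)" by (rule cochain_sub[OF cochain_zero[OF w] l w])
  show "cochain w d ?g" by (rule cochain_sub[OF ps(1) s0 w])
  have z: "vals d (\<lambda>_ _. \<zero>\<^sub>A)" by (simp add: vals_def)
  show "below (Suc r) d ?g" unfolding below_def
   using sub_apply[OF cochain_vals[OF ps(1)] cochain_vals[OF s0]] sub_apply[OF z cochain_vals[OF l]] belowD[OF ps(2)]
   by (simp add: layer_def a_minus_def)
  show "agree (Suc d) (bar_diff ?g) ph" unfolding agree_def
  proof (intro ballI)
   fix as x assume h: "as \<in> words (Suc d)" "x \<in> X"
   have "bar_diff ?g as x = bar_diff ps as x \<ominus>\<^sub>A (bar_diff (\<lambda>_ _. \<zero>\<^sub>A) as x \<ominus>\<^sub>A bar_diff ?l as x)"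
    using bar_diff_sub[OF cochain_vals[OF ps(1)] cochain_vals[OF s0] h] bar_diff_sub[OF z cochain_vals[OF l] h] by simp
   also have "bar_diff (\<lambda>_ _. \<zero>\<^sub>A) as x = \<zero>\<^sub>A" using bar_diff_zero[of d "\<lambda>_ _. \<zero>\<^sub>A"] h by (simp add: agree_def)
   also have "bar_diff ps as x = ph as x \<ominus>\<^sub>A bar_diff ?l as x" using ps(3) fa[OF h] h by (simp add: agree_def)
   finally show "bar_diff ?g as x = ph as x"
    using vals_D[OF cochain_vals[OF coc] h] vals_D[OF vals_diff[OF cochain_vals[OF l]] h] by simp algebra
  qed
 qed
qed

lemma lower_preimage:
 assumes w: "weight w" and ac: "!!x. x \<in> X ==> q < rank x ==> T.acyclic (\<lambda>_. w x) e"
 shows "cochain w e y ==> below (Suc q + r) e y ==> below (Suc q) (Suc e) (bar_diff y) ==>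
  \<exists>y'. cochain w e y' \<and> below (Suc q) e y' \<and> agree (Suc e) (bar_diff y') (bar_diff y)"
proof (induction r arbitrary: y)
 case 0
 then show ?case by (auto simp: agree_def)
next
 case (Suc r)
 let ?r = "Suc q + r"
 have coc: "T.cocycle (\<lambda>_. w x) e (\<lambda>as _. y as x)" if x: "x \<in> X" "rank x = ?r" for x
  unfolding T.cocycle_def T.agree_def using diff_top[OF _ x(1) cochain_vals[OF Suc.prems(1)]] x Suc.prems(2,3)
   cochain_component[OF Suc.prems(1) x(1)] by (auto simp: below_def)
 then have b: "T.boundary (\<lambda>_. w x) e (\<lambda>as _. y as x)" if "x \<in> X" "rank x = ?r" for x
  using ac[of x] that by (simp add: T.acyclic_def)
 show ?case
 proof (cases e)
  case 0
  have "below ?r e y" unfolding below_def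
  proof (intro ballI impI)
   fix as x assume h: "as \<in> words e" "x \<in> X" "?r \<le> rank x"
   show "y as x = \<zero>\<^sub>A"
   proof (cases "rank x = ?r")
    case True
    then show ?thesis using b[OF h(2) True] h 0 by (simp add: T.boundary_def T.agree_def)
   next
    case False
    then show ?thesis using belowD[OF Suc.prems(2) h(1,2)] h by simp
   qed
  qed
  then show ?thesis using Suc by blast
 next
  case e: (Suc k)
  obtain c where c: "!!x. x \<in> X ==> rank x = ?r ==> T.cochain (\<lambda>_. w x) k (c x) \<and> T.agree e (T.bar_diff (c x)) (\<lambda>as _. y as x)"
   using b unfolding T.boundary_def e by simp metis
  let ?l = "layer ?r c"
  have l: "cochain w k ?l" using w c by (intro cochain_layer) auto
  let ?f = "sub y (bar_diff ?l)"
  have dl: "cochain w e (bar_diff ?l)" using cochain_diff[OF l w] e by simp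
  have fa: "?f as x = y as x \<ominus>\<^sub>A bar_diff ?l as x" if "as \<in> words e" "x \<in> X" for as x
   using sub_apply[OF cochain_vals[OF Suc.prems(1)] cochain_vals[OF dl] that] .
  have f: "cochain w e ?f" using Suc.prems dl w by (intro cochain_sub)
  have df: "agree (Suc e) (bar_diff ?f) (bar_diff y)" unfolding agree_def
   using bar_diff_sub[OF cochain_vals[OF Suc.prems(1)] cochain_vals[OF dl]] bar_diff_twice[OF cochain_vals[OF l]] e
    vals_D[OF vals_diff[OF cochain_vals[OF Suc.prems(1)]]] by (simp add: a_minus_def)
  have "below ?r e ?f" unfolding below_def
  proof (intro ballI impI)
   fix as x assume h: "as \<in> words e" "x \<in> X" "?r \<le> rank x"
   have h': "as \<in> words (Suc k)" using h e by simp
   show "?f as x = \<zero>\<^sub>A"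
   proof (cases "rank x = ?r")
    case True
    then show ?thesis using fa[OF h(1,2)] diff_layer(1)[OF l h' h(2) True] c[OF h(2) True] h vals_D[OF cochain_vals[OF Suc.prems(1)] h(1,2)]
     by (simp add: T.agree_def a_minus_def A.r_neg)
   next
    case False
    then show ?thesis using fa[OF h(1,2)] diff_layer(2)[OF l h' h(2)] belowD[OF Suc.prems(2) h(1,2)] h by (simp add: a_minus_def)
   qed
  qed
  moreover have "below (Suc q) (Suc e) (bar_diff ?f)" using Suc.prems(3) df by (simp add: below_def agree_def)
  ultimately obtain y' where "cochain w e y'" "below (Suc q) e y'" "agree (Suc e) (bar_diff y') (bar_diff ?f)"
   using Suc.IH[OF f] by blast
  then show ?thesis using df agree_trans by blast
 qed
qed

text \<open>The long exact sequences of the rank filtration, without writing them down: the vanishing in degree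
d + 1 below extends a cocycle on the layer of x1 to the whole module, where it bounds; the vanishing
in degree d - 1 above corrects the bounding cochain to one that lives on the layer.\<close>
theorem acyclic_layer:
 assumes w: "weight w" and ac: "acyclic w d" and x1: "x1 \<in> X"
  and up: "!!x. x \<in> X ==> rank x < rank x1 ==> T.acyclic (\<lambda>_. w x) (Suc d)"
  and down: "!!x e. x \<in> X ==> rank x1 < rank x ==> d = Suc e ==> T.acyclic (\<lambda>_. w x) e"
 shows "T.acyclic (\<lambda>_. w x1) d"
 unfolding T.acyclic_def
proof (intro allI impI)
 fix u assume u: "T.cocycle (\<lambda>_. w x1) d u"
 define x where "x = layer (rank x1) (\<lambda>y. if y = x1 then u else (\<lambda>_ _. \<zero>\<^sub>A))"
 have xc: "cochain w d x" unfolding x_def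
  using u w by (intro cochain_layer) (auto simp: T.cocycle_def intro!: T_zero weightD)
 have "below (rank x1) (Suc d) (bar_diff x)" unfolding below_def
 proof (intro ballI impI)
  fix as y assume h: "as \<in> words (Suc d)" "y \<in> X" "rank x1 \<le> rank y"
  note l = diff_layer[OF xc[unfolded x_def] h(1,2), folded x_def]
  have "T.bar_diff (\<lambda>_ _. \<zero>\<^sub>A) as 0 = \<zero>\<^sub>A" using T.bar_diff_zero[of d "\<lambda>_ _. \<zero>\<^sub>A"] h by (simp add: T.agree_def)
  moreover have "T.bar_diff u as 0 = \<zero>\<^sub>A" using u h by (simp add: T.cocycle_def T.agree_def)
  ultimately show "bar_diff x as y = \<zero>\<^sub>A" using l h by (cases "rank y = rank x1"; cases "y = x1") auto
 qed
 moreover have "cocycle w (Suc d) (bar_diff x)"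
  using cochain_diff[OF xc w] bar_diff_twice[OF cochain_vals[OF xc]] by (simp add: cocycle_def agree_def)
 ultimately have "\<exists>z. cochain w d z \<and> below (rank x1) d z \<and> agree (Suc d) (bar_diff z) (bar_diff x)"
  by (intro solve_below[OF w up order_refl])
 then obtain z where z: "cochain w d z" "below (rank x1) d z" "agree (Suc d) (bar_diff z) (bar_diff x)" by blast
 let ?c = "sub x z"
 have ca: "?c as y = x as y \<ominus>\<^sub>A z as y" if "as \<in> words d" "y \<in> X" for as y
  using sub_apply[OF cochain_vals[OF xc] cochain_vals[OF z(1)] that] .
 have "cocycle w d ?c" unfolding cocycle_def
 proof
  show "cochain w d ?c" using xc z w by (intro cochain_sub)
  show "agree (Suc d) (bar_diff ?c) (\<lambda>_ _. \<zero>\<^sub>A)" unfolding agree_def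
   using bar_diff_sub[OF cochain_vals[OF xc] cochain_vals[OF z(1)]] z(3) vals_D[OF vals_diff[OF cochain_vals[OF xc]]]
   by (simp add: agree_def a_minus_def A.r_neg)
 qed
 then have b: "boundary w d ?c" using ac by (simp add: acyclic_def)
 have u1: "u as 0 = ?c as x1" if "as \<in> words d" for as
  using ca[OF that x1] belowD[OF z(2) that x1] vals_D[OF cochain_vals[OF xc] that x1] by (simp add: a_minus_def) (simp add: x_def layer_def)
 show "T.boundary (\<lambda>_. w x1) d u"
 proof (cases d)
  case 0
  then show ?thesis using b u1 x1 by (simp add: T.boundary_def boundary_def T.agree_def agree_def)
 next
  case (Suc e)
  then obtain y where y: "cochain w e y" "agree d (bar_diff y) ?c" using b by (auto simp: boundary_def)
  have "below (Suc (rank x1)) d ?c" unfolding below_def using ca belowD[OF z(2)] by (auto simp: x_def layer_def a_minus_def)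
  then have "below (Suc (rank x1)) (Suc e) (bar_diff y)" using y Suc by (auto simp: below_def agree_def)
  moreover have "below (Suc (rank x1) + N) e y"
   unfolding below_def using rank_bound by (meson add_leE not_le)
  ultimately have "\<exists>y'. cochain w e y' \<and> below (Suc (rank x1)) e y' \<and> agree (Suc e) (bar_diff y') (bar_diff y)"
   using Suc by (intro lower_preimage[OF w down y(1), of "rank x1" N])
  then obtain y' where y': "cochain w e y'" "below (Suc (rank x1)) e y'" "agree (Suc e) (bar_diff y') (bar_diff y)" by blast
  have "T.agree (Suc e) (T.bar_diff (\<lambda>as _. y' as x1)) u" unfolding T.agree_def
  proof (intro ballI)
   fix as and t :: nat assume t: "t \<in> {0}" and h: "as \<in> words (Suc e)"
   have "u as 0 = bar_diff y' as x1" using u1[of as] h y y' Suc x1 by (simp add: agree_def)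
   also have "\<dots> = T.bar_diff (\<lambda>bs _. y' bs x1) as 0"
    using diff_top[OF h x1 cochain_vals[OF y'(1)]] y'(2) by (simp add: below_def)
   finally show "T.bar_diff (\<lambda>as _. y' as x1) as t = u as t" using t by simp
  qed
  then show ?thesis using cochain_component[OF y'(1) x1] Suc by (auto simp: T.boundary_def)
 qed
qed

end

section \<open>Direct sum decompositions\<close>

locale direct_sum = vectorspace K V for K :: "'k ring" and V :: "('k, 'v) module" +
 fixes I :: "'i set" and W :: "'i => 'v set"
 assumes ids: "internal_direct_sum K V I W"
begin

definition proj :: "'i => 'v => 'v" where "proj i v = component V I W v i"

definition supp :: "'v => 'i set" where "supp v = {i \<in> I. proj i v ~= \<zero>\<^sub>V}"

lemma W_sub: "i \<in> I ==> VectorSpace.subspace K (W i) V" using ids by (simp add: internal_direct_sum_def)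

lemma W_carrier: "i \<in> I ==> x \<in> W i ==> x \<in> carrier V"
 and W_zero: "i \<in> I ==> \<zero>\<^sub>V \<in> W i"
 and W_add: "i \<in> I ==> x \<in> W i ==> y \<in> W i ==> x \<oplus>\<^sub>V y \<in> W i"
 and W_smult: "i \<in> I ==> c \<in> carrier K ==> x \<in> W i ==> c \<odot>\<^sub>V x \<in> W i"
 using W_sub[of i] by (auto simp: subspace_def submodule_def)

lemma decomposes_ex1: "v \<in> carrier V ==> \<exists>!a. decomposes V I W v a"
 using ids by (simp add: internal_direct_sum_def)

lemma decomposes_component: "v \<in> carrier V ==> decomposes V I W v (component V I W v)"
 unfolding component_def by (rule theI'[OF decomposes_ex1])

lemma decomposes_unique: "v \<in> carrier V ==> decomposes V I W v a ==> component V I W v = a"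
 unfolding component_def by (rule the1_equality[OF decomposes_ex1])

lemma proj_in: "v \<in> carrier V ==> i \<in> I ==> proj i v \<in> W i"
 using decomposes_component[of v] by (auto simp: proj_def decomposes_def)

lemma proj_closed [simp]: "v \<in> carrier V ==> i \<in> I ==> proj i v \<in> carrier V"
 using proj_in W_carrier by blast

lemma supp_finite: "v \<in> carrier V ==> finite (supp v)"
 using decomposes_component[of v] by (auto simp: supp_def proj_def decomposes_def)

lemma supp_sub: "supp v \<subseteq> I" by (auto simp: supp_def)

lemma proj_sum: "v \<in> carrier V ==> (\<Oplus>\<^sub>V i\<in>supp v. proj i v) = v"
 using decomposes_component[of v] by (simp add: supp_def proj_def decomposes_def)

lemma proj_sum_superset:
 assumes "v \<in> carrier V" "finite S" "supp v \<subseteq> S" "S \<subseteq> I"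
 shows "(\<Oplus>\<^sub>V i\<in>S. proj i v) = v"
proof -
 have "(\<Oplus>\<^sub>V i\<in>supp v. proj i v) = (\<Oplus>\<^sub>V i\<in>S. proj i v)"
  using assms by (intro M.add.finprod_mono_neutral_cong_left) (auto simp: supp_def)
 then show ?thesis using proj_sum[OF assms(1)] by simp
qed

lemma proj_unique:
 assumes "finite S" "S \<subseteq> I" "!!i. i \<in> S ==> a i \<in> W i" "v = (\<Oplus>\<^sub>V i\<in>S. a i)" "i \<in> I"
 shows "proj i v = (if i \<in> S then a i else \<zero>\<^sub>V)"
proof -
 define b where "b = (\<lambda>i\<in>I. if i \<in> S then a i else \<zero>\<^sub>V)"
 have c: "a j \<in> carrier V" if "j \<in> S" for j using W_carrier[of j "a j"] assms(2,3) that by blast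
 then have v: "v \<in> carrier V" unfolding assms(4) by (intro M.finsum_closed) auto
 have s: "{i \<in> I. b i ~= \<zero>\<^sub>V} \<subseteq> S" by (auto simp: b_def split: if_splits)
 have "(\<Oplus>\<^sub>V i\<in>{i \<in> I. b i ~= \<zero>\<^sub>V}. b i) = (\<Oplus>\<^sub>V i\<in>S. a i)"
  using assms(1,2) s c by (intro M.add.finprod_mono_neutral_cong_left) (auto simp: b_def)
 moreover have "b \<in> (\<Pi>\<^sub>E i\<in>I. W i)" using assms(3) by (auto simp: b_def W_zero)
 ultimately have "decomposes V I W v b" using assms(4) finite_subset[OF s assms(1)]
  by (simp add: decomposes_def)
 then have "component V I W v = b" using v by (rule decomposes_unique[rotated])
 then show ?thesis using assms(5) by (simp add: proj_def b_def)
qed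

lemma proj_linear:
 assumes "u \<in> carrier V" "v \<in> carrier V" "c \<in> carrier K" "i \<in> I"
 shows "proj i (c \<odot>\<^sub>V u \<oplus>\<^sub>V v) = c \<odot>\<^sub>V proj i u \<oplus>\<^sub>V proj i v"
proof -
 let ?S = "insert i (supp u \<union> supp v)"
 have S: "finite ?S" "?S \<subseteq> I" using assms supp_finite supp_sub by auto
 have c: "(\<lambda>i. proj i u) \<in> ?S \<rightarrow> carrier V" "(\<lambda>i. proj i v) \<in> ?S \<rightarrow> carrier V" using assms S by auto
 have "(\<Oplus>\<^sub>V i\<in>?S. c \<odot>\<^sub>V proj i u \<oplus>\<^sub>V proj i v) = c \<odot>\<^sub>V (\<Oplus>\<^sub>V i\<in>?S. proj i u) \<oplus>\<^sub>V (\<Oplus>\<^sub>V i\<in>?S. proj i v)"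
  using c assms S by (subst M.finsum_addf) (auto simp: finsum_smult_ldistr)
 also have "\<dots> = c \<odot>\<^sub>V u \<oplus>\<^sub>V v" using assms S proj_sum_superset[of u ?S] proj_sum_superset[of v ?S] by (simp add: subset_insertI2)
 finally have "c \<odot>\<^sub>V u \<oplus>\<^sub>V v = (\<Oplus>\<^sub>V i\<in>?S. c \<odot>\<^sub>V proj i u \<oplus>\<^sub>V proj i v)" by simp
 from proj_unique[OF S _ this assms(4)] show ?thesis using assms S by (auto intro!: W_add W_smult proj_in)
qed

lemma proj_hom: assumes "i \<in> I" "v \<in> W i" "j \<in> I" shows "proj j v = (if j = i then v else \<zero>\<^sub>V)"
proof -
 have "v = (\<Oplus>\<^sub>V k\<in>{i}. v)" using W_carrier[OF assms(1,2)] by (simp add: M.finsum_insert)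
 from proj_unique[OF _ _ _ this assms(3)] assms show ?thesis by simp
qed

lemma proj_zero [simp]: "i \<in> I ==> proj i \<zero>\<^sub>V = \<zero>\<^sub>V"
 using proj_hom[of i "\<zero>\<^sub>V" i] by (simp add: W_zero)

lemma proj_add: "u \<in> carrier V ==> v \<in> carrier V ==> i \<in> I ==> proj i (u \<oplus>\<^sub>V v) = proj i u \<oplus>\<^sub>V proj i v"
 using proj_linear[of u v "\<one>\<^sub>K" i] by simp

lemma proj_smult: "u \<in> carrier V ==> c \<in> carrier K ==> i \<in> I ==> proj i (c \<odot>\<^sub>V u) = c \<odot>\<^sub>V proj i u"
 using proj_linear[of u "\<zero>\<^sub>V" c i] by simp

lemma proj_ext: assumes "u \<in> carrier V" "v \<in> carrier V" "!!i. i \<in> I ==> proj i u = proj i v" shows "u = v"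
proof -
 have s: "supp u = supp v" using assms by (auto simp: supp_def)
 have "(\<Oplus>\<^sub>V i\<in>supp u. proj i u) = (\<Oplus>\<^sub>V i\<in>supp v. proj i v)"
  using assms s subsetD[OF supp_sub] by (intro M.finsum_cong') auto
 then show ?thesis using proj_sum assms by simp
qed

lemma in_submodule_of_proj:
 assumes "v \<in> carrier V" "\<zero>\<^sub>V \<in> T" "!!x y. x \<in> T ==> y \<in> T ==> x \<oplus>\<^sub>V y \<in> T" "T \<subseteq> carrier V" "!!i. i \<in> I ==> proj i v \<in> T"
 shows "v \<in> T"
proof -
 have "(\<Oplus>\<^sub>V i\<in>S. proj i v) \<in> T" if "finite S" "S \<subseteq> I" for S
  using that
 proof (induction S)
  case (insert i S)
  then show ?case using assms by (subst M.finsum_insert) auto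
 qed (use assms in simp)
 from this[OF supp_finite[OF assms(1)] supp_sub] show ?thesis using proj_sum[OF assms(1)] by simp
qed

lemma additive_vanish:
 assumes g: "!!x y. x \<in> carrier V ==> y \<in> carrier V ==> g (x \<oplus>\<^sub>V y) = g x \<oplus>\<^sub>V g y" "g \<zero>\<^sub>V = \<zero>\<^sub>V"
  and z: "!!i x. i \<in> I ==> x \<in> W i ==> g x = \<zero>\<^sub>V" and v: "v \<in> carrier V"
 shows "g v = \<zero>\<^sub>V"
proof -
 have "v \<in> {x \<in> carrier V. g x = \<zero>\<^sub>V}"
 proof (rule in_submodule_of_proj[OF v])
  fix i assume i: "i \<in> I"
  show "proj i v \<in> {x \<in> carrier V. g x = \<zero>\<^sub>V}" using z[OF i proj_in[OF v i]] v i by simp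
 qed (auto simp: g)
 then show ?thesis by simp
qed

end


text \<open>The augmentation comes from the grading by the natural numbers, while cochains are homogeneous for the group
grading; the last assumption makes the two compatible.\<close>
locale graded_algebra =
 fixes K :: "'k ring" and A :: "('k, 'a) module" and Adeg :: "nat => 'a set"
  and GG :: "('t, 's) monoid_scheme" and dA :: "'t => 'a set"
 assumes field_K: "field K" and conn: "connected_graded K A Adeg" and group_GG: "group GG"
  and dA_ids: "internal_direct_sum K A (carrier GG) dA"
  and dA_mult: "!!s t a b. [|s \<in> carrier GG; t \<in> carrier GG; a \<in> dA s; b \<in> dA t|] ==>
   a \<otimes>\<^sub>A b \<in> dA (s \<otimes>\<^sub>GG t)"
  and aug_degree: "!!t a. t \<in> carrier GG ==> a \<in> dA t ==> augmentation K A Adeg a ~= \<zero>\<^sub>K ==> t = \<one>\<^sub>GG"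
begin

lemma alg: "k_algebra K A" and A_nontrivial: "\<one>\<^sub>A ~= \<zero>\<^sub>A" and Adeg_ids: "internal_direct_sum K A UNIV Adeg"
 and Adeg_mult: "x \<in> Adeg i ==> y \<in> Adeg j ==> x \<otimes>\<^sub>A y \<in> Adeg (i + j)"
 and Adeg_0: "Adeg 0 = {c \<odot>\<^sub>A \<one>\<^sub>A | c. c \<in> carrier K}"
 using conn by (auto simp: connected_graded_def)

sublocale field K by (rule field_K)
sublocale A: ring A using alg by (simp add: k_algebra_def)
sublocale V: vectorspace K A using alg by (simp add: k_algebra_def)
sublocale N: direct_sum K A UNIV Adeg
 using V.vectorspace_axioms Adeg_ids by (intro direct_sum.intro direct_sum_axioms.intro)
sublocale D: direct_sum K A "carrier GG" dA
 using V.vectorspace_axioms dA_ids by (intro direct_sum.intro direct_sum_axioms.intro)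

abbreviation "aug \<equiv> augmentation K A Adeg"

lemma smult_one_inj: assumes "c \<in> carrier K" "d \<in> carrier K" "c \<odot>\<^sub>A \<one>\<^sub>A = d \<odot>\<^sub>A \<one>\<^sub>A" shows "c = d"
proof (rule ccontr)
 assume "c ~= d"
 then have n: "c \<ominus>\<^sub>K d ~= \<zero>\<^sub>K" "c \<ominus>\<^sub>K d \<in> carrier K" using assms by auto
 have "(c \<ominus>\<^sub>K d) \<odot>\<^sub>A \<one>\<^sub>A = \<zero>\<^sub>A"
  using assms by (simp add: a_minus_def V.smult_l_distr V.smult_l_minus A.r_neg)
 then have "inv\<^bsub>K\<^esub> (c \<ominus>\<^sub>K d) \<odot>\<^sub>A ((c \<ominus>\<^sub>K d) \<odot>\<^sub>A \<one>\<^sub>A) = \<zero>\<^sub>A"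
  using n by (simp add: V.smult_r_null field_Units)
 then have "\<one>\<^sub>A = \<zero>\<^sub>A" using n by (simp add: field_Units flip: V.smult_assoc1)
 then show False using A_nontrivial by blast
qed

lemma aug_ex1: assumes "a \<in> carrier A" shows "\<exists>!c. c \<in> carrier K \<and> component A UNIV Adeg a 0 = c \<odot>\<^sub>A \<one>\<^sub>A"
proof -
 have "component A UNIV Adeg a 0 \<in> Adeg 0" using N.proj_in[OF assms, of 0] by (simp add: N.proj_def)
 then obtain c where c: "c \<in> carrier K" "component A UNIV Adeg a 0 = c \<odot>\<^sub>A \<one>\<^sub>A"
  unfolding Adeg_0 by blast
 then show ?thesis using smult_one_inj by (intro ex1I[of _ c]) simp_all
qed

lemma aug_closed [simp]: "a \<in> carrier A ==> aug a \<in> carrier K"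
 and aug_proj: "a \<in> carrier A ==> N.proj 0 a = aug a \<odot>\<^sub>A \<one>\<^sub>A"
 using theI'[OF aug_ex1, of a] by (auto simp: augmentation_def N.proj_def)

lemma aug_eqI: "a \<in> carrier A ==> c \<in> carrier K ==> N.proj 0 a = c \<odot>\<^sub>A \<one>\<^sub>A ==> aug a = c"
 using smult_one_inj aug_proj by simp

lemma aug_linear: assumes "a \<in> carrier A" "b \<in> carrier A" "c \<in> carrier K"
 shows "aug (c \<odot>\<^sub>A a \<oplus>\<^sub>A b) = c \<otimes>\<^sub>K aug a \<oplus>\<^sub>K aug b"
 using assms by (intro aug_eqI) (auto simp: N.proj_linear aug_proj V.smult_l_distr V.smult_assoc1)

lemma aug_one [simp]: "aug \<one>\<^sub>A = \<one>\<^sub>K"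
proof (rule aug_eqI)
 have "\<one>\<^sub>A \<in> Adeg 0" unfolding Adeg_0 by (auto intro!: exI[of _ "\<one>\<^sub>K"])
 then show "N.proj 0 \<one>\<^sub>A = \<one>\<^sub>K \<odot>\<^sub>A \<one>\<^sub>A" using N.proj_hom[of 0 "\<one>\<^sub>A" 0] by simp
qed auto

lemma aug_pos: "a \<in> Adeg i ==> 0 < i ==> aug a = \<zero>\<^sub>K"
 using N.proj_hom[of i a 0] N.W_carrier[of i a] by (intro aug_eqI) (auto simp: V.smult_l_null)

lemma aug_scalar: "c \<in> carrier K ==> aug (c \<odot>\<^sub>A \<one>\<^sub>A) = c"
 using aug_linear[of "\<one>\<^sub>A" "\<zero>\<^sub>A" c] aug_linear[of "\<zero>\<^sub>A" "\<zero>\<^sub>A" "\<one>\<^sub>K"] aug_eqI[of "\<zero>\<^sub>A" "\<zero>\<^sub>K"]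
 by (simp add: V.smult_l_null)

lemma aug_zero [simp]: "aug \<zero>\<^sub>A = \<zero>\<^sub>K"
 using aug_scalar[of "\<zero>\<^sub>K"] by (simp add: V.smult_l_null)

lemma smult_assoc_l: "[|c \<in> carrier K; x \<in> carrier A; y \<in> carrier A|] ==>
  (c \<odot>\<^sub>A x) \<otimes>\<^sub>A y = c \<odot>\<^sub>A (x \<otimes>\<^sub>A y)"
 and smult_assoc_r: "[|c \<in> carrier K; x \<in> carrier A; y \<in> carrier A|] ==>
  x \<otimes>\<^sub>A (c \<odot>\<^sub>A y) = c \<odot>\<^sub>A (x \<otimes>\<^sub>A y)"
 using alg by (auto simp: k_algebra_def)

lemma aug_mult_hom:
 assumes "a \<in> Adeg i" "b \<in> Adeg j"
 shows "aug (a \<otimes>\<^sub>A b) = aug a \<otimes>\<^sub>K aug b"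
proof -
 have c: "a \<in> carrier A" "b \<in> carrier A" using assms N.W_carrier by auto
 consider "0 < i" | "0 < j" | "i = 0" "j = 0" by blast
 then show ?thesis
 proof cases
  case 3
  then obtain c d where cd: "a = c \<odot>\<^sub>A \<one>\<^sub>A" "b = d \<odot>\<^sub>A \<one>\<^sub>A" "c \<in> carrier K" "d \<in> carrier K"
   using assms by (auto simp: Adeg_0)
  then have "a \<otimes>\<^sub>A b = (c \<otimes>\<^sub>K d) \<odot>\<^sub>A \<one>\<^sub>A" by (simp add: smult_assoc_l V.smult_assoc1)
  then show ?thesis using cd by (simp add: aug_scalar)
 qed (use aug_pos[OF Adeg_mult[OF assms]] aug_pos[OF assms(1)] aug_pos[OF assms(2)] c in auto)
qed

lemma linear_aug_ext:
 assumes g: "!!x y. x \<in> carrier A ==> y \<in> carrier A ==> g (x \<oplus>\<^sub>A y) = g x \<oplus>\<^sub>K g y" "g \<zero>\<^sub>A = \<zero>\<^sub>K"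
  and h: "!!x y. x \<in> carrier A ==> y \<in> carrier A ==> h (x \<oplus>\<^sub>A y) = h x \<oplus>\<^sub>K h y" "h \<zero>\<^sub>A = \<zero>\<^sub>K"
  and e: "!!i x. x \<in> Adeg i ==> g x = h x" and v: "v \<in> carrier A"
 shows "g v = h v"
proof -
 have "v \<in> {x \<in> carrier A. g x = h x}"
 proof (rule N.in_submodule_of_proj[OF v])
  show "N.proj i v \<in> {x \<in> carrier A. g x = h x}" for i using e[OF N.proj_in[OF v UNIV_I]] v by simp
 qed (auto simp: g h)
 then show ?thesis by simp
qed

lemma aug_add: "a \<in> carrier A ==> b \<in> carrier A ==> aug (a \<oplus>\<^sub>A b) = aug a \<oplus>\<^sub>K aug b"
 using aug_linear[of a b "\<one>\<^sub>K"] by simp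

lemma aug_mult: assumes "a \<in> carrier A" "b \<in> carrier A" shows "aug (a \<otimes>\<^sub>A b) = aug a \<otimes>\<^sub>K aug b"
proof (rule linear_aug_ext[of "\<lambda>a. aug (a \<otimes>\<^sub>A b)" "\<lambda>a. aug a \<otimes>\<^sub>K aug b"])
 fix i x assume x: "x \<in> Adeg i"
 show "aug (x \<otimes>\<^sub>A b) = aug x \<otimes>\<^sub>K aug b"
  by (rule linear_aug_ext[of "\<lambda>b. aug (x \<otimes>\<^sub>A b)" "\<lambda>b. aug x \<otimes>\<^sub>K aug b"])
    (use x N.W_carrier[of i x] assms in \<open>auto simp: aug_add A.r_distr r_distr intro: aug_mult_hom\<close>)
qed (use assms in \<open>auto simp: aug_add A.l_distr l_distr\<close>)

sublocale T: graded_actor K A GG dA "{0::nat}" "\<lambda>_ x. x" "\<lambda>p _. aug (snd p)"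
proof (rule graded_actor.intro)
 show "field K" "k_algebra K A" "group GG" by (rule field_K alg group_GG)+
qed (auto simp: D.W_sub dA_mult D.W_carrier aug_linear aug_mult)


sublocale U: graded_actor K A "singleton_group (0::nat)" "\<lambda>_. carrier A" "{0::nat}" "\<lambda>_ x. x" "\<lambda>p _. aug (snd p)"
proof (rule graded_actor.intro)
 show "field K" "k_algebra K A" by (rule field_K alg)+
 show "group (singleton_group (0::nat))" by (rule singleton_group)
 show "VectorSpace.subspace K (carrier A) A"
  using V.vectorspace_axioms by (auto simp: subspace_def submodule_def V.module_axioms)
qed (auto simp: aug_linear aug_mult)

end

context graded_algebra begin

section \<open>Multilinear functions of lists\<close>

definition lists :: "nat => 'a list set" where "lists n = {as. length as = n \<and> set as \<subseteq> carrier A}"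

definition mlin :: "nat => ('a list => 'a) => bool" where
 "mlin n F \<longleftrightarrow> U.multilin n (\<lambda>w _. F (map snd w))"

fun linner :: "('a list => 'a) => 'a list => 'a" where
 "linner F [] = \<zero>\<^sub>A"
| "linner F [a] = aug a \<odot>\<^sub>A F []"
| "linner F (a # b # as) = F (a \<otimes>\<^sub>A b # as) \<ominus>\<^sub>A linner (\<lambda>bs. F (a # bs)) (b # as)"

definition ldiff :: "('a list => 'a) => 'a list => 'a" where
 "ldiff F as = hd as \<otimes>\<^sub>A F (tl as) \<ominus>\<^sub>A linner F as"

lemma U_inner: "U.bar_inner (\<lambda>w _. F (map snd w)) w x = linner F (map snd w)"
proof (induction w arbitrary: F rule: induct_list012)
 case (3 p q as)
 have "U.shift p (\<lambda>w (_::nat). F (map snd w)) = (\<lambda>w _. F (snd p # map snd w))"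
  by (simp add: U.shift_def fun_eq_iff)
 then show ?case using 3(2)[of "\<lambda>bs. F (snd p # bs)"] by (simp add: U.pm_def)
qed auto

lemma T_inner: "T.bar_inner (\<lambda>w _. F (map snd w)) w x = linner F (map snd w)"
proof (induction w arbitrary: F rule: induct_list012)
 case (3 p q as)
 have "T.shift p (\<lambda>w (_::nat). F (map snd w)) = (\<lambda>w _. F (snd p # map snd w))"
  by (simp add: T.shift_def fun_eq_iff)
 then show ?case using 3(2)[of "\<lambda>bs. F (snd p # bs)"] by (simp add: T.pm_def)
qed auto

lemma U_diff: "w ~= [] ==> U.bar_diff (\<lambda>w _. F (map snd w)) w x = ldiff F (map snd w)"
 by (simp add: U.bar_diff_def ldiff_def U_inner hd_map map_tl)

lemma T_diff: "w ~= [] ==> T.bar_diff (\<lambda>w _. F (map snd w)) w x = ldiff F (map snd w)"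
 by (simp add: T.bar_diff_def ldiff_def T_inner hd_map map_tl)

abbreviation tag :: "'a list => (nat \<times> 'a) list" where "tag \<equiv> map (Pair 0)"

lemma snd_tag [simp]: "map snd (tag as) = as" by (induction as) auto

lemma snd_tag' [simp]: "map (snd \<circ> Pair (0::nat)) as = as" by (simp add: comp_def)

lemma tag_words: "tag as \<in> U.words n \<longleftrightarrow> as \<in> lists n"
 by (auto simp: U.words_def lists_def carrier_singleton_group)

lemma U_words: "w \<in> U.words n \<longleftrightarrow> (\<exists>as. w = tag as \<and> as \<in> lists n)"
proof
 assume w: "w \<in> U.words n"
 then have "w = tag (map snd w)" by (induction n arbitrary: w) (auto simp: U.words_Suc carrier_singleton_group)
 then show "\<exists>as. w = tag as \<and> as \<in> lists n" using w tag_words by metis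
qed (auto simp: tag_words)

lemma mlin_closed: "mlin n F ==> as \<in> lists n ==> F as \<in> carrier A"
 using U.vals_D[OF U.multilin_vals, of n "\<lambda>w _. F (map snd w)" "tag as" 0] by (simp add: mlin_def tag_words)

lemma mlinD:
 assumes "mlin n F" "us \<in> lists i" "vs \<in> lists j" "i + j + 1 = n" "a \<in> carrier A" "b \<in> carrier A" "c \<in> carrier K"
 shows "F (us @ (c \<odot>\<^sub>A a \<oplus>\<^sub>A b) # vs) = c \<odot>\<^sub>A F (us @ a # vs) \<oplus>\<^sub>A F (us @ b # vs)"
 using U.multilinD[OF assms(1)[unfolded mlin_def], of "tag us" i "tag vs" j 0 a b c 0] assms
 by (simp add: tag_words carrier_singleton_group)

lemma mlinI:
 assumes "!!as. as \<in> lists n ==> F as \<in> carrier A"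
  and "!!us vs i j a b c. [|us \<in> lists i; vs \<in> lists j; i + j + 1 = n; a \<in> carrier A; b \<in> carrier A; c \<in> carrier K|] ==>
   F (us @ (c \<odot>\<^sub>A a \<oplus>\<^sub>A b) # vs) = c \<odot>\<^sub>A F (us @ a # vs) \<oplus>\<^sub>A F (us @ b # vs)"
 shows "mlin n F"
 unfolding mlin_def
proof (rule U.multilinI)
 show "U.vals n (\<lambda>w _. F (map snd w))" using assms(1) by (auto simp: U.vals_def U_words)
 fix us vs i j t a b c x
 assume "us \<in> U.words i" "vs \<in> U.words j" "i + j + 1 = n" "a \<in> carrier A" "b \<in> carrier A" "c \<in> carrier K"
 then show "F (map snd (us @ (t, c \<odot>\<^sub>A a \<oplus>\<^sub>A b) # vs)) = c \<odot>\<^sub>A F (map snd (us @ (t, a) # vs)) \<oplus>\<^sub>A F (map snd (us @ (t, b) # vs))"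
  using assms(2) by (auto simp: U_words)
qed

lemma lists_0 [simp]: "lists 0 = {[]}" by (auto simp: lists_def)

lemma lists_Suc: "as \<in> lists (Suc n) \<longleftrightarrow> (\<exists>a bs. as = a # bs \<and> a \<in> carrier A \<and> bs \<in> lists n)"
 by (cases as) (auto simp: lists_def)

lemma lists_Cons [simp]: "a # bs \<in> lists (Suc n) \<longleftrightarrow> a \<in> carrier A \<and> bs \<in> lists n"
 by (auto simp: lists_def)

lemma lists_slot: "us \<in> lists i ==> vs \<in> lists j ==> a \<in> carrier A ==> n = Suc (i + j) ==> us @ a # vs \<in> lists n"
 by (auto simp: lists_def)

lemma mlin_ldiff: assumes "mlin n F" shows "mlin (Suc n) (ldiff F)"
proof -
 have "U.agree (Suc n) (U.bar_diff (\<lambda>w _. F (map snd w))) (\<lambda>w _. ldiff F (map snd w))"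
  by (auto simp: U.agree_def U.words_Suc U_diff)
 from U.multilin_cong[OF this] U.multilin_diff assms show ?thesis by (simp add: mlin_def)
qed

lemma mlin_comb: assumes "mlin n F" "mlin n G" "c \<in> carrier K" shows "mlin n (\<lambda>as. c \<odot>\<^sub>A F as \<oplus>\<^sub>A G as)"
 using U.multilin_comb[OF assms(1)[unfolded mlin_def] assms(2)[unfolded mlin_def] assms(3)]
 by (simp add: mlin_def U.comb_def[abs_def])

lemma T_words_lists: "w \<in> T.words n ==> map snd w \<in> lists n"
 unfolding T.words_def lists_def using T.hom_elD(2) by auto


lemma mlin_vanish:
 assumes F: "mlin n F" and z: "!!w. w \<in> T.words n ==> F (map snd w) = \<zero>\<^sub>A"
 shows "k \<le> n ==> us \<in> lists k ==> w \<in> T.words (n - k) ==> F (us @ map snd w) = \<zero>\<^sub>A"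
proof (induction k arbitrary: us w)
 case 0
 then show ?case using z by simp
next
 case (Suc k)
 then obtain vs a where us: "us = vs @ [a]" "vs \<in> lists k" "a \<in> carrier A"
  by (cases us rule: rev_cases) (auto simp: lists_def)
 define g where "g x = F (vs @ x # map snd w)" for x
 have lin: "g (c \<odot>\<^sub>A x \<oplus>\<^sub>A y) = c \<odot>\<^sub>A g x \<oplus>\<^sub>A g y" if "x \<in> carrier A" "y \<in> carrier A" "c \<in> carrier K" for c x y
  unfolding g_def using Suc.prems us that T_words_lists[OF Suc.prems(3)] by (intro mlinD[OF F]) auto
 have cl: "g x \<in> carrier A" if "x \<in> carrier A" for x
  unfolding g_def using Suc.prems us that T_words_lists[OF Suc.prems(3)] by (intro mlin_closed[OF F] lists_slot) auto
 have "g a = \<zero>\<^sub>A"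
 proof (rule D.additive_vanish[where g = g])
  show "g (x \<oplus>\<^sub>A y) = g x \<oplus>\<^sub>A g y" if "x \<in> carrier A" "y \<in> carrier A" for x y
   using lin[OF that, of "\<one>\<^sub>K"] that cl by simp
  have "g \<zero>\<^sub>A = g \<zero>\<^sub>A \<oplus>\<^sub>A g \<zero>\<^sub>A" using lin[of "\<zero>\<^sub>A" "\<zero>\<^sub>A" "\<one>\<^sub>K"] cl by simp
  then show "g \<zero>\<^sub>A = \<zero>\<^sub>A" using cl[of "\<zero>\<^sub>A"] by (metis A.add.r_cancel_one' A.zero_closed)
  fix t x assume t: "t \<in> carrier GG" "x \<in> dA t"
  have "(t, x) # w \<in> T.words (Suc (n - Suc k))" using t Suc.prems by simp
  then have "F (vs @ map snd ((t, x) # w)) = \<zero>\<^sub>A" using Suc.prems us by (intro Suc.IH) (auto simp: Suc_diff_Suc)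
  then show "g x = \<zero>\<^sub>A" by (simp add: g_def)
 qed (rule us(3))
 then show ?case by (simp add: us g_def)
qed

lemma mlin_eqI:
 assumes F: "mlin n F" and G: "mlin n G" and e: "!!w. w \<in> T.words n ==> F (map snd w) = G (map snd w)" and as: "as \<in> lists n"
 shows "F as = G as"
proof -
 let ?H = "\<lambda>as. (\<ominus>\<^sub>K \<one>\<^sub>K) \<odot>\<^sub>A G as \<oplus>\<^sub>A F as"
 have m: "mlin n ?H" using F G by (intro mlin_comb) auto
 have z: "?H (map snd w) = \<zero>\<^sub>A" if w: "w \<in> T.words n" for w
  using e[OF w] mlin_closed[OF G T_words_lists[OF w]] by (simp add: T.smult_minus_one A.l_neg)
 have "[] \<in> T.words (n - n)" by simp
 from mlin_vanish[OF m z le_refl as this] have "?H as = \<zero>\<^sub>A" by simp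
 then show ?thesis using mlin_closed[OF F as] mlin_closed[OF G as]
  by (simp add: T.smult_minus_one) (metis A.add.inv_closed A.add.inv_equality A.minus_minus A.a_comm)
qed

section \<open>Multilinear extension from homogeneous words\<close>

fun ext :: "(('t \<times> 'a) list => nat => 'a) => 'a list => 'a" where
 "ext ph [] = ph [] 0"
| "ext ph (a # as) = (\<Oplus>\<^sub>A t\<in>D.supp a. ext (T.shift (t, D.proj t a) ph) as)"

lemma hom_proj: "a \<in> carrier A ==> t \<in> carrier GG ==> T.hom_el (t, D.proj t a)"
 by (simp add: D.proj_in)

lemma ext_closed: "as \<in> lists n ==> T.vals n ph ==> ext ph as \<in> carrier A"
proof (induction n arbitrary: as ph)
 case 0
 then show ?case by (simp add: T.vals_def)
next
 case (Suc n)
 then obtain a bs where as: "as = a # bs" "a \<in> carrier A" "bs \<in> lists n" by (auto simp: lists_Suc)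
 have "ext (T.shift (t, D.proj t a) ph) bs \<in> carrier A" if "t \<in> D.supp a" for t
  using Suc as that subsetD[OF D.supp_sub that] by (intro Suc.IH T.vals_shift hom_proj) auto
 then show ?case by (auto simp: as intro!: A.finsum_closed)
qed

lemma ext_cong: "as \<in> lists n ==> T.agree n ph ps ==> T.vals n ps ==> ext ph as = ext ps as"
proof (induction n arbitrary: as ph ps)
 case 0
 then show ?case by (simp add: T.agree_def)
next
 case (Suc n)
 then obtain a bs where as: "as = a # bs" "a \<in> carrier A" "bs \<in> lists n" by (auto simp: lists_Suc)
 have v: "T.vals n (T.shift (t, D.proj t a) ps)" if "t \<in> D.supp a" for t
  using Suc as subsetD[OF D.supp_sub that] by (intro T.vals_shift hom_proj) auto
 have "ext (T.shift (t, D.proj t a) ph) bs = ext (T.shift (t, D.proj t a) ps) bs" if "t \<in> D.supp a" for t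
  using Suc.prems as hom_proj[OF as(2) subsetD[OF D.supp_sub that]] v[OF that]
  by (intro Suc.IH v[OF that]) (auto simp: T.agree_def T.shift_def simp del: T.hom_el_pair)
 then show ?case using v ext_closed[OF as(3)] by (simp add: as) (intro A.finsum_cong', auto)
qed

lemma ext_comb: "as \<in> lists n ==> T.vals n ph ==> T.vals n ps ==> c \<in> carrier K ==>
 ext (T.comb c ph ps) as = c \<odot>\<^sub>A ext ph as \<oplus>\<^sub>A ext ps as"
proof (induction n arbitrary: as ph ps)
 case 0
 then show ?case by (simp add: T.comb_def)
next
 case (Suc n)
 then obtain a bs where as: "as = a # bs" "a \<in> carrier A" "bs \<in> lists n" by (auto simp: lists_Suc)
 have v: "T.vals n (T.shift (t, D.proj t a) ph)" "T.vals n (T.shift (t, D.proj t a) ps)" if "t \<in> D.supp a" for t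
  using Suc.prems as hom_proj[OF as(2) subsetD[OF D.supp_sub that]] by (auto intro!: T.vals_shift simp del: T.hom_el_pair)
 have "ext (T.comb c ph ps) as = (\<Oplus>\<^sub>A t\<in>D.supp a. c \<odot>\<^sub>A ext (T.shift (t, D.proj t a) ph) bs \<oplus>\<^sub>A ext (T.shift (t, D.proj t a) ps) bs)"
  unfolding as ext.simps T.shift_comb using Suc.prems v ext_closed[OF as(3)]
  by (intro A.finsum_cong' Suc.IH[OF as(3)]) auto
 also have "\<dots> = c \<odot>\<^sub>A ext ph as \<oplus>\<^sub>A ext ps as"
  using v ext_closed[OF as(3)] Suc.prems D.supp_finite[OF as(2)]
  by (subst A.finsum_addf) (auto simp: as V.finsum_smult_ldistr)
 finally show ?case .
qed

lemma ext_zero: "as \<in> lists n ==> ext (\<lambda>_ _. \<zero>\<^sub>A) as = \<zero>\<^sub>A"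
proof (induction n arbitrary: as)
 case (Suc n)
 then show ?case by (auto simp: lists_Suc T.shift_def[abs_def] A.finsum_zero)
qed simp

lemma T_slot_zero:
 assumes "T.multilin (Suc n) ph" "t \<in> carrier GG" shows "T.agree n (T.shift (t, \<zero>\<^sub>A) ph) (\<lambda>_ _. \<zero>\<^sub>A)"
 unfolding T.agree_def
proof (intro ballI)
 fix as and x :: nat assume h: "as \<in> T.words n" "x \<in> {0}"
 have z: "\<zero>\<^sub>A \<in> dA t" using assms D.W_zero by simp
 then have c: "ph ((t, \<zero>\<^sub>A) # as) x \<in> carrier A"
  using assms h by (intro T.vals_D[OF T.multilin_vals[OF assms(1)]]) auto
 then have "ph ((t, \<zero>\<^sub>A) # as) x = ph ((t, \<zero>\<^sub>A) # as) x \<oplus>\<^sub>A ph ((t, \<zero>\<^sub>A) # as) x"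
  using T.multilinD[OF assms(1), of "[]" 0 as n t "\<zero>\<^sub>A" "\<zero>\<^sub>A" "\<one>\<^sub>K" x] h assms z by simp
 then show "T.shift (t, \<zero>\<^sub>A) ph as x = \<zero>\<^sub>A" using c unfolding T.shift_def by (metis A.add.r_cancel_one' A.zero_closed)
qed

lemma ext_superset:
 assumes "T.multilin (Suc n) ph" "a \<in> carrier A" "bs \<in> lists n" "finite S" "D.supp a \<subseteq> S" "S \<subseteq> carrier GG"
 shows "ext ph (a # bs) = (\<Oplus>\<^sub>A t\<in>S. ext (T.shift (t, D.proj t a) ph) bs)"
proof -
 have c: "ext (T.shift (t, D.proj t a) ph) bs \<in> carrier A" if "t \<in> S" for t
  using assms(6) that by (intro ext_closed[OF assms(3)] T.vals_shift T.multilin_vals assms(1) hom_proj assms(2)) auto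
 have z: "ext (T.shift (t, D.proj t a) ph) bs = \<zero>\<^sub>A" if "t \<in> S - D.supp a" for t
 proof -
  have t: "t \<in> carrier GG" "D.proj t a = \<zero>\<^sub>A" using that assms(6) by (auto simp: D.supp_def)
  have "ext (T.shift (t, \<zero>\<^sub>A) ph) bs = ext (\<lambda>_ _. \<zero>\<^sub>A) bs"
   by (rule ext_cong[OF assms(3) T_slot_zero[OF assms(1) t(1)]]) (simp add: T.vals_def)
  then show ?thesis using ext_zero[OF assms(3)] t by simp
 qed
 show ?thesis unfolding ext.simps using assms(4,5) c z by (intro A.add.finprod_mono_neutral_cong_left) auto
qed

lemma ext_hom: "w \<in> T.words n ==> T.multilin n ph ==> ext ph (map snd w) = ph w 0"
proof (induction n arbitrary: w ph)
 case 0
 then show ?case by simp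
next
 case (Suc n)
 then obtain t a v where w: "w = (t, a) # v" "t \<in> carrier GG" "a \<in> dA t" "v \<in> T.words n" by (auto simp: T.words_Suc)
 have a: "a \<in> carrier A" using w D.W_carrier by blast
 have p: "D.proj t a = a" using D.proj_hom[OF w(2,3,2)] by simp
 have s: "D.supp a \<subseteq> {t}" using D.proj_hom[OF w(2,3)] by (auto simp: D.supp_def split: if_splits)
 have m: "T.multilin n (T.shift (t, a) ph)" using Suc.prems w by (intro T.multilin_shift) auto
 have "ext ph (map snd w) = (\<Oplus>\<^sub>A u\<in>{t}. ext (T.shift (u, D.proj u a) ph) (map snd v))"
  unfolding w using Suc.prems w a s T_words_lists[OF w(4)] by (simp only: list.map snd_conv) (intro ext_superset[of n], auto)
 also have "\<dots> = ext (T.shift (t, a) ph) (map snd v)"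
  using ext_closed[OF T_words_lists[OF w(4)] T.multilin_vals[OF m]] p by (simp add: A.finsum_insert)
 also have "\<dots> = ph w 0" unfolding Suc.IH[OF w(4) m] w T.shift_def ..
 finally show ?case .
qed

lemma ext_linear:
 "T.multilin n ph ==> us \<in> lists i ==> vs \<in> lists j ==> i + j + 1 = n ==> a \<in> carrier A ==> b \<in> carrier A ==> c \<in> carrier K ==>
  ext ph (us @ (c \<odot>\<^sub>A a \<oplus>\<^sub>A b) # vs) = c \<odot>\<^sub>A ext ph (us @ a # vs) \<oplus>\<^sub>A ext ph (us @ b # vs)"
proof (induction i arbitrary: us n ph)
 case 0
 then have us: "us = []" and n: "n = Suc j" by auto
 let ?l = "c \<odot>\<^sub>A a \<oplus>\<^sub>A b"
 have l: "?l \<in> carrier A" using 0 by simp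
 let ?S = "D.supp a \<union> D.supp b \<union> D.supp ?l"
 have S: "finite ?S" "?S \<subseteq> carrier GG" using 0 l D.supp_finite D.supp_sub by auto
 have m: "T.vals j (T.shift (t, D.proj t d) ph)" if "t \<in> ?S" "d \<in> carrier A" for t d
  using 0 S that n by (intro T.vals_shift T.multilin_vals hom_proj) auto
 have e: "ext (T.shift (t, D.proj t ?l) ph) vs = c \<odot>\<^sub>A ext (T.shift (t, D.proj t a) ph) vs \<oplus>\<^sub>A ext (T.shift (t, D.proj t b) ph) vs"
  if t: "t \<in> ?S" for t
 proof -
  have tG: "t \<in> carrier GG" using t S by blast
  have "T.agree j (T.shift (t, D.proj t ?l) ph) (T.comb c (T.shift (t, D.proj t a) ph) (T.shift (t, D.proj t b) ph))"
   unfolding T.agree_def T.shift_def T.comb_def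
   using T.multilinD[OF 0(1), of "[]" 0 _ j t "D.proj t a" "D.proj t b" c] 0 tG n by (auto simp: D.proj_linear D.proj_in)
  from ext_cong[OF 0(3) this] ext_comb[OF 0(3), of "T.shift (t, D.proj t a) ph" "T.shift (t, D.proj t b) ph" c] m[OF t] 0
  show ?thesis by (simp add: T.vals_comb)
 qed
 have cl: "ext (T.shift (t, D.proj t d) ph) vs \<in> carrier A" if "t \<in> ?S" "d \<in> carrier A" for t d
  using m[OF that] ext_closed[OF 0(3)] by simp
 have sup: "ext ph (d # vs) = (\<Oplus>\<^sub>A t\<in>?S. ext (T.shift (t, D.proj t d) ph) vs)" if "d \<in> {a, b, ?l}" for d
  using 0 n S l that by (intro ext_superset[of j]) auto
 have "ext ph (?l # vs) = (\<Oplus>\<^sub>A t\<in>?S. ext (T.shift (t, D.proj t ?l) ph) vs)" by (rule sup) simp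
 also have "\<dots> = (\<Oplus>\<^sub>A t\<in>?S. c \<odot>\<^sub>A ext (T.shift (t, D.proj t a) ph) vs \<oplus>\<^sub>A ext (T.shift (t, D.proj t b) ph) vs)"
  using cl 0 e by (intro A.finsum_cong') auto
 also have "\<dots> = (\<Oplus>\<^sub>A t\<in>?S. c \<odot>\<^sub>A ext (T.shift (t, D.proj t a) ph) vs) \<oplus>\<^sub>A (\<Oplus>\<^sub>A t\<in>?S. ext (T.shift (t, D.proj t b) ph) vs)"
  using cl 0 by (intro A.finsum_addf) auto
 also have "(\<Oplus>\<^sub>A t\<in>?S. c \<odot>\<^sub>A ext (T.shift (t, D.proj t a) ph) vs) = c \<odot>\<^sub>A (\<Oplus>\<^sub>A t\<in>?S. ext (T.shift (t, D.proj t a) ph) vs)"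
  using cl 0 S by (intro V.finsum_smult_ldistr[symmetric]) auto
 finally show ?case using sup[of a] sup[of b] by (simp add: us)
next
 case (Suc i)
 then obtain u ws where us: "us = u # ws" "u \<in> carrier A" "ws \<in> lists i" by (auto simp: lists_Suc)
 obtain k where n: "n = Suc k" "i + j + 1 = k" using Suc.prems by (cases n) auto
 have m: "T.multilin k (T.shift (t, D.proj t u) ph)" if "t \<in> D.supp u" for t
  using Suc.prems us n subsetD[OF D.supp_sub that] by (intro T.multilin_shift hom_proj) auto
 have cl: "ext (T.shift (t, D.proj t u) ph) (ws @ d # vs) \<in> carrier A" if "t \<in> D.supp u" "d \<in> carrier A" for t d
  using Suc.prems us n that by (intro ext_closed[of _ k] T.multilin_vals m lists_slot) auto
 have IH: "ext (T.shift (t, D.proj t u) ph) (ws @ (c \<odot>\<^sub>A a \<oplus>\<^sub>A b) # vs) =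
   c \<odot>\<^sub>A ext (T.shift (t, D.proj t u) ph) (ws @ a # vs) \<oplus>\<^sub>A ext (T.shift (t, D.proj t u) ph) (ws @ b # vs)"
  if "t \<in> D.supp u" for t using Suc.prems us n by (intro Suc.IH[OF m[OF that]]) auto
 have "ext ph (us @ (c \<odot>\<^sub>A a \<oplus>\<^sub>A b) # vs) = (\<Oplus>\<^sub>A t\<in>D.supp u.
   c \<odot>\<^sub>A ext (T.shift (t, D.proj t u) ph) (ws @ a # vs) \<oplus>\<^sub>A ext (T.shift (t, D.proj t u) ph) (ws @ b # vs))"
  unfolding us append_Cons ext.simps using cl Suc.prems IH by (intro A.finsum_cong') auto
 also have "\<dots> = c \<odot>\<^sub>A ext ph (us @ a # vs) \<oplus>\<^sub>A ext ph (us @ b # vs)"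
  using cl Suc.prems D.supp_finite[OF us(2)] by (subst A.finsum_addf) (auto simp: us V.finsum_smult_ldistr)
 finally show ?case .
qed

lemma mlin_ext: assumes "T.multilin n ph" shows "mlin n (ext ph)"
proof (rule mlinI)
 show "ext ph as \<in> carrier A" if "as \<in> lists n" for as using that by (rule ext_closed[OF _ T.multilin_vals[OF assms]])
qed (rule ext_linear[OF assms])

lemma T_of_mlin: assumes "mlin n F" shows "T.multilin n (\<lambda>w _. F (map snd w))"
proof (rule T.multilinI)
 show "T.vals n (\<lambda>w _. F (map snd w))" using mlin_closed[OF assms] T_words_lists by (auto simp: T.vals_def)
 fix us vs i j t a b c x
 assume "us \<in> T.words i" "vs \<in> T.words j" "i + j + 1 = n" "t \<in> carrier GG" "a \<in> dA t" "b \<in> dA t" "c \<in> carrier K"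
 then show "F (map snd (us @ (t, c \<odot>\<^sub>A a \<oplus>\<^sub>A b) # vs)) = c \<odot>\<^sub>A F (map snd (us @ (t, a) # vs)) \<oplus>\<^sub>A F (map snd (us @ (t, b) # vs))"
  using mlinD[OF assms T_words_lists T_words_lists] D.W_carrier by simp
qed

lemma ldiff_ext:
 assumes "T.multilin n ph" "as \<in> lists (Suc n)"
 shows "ldiff (ext ph) as = ext (T.bar_diff ph) as"
proof (rule mlin_eqI[OF mlin_ldiff[OF mlin_ext[OF assms(1)]] mlin_ext[OF T.multilin_diff[OF assms(1)]] _ assms(2)])
 fix w assume w: "w \<in> T.words (Suc n)"
 have "T.agree n (\<lambda>w _. ext ph (map snd w)) ph" using ext_hom[OF _ assms(1)] by (auto simp: T.agree_def)
 from T.agreeD[OF T.bar_diff_cong[OF this] w, of 0] have "ldiff (ext ph) (map snd w) = T.bar_diff ph w 0"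
  using w T_diff[of w "ext ph" 0] by (auto simp: T.words_Suc)
 then show "ldiff (ext ph) (map snd w) = ext (T.bar_diff ph) (map snd w)"
  using ext_hom[OF w T.multilin_diff[OF assms(1)]] by simp
qed

end

context graded_algebra begin

section \<open>Comparison with the bar cochains of modules\<close>

abbreviation "triv \<equiv> trivial_module K A Adeg"
abbreviation "reg \<equiv> regular_module A"

lemma reg_simps: "carrier reg = carrier A" "add reg = add A" "zero reg = zero A" "module.smult reg = monoid.mult A"
 "finsum reg = finsum A" "a_inv reg = a_inv A" "signed reg i x = (if even i then x else \<ominus>\<^sub>A x)"
 by (simp_all add: regular_module_def finsum_def a_inv_def fun_eq_iff signed_def finprod_def m_inv_def)

lemma triv_simps: "carrier triv = carrier K" "add triv = add K" "module.smult triv a m = aug a \<otimes>\<^sub>K m"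
 by (simp_all add: trivial_module_def)

lemma scal_reg: "c \<in> carrier K ==> x \<in> carrier A ==> scal A reg c x = c \<odot>\<^sub>A x"
 by (simp add: scal_def reg_simps smult_assoc_l)

lemma scal_triv: "c \<in> carrier K ==> scal A triv c m = c \<otimes>\<^sub>K m"
 by (simp add: scal_def triv_simps aug_scalar)

lemma bar_domain_triv: "bar_domain A triv n = lists n \<times> carrier K"
 by (auto simp: bar_domain_def lists_def triv_simps)

lemma linner_closed: "as \<in> lists (Suc n) ==> (!!bs. bs \<in> lists n ==> F bs \<in> carrier A) ==> linner F as \<in> carrier A"
proof (induction n arbitrary: as F)
 case 0
 then show ?case by (auto simp: lists_Suc)
next
 case (Suc n)
 then obtain a b cs where as: "as = a # b # cs" "a \<in> carrier A" "b \<in> carrier A" "cs \<in> lists n" by (auto simp: lists_Suc)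
 have "linner (\<lambda>bs. F (a # bs)) (b # cs) \<in> carrier A" using as Suc.prems by (intro Suc.IH) auto
 moreover have "F (a \<otimes>\<^sub>A b # cs) \<in> carrier A" using as by (intro Suc.prems) auto
 ultimately show ?case by (simp add: as)
qed

definition contract :: "nat => 'a list => 'a list" where
 "contract i as = take (i - 1) as @ [as ! (i - 1) \<otimes>\<^sub>A as ! i] @ drop (i + 1) as"

lemma contract_closed: "as \<in> lists (Suc n) ==> 1 \<le> i ==> i \<le> n ==> contract i as \<in> lists n"
 using set_take_subset[of "i - 1" as] set_drop_subset[of "i + 1" as]
 by (auto simp: contract_def lists_def intro!: A.m_closed subsetD[OF _ nth_mem])

lemma linner_sum:
 assumes "as \<in> lists (Suc n)" "!!bs. bs \<in> lists n ==> F bs \<in> carrier A"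
 shows "linner F as = \<ominus>\<^sub>A ((\<Oplus>\<^sub>A i\<in>{1..n}. signed reg i (F (contract i as))) \<oplus>\<^sub>A
  signed reg (Suc n) (aug (last as) \<odot>\<^sub>A F (butlast as)))"
 using assms
proof (induction n arbitrary: as F)
 case 0
 then show ?case by (auto simp: lists_Suc reg_simps)
next
 case (Suc n)
 then obtain a b cs where as: "as = a # b # cs" "a \<in> carrier A" "b \<in> carrier A" "cs \<in> lists n" by (auto simp: lists_Suc)
 let ?G = "\<lambda>bs. F (a # bs)"
 have G: "?G bs \<in> carrier A" if "bs \<in> lists n" for bs using that as by (intro Suc.prems) auto
 have bcs: "b # cs \<in> lists (Suc n)" using as by simp
 have s: "signed reg i (?G (contract i (b # cs))) \<in> carrier A" if "i \<in> {1..n}" for i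
  using that contract_closed[OF bcs] G by (auto simp: reg_simps)
 have bl: "butlast (b # cs) \<in> lists n" using bcs by (auto simp: lists_def dest: in_set_butlastD)
 have la: "last (b # cs) \<in> carrier A" using bcs last_in_set[of "b # cs"] unfolding lists_def by blast
 have l: "aug (last (b # cs)) \<odot>\<^sub>A ?G (butlast (b # cs)) \<in> carrier A"
  using la G[OF bl] by simp
 have F1: "F (a \<otimes>\<^sub>A b # cs) \<in> carrier A" using as by (intro Suc.prems) auto
 have c: "contract (Suc i) as = a # contract i (b # cs)" if "i \<in> {1..n}" for i
  using that by (cases i) (auto simp: contract_def as)
 have tc: "signed reg j (F (contract j as)) \<in> carrier A" if "j \<in> {1..Suc n}" for j
  using contract_closed[OF Suc.prems(1)] Suc.prems(2) that by (auto simp: reg_simps)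
 have shift: "(\<Oplus>\<^sub>A i\<in>{1..Suc n}. signed reg i (F (contract i as))) =
   \<ominus>\<^sub>A F (a \<otimes>\<^sub>A b # cs) \<oplus>\<^sub>A (\<Oplus>\<^sub>A i\<in>{1..n}. \<ominus>\<^sub>A signed reg i (?G (contract i (b # cs))))"
 proof -
  have "{1..Suc n} = insert 1 (Suc ` {1..n})" by auto
  moreover have "signed reg (Suc i) (F (contract (Suc i) as)) = \<ominus>\<^sub>A signed reg i (?G (contract i (b # cs)))" if "i \<in> {1..n}" for i
   using G[OF contract_closed[OF bcs]] c[OF that] that by (simp add: reg_simps)
  moreover have "signed reg 1 (F (contract 1 as)) = \<ominus>\<^sub>A F (a \<otimes>\<^sub>A b # cs)"
   by (simp add: reg_simps contract_def as)
  moreover have "(\<Oplus>\<^sub>A i\<in>insert 1 (Suc ` {1..n}). signed reg i (F (contract i as))) =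
    signed reg 1 (F (contract 1 as)) \<oplus>\<^sub>A (\<Oplus>\<^sub>A i\<in>Suc ` {1..n}. signed reg i (F (contract i as)))"
   using tc by (intro A.finsum_insert) auto
  moreover have "(\<Oplus>\<^sub>A i\<in>Suc ` {1..n}. signed reg i (F (contract i as))) = (\<Oplus>\<^sub>A i\<in>{1..n}. signed reg (Suc i) (F (contract (Suc i) as)))"
   using tc by (intro A.finsum_reindex) auto
  moreover have "\<dots> = (\<Oplus>\<^sub>A i\<in>{1..n}. \<ominus>\<^sub>A signed reg i (?G (contract i (b # cs))))"
   using calculation s by (intro A.finsum_cong') auto
  ultimately show ?thesis by (simp only:)
 qed
 have neg: "(\<Oplus>\<^sub>A i\<in>{1..n}. \<ominus>\<^sub>A signed reg i (?G (contract i (b # cs)))) = \<ominus>\<^sub>A (\<Oplus>\<^sub>A i\<in>{1..n}. signed reg i (?G (contract i (b # cs))))"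
 proof -
  have "(\<Oplus>\<^sub>A i\<in>{1..n}. \<ominus>\<^sub>A signed reg i (?G (contract i (b # cs)))) = (\<Oplus>\<^sub>A i\<in>{1..n}. (\<ominus>\<^sub>K \<one>\<^sub>K) \<odot>\<^sub>A signed reg i (?G (contract i (b # cs))))"
   using s by (intro A.finsum_cong') (auto simp: T.smult_minus_one)
  also have "\<dots> = (\<ominus>\<^sub>K \<one>\<^sub>K) \<odot>\<^sub>A (\<Oplus>\<^sub>A i\<in>{1..n}. signed reg i (?G (contract i (b # cs))))"
   using s by (intro V.finsum_smult_ldistr[symmetric]) auto
  finally show ?thesis using s by (simp add: T.smult_minus_one A.finsum_closed Pi_iff)
 qed
 have sg: "signed reg (Suc (Suc n)) (aug (last as) \<odot>\<^sub>A F (butlast as)) = \<ominus>\<^sub>A signed reg (Suc n) (aug (last (b # cs)) \<odot>\<^sub>A ?G (butlast (b # cs)))"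
  using l by (auto simp: reg_simps as)
 have S: "(\<Oplus>\<^sub>A i\<in>{1..n}. signed reg i (?G (contract i (b # cs)))) \<in> carrier A" using s by (auto intro: A.finsum_closed)
 have L: "signed reg (Suc n) (aug (last (b # cs)) \<odot>\<^sub>A ?G (butlast (b # cs))) \<in> carrier A" using l by (simp add: reg_simps)
 have "linner F as = F (a \<otimes>\<^sub>A b # cs) \<ominus>\<^sub>A linner ?G (b # cs)" by (simp add: as)
 also have "linner ?G (b # cs) = \<ominus>\<^sub>A ((\<Oplus>\<^sub>A i\<in>{1..n}. signed reg i (?G (contract i (b # cs)))) \<oplus>\<^sub>A
  signed reg (Suc n) (aug (last (b # cs)) \<odot>\<^sub>A ?G (butlast (b # cs))))"
  using bcs G by (rule Suc.IH)
 finally have 1: "linner F as = F (a \<otimes>\<^sub>A b # cs) \<ominus>\<^sub>A \<ominus>\<^sub>A ((\<Oplus>\<^sub>A i\<in>{1..n}. signed reg i (?G (contract i (b # cs)))) \<oplus>\<^sub>A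
  signed reg (Suc n) (aug (last (b # cs)) \<odot>\<^sub>A ?G (butlast (b # cs))))" .
 have "x \<ominus>\<^sub>A \<ominus>\<^sub>A (y \<oplus>\<^sub>A z) = \<ominus>\<^sub>A ((\<ominus>\<^sub>A x \<oplus>\<^sub>A \<ominus>\<^sub>A y) \<oplus>\<^sub>A \<ominus>\<^sub>A z)"
  if "x \<in> carrier A" "y \<in> carrier A" "z \<in> carrier A" for x y z using that by algebra
 from this[OF F1 S L] show ?case unfolding shift neg sg 1 .
qed

lemma ldiff_cong: assumes "!!bs. bs \<in> lists n ==> F bs = G bs" "as \<in> lists (Suc n)" shows "ldiff F as = ldiff G as"
proof -
 have "U.agree n (\<lambda>w _. F (map snd w)) (\<lambda>w _. G (map snd w))" using assms by (auto simp: U.agree_def U_words)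
 from U.agreeD[OF U.bar_diff_cong[OF this], of "tag as" 0] show ?thesis
  using assms(2) U_diff[of "tag as" F 0] U_diff[of "tag as" G 0] by (auto simp: tag_words lists_Suc)
qed

lemma ldiff_comb: assumes "mlin n F" "mlin n G" "c \<in> carrier K" "as \<in> lists (Suc n)"
 shows "ldiff (\<lambda>bs. c \<odot>\<^sub>A F bs \<oplus>\<^sub>A G bs) as = c \<odot>\<^sub>A ldiff F as \<oplus>\<^sub>A ldiff G as"
proof -
 have "tag as ~= []" using assms(4) by (auto simp: lists_Suc)
 then show ?thesis
  using U.agreeD[OF U.bar_diff_comb[OF U.multilin_vals[OF assms(1)[unfolded mlin_def]] U.multilin_vals[OF assms(2)[unfolded mlin_def]] assms(3)], of "tag as" 0]
   U_diff[of "tag as" F 0] U_diff[of "tag as" G 0] U_diff[of "tag as" "\<lambda>bs. c \<odot>\<^sub>A F bs \<oplus>\<^sub>A G bs" 0] assms(4)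
  by (simp add: tag_words U.comb_def[abs_def])
qed

lemma mlin_zero: "mlin n (\<lambda>_. \<zero>\<^sub>A)"
 by (rule mlinI) (auto simp: V.smult_r_null)

lemma ldiff_zero: "as \<in> lists (Suc n) ==> ldiff (\<lambda>_. \<zero>\<^sub>A) as = \<zero>\<^sub>A"
 using ldiff_comb[OF mlin_zero mlin_zero, of "\<one>\<^sub>K" as n] mlin_closed[OF mlin_ldiff[OF mlin_zero], of as n]
 by simp

lemma ldiff_smult: assumes "mlin n F" "c \<in> carrier K" "as \<in> lists (Suc n)"
 shows "ldiff (\<lambda>bs. c \<odot>\<^sub>A F bs) as = c \<odot>\<^sub>A ldiff F as"
proof -
 have "ldiff (\<lambda>bs. c \<odot>\<^sub>A F bs) as = ldiff (\<lambda>bs. c \<odot>\<^sub>A F bs \<oplus>\<^sub>A \<zero>\<^sub>A) as"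
  using mlin_closed[OF assms(1)] assms by (intro ldiff_cong[of n]) auto
 then show ?thesis using ldiff_comb[OF assms(1) mlin_zero assms(2,3)] ldiff_zero[OF assms(3)]
   mlin_closed[OF mlin_ldiff[OF assms(1)] assms(3)] assms(2) by simp
qed

definition lift :: "nat => ('a list => 'a) => 'a list \<times> 'k => 'a" where
 "lift n F = (\<lambda>(as, m)\<in>bar_domain A triv n. m \<odot>\<^sub>A F as)"

lemma lift_apply [simp]: "as \<in> lists n ==> m \<in> carrier K ==> lift n F (as, m) = m \<odot>\<^sub>A F as"
 by (simp add: lift_def bar_domain_triv)

lemma lift_cong: "(!!as. as \<in> lists n ==> F as = G as) ==> lift n F = lift n G"
 by (auto simp: lift_def bar_domain_triv fun_eq_iff restrict_def)

lemma lift_cochain: assumes "mlin n F" shows "lift n F \<in> bar_cochains K A triv reg n"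
proof -
 have upd: "F (as[i := c \<odot>\<^sub>A a \<oplus>\<^sub>A b]) = c \<odot>\<^sub>A F (as[i := a]) \<oplus>\<^sub>A F (as[i := b])"
  if "as \<in> lists n" "i < n" "a \<in> carrier A" "b \<in> carrier A" "c \<in> carrier K" for as i a b c
 proof -
  have "take i as \<in> lists i" "drop (Suc i) as \<in> lists (n - Suc i)"
   using that set_take_subset[of i as] set_drop_subset[of "Suc i" as] by (auto simp: lists_def)
  then show ?thesis using mlinD[OF assms, of "take i as" i "drop (Suc i) as" "n - Suc i" a b c] that
   by (simp add: upd_conv_take_nth_drop lists_def)
 qed
 have ul: "as[i := a] \<in> lists n" if "as \<in> lists n" "a \<in> carrier A" for as i a
  using that set_update_subset_insert[of as i a] by (auto simp: lists_def)
 note cl = mlin_closed[OF assms]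
 have z: "F (as[i := \<zero>\<^sub>A]) = \<zero>\<^sub>A" if "as \<in> lists n" "i < n" for as i
  using upd[OF that, of "\<zero>\<^sub>A" "\<zero>\<^sub>A" "\<one>\<^sub>K"] cl[OF ul[OF that(1)], of "\<zero>\<^sub>A" i] by simp
 have add: "F (as[i := a \<oplus>\<^sub>A b]) = F (as[i := a]) \<oplus>\<^sub>A F (as[i := b])"
  if "as \<in> lists n" "i < n" "a \<in> carrier A" "b \<in> carrier A" for as i a b
  using upd[OF that, of "\<one>\<^sub>K"] that cl ul by simp
 have sm: "F (as[i := c \<odot>\<^sub>A a]) = c \<odot>\<^sub>A F (as[i := a])"
  if "as \<in> lists n" "i < n" "a \<in> carrier A" "c \<in> carrier K" for as i a c
  using upd[OF that(1-3) _ that(4), of "\<zero>\<^sub>A"] that cl ul z by simp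
 show ?thesis unfolding bar_cochains_def
  using cl ul
  by (auto simp: bar_domain_triv reg_simps triv_simps scal_reg scal_triv lift_def add sm V.smult_r_distr V.smult_l_distr
    V.smult_assoc1[symmetric] m_comm)
qed

lemma cochain_mlin: assumes "\<Phi> \<in> bar_cochains K A triv reg n" "m \<in> carrier K" shows "mlin n (\<lambda>as. \<Phi> (as, m))"
proof (rule mlinI)
 show c: "\<Phi> (as, m) \<in> carrier A" if "as \<in> lists n" for as
  using assms that by (auto simp: bar_cochains_def bar_domain_triv reg_simps)
 fix us vs i j a b c
 assume h: "us \<in> lists i" "vs \<in> lists j" "i + j + 1 = n" "a \<in> carrier A" "b \<in> carrier A" "c \<in> carrier K"
 let ?as = "us @ \<zero>\<^sub>A # vs"
 have as: "?as \<in> lists n" "i < n" using h lists_slot[of us i vs j] by auto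
 have u: "?as[i := x] = us @ x # vs" for x using h by (simp add: list_update_append lists_def)
 have "\<forall>(as, m)\<in>bar_domain A triv n.
    (\<forall>i<n. \<forall>a\<in>carrier A. \<forall>b\<in>carrier A.
     \<Phi> (as[i := a \<oplus>\<^sub>A b], m) = \<Phi> (as[i := a], m) \<oplus>\<^sub>reg \<Phi> (as[i := b], m)) \<and>
    (\<forall>i<n. \<forall>a\<in>carrier A. \<forall>c\<in>carrier K.
     \<Phi> (as[i := c \<odot>\<^sub>A a], m) = scal A reg c (\<Phi> (as[i := a], m)))"
  using assms(1) unfolding bar_cochains_def by blast
 then have x: "\<Phi> (?as[i := a' \<oplus>\<^sub>A b'], m) = \<Phi> (?as[i := a'], m) \<oplus>\<^sub>reg \<Phi> (?as[i := b'], m)"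
  "\<Phi> (?as[i := c' \<odot>\<^sub>A a'], m) = scal A reg c' (\<Phi> (?as[i := a'], m))"
  if "a' \<in> carrier A" "b' \<in> carrier A" "c' \<in> carrier K" for a' b' c'
  using as assms(2) that by (auto simp: bar_domain_triv)
 have "\<Phi> (us @ a # vs, m) \<in> carrier A" using lists_slot[OF h(1,2,4)] h(3) by (intro c) auto
 then show "\<Phi> (us @ (c \<odot>\<^sub>A a \<oplus>\<^sub>A b) # vs, m) = c \<odot>\<^sub>A \<Phi> (us @ a # vs, m) \<oplus>\<^sub>A \<Phi> (us @ b # vs, m)"
  using x(1)[of "c \<odot>\<^sub>A a" b "\<one>\<^sub>K"] x(2)[of a a c] h unfolding u by (simp add: reg_simps scal_reg)
qed

lemma cochain_scalar: assumes "\<Phi> \<in> bar_cochains K A triv reg n" "as \<in> lists n" "m \<in> carrier K" "c \<in> carrier K"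
 shows "\<Phi> (as, c \<otimes>\<^sub>K m) = c \<odot>\<^sub>A \<Phi> (as, m)"
proof -
 have "\<forall>(as, m)\<in>bar_domain A triv n. \<forall>c\<in>carrier K. \<Phi> (as, scal A triv c m) = scal A reg c (\<Phi> (as, m))"
  using assms(1) unfolding bar_cochains_def by blast
 then have "\<Phi> (as, scal A triv c m) = scal A reg c (\<Phi> (as, m))"
  using assms by (auto simp: bar_domain_triv)
 then show ?thesis using assms mlin_closed[OF cochain_mlin[OF assms(1,3)] assms(2)] by (simp add: scal_triv scal_reg)
qed

lemma cochain_lift: assumes "\<Phi> \<in> bar_cochains K A triv reg n" shows "\<Phi> = lift n (\<lambda>as. \<Phi> (as, \<one>\<^sub>K))"
proof
 fix x :: "'a list \<times> 'k"
 obtain as m where x: "x = (as, m)" by (cases x)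
 show "\<Phi> x = lift n (\<lambda>as. \<Phi> (as, \<one>\<^sub>K)) x"
 proof (cases "x \<in> bar_domain A triv n")
  case True
  then have "as \<in> lists n" "m \<in> carrier K" using x by (auto simp: bar_domain_triv)
  then show ?thesis using cochain_scalar[OF assms, of as "\<one>\<^sub>K" m] x by simp
 next
  case False
  have "\<Phi> \<in> bar_domain A triv n \<rightarrow>\<^sub>E carrier reg" using assms by (simp add: bar_cochains_def)
  from PiE_arb[OF this False] show ?thesis using False by (simp add: lift_def)
 qed
qed

lemma bar_differential_lift: assumes "mlin n F" shows "bar_differential A triv reg n (lift n F) = lift (Suc n) (ldiff F)"
proof
 fix x
 show "bar_differential A triv reg n (lift n F) x = lift (Suc n) (ldiff F) x"
 proof (cases "x \<in> bar_domain A triv (Suc n)")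
  case False
  then show ?thesis by (simp add: bar_differential_def lift_def)
 next
  case True
  then obtain as m where x: "x = (as, m)" "as \<in> lists (Suc n)" "m \<in> carrier K" by (auto simp: bar_domain_triv)
  let ?G = "\<lambda>bs. m \<odot>\<^sub>A F bs"
  have G: "?G bs \<in> carrier A" if "bs \<in> lists n" for bs using that x mlin_closed[OF assms] by simp
  have tl: "tl as \<in> lists n" "butlast as \<in> lists n" "hd as \<in> carrier A" "last as \<in> carrier A"
   using x(2) last_in_set[of as] by (cases as; force simp: lists_def dest: in_set_butlastD)+
  have L: "lift n F (butlast as, aug (last as) \<otimes>\<^sub>K m) = aug (last as) \<odot>\<^sub>A ?G (butlast as)"
   using tl x mlin_closed[OF assms] by (simp add: V.smult_assoc1)
  have C: "lift n F (contract i as, m) = ?G (contract i as)" if "i \<in> {1..n}" for i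
   using contract_closed[OF x(2)] that x by simp
  have s: "signed reg i (?G (contract i as)) \<in> carrier A" if "i \<in> {1..n}" for i
   using that contract_closed[OF x(2)] G by (auto simp: reg_simps)
  have "bar_differential A triv reg n (lift n F) x = hd as \<otimes>\<^sub>A ?G (tl as) \<oplus>\<^sub>A
   (\<Oplus>\<^sub>A i\<in>{1..n}. signed reg i (lift n F (contract i as, m))) \<oplus>\<^sub>A
   signed reg (Suc n) (aug (last as) \<odot>\<^sub>A ?G (butlast as))"
   using True x tl L by (simp add: bar_differential_def reg_simps triv_simps contract_def del: lift_apply) (simp)
  also have "(\<Oplus>\<^sub>A i\<in>{1..n}. signed reg i (lift n F (contract i as, m))) = (\<Oplus>\<^sub>A i\<in>{1..n}. signed reg i (?G (contract i as)))"
   using C s by (intro A.finsum_cong') auto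
  also have "hd as \<otimes>\<^sub>A ?G (tl as) \<oplus>\<^sub>A (\<Oplus>\<^sub>A i\<in>{1..n}. signed reg i (?G (contract i as))) \<oplus>\<^sub>A
   signed reg (Suc n) (aug (last as) \<odot>\<^sub>A ?G (butlast as)) = ldiff ?G as"
  proof -
   have "(\<Oplus>\<^sub>A i\<in>{1..n}. signed reg i (?G (contract i as))) \<in> carrier A" using s by (auto intro: A.finsum_closed)
   moreover have "signed reg (Suc n) (aug (last as) \<odot>\<^sub>A ?G (butlast as)) \<in> carrier A"
    using tl G by (simp add: reg_simps)
   moreover have "hd as \<otimes>\<^sub>A ?G (tl as) \<in> carrier A" using tl G by simp
   moreover have "linner ?G as = \<ominus>\<^sub>A ((\<Oplus>\<^sub>A i\<in>{1..n}. signed reg i (?G (contract i as))) \<oplus>\<^sub>A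
     signed reg (Suc n) (aug (last as) \<odot>\<^sub>A ?G (butlast as)))"
    by (rule linner_sum[OF x(2)]) (rule G)
   ultimately show ?thesis unfolding ldiff_def by (simp add: a_minus_def A.a_assoc)
  qed
  also have "\<dots> = lift (Suc n) (ldiff F) x" using ldiff_smult[OF assms x(3,2)] x by simp
  finally show ?thesis .
 qed
qed

lemma zero_cochain_lift: "zero_cochain A triv reg n = lift n (\<lambda>_. \<zero>\<^sub>A)"
 by (auto simp: zero_cochain_def lift_def fun_eq_iff restrict_def bar_domain_triv reg_simps V.smult_r_null)

lemma lift_add: assumes "mlin n F" "mlin n G"
 shows "(\<lambda>x\<in>bar_domain A triv n. lift n F x \<oplus>\<^sub>reg lift n G x) = lift n (\<lambda>as. F as \<oplus>\<^sub>A G as)"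
 using mlin_closed[OF assms(1)] mlin_closed[OF assms(2)]
 by (auto simp: lift_def fun_eq_iff restrict_def bar_domain_triv reg_simps V.smult_r_distr)

end

context graded_algebra begin

lemma lift_diff_ext: "T.multilin n ph ==> bar_differential A triv reg n (lift n (ext ph)) = lift (Suc n) (ext (T.bar_diff ph))"
 unfolding bar_differential_lift[OF mlin_ext] by (rule lift_cong) (rule ldiff_ext)

lemma proj_lmult:
 assumes "s \<in> carrier GG" "t \<in> carrier GG" "a \<in> dA s" "y \<in> carrier A"
 shows "D.proj (s \<otimes>\<^sub>GG t) (a \<otimes>\<^sub>A y) = a \<otimes>\<^sub>A D.proj t y"
proof -
 have a: "a \<in> carrier A" and st: "s \<otimes>\<^sub>GG t \<in> carrier GG" using assms D.W_carrier T.Gr.m_closed by auto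
 define g where "g y = D.proj (s \<otimes>\<^sub>GG t) (a \<otimes>\<^sub>A y) \<ominus>\<^sub>A a \<otimes>\<^sub>A D.proj t y" for y
 have "g y = \<zero>\<^sub>A"
 proof (rule D.additive_vanish[where g = g])
  show "g (x \<oplus>\<^sub>A y) = g x \<oplus>\<^sub>A g y" if "x \<in> carrier A" "y \<in> carrier A" for x y
  proof -
   have "D.proj (s \<otimes>\<^sub>GG t) (a \<otimes>\<^sub>A x) \<in> carrier A" "D.proj (s \<otimes>\<^sub>GG t) (a \<otimes>\<^sub>A y) \<in> carrier A"
    "a \<otimes>\<^sub>A D.proj t x \<in> carrier A" "a \<otimes>\<^sub>A D.proj t y \<in> carrier A" using that a st assms by auto
   moreover have "g (x \<oplus>\<^sub>A y) = (D.proj (s \<otimes>\<^sub>GG t) (a \<otimes>\<^sub>A x) \<oplus>\<^sub>A D.proj (s \<otimes>\<^sub>GG t) (a \<otimes>\<^sub>A y)) \<ominus>\<^sub>A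
     (a \<otimes>\<^sub>A D.proj t x \<oplus>\<^sub>A a \<otimes>\<^sub>A D.proj t y)"
    using that a st assms by (simp add: g_def D.proj_add A.r_distr)
   ultimately show ?thesis unfolding g_def by (simp only:) algebra
  qed
  show "g \<zero>\<^sub>A = \<zero>\<^sub>A" using a st assms by (simp add: g_def a_minus_def)
  fix u x assume u: "u \<in> carrier GG" "x \<in> dA u"
  then have "a \<otimes>\<^sub>A x \<in> dA (s \<otimes>\<^sub>GG u)" "x \<in> carrier A" using assms D.W_carrier by (auto intro: dA_mult)
  then show "g x = \<zero>\<^sub>A"
   using a D.proj_hom[of "s \<otimes>\<^sub>GG u" "a \<otimes>\<^sub>A x" "s \<otimes>\<^sub>GG t"] D.proj_hom[OF u assms(2)] st assms u
   by (simp add: g_def a_minus_def A.r_neg)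
 qed (rule assms)
 then show ?thesis using a st assms by (simp add: g_def)
qed

lemma T_weight: "ka \<in> carrier GG ==> T.weight (\<lambda>_. ka)"
 using aug_degree by (auto simp: T.weight_def)

definition degree_part :: "'t => 't => (('t \<times> 'a) list => nat => 'a) => ('t \<times> 'a) list => nat => 'a" where
 "degree_part l ka ph as x = D.proj (l \<otimes>\<^sub>GG (T.tot as \<otimes>\<^sub>GG ka)) (ph as x)"

lemma inner_degree_part:
 "as \<in> T.words (Suc n) ==> T.vals n ph ==> x \<in> {0} ==> l \<in> carrier GG ==> ka \<in> carrier GG ==>
  T.bar_inner (degree_part l ka ph) as x = D.proj (l \<otimes>\<^sub>GG (T.tot as \<otimes>\<^sub>GG ka)) (T.bar_inner ph as x)"
proof (induction n arbitrary: as ph l)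
 case 0
 then obtain t a where p: "as = [(t, a)]" "t \<in> carrier GG" "a \<in> dA t" by (auto simp: T.words_Suc)
 have c: "ph [] x \<in> carrier A" "a \<in> carrier A" using 0 p D.W_carrier by (auto intro: T.vals_D)
 show ?case
 proof (cases "aug a = \<zero>\<^sub>K")
  case True
  then show ?thesis using p c 0 by (simp add: degree_part_def V.smult_l_null)
 next
  case False
  then have "t = \<one>\<^sub>GG" using aug_degree p by blast
  then show ?thesis using p c 0 by (simp add: degree_part_def D.proj_smult)
 qed
next
 case (Suc n)
 then obtain p q bs where as: "as = p # q # bs" "T.hom_el p" "T.hom_el q" "bs \<in> T.words n" by (auto simp: T.words_Suc)
 have t: "fst p \<in> carrier GG" "fst q \<in> carrier GG" "T.tot bs \<in> carrier GG"
  using as by (auto intro: T.hom_elD T.tot_closed simp del: T.hom_el_pair)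
 have v: "T.vals n (T.shift p ph)" using Suc.prems as by (auto intro: T.vals_shift)
 have "T.agree n (T.shift p (degree_part l ka ph)) (degree_part (l \<otimes>\<^sub>GG fst p) ka (T.shift p ph))"
  unfolding T.agree_def T.shift_def degree_part_def using Suc.prems t T.tot_closed by (simp add: T.Gr.m_assoc)
 then have "T.bar_inner (T.shift p (degree_part l ka ph)) (q # bs) x = T.bar_inner (degree_part (l \<otimes>\<^sub>GG fst p) ka (T.shift p ph)) (q # bs) x"
  using as Suc.prems by (intro T.bar_inner_cong[of _ n]) auto
 also have "\<dots> = D.proj (l \<otimes>\<^sub>GG fst p \<otimes>\<^sub>GG (T.tot (q # bs) \<otimes>\<^sub>GG ka)) (T.bar_inner (T.shift p ph) (q # bs) x)"
  using as Suc.prems v t by (intro Suc.IH) auto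
 finally have 1: "T.bar_inner (T.shift p (degree_part l ka ph)) (q # bs) x =
   D.proj (l \<otimes>\<^sub>GG (T.tot as \<otimes>\<^sub>GG ka)) (T.bar_inner (T.shift p ph) (q # bs) x)"
  using Suc.prems t by (simp add: as T.Gr.m_assoc)
 have 2: "degree_part l ka ph (T.pm p q # bs) x = D.proj (l \<otimes>\<^sub>GG (T.tot as \<otimes>\<^sub>GG ka)) (ph (T.pm p q # bs) x)"
  using Suc.prems t by (simp add: degree_part_def as T.pm_def T.Gr.m_assoc)
 have c: "ph (T.pm p q # bs) x \<in> carrier A" "T.bar_inner (T.shift p ph) (q # bs) x \<in> carrier A"
  using as Suc.prems v by (auto intro: T.vals_D T.bar_inner_closed)
 have k: "l \<otimes>\<^sub>GG (T.tot as \<otimes>\<^sub>GG ka) \<in> carrier GG" using Suc.prems t as by simp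
 show ?case using c D.proj_linear[OF c(2,1) _ k, of "\<ominus>\<^sub>K \<one>\<^sub>K"] k
  by (simp add: as(1) 1[unfolded as(1)] 2[unfolded as(1)] T.smult_minus_one a_minus_def A.a_comm del: T.tot_simps)
qed

lemma boundary_degree_part:
 assumes m: "T.multilin k ps" and e: "T.agree (Suc k) (T.bar_diff ps) ph" and h: "T.homog \<one>\<^sub>GG (\<lambda>_. ka) (Suc k) ph" and ka: "ka \<in> carrier GG"
 shows "\<exists>ps. T.cochain (\<lambda>_. ka) k ps \<and> T.agree (Suc k) (T.bar_diff ps) ph"
proof (intro exI conjI)
 let ?ps = "degree_part \<one>\<^sub>GG ka ps"
 have v: "T.vals k ps" using m by (rule T.multilin_vals)
 have tc: "\<one>\<^sub>GG \<otimes>\<^sub>GG (T.tot as \<otimes>\<^sub>GG ka) \<in> carrier GG" if "as \<in> T.words n" for as n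
  using T.tot_closed[OF that] ka by simp
 show "T.cochain (\<lambda>_. ka) k ?ps" unfolding T.cochain_def
 proof
  show "T.homog \<one>\<^sub>GG (\<lambda>_. ka) k ?ps" unfolding T.homog_def degree_part_def
   using tc T.vals_D[OF v] by (intro ballI D.proj_in)
  show "T.multilin k ?ps"
  proof (rule T.multilinI)
   show "T.vals k ?ps" unfolding T.vals_def degree_part_def using tc T.vals_D[OF v] by (intro ballI D.proj_closed)
   fix us vs i j t a b c x
   assume as: "us \<in> T.words i" "vs \<in> T.words j" "i + j + 1 = k" "t \<in> carrier GG" "a \<in> dA t" "b \<in> dA t" "c \<in> carrier K" "x \<in> {0::nat}"
   have w: "us @ (t, d) # vs \<in> T.words k" if "d \<in> dA t" for d using as that by (auto simp: T.words_def)
   have tt: "T.tot (us @ (t, d) # vs) = T.tot (us @ (t, a) # vs)" for d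
    by (induction us) (auto simp: T.tot_def)
   show "?ps (us @ (t, c \<odot>\<^sub>A a \<oplus>\<^sub>A b) # vs) x = c \<odot>\<^sub>A ?ps (us @ (t, a) # vs) x \<oplus>\<^sub>A ?ps (us @ (t, b) # vs) x"
    unfolding degree_part_def T.multilinD[OF m as] tt[of b] tt[of "c \<odot>\<^sub>A a \<oplus>\<^sub>A b"]
    using as tc[OF w] T.vals_D[OF v w] by (intro D.proj_linear) auto
  qed
 qed
 show "T.agree (Suc k) (T.bar_diff ?ps) ph" unfolding T.agree_def
 proof (intro ballI)
  fix as and x :: nat assume as: "as \<in> T.words (Suc k)" "x \<in> {0}"
  then obtain p bs where p: "as = p # bs" "T.hom_el p" "bs \<in> T.words k" by (auto simp: T.words_Suc)
  have g: "fst p \<in> carrier GG" "T.tot bs \<in> carrier GG" "snd p \<in> dA (fst p)" "snd p \<in> carrier A"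
   using p by (auto intro: T.hom_elD T.tot_closed simp del: T.hom_el_pair)
  let ?d = "\<one>\<^sub>GG \<otimes>\<^sub>GG (T.tot as \<otimes>\<^sub>GG ka)"
  have d: "?d \<in> carrier GG" using tc[OF as(1)] .
  have "snd p \<otimes>\<^sub>A ?ps bs x = D.proj ?d (snd p \<otimes>\<^sub>A ps bs x)"
   using proj_lmult[OF g(1) _ g(3) T.vals_D[OF v p(3) as(2)], of "T.tot bs \<otimes>\<^sub>GG ka"] g ka
   by (simp add: degree_part_def p T.Gr.m_assoc)
  moreover have "T.bar_inner ?ps as x = D.proj ?d (T.bar_inner ps as x)"
   using as v ka by (intro inner_degree_part) auto
  moreover have c: "snd p \<otimes>\<^sub>A ps bs x \<in> carrier A" "T.bar_inner ps as x \<in> carrier A"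
   using g p as v by (auto intro: T.vals_D T.bar_inner_closed)
  ultimately have "T.bar_diff ?ps as x = D.proj ?d (snd p \<otimes>\<^sub>A ps bs x \<ominus>\<^sub>A T.bar_inner ps as x)"
   using D.proj_linear[OF c(2,1) _ d, of "\<ominus>\<^sub>K \<one>\<^sub>K"] d
   by (simp add: T.bar_diff_def p(1) T.smult_minus_one a_minus_def A.a_comm del: T.tot_simps)
  also have "\<dots> = D.proj ?d (ph as x)" using T.agreeD[OF e as] by (simp add: T.bar_diff_def p(1))
  also have "\<dots> = ph as x" using D.proj_hom[OF d T.homogD[OF h as] d] by simp
  finally show "T.bar_diff ?ps as x = ph as x" .
 qed
qed

end


text \<open>Cochains that are homogeneous only for a coarser grading split into homogeneous parts for the finer
one, hence vanishing of the coarser Ext gives exactness at each finer degree.\<close>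
locale coarsened = graded_algebra K A Adeg GG dA
 for K :: "'k ring" and A :: "('k, 'a) module" and Adeg :: "nat => 'a set"
  and GG :: "('t, 's) monoid_scheme" and dA :: "'t => 'a set" +
 fixes GG' :: "('u, 'r) monoid_scheme" and dA' :: "'u => 'a set" and q :: "'t => 'u"
 assumes group': "group GG'" and q_closed: "!!t. t \<in> carrier GG ==> q t \<in> carrier GG'"
  and q_mult: "!!s t. s \<in> carrier GG ==> t \<in> carrier GG ==> q (s \<otimes>\<^sub>GG t) = q s \<otimes>\<^bsub>GG'\<^esub> q t"
  and sub': "!!u. u \<in> carrier GG' ==> VectorSpace.subspace K (dA' u) A"
  and dA_le: "!!t. t \<in> carrier GG ==> dA t \<subseteq> dA' (q t)"
  and proj_off: "!!u t a. u \<in> carrier GG' ==> a \<in> dA' u ==> t \<in> carrier GG ==> q t ~= u ==> D.proj t a = \<zero>\<^sub>A"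
begin

sublocale G': group GG' by (rule group')

lemma dA'_carrier: "u \<in> carrier GG' ==> x \<in> dA' u ==> x \<in> carrier A"
 and dA'_zero: "u \<in> carrier GG' ==> \<zero>\<^sub>A \<in> dA' u"
 and dA'_add: "u \<in> carrier GG' ==> x \<in> dA' u ==> y \<in> dA' u ==> x \<oplus>\<^sub>A y \<in> dA' u"
 and dA'_smult: "u \<in> carrier GG' ==> c \<in> carrier K ==> x \<in> dA' u ==> c \<odot>\<^sub>A x \<in> dA' u"
 using sub'[of u] by (auto simp: subspace_def submodule_def)

lemma dA'_finsum: "finite S ==> u \<in> carrier GG' ==> (!!s. s \<in> S ==> f s \<in> dA' u) ==> (\<Oplus>\<^sub>A s\<in>S. f s) \<in> dA' u"
proof (induction S rule: finite_induct)
 case (insert s S)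
 then show ?case using dA'_carrier by (subst A.finsum_insert) (auto intro!: dA'_add)
qed (auto intro: dA'_zero)

lemma q_one: "q \<one>\<^sub>GG = \<one>\<^bsub>GG'\<^esub>"
 using q_mult[of "\<one>\<^sub>GG" "\<one>\<^sub>GG"] q_closed[of "\<one>\<^sub>GG"] by (simp add: G'.l_cancel_one')

abbreviation "mdeg \<equiv> concentrated K \<one>\<^bsub>GG'\<^esub>"

lemma ext_degree:
 "list_all2 (\<lambda>u a. u \<in> carrier GG' \<and> a \<in> dA' u) us as ==> as \<in> lists n ==> T.vals n ph ==> d \<in> carrier GG' ==>
  (!!w. w \<in> T.words n ==> map (q \<circ> fst) w = us ==> ph w 0 \<in> dA' d) ==> ext ph as \<in> dA' d"
proof (induction n arbitrary: us as ph)
 case 0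
 then show ?case by auto
next
 case (Suc n)
 then obtain u us' a bs where as: "us = u # us'" "as = a # bs" "u \<in> carrier GG'" "a \<in> dA' u" "a \<in> carrier A" "bs \<in> lists n"
  "list_all2 (\<lambda>u a. u \<in> carrier GG' \<and> a \<in> dA' u) us' bs"
  by (auto simp: lists_Suc list_all2_Cons2)
 have "ext (T.shift (t, D.proj t a) ph) bs \<in> dA' d" if t: "t \<in> D.supp a" for t
 proof (rule Suc.IH[OF as(7,6)])
  have tG: "t \<in> carrier GG" using t D.supp_sub by blast
  have qt: "q t = u" using proj_off[OF as(3,4) tG] t by (auto simp: D.supp_def)
  have h: "T.hom_el (t, D.proj t a)" using tG as by (simp add: D.proj_in)
  show "T.vals n (T.shift (t, D.proj t a) ph)" using Suc.prems h by (intro T.vals_shift)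
  show "T.shift (t, D.proj t a) ph w 0 \<in> dA' d" if w: "w \<in> T.words n" "map (q \<circ> fst) w = us'" for w
   unfolding T.shift_def using w h qt as by (intro Suc.prems(5)) (auto simp del: T.hom_el_pair)
 qed (rule Suc.prems)
 then show ?case unfolding as ext.simps using D.supp_finite[OF as(5)] Suc.prems by (intro dA'_finsum) auto
qed

lemma q_tot: "w \<in> T.words n ==> x \<in> carrier GG' ==> foldr (\<otimes>\<^bsub>GG'\<^esub>) (map (q \<circ> fst) w) x = q (T.tot w) \<otimes>\<^bsub>GG'\<^esub> x"
proof (induction n arbitrary: w)
 case 0
 then show ?case by (simp add: q_one)
next
 case (Suc n)
 then obtain p v where w: "w = p # v" "T.hom_el p" "v \<in> T.words n" by (auto simp: T.words_Suc)
 then have "fst p \<in> carrier GG" "T.tot v \<in> carrier GG" by (auto intro: T.hom_elD T.tot_closed simp del: T.hom_el_pair)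
 then show ?case using Suc w by (simp add: q_mult q_closed G'.m_assoc)
qed

lemma lift_ext_homogeneous:
 assumes c: "T.cochain (\<lambda>_. ka) n ph" and ka: "ka \<in> carrier GG"
 shows "lift n (ext ph) \<in> homogeneous_cochains K A GG' dA' triv mdeg reg dA' n (q ka)"
 unfolding homogeneous_cochains_def
proof (intro CollectI conjI allI impI)
 have m: "T.multilin n ph" and hm: "T.homog \<one>\<^sub>GG (\<lambda>_. ka) n ph" using c by (auto simp: T.cochain_def)
 show "lift n (ext ph) \<in> bar_cochains K A triv reg n" using m by (intro lift_cochain mlin_ext)
 fix \<gamma>s as h m'
 assume a: "length as = n \<and> list_all2 (\<lambda>\<gamma> a. \<gamma> \<in> carrier GG' \<and> a \<in> dA' \<gamma>) \<gamma>s as \<and> h \<in> carrier GG' \<and> m' \<in> mdeg h"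
 have "set as \<subseteq> carrier A" using a dA'_carrier by (auto simp: list_all2_conv_all_nth set_conv_nth)
 then have as: "as \<in> lists n" using a by (simp add: lists_def)
 have m'K: "m' \<in> carrier K" using a by (auto simp: concentrated_def split: if_splits)
 have gc: "set \<gamma>s \<subseteq> carrier GG'" using a by (auto simp: list_all2_conv_all_nth set_conv_nth)
 have fc: "foldr (\<otimes>\<^bsub>GG'\<^esub>) \<gamma>s x \<in> carrier GG'" if "x \<in> carrier GG'" for x using gc that by (induction \<gamma>s) auto
 have d: "foldr (\<otimes>\<^bsub>GG'\<^esub>) \<gamma>s (h \<otimes>\<^bsub>GG'\<^esub> q ka) \<in> carrier GG'" using a q_closed[OF ka] by (intro fc) auto
 show "lift n (ext ph) (as, m') \<in> dA' (foldr (\<otimes>\<^bsub>GG'\<^esub>) \<gamma>s (h \<otimes>\<^bsub>GG'\<^esub> q ka))"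
 proof (cases "h = \<one>\<^bsub>GG'\<^esub>")
  case True
  have "ext ph as \<in> dA' (foldr (\<otimes>\<^bsub>GG'\<^esub>) \<gamma>s (h \<otimes>\<^bsub>GG'\<^esub> q ka))"
  proof (rule ext_degree[OF _ as T.multilin_vals[OF m] d])
   show "list_all2 (\<lambda>u a. u \<in> carrier GG' \<and> a \<in> dA' u) \<gamma>s as" using a by simp
   fix w assume w: "w \<in> T.words n" "map (q \<circ> fst) w = \<gamma>s"
   have t: "T.tot w \<in> carrier GG" using T.tot_closed[OF w(1)] .
   have "ph w 0 \<in> dA (\<one>\<^sub>GG \<otimes>\<^sub>GG (T.tot w \<otimes>\<^sub>GG ka))" using T.homogD[OF hm w(1), of 0] by simp
   then have "ph w 0 \<in> dA' (q (T.tot w \<otimes>\<^sub>GG ka))" using dA_le[of "T.tot w \<otimes>\<^sub>GG ka"] t ka by auto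
   moreover have "foldr (\<otimes>\<^bsub>GG'\<^esub>) \<gamma>s (h \<otimes>\<^bsub>GG'\<^esub> q ka) = q (T.tot w \<otimes>\<^sub>GG ka)"
    using q_tot[OF w(1) q_closed[OF ka]] w True t ka q_closed[OF ka] by (simp add: q_mult)
   ultimately show "ph w 0 \<in> dA' (foldr (\<otimes>\<^bsub>GG'\<^esub>) \<gamma>s (h \<otimes>\<^bsub>GG'\<^esub> q ka))" by simp
  qed
  then show ?thesis using as m'K d by (simp add: dA'_smult)
 next
  case False
  then have "m' = \<zero>\<^sub>K" using a by (simp add: concentrated_def)
  then show ?thesis using as d mlin_closed[OF mlin_ext[OF m] as] by (simp add: V.smult_l_null dA'_zero)
 qed
qed

definition Zsp :: "nat => 'u => ('a list \<times> 'k => 'a) set" where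
 "Zsp n k = {ph \<in> homogeneous_cochains K A GG' dA' triv mdeg reg dA' n k. bar_differential A triv reg n ph = zero_cochain A triv reg (Suc n)}"

definition Bsp :: "nat => 'u => ('a list \<times> 'k => 'a) set" where
 "Bsp n k = (case n of 0 => {zero_cochain A triv reg 0}
   | Suc i => bar_differential A triv reg i ` homogeneous_cochains K A GG' dA' triv mdeg reg dA' i k)"

abbreviation "ExtM n k \<equiv> graded_Ext K A GG' dA' triv mdeg reg dA' n k"

lemma Ext_eq: "ExtM n k = quotient (cochain_space A triv reg n (Zsp n k)) (Bsp n k)"
 by (simp add: graded_Ext_def Zsp_def Bsp_def Let_def)

lemma Ext_zero: "zero (ExtM n k) = Bsp n k" by (simp add: Ext_eq quotient_def)

definition cadd :: "nat => ('a list \<times> 'k => 'a) => ('a list \<times> 'k => 'a) => ('a list \<times> 'k => 'a)" where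
 "cadd n f g = (\<lambda>x\<in>bar_domain A triv n. f x \<oplus>\<^sub>reg g x)"

lemma Ext_carrier: "carrier (ExtM n k) = {(\<lambda>b. cadd n b z) ` Bsp n k | z. z \<in> Zsp n k}"
 by (auto simp: Ext_eq quotient_def A_RCOSETS_def RCOSETS_def r_coset_def cochain_space_def cadd_def[abs_def])

lemma zero_in_B: "u \<in> carrier GG ==> zero_cochain A triv reg n \<in> Bsp n (q u)"
proof (cases n)
 case (Suc i)
 assume u: "u \<in> carrier GG"
 have c: "T.cochain (\<lambda>_. u) i (\<lambda>_ _. \<zero>\<^sub>A)" using T.cochain_zero[OF T_weight[OF u]] .
 have "lift i (ext (\<lambda>_ _. \<zero>\<^sub>A)) = lift i (\<lambda>_. \<zero>\<^sub>A)" by (rule lift_cong) (simp add: ext_zero)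
 then have "lift i (\<lambda>_. \<zero>\<^sub>A) \<in> homogeneous_cochains K A GG' dA' triv mdeg reg dA' i (q u)"
  using lift_ext_homogeneous[OF c u] by simp
 moreover have "bar_differential A triv reg i (lift i (\<lambda>_. \<zero>\<^sub>A)) = zero_cochain A triv reg n"
  unfolding bar_differential_lift[OF mlin_zero] zero_cochain_lift Suc by (rule lift_cong) (rule ldiff_zero)
 ultimately show ?thesis unfolding Bsp_def Suc by (simp add: image_iff) metis
qed (simp add: Bsp_def)

text \<open>A cocycle given on homogeneous words extends multilinearly to a cocycle of the module bar complex; a cochain that
bounds there is replaced by its part of the right degree.\<close>
theorem acyclic_of_Ext:
 assumes Ext: "carrier (ExtM n (q ka)) = {zero (ExtM n (q ka))}" and ka: "ka \<in> carrier GG"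
 shows "T.acyclic (\<lambda>_. ka) n"
 unfolding T.acyclic_def
proof (intro allI impI)
 fix ph assume coc: "T.cocycle (\<lambda>_. ka) n ph"
 then have c: "T.cochain (\<lambda>_. ka) n ph" and m: "T.multilin n ph" and hm: "T.homog \<one>\<^sub>GG (\<lambda>_. ka) n ph"
  and z: "T.agree (Suc n) (T.bar_diff ph) (\<lambda>_ _. \<zero>\<^sub>A)"
  by (auto simp: T.cocycle_def T.cochain_def)
 let ?L = "lift n (ext ph)"
 have "bar_differential A triv reg n ?L = zero_cochain A triv reg (Suc n)"
  unfolding lift_diff_ext[OF m] zero_cochain_lift
  by (rule lift_cong) (use ext_cong[OF _ z] ext_zero in \<open>simp add: T.vals_def\<close>)
 then have "?L \<in> Zsp n (q ka)" using lift_ext_homogeneous[OF c ka] by (simp add: Zsp_def)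
 then have "(\<lambda>b. cadd n b ?L) ` Bsp n (q ka) \<in> carrier (ExtM n (q ka))" unfolding Ext_carrier
  by (intro CollectI exI[of _ ?L] conjI refl)
 then have "(\<lambda>b. cadd n b ?L) ` Bsp n (q ka) = Bsp n (q ka)" unfolding Ext Ext_zero by (rule singletonD)
 then have "cadd n (zero_cochain A triv reg n) ?L \<in> Bsp n (q ka)" using zero_in_B[OF ka, of n] by blast
 moreover have "cadd n (zero_cochain A triv reg n) ?L = ?L"
  unfolding zero_cochain_lift cadd_def lift_add[OF mlin_zero mlin_ext[OF m]]
  using mlin_closed[OF mlin_ext[OF m]] by (intro lift_cong) simp
 ultimately have B: "?L \<in> Bsp n (q ka)" by simp
 show "T.boundary (\<lambda>_. ka) n ph"
 proof (cases n)
  case 0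
  have "?L = lift 0 (\<lambda>_. \<zero>\<^sub>A)" using B unfolding Bsp_def 0 zero_cochain_lift by simp
  then have "?L ([], \<one>\<^sub>K) = lift 0 (\<lambda>_. \<zero>\<^sub>A) ([], \<one>\<^sub>K)" by (rule fun_cong)
  moreover have "ph [] 0 \<in> carrier A" using T.vals_D[OF T.multilin_vals[OF m], of "[]" 0] 0 by simp
  ultimately have "ph [] 0 = \<zero>\<^sub>A" using 0 by (simp add: V.smult_r_null)
  then show ?thesis using 0 by (simp add: T.boundary_def T.agree_def)
 next
  case (Suc k)
  then obtain \<Psi> where \<Psi>: "\<Psi> \<in> bar_cochains K A triv reg k" "?L = bar_differential A triv reg k \<Psi>"
   using B by (auto simp: Bsp_def homogeneous_cochains_def)
  let ?G = "\<lambda>as. \<Psi> (as, \<one>\<^sub>K)"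
  have G: "mlin k ?G" by (rule cochain_mlin[OF \<Psi>(1)]) simp
  have "?L = bar_differential A triv reg k (lift k ?G)" unfolding cochain_lift[OF \<Psi>(1), symmetric] by (rule \<Psi>(2))
  then have L: "?L = lift (Suc k) (ldiff ?G)" unfolding bar_differential_lift[OF G] .
  have "T.agree (Suc k) (T.bar_diff (\<lambda>w _. ?G (map snd w))) ph" unfolding T.agree_def
  proof (intro ballI)
   fix w and x :: nat assume w: "w \<in> T.words (Suc k)" "x \<in> {0}"
   have l: "map snd w \<in> lists (Suc k)" using T_words_lists[OF w(1)] .
   have ln: "map snd w \<in> lists n" using l unfolding Suc .
   have "\<one>\<^sub>K \<odot>\<^sub>A ext ph (map snd w) = \<one>\<^sub>K \<odot>\<^sub>A ldiff ?G (map snd w)"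
    using fun_cong[OF L, of "(map snd w, \<one>\<^sub>K)"] unfolding lift_apply[OF l one_closed] lift_apply[OF ln one_closed] .
   then have e: "ext ph (map snd w) = ldiff ?G (map snd w)"
    using mlin_closed[OF mlin_ext[OF m] ln] mlin_closed[OF mlin_ldiff[OF G] l] V.smult_one by metis
   have "w ~= []" using T.words_length[OF w(1)] by auto
   then have "T.bar_diff (\<lambda>w _. ?G (map snd w)) w x = ldiff ?G (map snd w)" by (rule T_diff)
   also have "\<dots> = ph w 0" unfolding e[symmetric] using w(1) unfolding Suc[symmetric] by (rule ext_hom[OF _ m])
   also have "ph w 0 = ph w x" using w(2) by simp
   finally show "T.bar_diff (\<lambda>w _. ?G (map snd w)) w x = ph w x" .
  qed
  from boundary_degree_part[OF T_of_mlin[OF G] this hm[unfolded Suc] ka] show ?thesis unfolding T.boundary_def Suc nat.case .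
 qed
qed

end

context graded_algebra begin

lemma coarsened_id: "coarsened K A Adeg GG dA GG dA id"
proof (rule coarsened.intro)
 show "graded_algebra K A Adeg GG dA" by (rule graded_algebra_axioms)
 show "coarsened_axioms K A GG dA GG dA id"
  by (rule coarsened_axioms.intro) (auto simp: group_GG D.W_sub D.proj_hom)
qed

theorem Ext_of_acyclic:
 assumes ac: "T.acyclic (\<lambda>_. ka) n" and ka: "ka \<in> carrier GG"
 shows "carrier (graded_Ext K A GG dA triv (concentrated K \<one>\<^sub>GG) reg dA n ka) \<subseteq>
   {zero (graded_Ext K A GG dA triv (concentrated K \<one>\<^sub>GG) reg dA n ka)}"
proof -
 interpret I: coarsened K A Adeg GG dA GG dA id by (rule coarsened_id)
 define res where "res \<Phi> = (\<lambda>(w :: ('t \<times> 'a) list) (_::nat). \<Phi> (map snd w, \<one>\<^sub>K) :: 'a)" for \<Phi> :: "'a list \<times> 'k => 'a"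
 have res: "T.cochain (\<lambda>_. ka) i (res \<Phi>)" "\<Phi> = lift i (ext (res \<Phi>))"
  if h: "\<Phi> \<in> homogeneous_cochains K A GG dA triv I.mdeg reg dA i ka" for i \<Phi>
 proof -
  have b: "\<Phi> \<in> bar_cochains K A triv reg i" and H: "\<forall>\<gamma>s as h m. length as = i \<and>
    list_all2 (\<lambda>\<gamma> a. \<gamma> \<in> carrier GG \<and> a \<in> dA \<gamma>) \<gamma>s as \<and> h \<in> carrier GG \<and> m \<in> I.mdeg h -->
    \<Phi> (as, m) \<in> dA (foldr (\<otimes>\<^sub>GG) \<gamma>s (h \<otimes>\<^sub>GG ka))"
   using h unfolding homogeneous_cochains_def by simp_all
  have m: "mlin i (\<lambda>as. \<Phi> (as, \<one>\<^sub>K))" by (rule cochain_mlin[OF b]) simp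
  have Tm: "T.multilin i (res \<Phi>)" unfolding res_def by (rule T_of_mlin[OF m])
  have "T.homog \<one>\<^sub>GG (\<lambda>_. ka) i (res \<Phi>)" unfolding T.homog_def
  proof (intro ballI)
   fix w and x :: nat assume w: "w \<in> T.words i" "x \<in> {0}"
   have "length (map snd w) = i \<and> list_all2 (\<lambda>\<gamma> a. \<gamma> \<in> carrier GG \<and> a \<in> dA \<gamma>) (map fst w) (map snd w)"
    using w by (auto simp: T.words_def list_all2_conv_all_nth T.hom_el_def)
   moreover have "\<one>\<^sub>K \<in> I.mdeg \<one>\<^sub>GG" by (simp add: concentrated_def)
   ultimately have "\<Phi> (map snd w, \<one>\<^sub>K) \<in> dA (foldr (\<otimes>\<^sub>GG) (map fst w) (\<one>\<^sub>GG \<otimes>\<^sub>GG ka))"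
    by (intro H[rule_format] conjI T.Gr.one_closed) (elim conjE, assumption)+
   then show "res \<Phi> w x \<in> dA (\<one>\<^sub>GG \<otimes>\<^sub>GG (T.tot w \<otimes>\<^sub>GG ka))"
    using I.q_tot[OF w(1) ka] ka T.tot_closed[OF w(1)] by (simp add: res_def)
  qed
  then show "T.cochain (\<lambda>_. ka) i (res \<Phi>)" using Tm by (simp add: T.cochain_def)
  have "ext (res \<Phi>) as = \<Phi> (as, \<one>\<^sub>K)" if "as \<in> lists i" for as
  proof (rule mlin_eqI[OF mlin_ext[OF Tm] m _ that])
   fix w assume "w \<in> T.words i"
   then have "ext (res \<Phi>) (map snd w) = res \<Phi> w 0" by (rule ext_hom[OF _ Tm])
   then show "ext (res \<Phi>) (map snd w) = \<Phi> (map snd w, \<one>\<^sub>K)" by (simp add: res_def)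
  qed
  then have "lift i (\<lambda>as. \<Phi> (as, \<one>\<^sub>K)) = lift i (ext (res \<Phi>))" by (intro lift_cong) simp
  with cochain_lift[OF b] show "\<Phi> = lift i (ext (res \<Phi>))" by (rule trans)
 qed
 have lift_hom: "lift i (ext ps) \<in> homogeneous_cochains K A GG dA triv I.mdeg reg dA i ka" if "T.cochain (\<lambda>_. ka) i ps" for i ps
  using I.lift_ext_homogeneous[OF that ka] by simp
 have "(\<lambda>b. I.cadd n b z) ` I.Bsp n ka = I.Bsp n ka" if z: "z \<in> I.Zsp n ka" for z
 proof -
  have zh: "z \<in> homogeneous_cochains K A GG dA triv I.mdeg reg dA n ka"
   and dz: "bar_differential A triv reg n z = zero_cochain A triv reg (Suc n)"
   using z by (simp_all add: I.Zsp_def)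
  note zc = res[OF zh]
  have zm: "T.multilin n (res z)" using zc(1) by (simp add: T.cochain_def)
  have "T.agree (Suc n) (T.bar_diff (res z)) (\<lambda>_ _. \<zero>\<^sub>A)" unfolding T.agree_def
  proof (intro ballI)
   fix w and x :: nat assume w: "w \<in> T.words (Suc n)" "x \<in> {0}"
   have "bar_differential A triv reg n (lift n (ext (res z))) = zero_cochain A triv reg (Suc n)"
    using dz unfolding zc(2)[symmetric] .
   then have "lift (Suc n) (ext (T.bar_diff (res z))) = lift (Suc n) (\<lambda>_. \<zero>\<^sub>A)"
    unfolding lift_diff_ext[OF zm] zero_cochain_lift .
   from fun_cong[OF this, of "(map snd w, \<one>\<^sub>K)"]
   show "T.bar_diff (res z) w x = \<zero>\<^sub>A"
    using ext_hom[OF w(1) T.multilin_diff[OF zm]] T_words_lists[OF w(1)] w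
     T.vals_D[OF T.multilin_vals[OF T.multilin_diff[OF zm]] w] by (simp add: V.smult_r_null)
  qed
  then have bd: "T.boundary (\<lambda>_. ka) n (res z)" using ac zc(1) by (simp add: T.acyclic_def T.cocycle_def)
  show ?thesis
  proof (cases n)
   case 0
   then have "ext (res z) as = \<zero>\<^sub>A" if "as \<in> lists 0" for as using bd that by (simp add: T.boundary_def T.agree_def)
   then have "lift n (ext (res z)) = lift n (\<lambda>_. \<zero>\<^sub>A)" using 0 by (intro lift_cong) simp
   with zc(2) have "z = lift n (\<lambda>_. \<zero>\<^sub>A)" by (rule trans)
   then show ?thesis using lift_add[OF mlin_zero mlin_zero, of 0] 0 by (simp add: I.Bsp_def zero_cochain_lift I.cadd_def)
  next
   case (Suc k)
   then obtain ps where ps: "T.cochain (\<lambda>_. ka) k ps" "T.agree (Suc k) (T.bar_diff ps) (res z)" using bd by (auto simp: T.boundary_def)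
   have psm: "T.multilin k ps" using ps by (simp add: T.cochain_def)
   define L where "L \<chi> = lift n (ext (T.bar_diff \<chi>))" for \<chi>
   have "lift n (ext (res z)) = L ps" unfolding L_def
   proof (rule lift_cong)
    fix as assume "as \<in> lists n"
    then have "ext (T.bar_diff ps) as = ext (res z) as"
     using Suc zm ps(2) by (intro ext_cong[of _ n] T.multilin_vals) simp_all
    then show "ext (res z) as = ext (T.bar_diff ps) as" ..
   qed
   with zc(2) have zL: "z = L ps" by (rule trans)
   have B: "I.Bsp n ka = {L \<chi> | \<chi>. T.cochain (\<lambda>_. ka) k \<chi>}"
   proof (intro equalityI subsetI)
    fix b assume "b \<in> I.Bsp n ka"
    then obtain \<Psi> where P: "\<Psi> \<in> homogeneous_cochains K A GG dA triv I.mdeg reg dA k ka" "b = bar_differential A triv reg k \<Psi>"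
     by (auto simp: I.Bsp_def Suc)
    note r = res[OF P(1)]
    have "b = bar_differential A triv reg k (lift k (ext (res \<Psi>)))" unfolding r(2)[symmetric] by (rule P(2))
    then have "b = L (res \<Psi>)" unfolding L_def Suc using r(1) lift_diff_ext[of k "res \<Psi>"] by (simp add: T.cochain_def)
    then show "b \<in> {L \<chi> | \<chi>. T.cochain (\<lambda>_. ka) k \<chi>}" using r(1) by blast
   next
    fix b assume "b \<in> {L \<chi> | \<chi>. T.cochain (\<lambda>_. ka) k \<chi>}"
    then obtain \<chi> where X: "b = L \<chi>" "T.cochain (\<lambda>_. ka) k \<chi>" by blast
    have "T.multilin k \<chi>" using X(2) by (simp add: T.cochain_def)
    then have "b = bar_differential A triv reg k (lift k (ext \<chi>))" unfolding X(1) L_def Suc by (rule lift_diff_ext[symmetric])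
    then show "b \<in> I.Bsp n ka" unfolding I.Bsp_def Suc nat.case using lift_hom[OF X(2)] by (rule image_eqI)
   qed
   have add: "I.cadd n (L \<chi>) (L ps) = L (T.comb \<one>\<^sub>K \<chi> ps)" if X: "T.cochain (\<lambda>_. ka) k \<chi>" for \<chi>
   proof -
    have Xm: "T.multilin k \<chi>" using X by (simp add: T.cochain_def)
    have v: "T.vals n (T.bar_diff \<chi>)" "T.vals n (T.bar_diff ps)" unfolding Suc by (rule T.multilin_vals[OF T.multilin_diff[OF Xm]] T.multilin_vals[OF T.multilin_diff[OF psm]])+
    have "I.cadd n (L \<chi>) (L ps) = lift n (\<lambda>as. ext (T.bar_diff \<chi>) as \<oplus>\<^sub>A ext (T.bar_diff ps) as)"
     unfolding I.cadd_def L_def Suc by (rule lift_add[OF mlin_ext[OF T.multilin_diff[OF Xm]] mlin_ext[OF T.multilin_diff[OF psm]]])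
    also have "\<dots> = L (T.comb \<one>\<^sub>K \<chi> ps)" unfolding L_def
    proof (rule lift_cong)
     fix as assume as: "as \<in> lists n"
     have "ext (T.bar_diff (T.comb \<one>\<^sub>K \<chi> ps)) as = ext (T.comb \<one>\<^sub>K (T.bar_diff \<chi>) (T.bar_diff ps)) as"
     proof (rule ext_cong[OF as])
      show "T.agree n (T.bar_diff (T.comb \<one>\<^sub>K \<chi> ps)) (T.comb \<one>\<^sub>K (T.bar_diff \<chi>) (T.bar_diff ps))"
       unfolding Suc by (rule T.bar_diff_comb[OF T.multilin_vals[OF Xm] T.multilin_vals[OF psm] one_closed])
     qed (rule T.vals_comb[OF v one_closed])
     then show "ext (T.bar_diff \<chi>) as \<oplus>\<^sub>A ext (T.bar_diff ps) as = ext (T.bar_diff (T.comb \<one>\<^sub>K \<chi> ps)) as"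
      using ext_comb[OF as v] ext_closed[OF as] v by simp
    qed
    finally show ?thesis .
   qed
   have w: "T.weight (\<lambda>_. ka)" using ka by (rule T_weight)
   show ?thesis unfolding B zL
   proof (intro equalityI subsetI)
    fix b assume "b \<in> (\<lambda>b. I.cadd n b (L ps)) ` {L \<chi> | \<chi>. T.cochain (\<lambda>_. ka) k \<chi>}"
    then show "b \<in> {L \<chi> | \<chi>. T.cochain (\<lambda>_. ka) k \<chi>}" using add T.cochain_comb[OF _ ps(1) w] by auto
   next
    fix b assume "b \<in> {L \<chi> | \<chi>. T.cochain (\<lambda>_. ka) k \<chi>}"
    then obtain \<chi> where X: "b = L \<chi>" "T.cochain (\<lambda>_. ka) k \<chi>" by blast
    have s: "T.cochain (\<lambda>_. ka) k (T.sub \<chi> ps)" using X ps w by (intro T.cochain_sub)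
    have "L (T.comb \<one>\<^sub>K (T.sub \<chi> ps) ps) = L \<chi>" unfolding L_def
    proof (rule lift_cong, rule ext_cong)
     have "T.agree k (T.comb \<one>\<^sub>K (T.sub \<chi> ps) ps) \<chi>" unfolding T.agree_def
      using T.cochain_vals[OF X(2)] T.cochain_vals[OF ps(1)]
      by (auto simp: T.comb_def T.sub_apply T.vals_D a_minus_def A.a_assoc A.l_neg)
     from T.bar_diff_cong[OF this] show "T.agree n (T.bar_diff (T.comb \<one>\<^sub>K (T.sub \<chi> ps) ps)) (T.bar_diff \<chi>)" by (simp add: Suc)
     show "T.vals n (T.bar_diff \<chi>)" unfolding Suc by (rule T.vals_diff[OF T.cochain_vals[OF X(2)]])
    qed
    then show "b \<in> (\<lambda>b. I.cadd n b (L ps)) ` {L \<chi> | \<chi>. T.cochain (\<lambda>_. ka) k \<chi>}" using add[OF s] s X by force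
   qed
  qed
 qed
 then show ?thesis using I.Ext_carrier[of n ka] I.Ext_zero[of n ka] by auto
qed

end

section \<open>Gradings\<close>

context
 fixes K :: "'k ring" and V :: "('k, 'v) module"
 assumes vs: "vectorspace K V"
begin

interpretation vectorspace K V by (rule vs)

text \<open>Criterion for a direct sum in terms of candidate projections; it avoids the choice of decompositions.\<close>
lemma ids_of_projections:
 assumes sub: "!!i. i \<in> I ==> VectorSpace.subspace K (W i) V"
  and p_in: "!!i v. i \<in> I ==> v \<in> carrier V ==> p i v \<in> W i"
  and p_add: "!!i u v. i \<in> I ==> u \<in> carrier V ==> v \<in> carrier V ==> p i (u \<oplus>\<^sub>V v) = p i u \<oplus>\<^sub>V p i v"
  and p_hom: "!!i j x. i \<in> I ==> j \<in> I ==> x \<in> W i ==> p j x = (if j = i then x else \<zero>\<^sub>V)"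
  and fin: "!!v. v \<in> carrier V ==> finite {i \<in> I. p i v ~= \<zero>\<^sub>V}"
  and sep: "!!v. v \<in> carrier V ==> (!!i. i \<in> I ==> p i v = \<zero>\<^sub>V) ==> v = \<zero>\<^sub>V"
 shows "internal_direct_sum K V I W" and "!!i v. i \<in> I ==> v \<in> carrier V ==> component V I W v i = p i v"
proof -
 have Wc: "x \<in> carrier V" if "i \<in> I" "x \<in> W i" for i x using sub[OF that(1)] that(2) by (auto simp: subspace_def submodule_def)
 have W0: "\<zero>\<^sub>V \<in> W i" if "i \<in> I" for i using sub[OF that] by (auto simp: subspace_def submodule_def)
 have p0: "p j \<zero>\<^sub>V = \<zero>\<^sub>V" if "j \<in> I" for j using p_hom[OF that that W0[OF that]] by simp
 have pc: "p i v \<in> carrier V" if "i \<in> I" "v \<in> carrier V" for i v using Wc[OF that(1) p_in[OF that]] .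
 have psum: "p j (\<Oplus>\<^sub>V i\<in>S. a i) = (if j \<in> S then a j else \<zero>\<^sub>V)"
  if "finite S" "S \<subseteq> I" "!!i. i \<in> S ==> a i \<in> W i" "j \<in> I" for S a j
  using that
 proof (induction S)
  case empty
  then show ?case by (simp add: p0)
 next
  case (insert i S)
  have c: "a i \<in> carrier V" "(\<lambda>i. a i) \<in> S \<rightarrow> carrier V" using insert Wc by auto
  have IH: "p j (\<Oplus>\<^sub>V i\<in>S. a i) = (if j \<in> S then a j else \<zero>\<^sub>V)" using insert by auto
  have i: "p j (a i) = (if j = i then a i else \<zero>\<^sub>V)" using insert by (intro p_hom) auto
  have "p j (\<Oplus>\<^sub>V i\<in>insert i S. a i) = p j (a i) \<oplus>\<^sub>V p j (\<Oplus>\<^sub>V i\<in>S. a i)"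
   using insert.hyps \<open>j \<in> I\<close> c by (simp add: M.finsum_insert p_add M.finsum_closed)
  moreover have "a j \<in> carrier V" if "j \<in> S" using c(2) that by auto
  ultimately show ?case using IH i c(1) insert.hyps(2) by (cases "j = i"; cases "j \<in> S") auto
 qed
 have dec: "decomposes V I W v (\<lambda>i\<in>I. p i v)" if v: "v \<in> carrier V" for v
 proof -
  let ?S = "{i \<in> I. p i v ~= \<zero>\<^sub>V}"
  have S: "{i \<in> I. (\<lambda>i\<in>I. p i v) i ~= \<zero>\<^sub>V} = ?S" by auto
  let ?s = "\<Oplus>\<^sub>V i\<in>?S. p i v"
  have sc: "?s \<in> carrier V" using pc v by (intro M.finsum_closed) auto
  let ?d = "v \<oplus>\<^sub>V \<ominus>\<^sub>V ?s"
  have dc: "?d \<in> carrier V" using v sc by simp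
  have "p j ?d = \<zero>\<^sub>V" if j: "j \<in> I" for j
  proof -
   have "p j ?s = (if j \<in> ?S then p j v else \<zero>\<^sub>V)" using p_in v j by (intro psum[OF fin[OF v]]) auto
   then have s: "p j ?s = p j v" using j by (simp split: if_splits)
   have "?d \<oplus>\<^sub>V ?s = v" using v sc by (simp add: M.a_assoc M.l_neg)
   then have "p j ?d \<oplus>\<^sub>V p j v = p j v" using p_add[OF j dc sc] s by simp
   then have "(p j ?d \<oplus>\<^sub>V p j v) \<oplus>\<^sub>V \<ominus>\<^sub>V p j v = \<zero>\<^sub>V" using pc[OF j v] by (simp add: M.r_neg)
   then show ?thesis using pc[OF j v] pc[OF j dc] by (simp add: M.a_assoc M.r_neg)
  qed
  then have d0: "?d = \<zero>\<^sub>V" by (rule sep[OF dc])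
  have "?d \<oplus>\<^sub>V ?s = v" using v sc by (simp add: M.a_assoc M.l_neg)
  then have "v = ?s" using sc unfolding d0 by simp
  moreover have "(\<Oplus>\<^sub>V i\<in>?S. (\<lambda>i\<in>I. p i v) i) = ?s" using pc v by (intro M.finsum_cong') auto
  ultimately have "v = (\<Oplus>\<^sub>V i\<in>?S. (\<lambda>i\<in>I. p i v) i)" by (rule trans[OF _ sym])
  moreover have "(\<lambda>i\<in>I. p i v) \<in> (\<Pi>\<^sub>E i\<in>I. W i)" using p_in[OF _ v] by (rule restrict_PiE_iff[THEN iffD2, OF ballI])
  ultimately show ?thesis unfolding decomposes_def S using fin[OF v] by (intro conjI)
 qed
 have uni: "a = (\<lambda>i\<in>I. p i v)" if "v \<in> carrier V" and d: "decomposes V I W v a" for v a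
 proof
  fix i
  show "a i = (\<lambda>i\<in>I. p i v) i"
  proof (cases "i \<in> I")
   case True
   let ?S = "{i \<in> I. a i ~= \<zero>\<^sub>V}"
   have s: "v = (\<Oplus>\<^sub>V i\<in>?S. a i)" "finite ?S" "!!i. i \<in> ?S ==> a i \<in> W i" using d by (auto simp: decomposes_def)
   have "p i (\<Oplus>\<^sub>V i\<in>?S. a i) = (if i \<in> ?S then a i else \<zero>\<^sub>V)" using s True by (intro psum) auto
   then have "p i v = (if i \<in> ?S then a i else \<zero>\<^sub>V)" unfolding s(1)[symmetric] .
   then show ?thesis using True by (auto split: if_splits)
  next
   case False
   then show ?thesis using d by (auto simp: decomposes_def PiE_def extensional_def)
  qed
 qed
 have ex1: "\<exists>!a. decomposes V I W v a" if "v \<in> carrier V" for v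
  using dec[OF that] uni[OF that] by (rule ex1I)
 then show "internal_direct_sum K V I W" using sub by (simp add: internal_direct_sum_def)
 show "component V I W v i = p i v" if "i \<in> I" "v \<in> carrier V" for i v
 proof -
  have "component V I W v = (\<lambda>i\<in>I. p i v)" unfolding component_def
   using dec[OF that(2)] uni[OF that(2)] by (rule the_equality)
  then show ?thesis using that(1) by simp
 qed
qed

lemma subspace_vectorspace:
 assumes "VectorSpace.subspace K W V" shows "vectorspace K (V\<lparr>carrier := W\<rparr>)"
 using assms by (rule subspace_is_vs)

lemma finsum_subspace:
 assumes W: "VectorSpace.subspace K W V" and S: "finite S" "!!i. i \<in> S ==> a i \<in> W"
 shows "finsum (V\<lparr>carrier := W\<rparr>) a S = finsum V a S" "finsum V a S \<in> W"
proof -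
 interpret W: vectorspace K "V\<lparr>carrier := W\<rparr>" by (rule subspace_vectorspace[OF W])
 have sub: "W \<subseteq> carrier V" "\<zero>\<^sub>V \<in> W" "!!x y. x \<in> W ==> y \<in> W ==> x \<oplus>\<^sub>V y \<in> W"
  using W by (auto simp: subspace_def submodule_def)
 have "finsum (V\<lparr>carrier := W\<rparr>) a S = finsum V a S \<and> finsum V a S \<in> W" using S
 proof (induction S rule: finite_induct)
  case (insert i S)
  have "finsum (V\<lparr>carrier := W\<rparr>) a (insert i S) = a i \<oplus>\<^sub>V finsum (V\<lparr>carrier := W\<rparr>) a S"
   using W.M.finsum_insert[of S i a] insert by auto
  moreover have "finsum V a (insert i S) = a i \<oplus>\<^sub>V finsum V a S"
   using insert sub by (intro M.finsum_insert) auto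
  ultimately show ?case using insert sub by auto
 qed (use W.M.finsum_empty sub in auto)
 then show "finsum (V\<lparr>carrier := W\<rparr>) a S = finsum V a S" "finsum V a S \<in> W" by auto
qed

end

locale connected_graded_algebra =
 fixes K :: "'k ring" and A :: "('k, 'a) module" and Adeg :: "nat => 'a set"
 assumes fK: "field K" and cg: "connected_graded K A Adeg"
begin

sublocale field K by (rule fK)
sublocale A: ring A using cg by (simp add: k_algebra_def connected_graded_def)
sublocale V: vectorspace K A using cg by (simp add: k_algebra_def connected_graded_def)
sublocale N: direct_sum K A UNIV Adeg
 using V.vectorspace_axioms cg by (intro direct_sum.intro direct_sum_axioms.intro) (simp_all add: connected_graded_def)

abbreviation "iA \<equiv> int_grading A Adeg"
abbreviation "aug \<equiv> augmentation K A Adeg"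

lemma deg_mult: "x \<in> Adeg i ==> y \<in> Adeg j ==> x \<otimes>\<^sub>A y \<in> Adeg (i + j)"
 and deg_0: "Adeg 0 = {c \<odot>\<^sub>A \<one>\<^sub>A | c. c \<in> carrier K}" and A_nontrivial: "\<one>\<^sub>A ~= \<zero>\<^sub>A" and alg: "k_algebra K A"
 using cg by (auto simp: connected_graded_def)

lemma zero_subspace: "VectorSpace.subspace K {\<zero>\<^sub>A} A"
 using V.vectorspace_axioms V.module_axioms by (auto simp: subspace_def submodule_def V.smult_r_null)

lemma iA_sub: "VectorSpace.subspace K (iA j) A"
 by (simp add: int_grading_def zero_subspace N.W_sub)

lemma iA_mult: "x \<in> iA i ==> y \<in> iA j ==> x \<otimes>\<^sub>A y \<in> iA (i + j)"
 using deg_mult[of x "nat i" y "nat j"] N.W_zero[of "nat (i + j)"] N.W_carrier[of "nat i"] N.W_carrier[of "nat j"]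
 by (auto simp: int_grading_def nat_add_distrib split: if_splits)

lemma iA_carrier: "x \<in> iA i ==> x \<in> carrier A"
 using N.W_carrier[of "nat i"] by (auto simp: int_grading_def split: if_splits)

lemma iA_int [simp]: "iA (int n) = Adeg n" by (simp add: int_grading_def)

definition iproj :: "int => 'a => 'a" where "iproj j v = (if 0 \<le> j then N.proj (nat j) v else \<zero>\<^sub>A)"

lemma iproj_in: "v \<in> carrier A ==> iproj j v \<in> iA j"
 by (simp add: iproj_def int_grading_def N.proj_in)

lemma iproj_hom: "x \<in> iA i ==> iproj j x = (if j = i then x else \<zero>\<^sub>A)"
 using N.proj_hom[of "nat i" x "nat j"] by (auto simp: iproj_def int_grading_def split: if_splits)

lemma iproj_finite: assumes "v \<in> carrier A" shows "finite {i \<in> UNIV. iproj i v ~= \<zero>\<^sub>A}"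
proof (rule finite_subset)
 show "{i \<in> UNIV. iproj i v ~= \<zero>\<^sub>A} \<subseteq> int ` N.supp v"
  by (auto simp: iproj_def N.supp_def image_iff split: if_splits) (metis nat_0_le)
qed (use N.supp_finite[OF assms] in simp)

lemma iproj_sep: assumes "v \<in> carrier A" "!!i. i \<in> UNIV ==> iproj i v = \<zero>\<^sub>A" shows "v = \<zero>\<^sub>A"
proof (rule N.proj_ext[OF assms(1)])
 fix i show "N.proj i v = N.proj i \<zero>\<^sub>A" using assms(2)[of "int i"] by (simp add: iproj_def)
qed simp

lemma iproj_add: "u \<in> carrier A ==> v \<in> carrier A ==> iproj i (u \<oplus>\<^sub>A v) = iproj i u \<oplus>\<^sub>A iproj i v"
 by (simp add: iproj_def N.proj_add)

lemma iA_ids: "internal_direct_sum K A UNIV iA"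
 by (rule ids_of_projections(1)[OF V.vectorspace_axioms iA_sub iproj_in iproj_add iproj_hom iproj_finite iproj_sep]) blast+

lemma iA_component: assumes "v \<in> carrier A" shows "component A UNIV iA v j = iproj j v"
 by (rule ids_of_projections(2)[OF V.vectorspace_axioms iA_sub iproj_in iproj_add iproj_hom iproj_finite iproj_sep UNIV_I assms]) blast+

lemma aug_negdeg: "a \<in> iA j ==> j ~= 0 ==> aug a = \<zero>\<^sub>K"
proof -
 assume a: "a \<in> iA j" "j ~= 0"
 have ac: "a \<in> carrier A" using a iA_carrier by blast
 have "iproj 0 a = \<zero>\<^sub>A" using iproj_hom[OF a(1), of 0] a(2) by simp
 then have z: "component A UNIV Adeg a 0 = \<zero>\<^sub>A" by (simp add: iproj_def N.proj_def)
 show "aug a = \<zero>\<^sub>K" unfolding augmentation_def z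
 proof (rule the_equality)
  show "\<zero>\<^sub>K \<in> carrier K \<and> \<zero>\<^sub>A = \<zero>\<^sub>K \<odot>\<^sub>A \<one>\<^sub>A" by (simp add: V.smult_l_null)
  fix c assume c: "c \<in> carrier K \<and> \<zero>\<^sub>A = c \<odot>\<^sub>A \<one>\<^sub>A"
  show "c = \<zero>\<^sub>K"
  proof (rule ccontr)
   assume n: "c ~= \<zero>\<^sub>K"
   then have "inv\<^bsub>K\<^esub> c \<odot>\<^sub>A (c \<odot>\<^sub>A \<one>\<^sub>A) = \<one>\<^sub>A" using c by (simp add: field_Units flip: V.smult_assoc1)
   then show False using c n A_nontrivial by (metis V.smult_r_null field_Units Diff_iff empty_iff insert_iff Units_inv_closed)
  qed
 qed
qed

lemma int_graded_algebra: "graded_algebra K A Adeg integer_group iA"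
proof (rule graded_algebra.intro)
 show "field K" "connected_graded K A Adeg" by (rule fK cg)+
 show "group integer_group" by simp
 show "internal_direct_sum K A (carrier integer_group) iA" by (simp add: iA_ids)
 show "t = \<one>\<^sub>integer_group" if "a \<in> iA t" "aug a ~= \<zero>\<^sub>K" for t a using aug_negdeg that by auto
qed (auto simp: iA_mult)

lemma degree_lmult:
 assumes "x \<in> Adeg i" "y \<in> carrier A"
 shows "N.proj (i + k) (x \<otimes>\<^sub>A y) = x \<otimes>\<^sub>A N.proj k y" "n < i ==> N.proj n (x \<otimes>\<^sub>A y) = \<zero>\<^sub>A"
proof -
 have x: "x \<in> carrier A" using assms N.W_carrier by simp
 interpret I: graded_algebra K A Adeg integer_group iA by (rule int_graded_algebra)
 have x': "x \<in> iA (int i)" using assms by simp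
 have pr: "I.D.proj j v = iproj j v" if "v \<in> carrier A" for j v
  using iA_component[OF that, of j] I.D.proj_def[of j v] by simp
 have 1: "iproj (int i + t) (x \<otimes>\<^sub>A y) = x \<otimes>\<^sub>A iproj t y" for t
  using I.proj_lmult[of "int i" t x y] x x' assms(2) pr by simp
 show "N.proj (i + k) (x \<otimes>\<^sub>A y) = x \<otimes>\<^sub>A N.proj k y"
  using 1[of "int k"] by (simp add: iproj_def nat_add_distrib)
 show "N.proj n (x \<otimes>\<^sub>A y) = \<zero>\<^sub>A" if "n < i"
  using 1[of "int n - int i"] that x by (simp add: iproj_def)
qed

text \<open>In a domain multiplication by a nonzero homogeneous element is injective on each component, so
a product can be homogeneous only if the other factor is.\<close>
lemma factor_degree:
 assumes dom: "nc_domain A" and "x \<in> Adeg i" "x ~= \<zero>\<^sub>A" "y \<in> carrier A" "x \<otimes>\<^sub>A y \<in> iA n"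
 shows "y \<in> iA (n - int i)"
proof -
 have x: "x \<in> carrier A" using assms N.W_carrier by simp
 have z: "N.proj k y = \<zero>\<^sub>A" if "int k ~= n - int i" for k
 proof -
  have "x \<otimes>\<^sub>A N.proj k y = N.proj (i + k) (x \<otimes>\<^sub>A y)" using degree_lmult(1)[OF assms(2,4)] by simp
  also have "\<dots> = iproj (int (i + k)) (x \<otimes>\<^sub>A y)" by (simp add: iproj_def nat_add_distrib)
  also have "\<dots> = \<zero>\<^sub>A" using iproj_hom[OF assms(5), of "int (i + k)"] that by auto
  finally show ?thesis using dom x assms(3,4) by (auto simp: nc_domain_def)
 qed
 have "y = iproj (n - int i) y"
  using z assms(4) by (intro N.proj_ext[OF assms(4)])
   (auto simp: iproj_def N.proj_hom[OF _ N.proj_in[OF assms(4)]])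
 then show ?thesis using iproj_in[OF assms(4), of "n - int i"] by simp
qed

end

locale group_graded_algebra = connected_graded_algebra K A Adeg
 for K :: "'k ring" and A :: "('k, 'a) module" and Adeg :: "nat => 'a set" +
 fixes G :: "'g monoid" and gr :: "'g => 'a set"
 assumes grp: "group G" and finG: "finite (carrier G)" and coact: "homogeneous_coaction K A Adeg G gr"
  and one_gr: "\<one>\<^sub>A \<in> gr \<one>\<^sub>G"
begin

sublocale G: group G by (rule grp)
sublocale Gd: direct_sum K A "carrier G" gr
 using V.vectorspace_axioms coact by (intro direct_sum.intro direct_sum_axioms.intro) (simp_all add: homogeneous_coaction_def)

lemma gr_mult: "g \<in> carrier G ==> h \<in> carrier G ==> x \<in> gr g ==> y \<in> gr h ==> x \<otimes>\<^sub>A y \<in> gr (g \<otimes>\<^sub>G h)"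
 using coact by (simp add: homogeneous_coaction_def)

lemma gproj_deg: assumes "v \<in> Adeg i" "g \<in> carrier G" shows "Gd.proj g v \<in> Adeg i \<inter> gr g"
proof -
 have v: "v \<in> carrier (A\<lparr>carrier := Adeg i\<rparr>)" using assms by simp
 have "internal_direct_sum K (A\<lparr>carrier := Adeg i\<rparr>) (carrier G) (\<lambda>g. Adeg i \<inter> gr g)"
  using coact by (simp add: homogeneous_coaction_def)
 then have "\<exists>!a. decomposes (A\<lparr>carrier := Adeg i\<rparr>) (carrier G) (\<lambda>g. Adeg i \<inter> gr g) v a"
  using v by (simp add: internal_direct_sum_def)
 then obtain a where "decomposes (A\<lparr>carrier := Adeg i\<rparr>) (carrier G) (\<lambda>g. Adeg i \<inter> gr g) v a" by (rule ex1E)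
 then have a: "!!h. h \<in> carrier G ==> a h \<in> Adeg i \<inter> gr h" "finite {h \<in> carrier G. a h ~= \<zero>\<^sub>A}"
  "v = (\<Oplus>\<^bsub>A\<lparr>carrier := Adeg i\<rparr>\<^esub>h\<in>{h \<in> carrier G. a h ~= \<zero>\<^sub>A}. a h)"
  by (auto simp: decomposes_def)
 have "v = (\<Oplus>\<^sub>A h\<in>{h \<in> carrier G. a h ~= \<zero>\<^sub>A}. a h)"
  using a(3) finsum_subspace(1)[OF V.vectorspace_axioms N.W_sub[OF UNIV_I] a(2), of a i] a(1) by auto
 from Gd.proj_unique[OF a(2) _ _ this assms(2)] a(1)
 have "Gd.proj g v = (if g \<in> {h \<in> carrier G. a h ~= \<zero>\<^sub>A} then a g else \<zero>\<^sub>A)" by blast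
 then show ?thesis using a(1)[OF assms(2)] N.W_zero[of i] Gd.W_zero[OF assms(2)] by auto
qed

abbreviation "GA \<equiv> integer_group \<times>\<times> G"
abbreviation "dA \<equiv> (\<lambda>(j, g). iA j \<inter> gr g)"

definition dp :: "int \<times> 'g => 'a => 'a" where "dp t v = Gd.proj (snd t) (iproj (fst t) v)"

lemma GA_simps: "carrier GA = UNIV \<times> carrier G" "(s \<otimes>\<^sub>GA t) = (fst s + fst t, snd s \<otimes>\<^sub>G snd t)" "\<one>\<^sub>GA = (0, \<one>\<^sub>G)"
 by (auto simp: DirProd_def integer_group_def split: prod.splits)

lemma iproj_closed: "v \<in> carrier A ==> iproj j v \<in> carrier A"
 using iproj_in iA_carrier by blast

lemma gproj_iA: "v \<in> iA j ==> g \<in> carrier G ==> Gd.proj g v \<in> iA j \<inter> gr g"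
 using gproj_deg[of v "nat j" g] by (auto simp: int_grading_def Gd.W_zero split: if_splits)

lemma dA_sub: assumes "t \<in> carrier GA" shows "VectorSpace.subspace K (dA t) A"
proof -
 have "snd t \<in> carrier G" using assms by (auto simp: GA_simps)
 then show ?thesis using iA_sub[of "fst t"] Gd.W_sub[of "snd t"] by (cases t) (auto simp: subspace_def submodule_def)
qed

lemma dp_in: "t \<in> carrier GA ==> v \<in> carrier A ==> dp t v \<in> dA t"
 using gproj_iA[OF iproj_in[of v "fst t"], of "snd t"] by (cases t) (auto simp: dp_def GA_simps)

lemma dp_add: "t \<in> carrier GA ==> u \<in> carrier A ==> v \<in> carrier A ==> dp t (u \<oplus>\<^sub>A v) = dp t u \<oplus>\<^sub>A dp t v"
 by (auto simp: dp_def GA_simps iproj_add Gd.proj_add iproj_closed)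

lemma dp_hom: assumes "s \<in> carrier GA" "t \<in> carrier GA" "x \<in> dA s" shows "dp t x = (if t = s then x else \<zero>\<^sub>A)"
proof -
 obtain i g j h where [simp]: "s = (i, g)" "t = (j, h)" by fastforce
 have g: "g \<in> carrier G" "h \<in> carrier G" "x \<in> iA i" "x \<in> gr g" using assms by (auto simp: GA_simps)
 show ?thesis using g iproj_hom[OF g(3), of j] Gd.proj_hom[OF g(1,4,2)] by (auto simp: dp_def)
qed

lemma dp_finite: assumes "v \<in> carrier A" shows "finite {t \<in> carrier GA. dp t v ~= \<zero>\<^sub>A}"
proof (rule finite_subset)
 show "{t \<in> carrier GA. dp t v ~= \<zero>\<^sub>A} \<subseteq> {i \<in> UNIV. iproj i v ~= \<zero>\<^sub>A} \<times> carrier G"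
  by (auto simp: dp_def GA_simps)
qed (use iproj_finite[OF assms] finG in blast)

lemma dp_sep: assumes v: "v \<in> carrier A" and z: "!!t. t \<in> carrier GA ==> dp t v = \<zero>\<^sub>A" shows "v = \<zero>\<^sub>A"
proof (rule iproj_sep[OF v])
 fix i :: int
 show "iproj i v = \<zero>\<^sub>A"
 proof (rule Gd.proj_ext)
  fix g assume "g \<in> carrier G"
  then show "Gd.proj g (iproj i v) = Gd.proj g \<zero>\<^sub>A" using z[of "(i, g)"] by (simp add: dp_def GA_simps)
 qed (use iproj_closed v in auto)
qed

lemma dA_ids: "internal_direct_sum K A (carrier GA) dA"
 by (rule ids_of_projections(1)[OF V.vectorspace_axioms dA_sub dp_in dp_add dp_hom dp_finite dp_sep])

lemma dA_component: "t \<in> carrier GA ==> v \<in> carrier A ==> component A (carrier GA) dA v t = dp t v"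
 by (rule ids_of_projections(2)[OF V.vectorspace_axioms dA_sub dp_in dp_add dp_hom dp_finite dp_sep])

lemma dA_mult: "s \<in> carrier GA ==> t \<in> carrier GA ==> a \<in> dA s ==> b \<in> dA t ==> a \<otimes>\<^sub>A b \<in> dA (s \<otimes>\<^sub>GA t)"
 using iA_mult[of a "fst s" b "fst t"] gr_mult[of "snd s" "snd t" a b] by (cases s; cases t) (auto simp: GA_simps)

lemma scalar_gr: assumes "a \<in> Adeg 0" shows "a \<in> gr \<one>\<^sub>G"
 using assms one_gr by (auto simp: deg_0 Gd.W_smult)

lemma gr_disjoint: "g \<in> carrier G ==> h \<in> carrier G ==> g ~= h ==> x \<in> gr g ==> x \<in> gr h ==> x = \<zero>\<^sub>A"
 using Gd.proj_hom[of g x h] Gd.proj_hom[of h x h] by simp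

lemma aug_zero: "aug \<zero>\<^sub>A = \<zero>\<^sub>K" using aug_negdeg[of "\<zero>\<^sub>A" 1] by (simp add: int_grading_def N.W_zero)

lemma aug_degree: assumes "t \<in> carrier GA" "a \<in> dA t" "aug a ~= \<zero>\<^sub>K" shows "t = \<one>\<^sub>GA"
proof -
 obtain j g where t: "t = (j, g)" by fastforce
 have g: "g \<in> carrier G" "a \<in> iA j" "a \<in> gr g" using assms by (auto simp: t GA_simps)
 have j: "j = 0" using aug_negdeg[OF g(2)] assms(3) by blast
 then have "a \<in> gr \<one>\<^sub>G" using g(2) scalar_gr by (simp add: int_grading_def)
 then have "g = \<one>\<^sub>G" using gr_disjoint[OF g(1) G.one_closed _ g(3)] assms(3) aug_zero by blast
 then show ?thesis using j by (simp add: t GA_simps)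
qed

lemma group_GA: "group GA" by (rule DirProd_group) (simp_all add: grp)

sublocale Q: graded_algebra K A Adeg GA dA
proof (rule graded_algebra.intro)
 show "field K" "connected_graded K A Adeg" "group GA" "internal_direct_sum K A (carrier GA) dA"
  by (rule fK cg group_GA dA_ids)+
 show "a \<otimes>\<^sub>A b \<in> dA (s \<otimes>\<^sub>GA t)" if "s \<in> carrier GA" "t \<in> carrier GA" "a \<in> dA s" "b \<in> dA t" for s t a b
  by (rule dA_mult[OF that])
 show "t = \<one>\<^sub>GA" if "t \<in> carrier GA" "a \<in> dA t" "aug a ~= \<zero>\<^sub>K" for t a by (rule aug_degree[OF that])
qed

lemma coarse: "coarsened K A Adeg GA dA integer_group iA fst"
proof (rule coarsened.intro)
 show "graded_algebra K A Adeg GA dA" by (rule Q.graded_algebra_axioms)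
 show "coarsened_axioms K A GA dA integer_group iA fst"
 proof (rule coarsened_axioms.intro)
  show "group integer_group" by simp
  show "VectorSpace.subspace K (iA u) A" for u by (rule iA_sub)
  show "Q.D.proj t a = \<zero>\<^sub>A" if "a \<in> iA u" "t \<in> carrier GA" "fst t ~= u" for u t a
  proof -
   have "Q.D.proj t a = dp t a" unfolding Q.D.proj_def by (rule dA_component[OF that(2) iA_carrier[OF that(1)]])
   also have "\<dots> = \<zero>\<^sub>A" using iproj_hom[OF that(1), of "fst t"] that(2,3) by (auto simp: dp_def GA_simps)
   finally show ?thesis .
  qed
 qed (auto simp: GA_simps)
qed

end

section \<open>The algebra over its fixed ring\<close>

text \<open>The part of the situation used for the structure of A over its fixed ring; that the f_g are nonzero expresses inner
faithfulness for a domain.\<close>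
locale dual_reflection_data = group_graded_algebra K A Adeg G gr
 for K :: "'k ring" and A :: "('k, 'a) module" and Adeg :: "nat => 'a set" and G :: "'g monoid" and gr :: "'g => 'a set" +
 fixes f :: "'g => 'a"
 assumes dom: "nc_domain A" and f_nz: "!!g. g \<in> carrier G ==> f g ~= \<zero>\<^sub>A"
  and f_hom: "!!g. g \<in> carrier G ==> \<exists>i. f g \<in> Adeg i" and f_one: "f \<one>\<^sub>G = \<one>\<^sub>A"
  and f_left: "!!g. g \<in> carrier G ==> gr g = {f g \<otimes>\<^sub>A x | x. x \<in> gr \<one>\<^sub>G}"
  and f_right: "!!g. g \<in> carrier G ==> gr g = {x \<otimes>\<^sub>A f g | x. x \<in> gr \<one>\<^sub>G}"
  and connB: "connected_graded K (fixed_ring A G gr) (fixed_deg Adeg G gr)"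
begin

abbreviation "B0 \<equiv> gr \<one>\<^sub>G"

definition dg :: "'g => nat" where "dg g = (SOME i. f g \<in> Adeg i)"

lemma f_deg: "g \<in> carrier G ==> f g \<in> Adeg (dg g)"
 unfolding dg_def using f_hom by (rule someI_ex)

lemma f_closed: "g \<in> carrier G ==> f g \<in> carrier A"
 using N.W_carrier[OF UNIV_I f_deg] by blast

lemma f_gr: assumes "g \<in> carrier G" shows "f g \<in> gr g"
proof -
 have "f g \<otimes>\<^sub>A \<one>\<^sub>A \<in> gr g" unfolding f_left[OF assms] using one_gr by blast
 then show ?thesis using f_closed[OF assms] by simp
qed

lemma B0_closed: "b \<in> B0 ==> b \<in> carrier A"
 by (rule Gd.W_carrier[OF G.one_closed])

lemma deg_unique: "x \<in> Adeg i ==> x \<in> Adeg j ==> x ~= \<zero>\<^sub>A ==> i = j"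
 using N.proj_hom[of i x i] N.proj_hom[of j x i] by (auto split: if_splits)

lemma dg_one: "dg \<one>\<^sub>G = 0"
proof -
 have "\<one>\<^sub>A \<in> Adeg 0" unfolding deg_0 by (auto intro!: exI[of _ "\<one>\<^sub>K"])
 then show ?thesis using deg_unique[OF f_deg[OF G.one_closed]] f_nz[OF G.one_closed] by (simp add: f_one)
qed

lemma dom_mult: "x \<in> carrier A ==> y \<in> carrier A ==> x \<otimes>\<^sub>A y = \<zero>\<^sub>A ==> x = \<zero>\<^sub>A \<or> y = \<zero>\<^sub>A"
 using dom by (simp add: nc_domain_def)

lemma cancel_left: assumes "x \<in> carrier A" "y \<in> carrier A" "z \<in> carrier A" "x ~= \<zero>\<^sub>A" "x \<otimes>\<^sub>A y = x \<otimes>\<^sub>A z" shows "y = z"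
proof -
 have "x \<otimes>\<^sub>A (y \<ominus>\<^sub>A z) = \<zero>\<^sub>A" using assms by (simp add: a_minus_def A.r_distr A.r_minus A.r_neg)
 then have "y \<ominus>\<^sub>A z = \<zero>\<^sub>A" using dom_mult[OF assms(1), of "y \<ominus>\<^sub>A z"] assms by simp
 then show ?thesis using assms by (simp add: A.r_right_minus_eq)
qed

lemma cancel_right: assumes "x \<in> carrier A" "y \<in> carrier A" "z \<in> carrier A" "x ~= \<zero>\<^sub>A" "y \<otimes>\<^sub>A x = z \<otimes>\<^sub>A x" shows "y = z"
proof -
 have "(y \<ominus>\<^sub>A z) \<otimes>\<^sub>A x = \<zero>\<^sub>A" using assms by (simp add: a_minus_def A.l_distr A.l_minus A.r_neg)
 then have "y \<ominus>\<^sub>A z = \<zero>\<^sub>A" using dom_mult[of "y \<ominus>\<^sub>A z" x] assms by simp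
 then show ?thesis using assms by (simp add: A.r_right_minus_eq)
qed

definition ldiv :: "'g => 'a => 'a" where "ldiv g y = (THE b. b \<in> B0 \<and> f g \<otimes>\<^sub>A b = y)"
definition rdiv :: "'g => 'a => 'a" where "rdiv g y = (THE b. b \<in> B0 \<and> b \<otimes>\<^sub>A f g = y)"

lemma ldiv_eq: assumes g: "g \<in> carrier G" and b: "b \<in> B0" and e: "f g \<otimes>\<^sub>A b = y" shows "ldiv g y = b"
 unfolding ldiv_def
proof (rule the_equality)
 show "b \<in> B0 \<and> f g \<otimes>\<^sub>A b = y" using b e by (rule conjI)
 fix b' assume b': "b' \<in> B0 \<and> f g \<otimes>\<^sub>A b' = y"
 have "f g \<otimes>\<^sub>A b' = f g \<otimes>\<^sub>A b" using conjunct2[OF b'] e[symmetric] by (rule trans)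
 then show "b' = b" by (rule cancel_left[OF f_closed[OF g] B0_closed[OF conjunct1[OF b']] B0_closed[OF b] f_nz[OF g]])
qed

lemma rdiv_eq: assumes g: "g \<in> carrier G" and b: "b \<in> B0" and e: "b \<otimes>\<^sub>A f g = y" shows "rdiv g y = b"
 unfolding rdiv_def
proof (rule the_equality)
 show "b \<in> B0 \<and> b \<otimes>\<^sub>A f g = y" using b e by (rule conjI)
 fix b' assume b': "b' \<in> B0 \<and> b' \<otimes>\<^sub>A f g = y"
 have "b' \<otimes>\<^sub>A f g = b \<otimes>\<^sub>A f g" using conjunct2[OF b'] e[symmetric] by (rule trans)
 then show "b' = b" by (rule cancel_right[OF f_closed[OF g] B0_closed[OF conjunct1[OF b']] B0_closed[OF b] f_nz[OF g]])
qed

lemma ldiv: assumes "g \<in> carrier G" "y \<in> gr g" shows "ldiv g y \<in> B0" "f g \<otimes>\<^sub>A ldiv g y = y"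
proof -
 obtain b where b: "b \<in> B0" "y = f g \<otimes>\<^sub>A b" using assms(2)[unfolded f_left[OF assms(1)]] by blast
 have "ldiv g y = b" by (rule ldiv_eq[OF assms(1) b(1) b(2)[symmetric]])
 then show "ldiv g y \<in> B0" "f g \<otimes>\<^sub>A ldiv g y = y" by (simp_all only: b(1) b(2)[symmetric])
qed

lemma rdiv: assumes "g \<in> carrier G" "y \<in> gr g" shows "rdiv g y \<in> B0" "rdiv g y \<otimes>\<^sub>A f g = y"
proof -
 obtain b where b: "b \<in> B0" "y = b \<otimes>\<^sub>A f g" using assms(2)[unfolded f_right[OF assms(1)]] by blast
 have "rdiv g y = b" by (rule rdiv_eq[OF assms(1) b(1) b(2)[symmetric]])
 then show "rdiv g y \<in> B0" "rdiv g y \<otimes>\<^sub>A f g = y" by (simp_all only: b(1) b(2)[symmetric])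
qed

lemma B0_linear: "c \<in> carrier K ==> a \<in> B0 ==> b \<in> B0 ==> c \<odot>\<^sub>A a \<oplus>\<^sub>A b \<in> B0"
 by (simp add: Gd.W_add Gd.W_smult)

lemma ldiv_linear: assumes "g \<in> carrier G" "y \<in> gr g" "z \<in> gr g" "c \<in> carrier K"
 shows "ldiv g (c \<odot>\<^sub>A y \<oplus>\<^sub>A z) = c \<odot>\<^sub>A ldiv g y \<oplus>\<^sub>A ldiv g z"
 using assms ldiv[OF assms(1,2)] ldiv[OF assms(1,3)]
 by (intro ldiv_eq B0_linear) (simp_all add: A.r_distr f_closed B0_closed Q.smult_assoc_r)

lemma rdiv_linear: assumes "g \<in> carrier G" "y \<in> gr g" "z \<in> gr g" "c \<in> carrier K"
 shows "rdiv g (c \<odot>\<^sub>A y \<oplus>\<^sub>A z) = c \<odot>\<^sub>A rdiv g y \<oplus>\<^sub>A rdiv g z"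
 using assms rdiv[OF assms(1,2)] rdiv[OF assms(1,3)]
 by (intro rdiv_eq B0_linear) (simp_all add: A.l_distr f_closed B0_closed Q.smult_assoc_l)

lemma ldiv_degree: "g \<in> carrier G ==> y \<in> gr g ==> y \<in> iA n ==> ldiv g y \<in> iA (n - int (dg g))"
 using factor_degree[OF dom f_deg f_nz, of g "ldiv g y" n] ldiv[of g y] B0_closed by simp

lemma iproj_rmult:
 assumes "x \<in> Adeg i" "y \<in> carrier A" shows "N.proj (k + i) (y \<otimes>\<^sub>A x) = N.proj k y \<otimes>\<^sub>A x"
proof -
 have x: "x \<in> carrier A" using assms N.W_carrier by simp
 define g where "g y = N.proj (k + i) (y \<otimes>\<^sub>A x) \<ominus>\<^sub>A N.proj k y \<otimes>\<^sub>A x" for y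
 have "g y = \<zero>\<^sub>A"
 proof (rule N.additive_vanish[where g = g])
  show "g (u \<oplus>\<^sub>A v) = g u \<oplus>\<^sub>A g v" if "u \<in> carrier A" "v \<in> carrier A" for u v
  proof -
   have "N.proj (k + i) (u \<otimes>\<^sub>A x) \<in> carrier A" "N.proj (k + i) (v \<otimes>\<^sub>A x) \<in> carrier A"
    "N.proj k u \<otimes>\<^sub>A x \<in> carrier A" "N.proj k v \<otimes>\<^sub>A x \<in> carrier A" using that x by auto
   moreover have "g (u \<oplus>\<^sub>A v) = (N.proj (k + i) (u \<otimes>\<^sub>A x) \<oplus>\<^sub>A N.proj (k + i) (v \<otimes>\<^sub>A x)) \<ominus>\<^sub>A
     (N.proj k u \<otimes>\<^sub>A x \<oplus>\<^sub>A N.proj k v \<otimes>\<^sub>A x)"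
    using that x by (simp add: g_def N.proj_add A.l_distr)
   ultimately show ?thesis unfolding g_def by (simp only:) algebra
  qed
  show "g \<zero>\<^sub>A = \<zero>\<^sub>A" using x by (simp add: g_def a_minus_def)
  fix u v assume u: "v \<in> Adeg u"
  then have "v \<otimes>\<^sub>A x \<in> Adeg (u + i)" "v \<in> carrier A" using assms N.W_carrier by (auto intro: deg_mult)
  then show "g v = \<zero>\<^sub>A"
   using x N.proj_hom[of "u + i" "v \<otimes>\<^sub>A x" "k + i"] N.proj_hom[of u v k] u
   by (simp add: g_def a_minus_def A.r_neg)
 qed (rule assms)
 then show ?thesis using x assms by (simp add: g_def)
qed

lemma rdiv_degree: assumes "g \<in> carrier G" "y \<in> gr g" "y \<in> iA n" shows "rdiv g y \<in> iA (n - int (dg g))"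
proof -
 let ?b = "rdiv g y"
 have b: "?b \<in> carrier A" "?b \<otimes>\<^sub>A f g = y" using rdiv[OF assms(1,2)] B0_closed by auto
 have z: "N.proj k ?b = \<zero>\<^sub>A" if "int k ~= n - int (dg g)" for k
 proof -
  have "N.proj k ?b \<otimes>\<^sub>A f g = N.proj (k + dg g) y" using iproj_rmult[OF f_deg[OF assms(1)] b(1)] b(2) by simp
  also have "\<dots> = iproj (int (k + dg g)) y" by (simp add: iproj_def nat_add_distrib)
  also have "\<dots> = \<zero>\<^sub>A" using iproj_hom[OF assms(3), of "int (k + dg g)"] that by auto
  finally show ?thesis using dom_mult[of "N.proj k ?b" "f g"] b f_closed[OF assms(1)] f_nz[OF assms(1)] by simp
 qed
 have "?b = iproj (n - int (dg g)) ?b"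
  using z b by (intro N.proj_ext[OF b(1)]) (auto simp: iproj_def N.proj_hom[OF _ N.proj_in[OF b(1)]])
 then show ?thesis using iproj_in[OF b(1), of "n - int (dg g)"] by simp
qed

text \<open>The module A/AB_+ on the basis of the f_g: moving a past f_g leaves a coefficient in B, and only its
augmentation survives.\<close>
definition gact :: "int \<times> 'g => 'g => 'g" where "gact t g = snd t \<otimes>\<^sub>G g"
definition gbel :: "(int \<times> 'g) \<times> 'a => 'g => 'a" where "gbel p g = ldiv (gact (fst p) g) (snd p \<otimes>\<^sub>A f g)"
definition glam :: "(int \<times> 'g) \<times> 'a => 'g => 'k" where "glam p g = aug (gbel p g)"
definition gbdeg :: "int \<times> 'g => 'g => int \<times> 'g" where
 "gbdeg t g = (fst t + int (dg g) - int (dg (gact t g)), \<one>\<^sub>G)"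
definition gfel :: "'g => (int \<times> 'g) \<times> 'a" where "gfel g = ((int (dg g), g), f g)"

lemma gact_closed: "t \<in> carrier GA ==> g \<in> carrier G ==> gact t g \<in> carrier G"
 by (auto simp: gact_def GA_simps)

lemma gact_mult: "s \<in> carrier GA ==> t \<in> carrier GA ==> g \<in> carrier G ==> gact (s \<otimes>\<^sub>GA t) g = gact s (gact t g)"
 by (auto simp: gact_def GA_simps G.m_assoc)

lemma mult_f: assumes "t \<in> carrier GA" "a \<in> dA t" "g \<in> carrier G"
 shows "a \<otimes>\<^sub>A f g \<in> gr (gact t g)" "a \<otimes>\<^sub>A f g \<in> iA (fst t + int (dg g))" "a \<in> carrier A"
proof -
 have t: "snd t \<in> carrier G" "a \<in> iA (fst t)" "a \<in> gr (snd t)" using assms by (auto simp: GA_simps)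
 show "a \<otimes>\<^sub>A f g \<in> gr (gact t g)" unfolding gact_def using t assms by (intro gr_mult f_gr)
 show "a \<otimes>\<^sub>A f g \<in> iA (fst t + int (dg g))" using t f_deg[OF assms(3)] by (intro iA_mult) auto
 show "a \<in> carrier A" using t iA_carrier by blast
qed

lemma gbel: assumes "t \<in> carrier GA" "a \<in> dA t" "g \<in> carrier G"
 shows "gbel (t, a) g \<in> B0" "a \<otimes>\<^sub>A f g = f (gact t g) \<otimes>\<^sub>A gbel (t, a) g" "gbel (t, a) g \<in> dA (gbdeg t g)"
proof -
 note m = mult_f[OF assms] and c = gact_closed[OF assms(1,3)]
 have e: "gbel (t, a) g = ldiv (gact t g) (a \<otimes>\<^sub>A f g)" by (simp only: gbel_def fst_conv snd_conv)
 show 1: "gbel (t, a) g \<in> B0" unfolding e by (rule ldiv(1)[OF c m(1)])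
 show "a \<otimes>\<^sub>A f g = f (gact t g) \<otimes>\<^sub>A gbel (t, a) g" unfolding e by (rule ldiv(2)[OF c m(1), symmetric])
 have "gbel (t, a) g \<in> iA (fst t + int (dg g) - int (dg (gact t g)))" unfolding e by (rule ldiv_degree[OF c m(1,2)])
 then show "gbel (t, a) g \<in> dA (gbdeg t g)" using 1 by (simp add: gbdeg_def)
qed

lemma gbel_eq: "t \<in> carrier GA ==> g \<in> carrier G ==> b \<in> B0 ==> f (gact t g) \<otimes>\<^sub>A b = a \<otimes>\<^sub>A f g ==> gbel (t, a) g = b"
 unfolding gbel_def fst_conv snd_conv by (rule ldiv_eq[OF gact_closed])

lemma gbel_linear: assumes "t \<in> carrier GA" "a \<in> dA t" "b \<in> dA t" "c \<in> carrier K" "g \<in> carrier G"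
 shows "gbel (t, c \<odot>\<^sub>A a \<oplus>\<^sub>A b) g = c \<odot>\<^sub>A gbel (t, a) g \<oplus>\<^sub>A gbel (t, b) g"
proof -
 have c: "a \<in> carrier A" "b \<in> carrier A" "f g \<in> carrier A"
  by (rule mult_f(3)[OF assms(1,2,5)] mult_f(3)[OF assms(1,3,5)] f_closed[OF assms(5)])+
 have "(c \<odot>\<^sub>A a \<oplus>\<^sub>A b) \<otimes>\<^sub>A f g = c \<odot>\<^sub>A (a \<otimes>\<^sub>A f g) \<oplus>\<^sub>A b \<otimes>\<^sub>A f g"
  using c assms(4) by (simp add: A.l_distr Q.smult_assoc_l)
 then show ?thesis
  using ldiv_linear[OF gact_closed[OF assms(1,5)] mult_f(1)[OF assms(1,2,5)] mult_f(1)[OF assms(1,3,5)] assms(4)]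
  unfolding gbel_def fst_conv snd_conv by (simp only:)
qed

lemma gbel_mult: assumes "s \<in> carrier GA" "t \<in> carrier GA" "a \<in> dA s" "b \<in> dA t" "g \<in> carrier G"
 shows "gbel (s \<otimes>\<^sub>GA t, a \<otimes>\<^sub>A b) g = gbel (s, a) (gact t g) \<otimes>\<^sub>A gbel (t, b) g"
proof (rule gbel_eq)
 let ?h = "gact t g"
 have h: "?h \<in> carrier G" using gact_closed assms by blast
 note 1 = gbel[OF assms(1,3) h] and 2 = gbel[OF assms(2,4,5)]
 have c: "a \<in> carrier A" "b \<in> carrier A" "f g \<in> carrier A" "f ?h \<in> carrier A" "f (gact s ?h) \<in> carrier A"
  using mult_f(3)[OF assms(1,3,5)] mult_f(3)[OF assms(2,4,5)] f_closed assms h gact_closed by auto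
 show "gbel (s, a) ?h \<otimes>\<^sub>A gbel (t, b) g \<in> B0" using gr_mult[OF G.one_closed G.one_closed 1(1) 2(1)] by simp
 have "a \<otimes>\<^sub>A b \<otimes>\<^sub>A f g = a \<otimes>\<^sub>A (f ?h \<otimes>\<^sub>A gbel (t, b) g)" using c 2(2) by (simp add: A.m_assoc)
 also have "\<dots> = f (gact s ?h) \<otimes>\<^sub>A (gbel (s, a) ?h \<otimes>\<^sub>A gbel (t, b) g)"
  using c 1 2(1) B0_closed by (simp flip: A.m_assoc)
 finally show "f (gact (s \<otimes>\<^sub>GA t) g) \<otimes>\<^sub>A (gbel (s, a) ?h \<otimes>\<^sub>A gbel (t, b) g) = a \<otimes>\<^sub>A b \<otimes>\<^sub>A f g"
  using gact_mult[OF assms(1,2,5)] by simp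
qed (use assms Q.T.Gr.m_closed in auto)

sublocale R: graded_actor K A GA dA "carrier G" gact glam
proof (rule graded_actor.intro)
 show "field K" "k_algebra K A" "group GA" by (rule fK alg group_GA)+
 show "VectorSpace.subspace K (dA t) A" if "t \<in> carrier GA" for t by (rule dA_sub[OF that])
 show "a \<otimes>\<^sub>A b \<in> dA (s \<otimes>\<^sub>GA t)" if "s \<in> carrier GA" "t \<in> carrier GA" "a \<in> dA s" "b \<in> dA t" for s t a b by (rule dA_mult[OF that])
 show "gact t g \<in> carrier G" if "t \<in> carrier GA" "g \<in> carrier G" for t g by (rule gact_closed[OF that])
 show "gact (s \<otimes>\<^sub>GA t) g = gact s (gact t g)" if "s \<in> carrier GA" "t \<in> carrier GA" "g \<in> carrier G" for s t g by (rule gact_mult[OF that])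
 show "glam (t, a) g \<in> carrier K" if "t \<in> carrier GA" "a \<in> dA t" "g \<in> carrier G" for t a g
  using B0_closed[OF gbel(1)[OF that]] by (simp add: glam_def)
 show "glam (t, c \<odot>\<^sub>A a \<oplus>\<^sub>A b) g = c \<otimes>\<^sub>K glam (t, a) g \<oplus>\<^sub>K glam (t, b) g"
  if "t \<in> carrier GA" "a \<in> dA t" "b \<in> dA t" "c \<in> carrier K" "g \<in> carrier G" for t a b c g
  using gbel_linear[OF that] Q.aug_linear[OF B0_closed[OF gbel(1)[OF that(1,2,5)]] B0_closed[OF gbel(1)[OF that(1,3,5)]] that(4)]
  by (simp add: glam_def)
 show "glam (s \<otimes>\<^sub>GA t, a \<otimes>\<^sub>A b) g = glam (s, a) (gact t g) \<otimes>\<^sub>K glam (t, b) g"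
  if h: "s \<in> carrier GA" "t \<in> carrier GA" "a \<in> dA s" "b \<in> dA t" "g \<in> carrier G" for s t a b g
  using gbel_mult[OF h] Q.aug_mult[OF B0_closed[OF gbel(1)[OF h(1,3) gact_closed[OF h(2,5)]]] B0_closed[OF gbel(1)[OF h(2,4,5)]]]
  by (simp add: glam_def)
qed

lemma hom_el_eq: "R.hom_el p \<longleftrightarrow> fst p \<in> carrier GA \<and> snd p \<in> dA (fst p)"
 by (rule R.hom_el_def)

lemma gbel_one: "b \<in> B0 ==> gbel ((i, \<one>\<^sub>G), b) \<one>\<^sub>G = b"
 using B0_closed[of b] by (intro gbel_eq) (simp_all add: GA_simps gact_def f_one)

lemma gfel_hom: "g \<in> carrier G ==> R.hom_el (gfel g)"
 using f_deg f_gr by (simp add: gfel_def hom_el_eq GA_simps)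

sublocale FE: free_extension K A GA dA "carrier G" gact glam gfel "\<one>\<^sub>G" "{t. snd t = \<one>\<^sub>G}" gbdeg gbel
proof (rule free_extension.intro, rule R.graded_actor_axioms, rule free_extension_axioms.intro)
 show "\<one>\<^sub>G \<in> carrier G" by simp
 show "R.hom_el (gfel g)" if "g \<in> carrier G" for g by (rule gfel_hom[OF that])
 show "gact (fst (gfel g)) \<one>\<^sub>G = g" if "g \<in> carrier G" for g using that by (simp add: gact_def gfel_def)
 show "glam (gfel g) \<one>\<^sub>G = \<one>\<^sub>K" if "g \<in> carrier G" for g
 proof -
  have "gbel (gfel g) \<one>\<^sub>G = \<one>\<^sub>A" unfolding gfel_def
   using that f_closed[OF that] one_gr by (intro gbel_eq) (simp_all add: GA_simps gact_def f_one)
  then show ?thesis by (simp add: glam_def)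
 qed
 show "gbdeg t g \<in> {t. snd t = \<one>\<^sub>G} \<inter> carrier GA" if "t \<in> carrier GA" "g \<in> carrier G" for t g
  by (simp add: gbdeg_def GA_simps)
 show "gact t \<one>\<^sub>G = \<one>\<^sub>G" if "t \<in> {t. snd t = \<one>\<^sub>G}" "t \<in> carrier GA" for t using that by (simp add: gact_def)
 show "gbel (t, a) g \<in> dA (gbdeg t g)" if "t \<in> carrier GA" "a \<in> dA t" "g \<in> carrier G" for t a g
  by (rule gbel(3)[OF that])
 show "R.pm p (gfel g) = R.pm (gfel (gact (fst p) g)) (gbdeg (fst p) g, gbel p g)" if "R.hom_el p" "g \<in> carrier G" for p g
 proof -
  obtain t a where pe: "p = (t, a)" by (rule prod.exhaust)
  have p: "p = (t, a)" "t \<in> carrier GA" "a \<in> dA t" using pe that(1)[unfolded hom_el_eq] by (simp_all only: fst_conv snd_conv)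
  show ?thesis using gbel(2)[OF p(2,3) that(2)] gact_closed[OF p(2) that(2)] p(2)
   by (simp add: p(1) R.pm_def gfel_def GA_simps gbdeg_def) (simp add: gact_def)
 qed
 show "gbel (t, c \<odot>\<^sub>A a \<oplus>\<^sub>A b) g = c \<odot>\<^sub>A gbel (t, a) g \<oplus>\<^sub>A gbel (t, b) g"
  if "t \<in> carrier GA" "a \<in> dA t" "b \<in> dA t" "c \<in> carrier K" "g \<in> carrier G" for t a b c g by (rule gbel_linear[OF that])
 show "(gbdeg (fst (R.pm p q)) g, gbel (R.pm p q) g) =
   R.pm (gbdeg (fst p) (gact (fst q) g), gbel p (gact (fst q) g)) (gbdeg (fst q) g, gbel q g)"
  if "R.hom_el p" "R.hom_el q" "g \<in> carrier G" for p q g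
 proof -
  obtain s a where pe: "p = (s, a)" by (rule prod.exhaust)
  obtain t b where qe: "q = (t, b)" by (rule prod.exhaust)
  have p: "p = (s, a)" "s \<in> carrier GA" "a \<in> dA s" "q = (t, b)" "t \<in> carrier GA" "b \<in> dA t"
   using pe qe that(1,2)[unfolded hom_el_eq] by (simp_all only: fst_conv snd_conv)
  show ?thesis using gbel_mult[OF p(2,5,3,6) that(3)] gact_mult[OF p(2,5) that(3)]
   unfolding R.pm_def p(1,4) by (simp add: gbdeg_def) (simp add: GA_simps)
 qed
 show "glam p g = glam (gbdeg (fst p) g, gbel p g) \<one>\<^sub>G" if "R.hom_el p" "g \<in> carrier G" for p g
 proof -
  obtain t a where pe: "p = (t, a)" by (rule prod.exhaust)
  have p: "p = (t, a)" "t \<in> carrier GA" "a \<in> dA t" using pe that(1)[unfolded hom_el_eq] by (simp_all only: fst_conv snd_conv)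
  show ?thesis using gbel_one[OF gbel(1)[OF p(2,3) that(2)]] by (simp add: p(1) glam_def gbdeg_def)
 qed
qed

definition dgmax :: nat where "dgmax = Max (dg ` carrier G)"

lemma dg_le: "g \<in> carrier G ==> dg g \<le> dgmax"
 using finG by (simp add: dgmax_def)

sublocale FA: filtered_actor K A GA dA "carrier G" gact glam "\<lambda>p. aug (snd p)" dg "Suc dgmax"
proof (rule filtered_actor.intro, rule R.graded_actor_axioms, rule filtered_actor_axioms.intro)
 show "dg g < Suc dgmax" if "g \<in> carrier G" for g using dg_le[OF that] by simp
 show "aug (snd p) \<in> carrier K" if "R.hom_el p" for p using R.hom_elD(2)[OF that] by simp
 show "aug (snd (t, c \<odot>\<^sub>A a \<oplus>\<^sub>A b)) = c \<otimes>\<^sub>K aug (snd (t, a)) \<oplus>\<^sub>K aug (snd (t, b))"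
  if "t \<in> carrier GA" "a \<in> dA t" "b \<in> dA t" "c \<in> carrier K" for t a b c
  using Q.aug_linear[OF R.dA_carrier[OF that(1,2)] R.dA_carrier[OF that(1,3)] that(4)] by simp
 show "aug (snd (R.pm p q)) = aug (snd p) \<otimes>\<^sub>K aug (snd q)" if "R.hom_el p" "R.hom_el q" for p q
  using Q.aug_mult R.hom_elD that by (simp add: R.pm_def)
 have core: "gact t g ~= g ==> glam (t, a) g ~= \<zero>\<^sub>K ==> dg g < dg (gact t g)"
   "gact t g = g ==> glam (t, a) g = aug a" "gact t g ~= g ==> aug a = \<zero>\<^sub>K"
  if h: "t \<in> carrier GA" "a \<in> dA t" "g \<in> carrier G" for t a g
 proof -
  note b = gbel[OF h] and m = mult_f[OF h]
  have tG: "snd t \<in> carrier G" "a \<in> iA (fst t)" "a \<in> gr (snd t)" using h by (auto simp: GA_simps)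
  show z: "aug a = \<zero>\<^sub>K" if "gact t g ~= g"
  proof (rule ccontr)
   assume "aug a ~= \<zero>\<^sub>K"
   then have "t = \<one>\<^sub>GA" using aug_degree[OF h(1,2)] by blast
   then show False using that h by (simp add: gact_def GA_simps)
  qed
  show "dg g < dg (gact t g)" if ne: "gact t g ~= g" and l: "glam (t, a) g ~= \<zero>\<^sub>K"
  proof -
   have "gbdeg t g = \<one>\<^sub>GA"
    using aug_degree[OF _ b(3)] l by (auto simp: glam_def gbdeg_def GA_simps)
   then have d: "int (dg (gact t g)) = fst t + int (dg g)" by (simp add: gbdeg_def GA_simps)
   have "fst t ~= 0"
   proof
    assume "fst t = 0"
    then have "a \<in> gr \<one>\<^sub>G" using tG scalar_gr by (simp add: int_grading_def)
    moreover have "snd t ~= \<one>\<^sub>G" using ne h by (auto simp: gact_def)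
    ultimately have "a = \<zero>\<^sub>A" using gr_disjoint[OF tG(1) G.one_closed _ tG(3)] by blast
    then have "gbel (t, a) g = \<zero>\<^sub>A" using h f_closed gact_closed Gd.W_zero by (intro gbel_eq) auto
    then show False using l aug_zero by (simp add: glam_def)
   qed
   moreover have "\<not> fst t < 0"
   proof
    assume "fst t < 0"
    then have "a = \<zero>\<^sub>A" using tG by (simp add: int_grading_def)
    then have "gbel (t, a) g = \<zero>\<^sub>A" using h f_closed gact_closed Gd.W_zero by (intro gbel_eq) auto
    then show False using l aug_zero by (simp add: glam_def)
   qed
   ultimately show ?thesis using d by simp
  qed
  show "glam (t, a) g = aug a" if e: "gact t g = g"
  proof (cases "fst t = 0")
   case True
   then obtain c where c: "a = c \<odot>\<^sub>A \<one>\<^sub>A" "c \<in> carrier K" using tG by (auto simp: int_grading_def deg_0)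
   have "gbel (t, a) g = a"
    using h e c f_closed[OF h(3)] Gd.W_smult[OF G.one_closed c(2) one_gr]
    by (intro gbel_eq) (auto simp: Q.smult_assoc_l Q.smult_assoc_r)
   then show ?thesis by (simp add: glam_def)
  next
   case False
   then show ?thesis using aug_negdeg[OF tG(2)] aug_negdeg[of "gbel (t, a) g" "fst t"] b(3) e by (simp add: glam_def gbdeg_def)
  qed
 qed
 show "dg g < dg (gact (fst p) g)" if "R.hom_el p" "g \<in> carrier G" "gact (fst p) g ~= g" "glam p g ~= \<zero>\<^sub>K" for p g
  using core(1)[of "fst p" "snd p" g] that by (simp add: hom_el_eq)
 show "glam p g = aug (snd p)" if "R.hom_el p" "g \<in> carrier G" "gact (fst p) g = g" for p g
  using core(2)[of "fst p" "snd p" g] that by (simp add: hom_el_eq)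
 show "aug (snd p) = \<zero>\<^sub>K" if "R.hom_el p" "g \<in> carrier G" "gact (fst p) g ~= g" for p g
  using core(3)[of "fst p" "snd p" g] that by (simp add: hom_el_eq)
qed

lemma family_weight: assumes "ka \<in> carrier GA" shows "R.weight (\<lambda>g. (int (dg g), g) \<otimes>\<^sub>GA ka)"
 unfolding R.weight_def
proof (intro ballI conjI allI impI)
 fix g assume g: "g \<in> carrier G"
 show "(int (dg g), g) \<otimes>\<^sub>GA ka \<in> carrier GA" using g assms by (auto simp: GA_simps)
 fix p assume p: "R.hom_el p" "glam p g ~= \<zero>\<^sub>K"
 obtain t a where pe: "p = (t, a)" by (rule prod.exhaust)
 have ta: "p = (t, a)" "t \<in> carrier GA" "a \<in> dA t" using pe p(1)[unfolded hom_el_eq] by (simp_all only: fst_conv snd_conv)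
 have "gbdeg t g = \<one>\<^sub>GA" using aug_degree[OF _ gbel(3)[OF ta(2,3) g]] p(2) by (auto simp: glam_def gbdeg_def GA_simps ta(1))
 then have "int (dg (gact t g)) = fst t + int (dg g)" by (simp add: gbdeg_def GA_simps)
 then show "(int (dg (gact (fst p) g)), gact (fst p) g) \<otimes>\<^sub>GA ka = fst p \<otimes>\<^sub>GA ((int (dg g), g) \<otimes>\<^sub>GA ka)"
  using g assms ta by (auto simp: GA_simps gact_def G.m_assoc)
qed

end

section \<open>Transfer to the fixed ring\<close>

context dual_reflection_data
begin

abbreviation "BB \<equiv> fixed_ring A G gr"
abbreviation "Bdeg \<equiv> fixed_deg Adeg G gr"

sublocale Bc: connected_graded_algebra K BB Bdeg
 by (rule connected_graded_algebra.intro[OF fK connB])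

lemma BB_simps [simp]: "carrier BB = B0" "monoid.mult BB = monoid.mult A" "one BB = one A" "zero BB = zero A" "add BB = add A"
  "module.smult BB = module.smult A"
 by (simp_all add: fixed_ring_def)

lemma Bdeg_iff: "b \<in> Bdeg i \<longleftrightarrow> b \<in> Adeg i \<and> b \<in> B0"
 by (simp add: fixed_deg_def)

lemma iB_iff: "b \<in> Bc.iA j \<longleftrightarrow> b \<in> iA j \<and> b \<in> B0"
 using Gd.W_zero[OF G.one_closed] by (auto simp: int_grading_def Bdeg_iff)

sublocale BI: graded_algebra K BB Bdeg integer_group Bc.iA
 by (rule Bc.int_graded_algebra)

lemma BI_one [simp]: "\<one>\<^sub>integer_group = 0" "carrier integer_group = UNIV" "(a \<otimes>\<^sub>integer_group b) = a + b"
 by (auto simp: integer_group_def)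

lemma BB_minus: assumes "x \<in> B0" "y \<in> B0" shows "x \<ominus>\<^sub>BB y = x \<ominus>\<^sub>A y"
proof -
 have n: "\<ominus>\<^sub>A y \<in> B0" using Gd.W_smult[OF G.one_closed _ assms(2), of "\<ominus>\<^sub>K \<one>\<^sub>K"] R.smult_minus_one[OF B0_closed[OF assms(2)]] by simp
 have "(\<ominus>\<^sub>A y) \<oplus>\<^sub>BB y = \<zero>\<^sub>BB" using B0_closed[OF assms(2)] by (simp add: A.l_neg)
 then have "\<ominus>\<^sub>BB y = \<ominus>\<^sub>A y" using Bc.A.minus_equality[of "\<ominus>\<^sub>A y" y] n assms(2) by simp
 then show ?thesis by (simp add: a_minus_def)
qed

lemma B0_minus: assumes "x \<in> B0" "y \<in> B0" shows "x \<ominus>\<^sub>A y \<in> B0"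
proof -
 have "x \<ominus>\<^sub>BB y \<in> carrier BB" using assms by (intro Bc.A.minus_closed) simp_all
 then show ?thesis using BB_minus[OF assms] by simp
qed

lemma B0_mult: "x \<in> B0 ==> y \<in> B0 ==> x \<otimes>\<^sub>A y \<in> B0"
 using gr_mult[OF G.one_closed G.one_closed] by simp

lemma BB_aug: assumes "b \<in> Bc.iA j" shows "Bc.aug b = aug b"
proof (cases "j = 0")
 case True
 then have "b \<in> Bdeg 0" using assms by (simp add: int_grading_def)
 then obtain c where c: "c \<in> carrier K" "b = c \<odot>\<^sub>A \<one>\<^sub>A" using Bc.deg_0 by auto
 have "Bc.aug b = c" using BI.aug_scalar[OF c(1)] c(2) by simp
 moreover have "aug b = c" using Q.aug_scalar[OF c(1)] c(2) by simp
 ultimately show ?thesis by simp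
next
 case False
 have "b \<in> iA j" using assms iB_iff by blast
 then show ?thesis using Bc.aug_negdeg[OF assms False] aug_negdeg[OF _ False] by simp
qed

definition emb :: "int \<times> 'a => (int \<times> 'g) \<times> 'a" where "emb p = ((fst p, \<one>\<^sub>G), snd p)"
definition unemb :: "(int \<times> 'g) \<times> 'a => int \<times> 'a" where "unemb p = (fst (fst p), snd p)"

lemma unemb_emb [simp]: "unemb (emb p) = p" "map unemb (map emb bs) = bs"
 by (simp_all add: emb_def unemb_def map_idI)

lemma BI_hom_el: "BI.T.hom_el p \<longleftrightarrow> snd p \<in> iA (fst p) \<and> snd p \<in> B0"
 by (simp add: BI.T.hom_el_def iB_iff)

lemma emb_hom: "R.hom_el (emb p) \<longleftrightarrow> BI.T.hom_el p"
 by (simp add: BI_hom_el hom_el_eq emb_def GA_simps)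

lemma emb_unemb: "snd (fst p) = \<one>\<^sub>G ==> emb (unemb p) = p"
 by (simp add: emb_def unemb_def prod_eq_iff)

lemma emb_words: "bs \<in> BI.T.words n \<longleftrightarrow> map emb bs \<in> R.words n"
 by (auto simp: BI.T.words_def R.words_def emb_hom)

lemma emb_words0: assumes "as \<in> FE.words0 n" shows "\<exists>bs\<in>BI.T.words n. as = map emb bs"
proof -
 have "map emb (map unemb as) = as"
  using assms by (auto simp: FE.words0_def emb_unemb intro!: map_idI)
 moreover then have "map unemb as \<in> BI.T.words n" using assms emb_words[of "map unemb as" n] by (simp add: FE.words0_def)
 ultimately show ?thesis by metis
qed

lemma emb_pm: "emb (BI.T.pm p q) = R.pm (emb p) (emb q)"
 by (simp add: emb_def BI.T.pm_def R.pm_def GA_simps)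

lemma emb_tot: "R.tot (map emb bs) = (BI.T.tot bs, \<one>\<^sub>G)"
 by (induction bs) (simp_all add: emb_def GA_simps)

lemma emb_glam: assumes "BI.T.hom_el p" shows "glam (emb p) \<one>\<^sub>G = Bc.aug (snd p)"
proof -
 have "snd p \<in> Bc.iA (fst p)" using assms by (simp add: BI_hom_el iB_iff)
 then show ?thesis using gbel_one[of "snd p" "fst p"] BB_aug[of "snd p" "fst p"] by (simp add: glam_def emb_def iB_iff)
qed

lemma emb_gact: "gact (fst (emb p)) \<one>\<^sub>G = \<one>\<^sub>G"
 by (simp add: gact_def emb_def)

definition lifts :: "'g => nat => (((int \<times> 'g) \<times> 'a) list => 'g => 'a) => ((int \<times> 'a) list => nat => 'a) => bool" where
 "lifts k n ph ph0 \<longleftrightarrow> (\<forall>cs\<in>BI.T.words n. ph0 cs 0 \<in> B0 \<and> ph (map emb cs) \<one>\<^sub>G = ph0 cs 0 \<otimes>\<^sub>A f k)"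

lemma lifts_shift: "lifts k (Suc n) ph ph0 ==> BI.T.hom_el p ==> lifts k n (R.shift (emb p) ph) (BI.T.shift p ph0)"
 unfolding lifts_def R.shift_def BI.T.shift_def list.map(2)[symmetric]
 by (intro ballI) (erule bspec, simp only: BI.T.words_Cons simp_thms)

lemma lifts_inner:
 assumes k: "k \<in> carrier G" and "lifts k n ph ph0" "bs \<in> BI.T.words (Suc n)"
 shows "BI.T.bar_inner ph0 bs 0 \<in> B0 \<and> R.bar_inner ph (map emb bs) \<one>\<^sub>G = BI.T.bar_inner ph0 bs 0 \<otimes>\<^sub>A f k"
 using assms(2,3)
proof (induction n arbitrary: bs ph ph0)
 case 0
 then obtain p where p: "bs = [p]" "BI.T.hom_el p" by (auto simp: BI.T.words_Suc)
 have l: "ph0 [] 0 \<in> B0" "ph [] \<one>\<^sub>G = ph0 [] 0 \<otimes>\<^sub>A f k" using 0(1) by (auto simp: lifts_def)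
 have c: "Bc.aug (snd p) \<in> carrier K" using p BI.T.lam_cl[of p 0] by simp
 show ?case using l c B0_closed[OF l(1)] f_closed[OF k] emb_glam[OF p(2)] emb_gact[of p]
  by (simp add: p(1) Gd.W_smult Q.smult_assoc_l)
next
 case (Suc n)
 then obtain p q cs where b: "bs = p # q # cs" "BI.T.hom_el p" "BI.T.hom_el q" "cs \<in> BI.T.words n" by (auto simp: BI.T.words_Suc)
 have w: "BI.T.pm p q # cs \<in> BI.T.words (Suc n)" "q # cs \<in> BI.T.words (Suc n)" using b by simp_all
 let ?u = "ph0 (BI.T.pm p q # cs) 0" and ?v = "BI.T.bar_inner (BI.T.shift p ph0) (q # cs) 0"
 have l: "?u \<in> B0" "ph (R.pm (emb p) (emb q) # map emb cs) \<one>\<^sub>G = ?u \<otimes>\<^sub>A f k"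
  using Suc.prems(1)[unfolded lifts_def, THEN bspec, OF w(1)] by (simp_all only: list.map emb_pm)
 have IH: "?v \<in> B0" "R.bar_inner (R.shift (emb p) ph) (emb q # map emb cs) \<one>\<^sub>G = ?v \<otimes>\<^sub>A f k"
  using Suc.IH[OF lifts_shift[OF Suc.prems(1) b(2)] w(2)] by auto
 have "R.bar_inner ph (map emb bs) \<one>\<^sub>G = ?u \<otimes>\<^sub>A f k \<ominus>\<^sub>A ?v \<otimes>\<^sub>A f k"
  by (simp only: b(1) list.map R.bar_inner.simps l(2) IH(2))
 also have "\<dots> = (?u \<ominus>\<^sub>A ?v) \<otimes>\<^sub>A f k"
  using B0_closed[OF l(1)] B0_closed[OF IH(1)] f_closed[OF k] by (simp add: a_minus_def A.l_distr A.l_minus)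
 also have e: "?u \<ominus>\<^sub>A ?v = BI.T.bar_inner ph0 bs 0"
  by (simp only: b(1) BI.T.bar_inner.simps BB_minus[OF l(1) IH(1)])
 finally show ?case using B0_minus[OF l(1) IH(1)] unfolding e by (intro conjI)
qed

text \<open>Values of cochains in A f_k are multiples of f_k by cochains with values in B, compatibly with the
differentials.\<close>
lemma lifts_diff:
 assumes k: "k \<in> carrier G" and l: "lifts k n ph ph0" and b: "bs \<in> BI.T.words (Suc n)"
 shows "BI.T.bar_diff ph0 bs 0 \<in> B0" "R.bar_diff ph (map emb bs) \<one>\<^sub>G = BI.T.bar_diff ph0 bs 0 \<otimes>\<^sub>A f k"
proof -
 obtain p cs where bs: "bs = p # cs" "BI.T.hom_el p" "cs \<in> BI.T.words n" using b by (auto simp: BI.T.words_Suc)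
 have p: "snd p \<in> B0" using bs BI_hom_el by blast
 have 1: "ph0 cs 0 \<in> B0" "ph (map emb cs) \<one>\<^sub>G = ph0 cs 0 \<otimes>\<^sub>A f k" using l bs(3) by (auto simp: lifts_def)
 let ?v = "BI.T.bar_inner ph0 bs 0"
 have 2: "?v \<in> B0" "R.bar_inner ph (map emb bs) \<one>\<^sub>G = ?v \<otimes>\<^sub>A f k" using lifts_inner[OF assms] by auto
 have e: "BI.T.bar_diff ph0 bs 0 = snd p \<otimes>\<^sub>A ph0 cs 0 \<ominus>\<^sub>A ?v"
  using BB_minus[OF B0_mult[OF p 1(1)] 2(1)] by (simp add: BI.T.bar_diff_def bs(1))
 show "BI.T.bar_diff ph0 bs 0 \<in> B0" unfolding e using B0_mult p 1 2 by (intro B0_minus) auto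
 have "R.bar_diff ph (map emb bs) \<one>\<^sub>G = snd p \<otimes>\<^sub>A (ph0 cs 0 \<otimes>\<^sub>A f k) \<ominus>\<^sub>A ?v \<otimes>\<^sub>A f k"
  unfolding R.bar_diff_def 2(2) using 1(2) by (simp add: bs(1) emb_def)
 also have "\<dots> = (snd p \<otimes>\<^sub>A ph0 cs 0 \<ominus>\<^sub>A ?v) \<otimes>\<^sub>A f k"
  using B0_closed[OF p] B0_closed[OF 1(1)] B0_closed[OF 2(1)] f_closed[OF k]
  by (simp add: a_minus_def A.l_distr A.l_minus A.m_assoc)
 finally show "R.bar_diff ph (map emb bs) \<one>\<^sub>G = BI.T.bar_diff ph0 bs 0 \<otimes>\<^sub>A f k" unfolding e .
qed

text \<open>The family of degrees of cochains on A/AB_+ whose component at f_g is shifted by the degree of f_g.\<close>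
definition wt :: "int \<times> 'g => 'g => int \<times> 'g" where "wt ka g = (int (dg g), g) \<otimes>\<^sub>GA ka"

lemma wt_weight: "ka \<in> carrier GA ==> R.weight (wt ka)"
 using family_weight[of ka] unfolding wt_def .

lemma wt_one: "k \<in> carrier G ==> wt (j, k) \<one>\<^sub>G = (j, k)"
 by (simp add: wt_def GA_simps dg_one)

lemma dA_iff: "x \<in> dA t \<longleftrightarrow> x \<in> iA (fst t) \<and> x \<in> gr (snd t)"
 by (simp add: split_beta)

definition restr :: "'g => (((int \<times> 'g) \<times> 'a) list => 'g => 'a) => (int \<times> 'a) list => nat => 'a" where
 "restr k ph cs x = rdiv k (ph (map emb cs) \<one>\<^sub>G)"

lemma restr_lifts:
 assumes k: "k \<in> carrier G" and h: "R.homog \<one>\<^sub>GA (wt (j, k)) n ph"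
 shows "lifts k n ph (restr k ph)" "BI.T.homog 0 (\<lambda>_. j - int (dg k)) n (restr k ph)"
  "cs \<in> BI.T.words n ==> ph (map emb cs) \<one>\<^sub>G \<in> gr k"
proof -
 have m: "ph (map emb cs) \<one>\<^sub>G \<in> gr k" "ph (map emb cs) \<one>\<^sub>G \<in> iA (BI.T.tot cs + j)" if "cs \<in> BI.T.words n" for cs
 proof -
  have e: "\<one>\<^sub>GA \<otimes>\<^sub>GA (R.tot (map emb cs) \<otimes>\<^sub>GA wt (j, k) \<one>\<^sub>G) = (BI.T.tot cs + j, k)"
   unfolding wt_one[OF k] emb_tot using k by (simp add: GA_simps)
  have "ph (map emb cs) \<one>\<^sub>G \<in> dA (BI.T.tot cs + j, k)"
   using R.homogD[OF h emb_words[THEN iffD1, OF that] G.one_closed] unfolding e .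
  then show "ph (map emb cs) \<one>\<^sub>G \<in> gr k" "ph (map emb cs) \<one>\<^sub>G \<in> iA (BI.T.tot cs + j)" by simp_all
 qed
 show "lifts k n ph (restr k ph)" unfolding lifts_def restr_def
  by (intro ballI conjI) (rule rdiv(1)[OF k m(1)] rdiv(2)[OF k m(1), symmetric], assumption)+
 show "BI.T.homog 0 (\<lambda>_. j - int (dg k)) n (restr k ph)"
  unfolding BI.T.homog_def
 proof (intro ballI)
  fix cs x assume c: "cs \<in> BI.T.words n"
  have "rdiv k (ph (map emb cs) \<one>\<^sub>G) \<in> iA (BI.T.tot cs + j - int (dg k))" by (rule rdiv_degree[OF k m(1)[OF c] m(2)[OF c]])
  then show "restr k ph cs x \<in> Bc.iA (0 \<otimes>\<^sub>integer_group (BI.T.tot cs \<otimes>\<^sub>integer_group (j - int (dg k))))"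
   unfolding iB_iff restr_def BI_one add_0 add_diff_eq using rdiv(1)[OF k m(1)[OF c]] by (rule conjI)
 qed
 show "cs \<in> BI.T.words n ==> ph (map emb cs) \<one>\<^sub>G \<in> gr k" by (rule m(1))
qed

lemma restr_multilin:
 assumes k: "k \<in> carrier G" and h: "R.homog \<one>\<^sub>GA (wt (j, k)) n ph" and ml: "R.multilin n ph"
 shows "BI.T.multilin n (restr k ph)"
proof (rule BI.T.multilinI)
 note l = restr_lifts[OF k h]
 show "BI.T.vals n (restr k ph)" using l(1) unfolding BI.T.vals_def lifts_def by simp
 fix us vs i l t a b c and x :: nat
 assume s: "us \<in> BI.T.words i" "vs \<in> BI.T.words l" "i + l + 1 = n" "t \<in> carrier integer_group" "a \<in> Bc.iA t" "b \<in> Bc.iA t"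
  "c \<in> carrier K" "x \<in> {0}"
 have "us @ (t, y) # vs \<in> BI.T.words n" if "y \<in> Bc.iA t" for y using s(1-3) that by (auto simp: BI.T.words_def)
 then have y: "ph (map emb us @ ((t, \<one>\<^sub>G), y) # map emb vs) \<one>\<^sub>G \<in> gr k" if "y \<in> Bc.iA t" for y
  using l(3)[of "us @ (t, y) # vs"] that by (simp add: emb_def)
 have "ph (map emb us @ ((t, \<one>\<^sub>G), c \<odot>\<^sub>A a \<oplus>\<^sub>A b) # map emb vs) \<one>\<^sub>G =
   c \<odot>\<^sub>A ph (map emb us @ ((t, \<one>\<^sub>G), a) # map emb vs) \<one>\<^sub>G \<oplus>\<^sub>A ph (map emb us @ ((t, \<one>\<^sub>G), b) # map emb vs) \<one>\<^sub>G"
  using s emb_words by (intro R.multilinD[OF ml, of _ i _ l]) (simp_all add: GA_simps iB_iff)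
 then show "restr k ph (us @ (t, c \<odot>\<^sub>BB a \<oplus>\<^sub>BB b) # vs) x =
   c \<odot>\<^sub>BB restr k ph (us @ (t, a) # vs) x \<oplus>\<^sub>BB restr k ph (us @ (t, b) # vs) x"
  using rdiv_linear[OF k y[OF s(5)] y[OF s(6)] s(7)] by (simp add: restr_def emb_def)
qed

definition extd :: "'g => ((int \<times> 'a) list => nat => 'a) => ((int \<times> 'g) \<times> 'a) list => 'g => 'a" where
 "extd k ps as x = (if x = \<one>\<^sub>G \<and> (\<forall>p\<in>set as. snd (fst p) = \<one>\<^sub>G) then ps (map unemb as) 0 \<otimes>\<^sub>A f k else \<zero>\<^sub>A)"

lemma unemb_words: assumes "as \<in> R.words n" "\<forall>p\<in>set as. snd (fst p) = \<one>\<^sub>G" shows "map unemb as \<in> BI.T.words n" "R.tot as = (BI.T.tot (map unemb as), \<one>\<^sub>G)"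
proof -
 have e: "map emb (map unemb as) = as" using assms(2) by (auto simp: emb_unemb intro!: map_idI)
 show "map unemb as \<in> BI.T.words n" using assms(1) unfolding emb_words e .
 show "R.tot as = (BI.T.tot (map unemb as), \<one>\<^sub>G)" using emb_tot[of "map unemb as"] unfolding e .
qed

lemma extd_homog:
 assumes k: "k \<in> carrier G" and h: "BI.T.homog 0 (\<lambda>_. j - int (dg k)) n ps"
 shows "R.homog \<one>\<^sub>GA (wt (j, k)) n (extd k ps)"
 unfolding R.homog_def
proof (intro ballI)
 fix as x assume a: "as \<in> R.words n" "x \<in> carrier G"
 show "extd k ps as x \<in> dA (\<one>\<^sub>GA \<otimes>\<^sub>GA (R.tot as \<otimes>\<^sub>GA wt (j, k) x))"
 proof (cases "x = \<one>\<^sub>G \<and> (\<forall>p\<in>set as. snd (fst p) = \<one>\<^sub>G)")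
  case True
  note u = unemb_words[OF a(1) conjunct2[OF True]]
  have "ps (map unemb as) 0 \<in> Bc.iA (0 \<otimes>\<^sub>integer_group (BI.T.tot (map unemb as) \<otimes>\<^sub>integer_group (j - int (dg k))))"
   by (rule BI.T.homogD[OF h u(1)]) simp
  then have b: "ps (map unemb as) 0 \<in> iA (BI.T.tot (map unemb as) + (j - int (dg k)))" "ps (map unemb as) 0 \<in> B0" by (simp_all add: iB_iff)
  have 1: "ps (map unemb as) 0 \<otimes>\<^sub>A f k \<in> gr k" using gr_mult[OF G.one_closed k b(2) f_gr[OF k]] unfolding G.l_one[OF k] .
  have "ps (map unemb as) 0 \<otimes>\<^sub>A f k \<in> iA (BI.T.tot (map unemb as) + (j - int (dg k)) + int (dg k))"
   by (rule iA_mult[OF b(1)]) (simp add: f_deg k)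
  then have 2: "ps (map unemb as) 0 \<otimes>\<^sub>A f k \<in> dA (BI.T.tot (map unemb as) + j, k)" using 1 by simp
  have e: "\<one>\<^sub>GA \<otimes>\<^sub>GA (R.tot as \<otimes>\<^sub>GA wt (j, k) x) = (BI.T.tot (map unemb as) + j, k)"
   unfolding conjunct1[OF True] wt_one[OF k] u(2) using k by (simp add: GA_simps)
  show ?thesis using 2 unfolding e extd_def if_P[OF True] .
 next
  case False
  have "(j, k) \<in> carrier GA" using k by (simp add: GA_simps)
  note R.weightD(1)[OF wt_weight[OF this] a(2)]
  then have "\<one>\<^sub>GA \<otimes>\<^sub>GA (R.tot as \<otimes>\<^sub>GA wt (j, k) x) \<in> carrier GA"
   by (intro Q.T.Gr.m_closed Q.T.Gr.one_closed R.tot_closed[OF a(1)] \<open>wt (j, k) x \<in> carrier GA\<close>)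
  then show ?thesis unfolding extd_def if_not_P[OF False] by (rule R.dA_zero)
 qed
qed

lemma extd_multilin:
 assumes k: "k \<in> carrier G" and ml: "BI.T.multilin n ps"
 shows "R.multilin n (extd k ps)"
proof (rule R.multilinI)
 have v: "ps bs 0 \<in> B0" if "bs \<in> BI.T.words n" for bs using BI.T.vals_D[OF BI.T.multilin_vals[OF ml] that, of 0] by simp
 show "R.vals n (extd k ps)" unfolding R.vals_def
 proof (intro ballI)
  fix as x assume a: "as \<in> R.words n" "x \<in> carrier G"
  show "extd k ps as x \<in> carrier A"
  proof (cases "x = \<one>\<^sub>G \<and> (\<forall>p\<in>set as. snd (fst p) = \<one>\<^sub>G)")
   case True
   show ?thesis unfolding extd_def if_P[OF True]
    by (rule A.m_closed[OF B0_closed[OF v[OF unemb_words(1)[OF a(1) conjunct2[OF True]]]] f_closed[OF k]])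
  next
   case False
   show ?thesis unfolding extd_def if_not_P[OF False] by (rule A.zero_closed)
  qed
 qed
 fix us vs i l t a b c x
 assume s: "us \<in> R.words i" "vs \<in> R.words l" "i + l + 1 = n" "t \<in> carrier GA" "a \<in> dA t" "b \<in> dA t" "c \<in> carrier K" "x \<in> carrier G"
 show "extd k ps (us @ (t, c \<odot>\<^sub>A a \<oplus>\<^sub>A b) # vs) x = c \<odot>\<^sub>A extd k ps (us @ (t, a) # vs) x \<oplus>\<^sub>A extd k ps (us @ (t, b) # vs) x"
 proof (cases "x = \<one>\<^sub>G \<and> (\<forall>p\<in>set us. snd (fst p) = \<one>\<^sub>G) \<and> (\<forall>p\<in>set vs. snd (fst p) = \<one>\<^sub>G) \<and> snd t = \<one>\<^sub>G")
  case True
  have w: "map unemb us \<in> BI.T.words i" "map unemb vs \<in> BI.T.words l" using unemb_words(1) s True by auto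
  have ab: "a \<in> Bc.iA (fst t)" "b \<in> Bc.iA (fst t)" using s(5,6) True unfolding dA_iff iB_iff by auto
  have e: "extd k ps (us @ (t, y) # vs) x = ps (map unemb us @ (fst t, y) # map unemb vs) 0 \<otimes>\<^sub>A f k" for y
  proof -
   have u: "x = \<one>\<^sub>G \<and> (\<forall>p\<in>set (us @ (t, y) # vs). snd (fst p) = \<one>\<^sub>G)" using True by (simp add: ball_Un)
   show ?thesis unfolding extd_def if_P[OF u] by (simp only: map_append list.map unemb_def fst_conv snd_conv)
  qed
  have m: "ps (map unemb us @ (fst t, c \<odot>\<^sub>A a \<oplus>\<^sub>A b) # map unemb vs) 0 =
    c \<odot>\<^sub>A ps (map unemb us @ (fst t, a) # map unemb vs) 0 \<oplus>\<^sub>A ps (map unemb us @ (fst t, b) # map unemb vs) 0"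
   using BI.T.multilinD[OF ml w s(3), of "fst t" a b c 0] ab s(7) by simp
  have "map unemb us @ (fst t, y) # map unemb vs \<in> BI.T.words n" if "y \<in> Bc.iA (fst t)" for y
   using w s(3) that by (auto simp: BI.T.words_def)
  from B0_closed[OF v[OF this[OF ab(1)]]] B0_closed[OF v[OF this[OF ab(2)]]]
  show ?thesis unfolding e m using s(7) f_closed[OF k] by (simp add: A.l_distr Q.smult_assoc_l del: BB_simps)
 next
  case False
  then have "extd k ps (us @ (t, y) # vs) x = \<zero>\<^sub>A" for y by (auto simp: extd_def)
  then show ?thesis using s(7) by (simp add: V.smult_r_null)
 qed
qed

lemma extd_lifts: assumes "BI.T.multilin n ps" shows "lifts k n (extd k ps) ps"
 unfolding lifts_def
proof (intro ballI conjI)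
 fix cs assume c: "cs \<in> BI.T.words n"
 show "ps cs 0 \<in> B0" using BI.T.vals_D[OF BI.T.multilin_vals[OF assms] c, of 0] by simp
 have "\<forall>p\<in>set (map emb cs). snd (fst p) = \<one>\<^sub>G" by (simp add: emb_def)
 then show "extd k ps (map emb cs) \<one>\<^sub>G = ps cs 0 \<otimes>\<^sub>A f k" unfolding extd_def unemb_emb(2) by (intro if_P conjI refl)
qed

text \<open>By freeness Ext over A of A/AB_+ is Ext over B of K with values in A; the component of G-degree k of the latter
is the copy B f_k of B, shifted by the degree of f_k.\<close>
lemma family_acyclic:
 assumes k: "k \<in> carrier G" and ac: "BI.T.acyclic (\<lambda>_. j - int (dg k)) n"
 shows "R.acyclic (wt (j, k)) n"
 unfolding R.acyclic_def
proof (intro allI impI)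
 fix ph assume coc: "R.cocycle (wt (j, k)) n ph"
 then have ml: "R.multilin n ph" and h: "R.homog \<one>\<^sub>GA (wt (j, k)) n ph"
  and Z: "!!as x. as \<in> R.words (Suc n) ==> x \<in> carrier G ==> R.bar_diff ph as x = \<zero>\<^sub>A"
  by (auto simp: R.cocycle_def R.cochain_def R.agree_def)
 note l = restr_lifts[OF k h]
 have w: "R.weight (wt (j, k))" using k by (intro wt_weight) (simp add: GA_simps)
 have "BI.T.bar_diff (restr k ph) bs 0 = \<zero>\<^sub>A" if b: "bs \<in> BI.T.words (Suc n)" for bs
 proof -
  have "BI.T.bar_diff (restr k ph) bs 0 \<otimes>\<^sub>A f k = \<zero>\<^sub>A"
   unfolding lifts_diff(2)[OF k l(1) b, symmetric] by (rule Z[OF emb_words[THEN iffD1, OF b] G.one_closed])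
  from dom_mult[OF B0_closed[OF lifts_diff(1)[OF k l(1) b]] f_closed[OF k] this] show ?thesis using f_nz[OF k] by blast
 qed
 then have "BI.T.cocycle (\<lambda>_. j - int (dg k)) n (restr k ph)"
  unfolding BI.T.cocycle_def BI.T.cochain_def BI.T.agree_def using restr_multilin[OF k h ml] l(2) by (simp only: BI_one BB_simps singleton_iff) simp
 then have bd: "BI.T.boundary (\<lambda>_. j - int (dg k)) n (restr k ph)" using ac BI.T.acyclic_def by blast
 show "R.boundary (wt (j, k)) n ph"
 proof (cases n)
  case 0
  have r: "restr k ph [] 0 = \<zero>\<^sub>A" using bd by (simp add: 0 BI.T.boundary_def BI.T.agree_def)
  have "ph (map emb []) \<one>\<^sub>G = restr k ph [] 0 \<otimes>\<^sub>A f k" using l(1)[unfolded lifts_def, THEN bspec, of "[]"] 0 by simp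
  then have "ph [] \<one>\<^sub>G = \<zero>\<^sub>A" unfolding r using f_closed[OF k] by simp
  then have "ph [] x = \<zero>\<^sub>A" if "x \<in> carrier G" for x
   using FE.restriction_detects_zero[where ph = ph] Z[unfolded 0] R.multilin_vals[OF ml, unfolded 0] that by (metis One_nat_def)
  then show ?thesis by (simp add: 0 R.boundary_def R.agree_def)
 next
  case (Suc i)
  obtain ps where p: "BI.T.multilin i ps" "BI.T.homog 0 (\<lambda>_. j - int (dg k)) i ps" "BI.T.agree (Suc i) (BI.T.bar_diff ps) (restr k ph)"
   using bd by (auto simp: Suc BI.T.boundary_def BI.T.cochain_def)
  have "\<exists>\<chi>. R.multilin i \<chi> \<and> R.homog \<one>\<^sub>GA (wt (j, k)) i \<chi> \<and> R.agree (Suc i) (R.bar_diff \<chi>) ph"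
  proof (rule FE.restriction_detects_boundaries[where ps = "extd k ps"])
   show "R.multilin (Suc i) ph" "R.homog \<one>\<^sub>GA (wt (j, k)) (Suc i) ph" using ml h by (simp_all only: Suc)
   show "R.weight (wt (j, k))" by (rule w)
   show "R.bar_diff ph as x = \<zero>\<^sub>A" if "as \<in> R.words (Suc (Suc i))" "x \<in> carrier G" for as x using Z that by (simp only: Suc)
   show "R.multilin i (extd k ps)" by (rule extd_multilin[OF k p(1)])
   show "R.homog \<one>\<^sub>GA (wt (j, k)) i (extd k ps)" by (rule extd_homog[OF k p(2)])
   fix bs assume "bs \<in> FE.words0 (Suc i)"
   then obtain cs where c: "cs \<in> BI.T.words (Suc i)" "bs = map emb cs" using emb_words0 by blast
   have "R.bar_diff (extd k ps) bs \<one>\<^sub>G = BI.T.bar_diff ps cs 0 \<otimes>\<^sub>A f k"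
    unfolding c(2) by (rule lifts_diff(2)[OF k extd_lifts[OF p(1)] c(1)])
   also have "BI.T.bar_diff ps cs 0 = restr k ph cs 0" using BI.T.agreeD[OF p(3) c(1)] by simp
   also have "\<dots> \<otimes>\<^sub>A f k = ph bs \<one>\<^sub>G"
    unfolding c(2) by (rule conjunct2[OF l(1)[unfolded Suc lifts_def, THEN bspec, OF c(1)], symmetric])
   finally show "R.bar_diff (extd k ps) bs \<one>\<^sub>G = ph bs \<one>\<^sub>G" .
  qed
  then show ?thesis by (simp add: Suc R.boundary_def R.cochain_def)
 qed
qed

end

section \<open>The degree pairing and leading coefficients\<close>

context dual_reflection_data
begin

text \<open>At k = g^-1 m the layer of g sees the G-degree m of the one-dimensional group Ext^d(K,A). If the
internal degrees did not match, the group over B would vanish there, the family would be exact, and so would the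
layer, although Ext^d(K,A) is nonzero.\<close>
lemma degree_pairing:
 assumes ExtA: "!!i j. i ~= d ==> carrier (Ext_trivial K A Adeg i j) = {zero (Ext_trivial K A Adeg i j)}"
  and ExtB: "!!j. j ~= s ==> carrier (Ext_trivial K BB Bdeg d j) = {zero (Ext_trivial K BB Bdeg d j)}"
  and m: "m \<in> carrier G"
  and nz: "\<not> carrier (Ext_trivial_G K A Adeg G gr d (a, m)) \<subseteq> {zero (Ext_trivial_G K A Adeg G gr d (a, m))}"
  and g: "g \<in> carrier G"
 shows "a - int (dg g) - int (dg (inv\<^bsub>G\<^esub> g \<otimes>\<^sub>G m)) = s"
proof (rule ccontr)
 define k where "k = inv\<^bsub>G\<^esub> g \<otimes>\<^sub>G m"
 define j where "j = a - int (dg g)"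
 assume "a - int (dg g) - int (dg (inv\<^bsub>G\<^esub> g \<otimes>\<^sub>G m)) ~= s"
 then have ne: "j - int (dg k) ~= s" by (simp add: k_def j_def)
 have k: "k \<in> carrier G" using g m by (simp add: k_def)
 interpret CB: coarsened K BB Bdeg integer_group Bc.iA integer_group Bc.iA id by (rule BI.coarsened_id)
 interpret CA: coarsened K A Adeg GA dA integer_group iA fst by (rule coarse)
 have "BI.T.acyclic (\<lambda>_. j - int (dg k)) d"
  using ExtB[OF ne] by (intro CB.acyclic_of_Ext) (simp_all add: Ext_trivial_def)
 then have fam: "R.acyclic (wt (j, k)) d" by (rule family_acyclic[OF k])
 have triv: "Q.T.acyclic (\<lambda>_. ka) n" if "ka \<in> carrier GA" "n ~= d" for ka n
  using ExtA[OF that(2), of "fst ka"] that(1) by (intro CA.acyclic_of_Ext) (simp_all add: Ext_trivial_def)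
 have w: "R.weight (wt (j, k))" using k by (intro wt_weight) (simp add: GA_simps)
 have "Q.T.acyclic (\<lambda>_. wt (j, k) g) d"
 proof (rule FA.acyclic_layer[OF w fam g])
  fix x assume "x \<in> carrier G"
  then show "Q.T.acyclic (\<lambda>_. wt (j, k) x) (Suc d)" using R.weightD(1)[OF w] by (intro triv) auto
 next
  fix x e assume "x \<in> carrier G" "d = Suc e"
  then show "Q.T.acyclic (\<lambda>_. wt (j, k) x) e" using R.weightD(1)[OF w] by (intro triv) auto
 qed
 moreover have "wt (j, k) g = (a, m)" using g m by (simp add: wt_def GA_simps k_def j_def G.m_assoc[symmetric])
 ultimately have "Q.T.acyclic (\<lambda>_. (a, m)) d" by simp
 from Q.Ext_of_acyclic[OF this] have "carrier (Ext_trivial_G K A Adeg G gr d (a, m)) \<subseteq> {zero (Ext_trivial_G K A Adeg G gr d (a, m))}"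
  using m by (simp add: Ext_trivial_G_def GA_simps Let_def)
 then show False using nz by blast
qed

text \<open>The coordinates of an element modulo the ideal generated by the fixed elements of positive degree.\<close>
definition co :: "'a => 'g => 'k" where "co x g = aug (ldiv g (Gd.proj g x))"
definition cc :: "'g => 'g => 'k" where "cc g h = co (f g \<otimes>\<^sub>A f h) (g \<otimes>\<^sub>G h)"

text \<open>The component of lowest degree in A_g is spanned by f_g, so left and right division by f_g have the
same augmentation.\<close>
lemma leading_component:
 assumes g: "g \<in> carrier G" and y: "y \<in> gr g"
 shows "N.proj (dg g) y = aug (ldiv g y) \<odot>\<^sub>A f g" "N.proj (dg g) y = aug (rdiv g y) \<odot>\<^sub>A f g"
proof -
 have c: "ldiv g y \<in> carrier A" "rdiv g y \<in> carrier A" "f g \<in> carrier A"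
  using ldiv(1)[OF g y] rdiv(1)[OF g y] B0_closed f_closed[OF g] by blast+
 have "N.proj (dg g + 0) (f g \<otimes>\<^sub>A ldiv g y) = f g \<otimes>\<^sub>A N.proj 0 (ldiv g y)" by (rule degree_lmult(1)[OF f_deg[OF g] c(1)])
 then show "N.proj (dg g) y = aug (ldiv g y) \<odot>\<^sub>A f g"
  unfolding ldiv(2)[OF g y] Q.aug_proj[OF c(1)] using c by (simp add: Q.smult_assoc_r)
 have "N.proj (0 + dg g) (rdiv g y \<otimes>\<^sub>A f g) = N.proj 0 (rdiv g y) \<otimes>\<^sub>A f g" by (rule iproj_rmult[OF f_deg[OF g] c(2)])
 then show "N.proj (dg g) y = aug (rdiv g y) \<odot>\<^sub>A f g"
  unfolding rdiv(2)[OF g y] Q.aug_proj[OF c(2)] using c by (simp add: Q.smult_assoc_l)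
qed

lemma smult_f_inj: assumes "g \<in> carrier G" "c \<in> carrier K" "d \<in> carrier K" "c \<odot>\<^sub>A f g = d \<odot>\<^sub>A f g" shows "c = d"
proof -
 have "f g \<otimes>\<^sub>A (c \<odot>\<^sub>A \<one>\<^sub>A) = f g \<otimes>\<^sub>A (d \<odot>\<^sub>A \<one>\<^sub>A)"
  using assms f_closed[OF assms(1)] by (simp add: Q.smult_assoc_r)
 then have "c \<odot>\<^sub>A \<one>\<^sub>A = d \<odot>\<^sub>A \<one>\<^sub>A"
  using cancel_left[OF f_closed[OF assms(1)] _ _ f_nz[OF assms(1)], of "c \<odot>\<^sub>A \<one>\<^sub>A" "d \<odot>\<^sub>A \<one>\<^sub>A"] assms(2,3) by simp
 then show ?thesis by (rule Q.smult_one_inj[OF assms(2,3)])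
qed

lemma aug_ldiv_closed: "g \<in> carrier G ==> y \<in> gr g ==> aug (ldiv g y) \<in> carrier K"
 by (rule Q.aug_closed[OF B0_closed[OF ldiv(1)]])

lemma aug_ldiv_rdiv: assumes "g \<in> carrier G" "y \<in> gr g" shows "aug (ldiv g y) = aug (rdiv g y)"
 using leading_component[OF assms] aug_ldiv_closed[OF assms] Q.aug_closed[OF B0_closed[OF rdiv(1)[OF assms]]]
 by (intro smult_f_inj[OF assms(1)]) simp_all

lemma co_closed [simp]: "x \<in> carrier A ==> g \<in> carrier G ==> co x g \<in> carrier K"
 unfolding co_def by (rule aug_ldiv_closed[OF _ Gd.proj_in])

lemma co_linear:
 assumes "x \<in> carrier A" "y \<in> carrier A" "c \<in> carrier K" "g \<in> carrier G"
 shows "co (c \<odot>\<^sub>A x \<oplus>\<^sub>A y) g = c \<otimes>\<^sub>K co x g \<oplus>\<^sub>K co y g"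
 unfolding co_def Gd.proj_linear[OF assms] ldiv_linear[OF assms(4) Gd.proj_in[OF assms(1,4)] Gd.proj_in[OF assms(2,4)] assms(3)]
 by (rule Q.aug_linear[OF B0_closed[OF ldiv(1)[OF assms(4) Gd.proj_in[OF assms(1,4)]]] B0_closed[OF ldiv(1)[OF assms(4) Gd.proj_in[OF assms(2,4)]]] assms(3)])

lemma ldiv_zero: "g \<in> carrier G ==> ldiv g \<zero>\<^sub>A = \<zero>\<^sub>A"
 by (rule ldiv_eq) (simp_all add: Gd.W_zero f_closed)

lemma co_hom: assumes "h \<in> carrier G" "x \<in> gr h" "g \<in> carrier G" shows "co x g = (if g = h then aug (ldiv h x) else \<zero>\<^sub>K)"
 unfolding co_def Gd.proj_hom[OF assms] using ldiv_zero[OF assms(3)] aug_zero by (cases "g = h") simp_all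

lemma co_zero [simp]: "g \<in> carrier G ==> co \<zero>\<^sub>A g = \<zero>\<^sub>K"
 by (simp add: co_def ldiv_zero aug_zero)

lemma co_add: "x \<in> carrier A ==> y \<in> carrier A ==> g \<in> carrier G ==> co (x \<oplus>\<^sub>A y) g = co x g \<oplus>\<^sub>K co y g"
 using co_linear[of x y "\<one>\<^sub>K" g] by simp

lemma co_smult: "x \<in> carrier A ==> c \<in> carrier K ==> g \<in> carrier G ==> co (c \<odot>\<^sub>A x) g = c \<otimes>\<^sub>K co x g"
 using co_linear[of x "\<zero>\<^sub>A" c g] by simp

lemma ldiv_f: "h \<in> carrier G ==> ldiv h (f h) = \<one>\<^sub>A"
 by (rule ldiv_eq) (simp_all add: one_gr f_closed)

lemma co_f: "h \<in> carrier G ==> g \<in> carrier G ==> co (f h) g = (if g = h then \<one>\<^sub>K else \<zero>\<^sub>K)"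
 using co_hom[OF _ f_gr, of h g] ldiv_f[of h] by simp

lemma cc_closed [simp]: "g \<in> carrier G ==> h \<in> carrier G ==> cc g h \<in> carrier K"
 by (simp add: cc_def f_closed)

lemma ff_gr: "g \<in> carrier G ==> h \<in> carrier G ==> f g \<otimes>\<^sub>A f h \<in> gr (g \<otimes>\<^sub>G h)"
 by (simp add: gr_mult f_gr)

text \<open>The coordinates multiply like a twisted group algebra; left coefficients can be moved to the right
because their augmentation does not change.\<close>
lemma co_mult_hom:
 assumes h: "h \<in> carrier G" and k: "k \<in> carrier G" and x: "x \<in> gr h" and y: "y \<in> gr k" and g: "g \<in> carrier G"
 shows "co (x \<otimes>\<^sub>A y) g = (if g = h \<otimes>\<^sub>G k then co x h \<otimes>\<^sub>K co y k \<otimes>\<^sub>K cc h k else \<zero>\<^sub>K)"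
proof -
 let ?p = "h \<otimes>\<^sub>G k"
 have p: "?p \<in> carrier G" using h k by simp
 define x' y' z where d: "x' = rdiv h x" "y' = ldiv k y" "z = ldiv ?p (f h \<otimes>\<^sub>A f k)"
 have x': "x' \<in> B0" "x' \<otimes>\<^sub>A f h = x" unfolding d by (rule rdiv[OF h x])+
 have y': "y' \<in> B0" "f k \<otimes>\<^sub>A y' = y" unfolding d by (rule ldiv[OF k y])+
 have z: "z \<in> B0" "f ?p \<otimes>\<^sub>A z = f h \<otimes>\<^sub>A f k" unfolding d by (rule ldiv[OF p ff_gr[OF h k]])+
 have w: "x' \<otimes>\<^sub>A f ?p \<in> gr ?p" using gr_mult[OF G.one_closed p x'(1) f_gr[OF p]] p by simp
 define x'' where "x'' = ldiv ?p (x' \<otimes>\<^sub>A f ?p)"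
 have x'': "x'' \<in> B0" "f ?p \<otimes>\<^sub>A x'' = x' \<otimes>\<^sub>A f ?p" unfolding x''_def by (rule ldiv[OF p w])+
 have ax: "aug x'' = aug x'" unfolding x''_def aug_ldiv_rdiv[OF p w] by (rule arg_cong[OF rdiv_eq[OF p x'(1) refl]])
 note c = B0_closed[OF x'(1)] B0_closed[OF y'(1)] B0_closed[OF z(1)] B0_closed[OF x''(1)] f_closed[OF h] f_closed[OF k] f_closed[OF p]
 have "x \<otimes>\<^sub>A y = x' \<otimes>\<^sub>A ((f h \<otimes>\<^sub>A f k) \<otimes>\<^sub>A y')"
  unfolding x'(2)[symmetric] y'(2)[symmetric] using c by (simp add: A.m_assoc)
 also have "\<dots> = (x' \<otimes>\<^sub>A f ?p) \<otimes>\<^sub>A (z \<otimes>\<^sub>A y')" unfolding z(2)[symmetric] using c by (simp add: A.m_assoc)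
 also have "\<dots> = f ?p \<otimes>\<^sub>A (x'' \<otimes>\<^sub>A (z \<otimes>\<^sub>A y'))" unfolding x''(2)[symmetric] using c by (simp add: A.m_assoc)
 finally have "ldiv ?p (x \<otimes>\<^sub>A y) = x'' \<otimes>\<^sub>A (z \<otimes>\<^sub>A y')"
  using B0_mult x'(1) x''(1) y'(1) z(1) by (intro ldiv_eq[OF p]) simp_all
 then have "aug (ldiv ?p (x \<otimes>\<^sub>A y)) = aug x' \<otimes>\<^sub>K aug y' \<otimes>\<^sub>K aug z"
  using c by (simp add: Q.aug_mult ax m_ac)
 moreover have "co x h = aug x'" "co y k = aug y'" "cc h k = aug z"
  using co_hom[OF h x h] co_hom[OF k y k] co_hom[OF p ff_gr[OF h k] p] aug_ldiv_rdiv[OF h x] unfolding d cc_def by simp_all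
 ultimately show ?thesis using co_hom[OF p gr_mult[OF h k x y] g] by simp
qed

lemma co_mult_vanish:
 assumes x: "x \<in> carrier A" and y: "y \<in> carrier A" and g: "g \<in> carrier G"
  and z: "!!h k. h \<in> carrier G ==> k \<in> carrier G ==> h \<otimes>\<^sub>G k = g ==> co x h \<otimes>\<^sub>K co y k \<otimes>\<^sub>K cc h k = \<zero>\<^sub>K"
 shows "co (x \<otimes>\<^sub>A y) g = \<zero>\<^sub>K"
proof -
 have pr: "co (Gd.proj h x) h = co x h" if "h \<in> carrier G" "x \<in> carrier A" for h x
  using Gd.proj_hom[OF that(1) Gd.proj_in[OF that(2,1)] that(1)] by (simp add: co_def)
 have "y \<in> {y \<in> carrier A. co (x \<otimes>\<^sub>A y) g = \<zero>\<^sub>K}"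
 proof (rule Gd.in_submodule_of_proj[OF y])
  fix k assume k: "k \<in> carrier G"
  let ?y = "Gd.proj k y"
  have yc: "?y \<in> carrier A" using y k by simp
  have "x \<in> {x \<in> carrier A. co (x \<otimes>\<^sub>A ?y) g = \<zero>\<^sub>K}"
  proof (rule Gd.in_submodule_of_proj[OF x])
   fix h assume h: "h \<in> carrier G"
   have "co (Gd.proj h x \<otimes>\<^sub>A ?y) g = \<zero>\<^sub>K"
    using co_mult_hom[OF h k Gd.proj_in[OF x h] Gd.proj_in[OF y k] g] z[OF h k] pr[OF h x] pr[OF k y] by simp
   then show "Gd.proj h x \<in> {x \<in> carrier A. co (x \<otimes>\<^sub>A ?y) g = \<zero>\<^sub>K}" using x h by simp
  qed (use yc g in \<open>auto simp: A.l_distr co_add\<close>)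
  then show "?y \<in> {y \<in> carrier A. co (x \<otimes>\<^sub>A y) g = \<zero>\<^sub>K}" using yc by simp
 qed (use x g in \<open>auto simp: A.r_distr co_add\<close>)
 then show ?thesis by simp
qed

text \<open>Modulo elements with zero coordinates every element is a combination of the f_g.\<close>
lemma mod_induct:
 assumes x: "x \<in> carrier A" and S: "S \<subseteq> carrier A" "!!x y. x \<in> S ==> y \<in> S ==> x \<oplus>\<^sub>A y \<in> S"
  and f: "!!c g. c \<in> carrier K ==> g \<in> carrier G ==> c \<odot>\<^sub>A f g \<in> S"
  and N: "!!x. x \<in> carrier A ==> \<forall>g\<in>carrier G. co x g = \<zero>\<^sub>K ==> x \<in> S"
 shows "x \<in> S"
proof (rule Gd.in_submodule_of_proj[OF x _ S(2,1)])
 show "\<zero>\<^sub>A \<in> S" by (rule N) simp_all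
 fix g assume g: "g \<in> carrier G"
 let ?y = "Gd.proj g x" and ?c = "co x g"
 have c: "?c \<in> carrier K" "?y \<in> carrier A" "f g \<in> carrier A" "?y \<in> gr g" using x g f_closed Gd.proj_in by auto
 let ?n = "(\<ominus>\<^sub>K ?c) \<odot>\<^sub>A f g \<oplus>\<^sub>A ?y"
 have "co ?n h = \<zero>\<^sub>K" if "h \<in> carrier G" for h
  using c that g co_linear[of "f g" ?y "\<ominus>\<^sub>K ?c" h] co_f[OF g that] co_hom[OF g c(4) that]
  by (simp add: co_def[of x] l_neg)
 then have "?n \<in> S" using c by (intro N) simp_all
 moreover have "?c \<odot>\<^sub>A f g \<oplus>\<^sub>A ?n = ?y" using c by (simp add: V.smult_l_minus A.r_neg2)
 ultimately show "?y \<in> S" using S(2)[OF f[OF c(1) g]] by metis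
qed

lemma iA_fg: "g \<in> carrier G ==> h \<in> carrier G ==> f g \<otimes>\<^sub>A f h \<in> Adeg (dg g + dg h)"
 by (rule deg_mult[OF f_deg f_deg])

lemma ff_nz: "g \<in> carrier G ==> h \<in> carrier G ==> f g \<otimes>\<^sub>A f h ~= \<zero>\<^sub>A"
 using dom_mult[of "f g" "f h"] f_nz f_closed by blast

lemma co_degree: assumes "x \<in> Adeg i" "g \<in> carrier G" "dg g ~= i" shows "co x g = \<zero>\<^sub>K"
proof -
 have y: "Gd.proj g x \<in> gr g" "Gd.proj g x \<in> Adeg i" using gproj_deg[OF assms(1,2)] by blast+
 have "ldiv g (Gd.proj g x) \<in> iA (int i - int (dg g))" using y by (intro ldiv_degree[OF assms(2)]) simp_all
 then show ?thesis unfolding co_def using assms(3) by (intro aug_negdeg) auto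
qed

lemma dg_subadd: assumes "g \<in> carrier G" "h \<in> carrier G" shows "dg (g \<otimes>\<^sub>G h) \<le> dg g + dg h"
proof (rule ccontr)
 let ?p = "g \<otimes>\<^sub>G h" and ?b = "ldiv (g \<otimes>\<^sub>G h) (f g \<otimes>\<^sub>A f h)"
 assume n: "\<not> dg ?p \<le> dg g + dg h"
 have p: "?p \<in> carrier G" using assms by simp
 have "?b \<in> iA (int (dg g + dg h) - int (dg ?p))" by (rule ldiv_degree[OF p ff_gr[OF assms]]) (simp only: iA_int iA_fg[OF assms])
 then have "?b = \<zero>\<^sub>A" using n by (simp add: int_grading_def split: if_splits)
 then have "f g \<otimes>\<^sub>A f h = \<zero>\<^sub>A" using ldiv(2)[OF p ff_gr[OF assms]] f_closed[OF p] by simp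
 then show False using ff_nz[OF assms] by blast
qed

text \<open>The product f_g f_h is a nonzero element of its degree; it is a scalar multiple of f_gh exactly when the degrees
agree, and lies in the ideal otherwise.\<close>
lemma cc_nonzero_iff: assumes "g \<in> carrier G" "h \<in> carrier G" shows "cc g h ~= \<zero>\<^sub>K \<longleftrightarrow> dg (g \<otimes>\<^sub>G h) = dg g + dg h"
proof
 have p: "g \<otimes>\<^sub>G h \<in> carrier G" using assms by simp
 show "dg (g \<otimes>\<^sub>G h) = dg g + dg h" if "cc g h ~= \<zero>\<^sub>K"
  using that co_degree[OF iA_fg[OF assms] p] unfolding cc_def by blast
 assume e: "dg (g \<otimes>\<^sub>G h) = dg g + dg h"
 have "f g \<otimes>\<^sub>A f h = N.proj (dg (g \<otimes>\<^sub>G h)) (f g \<otimes>\<^sub>A f h)" using N.proj_hom[OF UNIV_I iA_fg[OF assms] UNIV_I] e by simp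
 also have "\<dots> = cc g h \<odot>\<^sub>A f (g \<otimes>\<^sub>G h)" unfolding cc_def co_hom[OF p ff_gr[OF assms] p] leading_component(1)[OF p ff_gr[OF assms]] by simp
 finally show "cc g h ~= \<zero>\<^sub>K" using ff_nz[OF assms] f_closed[OF p] by (auto simp: V.smult_l_null)
qed

lemma dg_zero: assumes "g \<in> carrier G" "dg g = 0" shows "g = \<one>\<^sub>G"
proof -
 have "f g \<in> gr \<one>\<^sub>G" using f_deg[OF assms(1)] assms(2) scalar_gr by simp
 then show ?thesis using gr_disjoint[OF assms(1) G.one_closed _ f_gr[OF assms(1)]] f_nz[OF assms(1)] by blast
qed

text \<open>Products of elements of S along which the degree grows by one at each step.\<close>
inductive reach :: "'g set => 'g => bool" for S where
 one: "reach S \<one>\<^sub>G"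
| step: "v \<in> S ==> reach S h ==> dg (v \<otimes>\<^sub>G h) = Suc (dg h) ==> reach S (v \<otimes>\<^sub>G h)"

context
 fixes S :: "'g set"
 assumes S: "S \<subseteq> carrier G" and S_A1: "internal_direct_sum K (A\<lparr>carrier := Adeg 1\<rparr>) (insert None (Some ` S))
   (\<lambda>i. case i of None => Adeg 1 \<inter> gr \<one>\<^sub>G | Some g => {c \<odot>\<^sub>A f g | c. c \<in> carrier K})"
  and gen1: "generated_in_degree_1 K A Adeg"
begin

lemma S_degree: assumes "v \<in> S" shows "dg v = 1"
proof -
 have v: "v \<in> carrier G" using assms S by blast
 have "VectorSpace.subspace K {c \<odot>\<^sub>A f v | c. c \<in> carrier K} (A\<lparr>carrier := Adeg 1\<rparr>)"
  using S_A1 assms by (force simp: internal_direct_sum_def)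
 then have "{c \<odot>\<^sub>A f v | c. c \<in> carrier K} \<subseteq> Adeg 1" by (simp add: subspace_def submodule_def)
 moreover have "f v = \<one>\<^sub>K \<odot>\<^sub>A f v" using f_closed[OF v] by simp
 ultimately have "f v \<in> Adeg 1" by blast
 then show ?thesis using deg_unique[OF f_deg[OF v]] f_nz[OF v] by blast
qed

lemma reach_closed: "reach S g ==> g \<in> carrier G"
 by (induction rule: reach.induct) (use S in auto)

lemma reach_mult: "reach S h ==> reach S k ==> dg (h \<otimes>\<^sub>G k) = dg h + dg k ==> reach S (h \<otimes>\<^sub>G k)"
proof (induction rule: reach.induct)
 case one
 then show ?case using reach_closed[of k] by simp
next
 case (step v h)
 have c: "v \<in> carrier G" "h \<in> carrier G" "k \<in> carrier G" using step S reach_closed by auto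
 have "dg (v \<otimes>\<^sub>G (h \<otimes>\<^sub>G k)) = Suc (dg h) + dg k" using step.prems(2) step.hyps(3) c by (simp add: G.m_assoc)
 moreover have "dg (v \<otimes>\<^sub>G (h \<otimes>\<^sub>G k)) \<le> 1 + dg (h \<otimes>\<^sub>G k)" using dg_subadd[of v "h \<otimes>\<^sub>G k"] c S_degree[OF step.hyps(1)] by simp
 moreover have "dg (h \<otimes>\<^sub>G k) \<le> dg h + dg k" by (rule dg_subadd[OF c(2,3)])
 ultimately have e: "dg (h \<otimes>\<^sub>G k) = dg h + dg k" "dg (v \<otimes>\<^sub>G (h \<otimes>\<^sub>G k)) = Suc (dg (h \<otimes>\<^sub>G k))" by linarith+
 show ?case using reach.step[OF step.hyps(1) step.IH[OF step.prems(1) e(1)] e(2)] c by (simp add: G.m_assoc)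
qed

lemma degree_one_support:
 assumes x: "x \<in> Adeg 1" and g: "g \<in> carrier G" "g \<notin> S" "g ~= \<one>\<^sub>G" shows "Gd.proj g x = \<zero>\<^sub>A"
proof -
 let ?A1 = "A\<lparr>carrier := Adeg 1\<rparr>" and ?W = "\<lambda>i. case i of None => Adeg 1 \<inter> gr \<one>\<^sub>G | Some g => {c \<odot>\<^sub>A f g | c. c \<in> carrier K}"
 interpret D1: direct_sum K ?A1 "insert None (Some ` S)" ?W
  by (intro direct_sum.intro direct_sum_axioms.intro subspace_vectorspace[OF V.vectorspace_axioms N.W_sub[OF UNIV_I]] S_A1)
 have "x \<in> {x \<in> Adeg 1. Gd.proj g x = \<zero>\<^sub>A}"
 proof (rule D1.in_submodule_of_proj)
  fix i assume i: "i \<in> insert None (Some ` S)"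
  define y where "y = D1.proj i x"
  have x': "x \<in> carrier ?A1" using x by simp
  have w: "y \<in> ?W i" unfolding y_def by (rule D1.proj_in[OF x' i])
  have cA: "carrier ?A1 = Adeg 1" by simp
  have y1: "y \<in> Adeg 1" using D1.proj_closed[OF x' i] unfolding y_def cA .
  have "Gd.proj g y = \<zero>\<^sub>A"
  proof (cases i)
   case None
   then show ?thesis using w Gd.proj_hom[OF G.one_closed _ g(1), of y] g(3) by simp
  next
   case (Some v)
   then have v: "v \<in> carrier G" "v \<in> S" using i S by auto
   obtain c where "c \<in> carrier K" "y = c \<odot>\<^sub>A f v" using w Some by auto
   then show ?thesis using Gd.proj_hom[OF v(1) Gd.W_smult[OF v(1) _ f_gr[OF v(1)]] g(1), of c] v(2) g(2) by auto
  qed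
  then show "D1.proj i x \<in> {x \<in> Adeg 1. Gd.proj g x = \<zero>\<^sub>A}" using y1 unfolding y_def[symmetric] by blast
 qed (use x g N.W_add N.W_zero N.W_carrier Gd.proj_add in auto)
 then show ?thesis by simp
qed

text \<open>The elements supported on reachable group elements modulo the ideal form a subalgebra that
contains the component of degree 1, hence they are everything.\<close>
lemma reach_all: assumes g: "g \<in> carrier G" shows "reach S g"
proof -
 let ?T = "{x \<in> carrier A. \<forall>g\<in>carrier G. \<not> reach S g --> co x g = \<zero>\<^sub>K}"
 have "subring ?T A"
 proof (rule A.subringI)
  show "?T \<subseteq> carrier A" by blast
  show "\<one>\<^sub>A \<in> ?T" using co_f[OF G.one_closed] reach.one[of S] by (auto simp: f_one)
  show "\<ominus>\<^sub>A x \<in> ?T" if "x \<in> ?T" for x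
  proof -
   have "co (\<ominus>\<^sub>A x) g = \<ominus>\<^sub>K \<one>\<^sub>K \<otimes>\<^sub>K co x g" if "g \<in> carrier G" for g
    using co_smult[of x "\<ominus>\<^sub>K \<one>\<^sub>K" g] R.smult_minus_one[of x] \<open>x \<in> ?T\<close> that by simp
   then show ?thesis using that by simp
  qed
  show "x \<otimes>\<^sub>A y \<in> ?T" if xy: "x \<in> ?T" "y \<in> ?T" for x y
  proof -
   have "co (x \<otimes>\<^sub>A y) g = \<zero>\<^sub>K" if g: "g \<in> carrier G" "\<not> reach S g" for g
   proof (rule co_mult_vanish)
    show "x \<in> carrier A" "y \<in> carrier A" "g \<in> carrier G" using xy g by simp_all
    fix h k assume hk: "h \<in> carrier G" "k \<in> carrier G" "h \<otimes>\<^sub>G k = g"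
    have cl: "co x h \<in> carrier K" "co y k \<in> carrier K" "cc h k \<in> carrier K" using xy hk by simp_all
    have "\<not> reach S h \<or> \<not> reach S k \<or> cc h k = \<zero>\<^sub>K"
     using reach_mult[of h k] cc_nonzero_iff[OF hk(1,2)] g(2) hk(3) by blast
    then have "co x h = \<zero>\<^sub>K \<or> co y k = \<zero>\<^sub>K \<or> cc h k = \<zero>\<^sub>K" using xy hk by blast
    then show "co x h \<otimes>\<^sub>K co y k \<otimes>\<^sub>K cc h k = \<zero>\<^sub>K" using cl by auto
   qed
   then show ?thesis using xy by simp
  qed
  show "x \<oplus>\<^sub>A y \<in> ?T" if "x \<in> ?T" "y \<in> ?T" for x y using that by (simp add: co_add)
 qed
 moreover have "VectorSpace.subspace K ?T A"
  using V.vectorspace_axioms V.module_axioms by (auto simp: subspace_def submodule_def co_add co_smult)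
 moreover have "Adeg 1 \<subseteq> ?T"
 proof
  fix x assume x: "x \<in> Adeg 1"
  have "co x g = \<zero>\<^sub>K" if g: "g \<in> carrier G" "\<not> reach S g" for g
  proof -
   have "g \<notin> S"
   proof
    assume "g \<in> S"
    then have "reach S (g \<otimes>\<^sub>G \<one>\<^sub>G)" using S_degree[of g] dg_one g(1) by (intro reach.step reach.one) simp_all
    then show False using g by simp
   qed
   moreover have "g ~= \<one>\<^sub>G" using g reach.one by blast
   ultimately show ?thesis using degree_one_support[OF x g(1)] ldiv_zero[OF g(1)] aug_zero by (simp add: co_def)
  qed
  then show "x \<in> ?T" using x N.W_carrier by simp
 qed
 ultimately have "?T = carrier A" using gen1 unfolding generated_in_degree_1_def by blast
 then have "f g \<in> ?T" using f_closed[OF g] by simp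
 then show ?thesis using co_f[OF g g] g by (cases "reach S g") simp_all
qed

lemma word_length_dg: assumes g: "g \<in> carrier G" shows "word_length G S g = dg g"
proof -
 have ex: "\<exists>vs. length vs = dg g \<and> set vs \<subseteq> S \<and> g = foldr (\<otimes>\<^sub>G) vs \<one>\<^sub>G" if "reach S g" for g
  using that
 proof (induction rule: reach.induct)
  case one
  show ?case by (rule exI[of _ "[]"]) (simp add: dg_one)
 next
  case (step v h)
  then obtain vs where "length vs = dg h" "set vs \<subseteq> S" "h = foldr (\<otimes>\<^sub>G) vs \<one>\<^sub>G" by blast
  then show ?case using step by (intro exI[of _ "v # vs"]) simp
 qed
 have le: "foldr (\<otimes>\<^sub>G) vs \<one>\<^sub>G \<in> carrier G \<and> dg (foldr (\<otimes>\<^sub>G) vs \<one>\<^sub>G) \<le> length vs" if "set vs \<subseteq> S" for vs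
  using that
 proof (induction vs)
  case (Cons v vs)
  then have v: "v \<in> carrier G" "foldr (\<otimes>\<^sub>G) vs \<one>\<^sub>G \<in> carrier G" "dg (foldr (\<otimes>\<^sub>G) vs \<one>\<^sub>G) \<le> length vs" using S by auto
  then show ?case using dg_subadd[OF v(1,2)] S_degree[of v] Cons.prems by simp
 qed (simp add: dg_one)
 show ?thesis unfolding word_length_def
 proof (rule Least_equality)
  show "\<exists>vs. length vs = dg g \<and> set vs \<subseteq> S \<and> g = foldr (\<otimes>\<^sub>G) vs \<one>\<^sub>G" by (rule ex[OF reach_all[OF g]])
  fix n assume "\<exists>vs. length vs = n \<and> set vs \<subseteq> S \<and> g = foldr (\<otimes>\<^sub>G) vs \<one>\<^sub>G"
  then show "dg g \<le> n" using le by blast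
 qed
qed

lemma dg_levels: assumes "g \<in> carrier G" "n \<le> dg g" shows "\<exists>h\<in>carrier G. dg h = n"
proof -
 have "\<forall>n\<le>dg g. \<exists>h\<in>carrier G. dg h = n" using reach_all[OF assms(1)]
 proof (induction rule: reach.induct)
  case one
  then show ?case using dg_one by (auto intro!: bexI[of _ "\<one>\<^sub>G"])
 next
  case (step v h)
  have "v \<otimes>\<^sub>G h \<in> carrier G" using step S reach_closed by auto
  then show ?case using step by (metis le_Suc_eq)
 qed
 then show ?thesis using assms(2) by blast
qed

end

end

section \<open>Bases and coordinates\<close>

context
 fixes K :: "'k ring" and V :: "('k, 'v) module"
 assumes vs: "vectorspace K V"
begin

interpretation vectorspace K V by (rule vs)

lemma coordinate_basis:
 assumes S: "finite S" and b: "!!s. s \<in> S ==> b s \<in> carrier V"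
  and cl: "!!s x. s \<in> S ==> x \<in> carrier V ==> cf s x \<in> carrier K"
  and lin: "!!s x y c. s \<in> S ==> x \<in> carrier V ==> y \<in> carrier V ==> c \<in> carrier K ==>
   cf s (c \<odot>\<^sub>V x \<oplus>\<^sub>V y) = c \<otimes>\<^sub>K cf s x \<oplus>\<^sub>K cf s y"
  and delta: "!!s t. s \<in> S ==> t \<in> S ==> cf s (b t) = (if s = t then \<one>\<^sub>K else \<zero>\<^sub>K)"
  and sep: "!!x. x \<in> carrier V ==> \<forall>s\<in>S. cf s x = \<zero>\<^sub>K ==> x = \<zero>\<^sub>V"
 shows "inj_on b S" "basis (b ` S)" "fin_dim" "dim = card S"
proof -
 have K_neg: "(\<ominus>\<^sub>K x) \<oplus>\<^sub>K x = \<zero>\<^sub>K" if "x \<in> carrier K" for x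
  using vs that by (intro abelian_group.l_neg ring.is_abelian_group) (simp_all add: vectorspace_def field_def domain_def cring_def)
 show inj: "inj_on b S"
 proof (rule inj_onI)
  fix s t assume "s \<in> S" "t \<in> S" "b s = b t"
  then show "s = t" using delta[of s s] delta[of s t] by (simp split: if_splits)
 qed
 have z: "cf s \<zero>\<^sub>V = \<zero>\<^sub>K" if "s \<in> S" for s
  using lin[OF that M.zero_closed M.zero_closed, of "\<ominus>\<^sub>K \<one>\<^sub>K"] cl[OF that M.zero_closed]
  by (simp add: smult_r_null K_neg l_minus)
 have comb: "(\<Oplus>\<^sub>V t\<in>T. a t \<odot>\<^sub>V b t) \<in> carrier V \<and> cf s (\<Oplus>\<^sub>V t\<in>T. a t \<odot>\<^sub>V b t) = (if s \<in> T then a s else \<zero>\<^sub>K)"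
  if "finite T" "T \<subseteq> S" "!!t. t \<in> T ==> a t \<in> carrier K" "s \<in> S" for T a s
  using that
 proof (induction T)
  case (insert t T)
  have c: "a t \<in> carrier K" "b t \<in> carrier V" "(\<lambda>t. a t \<odot>\<^sub>V b t) \<in> T \<rightarrow> carrier V" using insert.prems b by auto
  have IH: "(\<Oplus>\<^sub>V t\<in>T. a t \<odot>\<^sub>V b t) \<in> carrier V" "cf s (\<Oplus>\<^sub>V t\<in>T. a t \<odot>\<^sub>V b t) = (if s \<in> T then a s else \<zero>\<^sub>K)"
   using insert by auto
  have e: "(\<Oplus>\<^sub>V t\<in>insert t T. a t \<odot>\<^sub>V b t) = a t \<odot>\<^sub>V b t \<oplus>\<^sub>V (\<Oplus>\<^sub>V t\<in>T. a t \<odot>\<^sub>V b t)"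
   using insert.hyps c by (intro M.finsum_insert) auto
  have "a s \<in> carrier K" if "s \<in> T" using insert.prems(2) that by simp
  then show ?case using lin[OF \<open>s \<in> S\<close> c(2) IH(1) c(1)] IH delta[of s t] c insert by (auto simp: e)
 qed (simp add: z)
 have bS: "b ` S \<subseteq> carrier V" "finite (b ` S)" using b S by auto
 have lc: "lincomb a (b ` S) = (\<Oplus>\<^sub>V t\<in>S. a (b t) \<odot>\<^sub>V b t)" if "a \<in> b ` S \<rightarrow> carrier K" for a
  unfolding lincomb_def using that b by (intro M.add.finprod_reindex inj) auto
 have "lin_indpt (b ` S)"
 proof (rule finite_lin_indpt2[OF bS(2,1)])
  fix a assume a: "a \<in> b ` S \<rightarrow> carrier K" and z0: "lincomb a (b ` S) = \<zero>\<^sub>V"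
  have "a (b s) = \<zero>\<^sub>K" if "s \<in> S" for s
  proof -
   have "a (b t) \<in> carrier K" if "t \<in> S" for t using a that by auto
   then show ?thesis using comb[OF S subset_refl, of "\<lambda>t. a (b t)" s] that z[OF that] unfolding lc[OF a, symmetric] z0 by simp
  qed
  then show "\<forall>v\<in>b ` S. a v = \<zero>\<^sub>K" by blast
 qed
 moreover have gen: "gen_set (b ` S)"
 proof
  show "span (b ` S) \<subseteq> carrier V" by (rule span_is_subset2[OF bS(1)])
  show "carrier V \<subseteq> span (b ` S)"
  proof
   fix x assume x: "x \<in> carrier V"
   let ?y = "\<Oplus>\<^sub>V t\<in>S. cf t x \<odot>\<^sub>V b t" and ?a = "\<lambda>v. cf (the_inv_into S b v) x"
   have y: "?y \<in> carrier V" using cl x b by (intro M.finsum_closed) auto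
   have cy: "cf s ?y = cf s x" if "s \<in> S" for s using comb[OF S subset_refl, of "\<lambda>t. cf t x" s] cl x that by auto
   let ?d = "(\<ominus>\<^sub>K \<one>\<^sub>K) \<odot>\<^sub>V ?y \<oplus>\<^sub>V x"
   have "cf s ?d = \<zero>\<^sub>K" if "s \<in> S" for s using lin[OF that y x, of "\<ominus>\<^sub>K \<one>\<^sub>K"] cy[OF that] cl[OF that x] by (simp add: l_minus K_neg)
   then have d: "?d = \<zero>\<^sub>V" using x y by (intro sep) simp_all
   have "?y \<oplus>\<^sub>V ?d = x" using x y by (simp add: smult_l_minus M.r_neg2)
   then have xy: "x = ?y" using y unfolding d by simp
   have a: "?a \<in> b ` S \<rightarrow> carrier K" using cl x by (auto simp: the_inv_into_f_f[OF inj])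
   have "lincomb ?a (b ` S) = ?y" unfolding lc[OF a] using cl x b by (intro M.finsum_cong') (auto simp: the_inv_into_f_f[OF inj])
   then show "x \<in> span (b ` S)" unfolding finite_span[OF bS(2,1)] using a xy by (metis (mono_tags, lifting) mem_Collect_eq)
  qed
 qed
 ultimately show bas: "basis (b ` S)" using bS by (simp add: basis_def)
 show "fin_dim" unfolding fin_dim_def using bS gen by blast
 show "dim = card S" using dim_basis[OF bS(2) bas] card_image[OF inj] by simp
qed

text \<open>The dual basis of a finite basis.\<close>
lemma basis_coordinates:
 assumes B: "finite B" "basis B"
 shows "\<exists>cf. (\<forall>s\<in>B. \<forall>x\<in>carrier V. cf s x \<in> carrier K) \<and>
  (\<forall>s\<in>B. \<forall>x\<in>carrier V. \<forall>y\<in>carrier V. \<forall>c\<in>carrier K.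
   cf s (c \<odot>\<^sub>V x \<oplus>\<^sub>V y) = c \<otimes>\<^sub>K cf s x \<oplus>\<^sub>K cf s y) \<and>
  (\<forall>s\<in>B. \<forall>t\<in>B. cf s t = (if s = t then \<one>\<^sub>K else \<zero>\<^sub>K)) \<and>
  (\<forall>x\<in>carrier V. (\<forall>s\<in>B. cf s x = \<zero>\<^sub>K) --> x = \<zero>\<^sub>V)"
proof -
 have Bc: "B \<subseteq> carrier V" using B by (simp add: basis_def)
 let ?P = "\<lambda>v a. a \<in> B \<rightarrow>\<^sub>E carrier K \<and> lincomb a B = v"
 have ex: "\<exists>!a. ?P v a" if "v \<in> carrier V" for v using basis_criterion[OF B(1) Bc] B(2) that by blast
 define cf where "cf s v = (THE a. ?P v a) s" for s v
 have P: "?P v (THE a. ?P v a)" if "v \<in> carrier V" for v by (rule theI'[OF ex[OF that]])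
 have eq: "cf s v = a s" if "v \<in> carrier V" "a \<in> B \<rightarrow> carrier K" "lincomb a B = v" "s \<in> B" for s v a
 proof -
  have "lincomb (restrict a B) B = lincomb a B" unfolding lincomb_def using that(2) Bc by (intro M.finsum_cong') auto
  then have "?P v (restrict a B)" using that by auto
  then have "(THE a. ?P v a) = restrict a B" using ex[OF that(1)] by (rule the1_equality[rotated])
  then show ?thesis using that(4) by (simp add: cf_def)
 qed
 have cl: "cf s v \<in> carrier K" if "s \<in> B" "v \<in> carrier V" for s v using P[OF that(2)] that(1) by (auto simp: cf_def)
 have sum: "lincomb (\<lambda>s. cf s v) B = v" if "v \<in> carrier V" for v using P[OF that] by (simp add: cf_def)
 show ?thesis
 proof (intro exI[of _ cf] conjI ballI impI)
  show "cf s x \<in> carrier K" if "s \<in> B" "x \<in> carrier V" for s x by (rule cl[OF that])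
  show "cf s (c \<odot>\<^sub>V x \<oplus>\<^sub>V y) = c \<otimes>\<^sub>K cf s x \<oplus>\<^sub>K cf s y"
   if "s \<in> B" "x \<in> carrier V" "y \<in> carrier V" "c \<in> carrier K" for s x y c
  proof (rule eq[OF _ _ _ that(1)])
   show "c \<odot>\<^sub>V x \<oplus>\<^sub>V y \<in> carrier V" using that by simp
   show "(\<lambda>s. c \<otimes>\<^sub>K cf s x \<oplus>\<^sub>K cf s y) \<in> B \<rightarrow> carrier K" using that cl by auto
   have "lincomb (\<lambda>s. c \<otimes>\<^sub>K cf s x \<oplus>\<^sub>K cf s y) B = (\<Oplus>\<^sub>V s\<in>B. c \<odot>\<^sub>V (cf s x \<odot>\<^sub>V s) \<oplus>\<^sub>V cf s y \<odot>\<^sub>V s)"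
    unfolding lincomb_def using that cl Bc by (intro M.finsum_cong') (auto simp: smult_l_distr smult_assoc1 subsetD)
   also have "\<dots> = (\<Oplus>\<^sub>V s\<in>B. c \<odot>\<^sub>V (cf s x \<odot>\<^sub>V s)) \<oplus>\<^sub>V (\<Oplus>\<^sub>V s\<in>B. cf s y \<odot>\<^sub>V s)"
    using that cl Bc by (intro M.finsum_addf) auto
   also have "(\<Oplus>\<^sub>V s\<in>B. c \<odot>\<^sub>V (cf s x \<odot>\<^sub>V s)) = c \<odot>\<^sub>V (\<Oplus>\<^sub>V s\<in>B. cf s x \<odot>\<^sub>V s)"
    using that cl Bc B(1) by (intro finsum_smult_ldistr[symmetric]) auto
   finally show "lincomb (\<lambda>s. c \<otimes>\<^sub>K cf s x \<oplus>\<^sub>K cf s y) B = c \<odot>\<^sub>V x \<oplus>\<^sub>V y"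
    using sum[OF that(2)] sum[OF that(3)] by (simp add: lincomb_def)
  qed
  show "cf s t = (if s = t then \<one>\<^sub>K else \<zero>\<^sub>K)" if "s \<in> B" "t \<in> B" for s t
  proof (rule eq[OF _ _ _ that(1)])
   show t: "t \<in> carrier V" using Bc that by blast
   have "lincomb (\<lambda>s. if s = t then \<one>\<^sub>K else \<zero>\<^sub>K) B = (\<Oplus>\<^sub>V s\<in>{t}. s)"
    unfolding lincomb_def using that(2) Bc B(1) by (intro M.add.finprod_mono_neutral_cong_right) (auto simp: subsetD smult_l_null)
   then show "lincomb (\<lambda>s. if s = t then \<one>\<^sub>K else \<zero>\<^sub>K) B = t" using t by (simp add: M.finsum_insert)
  qed auto
  show "x = \<zero>\<^sub>V" if "x \<in> carrier V" "\<forall>s\<in>B. cf s x = \<zero>\<^sub>K" for x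
  proof -
   have "lincomb (\<lambda>s. cf s x) B = (\<Oplus>\<^sub>V s\<in>B. \<zero>\<^sub>V)" unfolding lincomb_def
    using that(2) Bc by (intro M.finsum_cong') (auto simp: subsetD smult_l_null)
   then show ?thesis using sum[OF that(1)] by simp
  qed
 qed
qed

end

section \<open>The covariant ring\<close>

context dual_reflection_data
begin

abbreviation "II \<equiv> covariant_ideal A Adeg G gr"
abbreviation "CC \<equiv> covariant_ring A Adeg G gr"
abbreviation "Cdeg \<equiv> covariant_deg A Adeg G gr"
abbreviation "cov \<equiv> covariant_image A Adeg G gr"

lemma coordinates_ideal: "ideal {x \<in> carrier A. \<forall>g\<in>carrier G. co x g = \<zero>\<^sub>K} A" (is "ideal ?N A")
proof (rule idealI)
 show "ring A" by (rule A.ring_axioms)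
 have n: "\<ominus>\<^sub>A x \<in> ?N" if "x \<in> ?N" for x
  using co_smult[of x "\<ominus>\<^sub>K \<one>\<^sub>K"] R.smult_minus_one[of x] that by simp
 show "subgroup ?N (add_monoid A)"
  by (rule subgroup.intro) (use n in \<open>auto simp: co_add simp flip: a_inv_def\<close>)
 show "x \<otimes>\<^sub>A a \<in> ?N" "a \<otimes>\<^sub>A x \<in> ?N" if "a \<in> ?N" "x \<in> carrier A" for a x
 proof -
  have "co (x \<otimes>\<^sub>A a) g = \<zero>\<^sub>K" "co (a \<otimes>\<^sub>A x) g = \<zero>\<^sub>K" if "g \<in> carrier G" for g
   using \<open>a \<in> ?N\<close> \<open>x \<in> carrier A\<close> that by (intro co_mult_vanish; simp)+
  then show "x \<otimes>\<^sub>A a \<in> ?N" "a \<otimes>\<^sub>A x \<in> ?N" using that by simp_all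
 qed
qed

lemma II_ideal: "ideal II A"
 unfolding covariant_ideal_def using N.W_carrier by (intro A.genideal_ideal) (auto simp: Bdeg_iff)

lemma Bdeg_II: "1 \<le> i ==> Bdeg i \<subseteq> II"
 unfolding covariant_ideal_def using N.W_carrier
 by (intro subset_trans[OF _ A.genideal_self]) (auto simp: Bdeg_iff)

text \<open>Fixed elements of positive degree have zero coordinates. Conversely an element of A_g with zero coordinate is f_g
times a fixed element whose component of degree 0 vanishes.\<close>
lemma II_eq: "II = {x \<in> carrier A. \<forall>g\<in>carrier G. co x g = \<zero>\<^sub>K}" (is "_ = ?N")
proof
 interpret I: ideal II A by (rule II_ideal)
 show "II \<subseteq> ?N" unfolding covariant_ideal_def
 proof (rule A.genideal_minimal[OF coordinates_ideal], rule UN_least, rule subsetI)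
  fix i x assume i: "i \<in> {1::nat..}" and "x \<in> Bdeg i"
  then have x: "x \<in> Adeg i" "x \<in> B0" by (simp_all add: Bdeg_iff)
  have "co x g = \<zero>\<^sub>K" if g: "g \<in> carrier G" for g
  proof (cases "g = \<one>\<^sub>G")
   case True
   then show ?thesis using co_degree[OF x(1) g] dg_one i by simp
  next
   case False
   then show ?thesis using co_hom[OF G.one_closed x(2) g] by simp
  qed
  then show "x \<in> ?N" using B0_closed[OF x(2)] by simp
 qed
 have add: "x \<oplus>\<^sub>A y \<in> II" if "x \<in> II" "y \<in> II" for x y using I.a_closed that by simp
 have fixed: "b \<in> II" if b: "b \<in> B0" "aug b = \<zero>\<^sub>K" for b
 proof -
  let ?h = "\<lambda>v. (\<ominus>\<^sub>K aug v) \<odot>\<^sub>A \<one>\<^sub>A \<oplus>\<^sub>A Gd.proj \<one>\<^sub>G v"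
  have bc: "b \<in> carrier A" using B0_closed b by blast
  have "b \<in> {v \<in> carrier A. ?h v \<in> II}"
  proof (rule N.in_submodule_of_proj[OF bc])
   show "\<zero>\<^sub>A \<in> {v \<in> carrier A. ?h v \<in> II}" using I.zero_closed by (simp add: aug_zero V.smult_l_null)
   show "x \<oplus>\<^sub>A y \<in> {v \<in> carrier A. ?h v \<in> II}" if "x \<in> {v \<in> carrier A. ?h v \<in> II}" "y \<in> {v \<in> carrier A. ?h v \<in> II}" for x y
   proof -
    have c: "x \<in> carrier A" "y \<in> carrier A" using that by auto
    have "?h (x \<oplus>\<^sub>A y) = ?h x \<oplus>\<^sub>A ?h y"
     using c by (simp add: Q.aug_add minus_add V.smult_l_distr Gd.proj_add A.a_ac)
    then show ?thesis using that add[of "?h x" "?h y"] by simp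
   qed
   fix i :: nat
   let ?v = "N.proj i b"
   have v: "?v \<in> Adeg i" "?v \<in> carrier A" using N.proj_in[OF bc] bc by simp_all
   have "?h ?v \<in> II"
   proof (cases "i = 0")
    case True
    then obtain c where c: "c \<in> carrier K" "?v = c \<odot>\<^sub>A \<one>\<^sub>A" using v deg_0 by auto
    have "Gd.proj \<one>\<^sub>G (c \<odot>\<^sub>A \<one>\<^sub>A) = c \<odot>\<^sub>A \<one>\<^sub>A"
     using Gd.proj_hom[OF G.one_closed Gd.W_smult[OF G.one_closed c(1) one_gr] G.one_closed] by simp
    then have "?h ?v = \<zero>\<^sub>A" unfolding c(2) Q.aug_scalar[OF c(1)] using c(1) by (simp add: V.smult_l_minus A.l_neg)
    then show ?thesis using I.zero_closed by simp
   next
    case False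
    have "aug ?v = \<zero>\<^sub>K" using Q.aug_pos[OF v(1)] False by simp
    moreover have "Gd.proj \<one>\<^sub>G ?v \<in> II" using Bdeg_II[of i] gproj_deg[OF v(1) G.one_closed] False by (auto simp: Bdeg_iff)
    ultimately show ?thesis using v Gd.proj_closed[OF v(2) G.one_closed] by (simp add: V.smult_l_null)
   qed
   then show "?v \<in> {v \<in> carrier A. ?h v \<in> II}" using v by simp
  qed simp
  then show ?thesis using b bc Gd.proj_hom[OF G.one_closed b(1) G.one_closed] by (simp add: V.smult_l_null)
 qed
 show "?N \<subseteq> II"
 proof
  fix x assume x: "x \<in> ?N"
  have xc: "x \<in> carrier A" using x by simp
  show "x \<in> II"
  proof (rule Gd.in_submodule_of_proj[OF xc I.zero_closed add])
   show "II \<subseteq> carrier A" by (rule I.a_subset)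
   fix g assume g: "g \<in> carrier G"
   note l = ldiv[OF g Gd.proj_in[OF xc g]]
   have "ldiv g (Gd.proj g x) \<in> II" using x g by (intro fixed[OF l(1)]) (simp add: co_def)
   then have "f g \<otimes>\<^sub>A ldiv g (Gd.proj g x) \<in> II" by (rule I.I_l_closed[OF _ f_closed[OF g]])
   then show "Gd.proj g x \<in> II" unfolding l(2) .
  qed
 qed
qed

lemma carrier_CC: "carrier CC = cov ` carrier A"
 by (auto simp: covariant_ring_def quotient_def A_RCOSETS_def' covariant_image_def)

lemma cov_closed [simp]: "x \<in> carrier A ==> cov x \<in> carrier CC"
 by (simp add: carrier_CC)

lemma cov_eq: assumes "x \<in> carrier A" "y \<in> carrier A" shows "cov x = cov y \<longleftrightarrow> (\<forall>g\<in>carrier G. co x g = co y g)"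
proof -
 have m: "co (x \<ominus>\<^sub>A y) g = co x g \<ominus>\<^sub>K co y g" if "g \<in> carrier G" for g
  using assms that co_smult[of y "\<ominus>\<^sub>K \<one>\<^sub>K" g] R.smult_minus_one[of y] by (simp add: a_minus_def co_add l_minus)
 have "cov x = cov y \<longleftrightarrow> x \<ominus>\<^sub>A y \<in> II"
  unfolding covariant_image_def using A.quotient_eq_iff_same_a_r_cos[OF II_ideal assms] by simp
 also have "\<dots> \<longleftrightarrow> (\<forall>g\<in>carrier G. co x g = co y g)"
  unfolding II_eq using assms m by (simp add: r_right_minus_eq)
 finally show ?thesis .
qed

lemma cov_ops:
 shows cov_add: "x \<in> carrier A ==> y \<in> carrier A ==> cov x \<oplus>\<^sub>CC cov y = cov (x \<oplus>\<^sub>A y)"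
  and cov_mult: "x \<in> carrier A ==> y \<in> carrier A ==> cov x \<otimes>\<^sub>CC cov y = cov (x \<otimes>\<^sub>A y)"
  and cov_one: "\<one>\<^sub>CC = cov \<one>\<^sub>A" and cov_zero: "\<zero>\<^sub>CC = cov \<zero>\<^sub>A"
  and cov_smult: "c \<in> carrier K ==> x \<in> carrier A ==> c \<odot>\<^sub>CC cov x = cov (c \<odot>\<^sub>A x)"
proof -
 interpret I: ideal II A by (rule II_ideal)
 show "x \<in> carrier A ==> y \<in> carrier A ==> cov x \<oplus>\<^sub>CC cov y = cov (x \<oplus>\<^sub>A y)"
  by (simp add: covariant_ring_def quotient_def covariant_image_def I.a_rcos_sum)
 show "x \<in> carrier A ==> y \<in> carrier A ==> cov x \<otimes>\<^sub>CC cov y = cov (x \<otimes>\<^sub>A y)"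
  by (simp add: covariant_ring_def quotient_def covariant_image_def I.rcoset_mult_add)
 show "\<one>\<^sub>CC = cov \<one>\<^sub>A" by (simp add: covariant_ring_def quotient_def covariant_image_def)
 show "\<zero>\<^sub>CC = cov \<zero>\<^sub>A" using I.a_subset by (simp add: covariant_ring_def quotient_def covariant_image_def A.a_coset_add_zero)
 show "c \<odot>\<^sub>CC cov x = cov (c \<odot>\<^sub>A x)" if cx: "c \<in> carrier K" "x \<in> carrier A"
 proof -
  have "cov (c \<odot>\<^sub>A z) = cov (c \<odot>\<^sub>A x)" if z: "z \<in> cov x" for z
  proof -
   have zc: "z \<in> carrier A" using z A.a_r_coset_subset_G[OF I.a_subset cx(2)] by (auto simp: covariant_image_def)
   have "cov z = cov x" using A.a_repr_independence[OF _ cx(2) I.a_subgroup, of z] z unfolding covariant_image_def by simp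
   then have "\<forall>g\<in>carrier G. co z g = co x g" using cov_eq[OF zc cx(2)] by simp
   then show ?thesis using cx zc by (subst cov_eq) (simp_all add: co_smult)
  qed
  moreover have "x \<in> cov x" unfolding covariant_image_def by (rule I.a_rcos_self[OF cx(2)])
  moreover have "c \<odot>\<^sub>CC cov x = (\<Union>z\<in>cov x. cov (c \<odot>\<^sub>A z))" by (simp add: covariant_ring_def quotient_def covariant_image_def)
  ultimately show ?thesis by (metis (no_types, lifting) SUP_eq_const empty_iff)
 qed
qed

lemma CC_E: assumes "X \<in> carrier CC" obtains x where "x \<in> carrier A" "X = cov x"
 using assms by (auto simp: carrier_CC)

lemma CC_ring: "ring CC"
proof (rule ringI)
 show "abelian_group CC"
 proof (rule abelian_groupI)
  fix X assume "X \<in> carrier CC"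
  then obtain x where x: "x \<in> carrier A" "X = cov x" by (rule CC_E)
  then show "\<exists>Y\<in>carrier CC. Y \<oplus>\<^sub>CC X = \<zero>\<^sub>CC" by (intro bexI[of _ "cov (\<ominus>\<^sub>A x)"]) (simp_all add: cov_ops A.l_neg)
 qed (auto elim!: CC_E simp: cov_ops A.a_ac)
 show "monoid CC" by (rule monoidI) (auto elim!: CC_E simp: cov_ops A.m_assoc)
qed (auto elim!: CC_E simp: cov_ops A.l_distr A.r_distr)

lemma CC_vectorspace: "vectorspace K CC"
 unfolding vectorspace_def
proof
 show "module K CC"
  by (rule moduleI[OF _ ring.is_abelian_group[OF CC_ring]])
   (auto elim!: CC_E simp: cov_ops V.smult_l_distr V.smult_r_distr V.smult_assoc1 is_cring)
qed (rule fK)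

lemma CC_algebra: "k_algebra K CC"
 unfolding k_algebra_def using CC_ring CC_vectorspace
 by (auto elim!: CC_E simp: cov_ops Q.smult_assoc_l Q.smult_assoc_r)

definition rep :: "'a set => 'a" where "rep X = (SOME x. x \<in> carrier A \<and> cov x = X)"
definition cx :: "'a set => 'g => 'k" where "cx X g = co (rep X) g"

lemma rep: assumes "X \<in> carrier CC" shows "rep X \<in> carrier A" "cov (rep X) = X"
proof -
 have "rep X \<in> carrier A \<and> cov (rep X) = X" unfolding rep_def by (rule someI_ex) (use assms in \<open>auto simp: carrier_CC\<close>)
 then show "rep X \<in> carrier A" "cov (rep X) = X" by blast+
qed

lemma cx_cov: "x \<in> carrier A ==> g \<in> carrier G ==> cx (cov x) g = co x g"
 using cov_eq[of "rep (cov x)" x] rep[of "cov x"] by (simp add: cx_def)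

lemma cx_closed: "X \<in> carrier CC ==> g \<in> carrier G ==> cx X g \<in> carrier K"
 by (auto elim!: CC_E simp: cx_cov)

lemma cx_linear: "X \<in> carrier CC ==> Y \<in> carrier CC ==> c \<in> carrier K ==> g \<in> carrier G ==>
  cx (c \<odot>\<^sub>CC X \<oplus>\<^sub>CC Y) g = c \<otimes>\<^sub>K cx X g \<oplus>\<^sub>K cx Y g"
 by (auto elim!: CC_E simp: cx_cov cov_ops co_linear)

lemma cx_ext: "X \<in> carrier CC ==> Y \<in> carrier CC ==> (!!g. g \<in> carrier G ==> cx X g = cx Y g) ==> X = Y"
 by (elim CC_E) (simp only: cx_cov cov_eq, blast)

lemma cx_zero: "g \<in> carrier G ==> cx \<zero>\<^sub>CC g = \<zero>\<^sub>K"
 by (simp add: cov_zero cx_cov)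

lemma cx_f: "h \<in> carrier G ==> g \<in> carrier G ==> cx (cov (f h)) g = (if g = h then \<one>\<^sub>K else \<zero>\<^sub>K)"
 by (simp add: cx_cov f_closed co_f)

lemma CC_basis:
 shows "inj_on (\<lambda>g. cov (f g)) (carrier G)" "vectorspace.basis K CC ((\<lambda>g. cov (f g)) ` carrier G)"
  "vectorspace.fin_dim K CC" "vectorspace.dim K CC = card (carrier G)"
proof -
 have z: "X = \<zero>\<^sub>CC" if "X \<in> carrier CC" "\<forall>g\<in>carrier G. cx X g = \<zero>\<^sub>K" for X
  by (rule cx_ext[OF that(1)]) (use that(2) in \<open>simp_all add: cx_zero, simp add: cov_zero\<close>)
 note * = coordinate_basis[OF CC_vectorspace finG, where cf = "\<lambda>g X. cx X g" and b = "\<lambda>g. cov (f g)",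
   OF cov_closed[OF f_closed] cx_closed cx_linear _ z]
 show "inj_on (\<lambda>g. cov (f g)) (carrier G)" "vectorspace.basis K CC ((\<lambda>g. cov (f g)) ` carrier G)"
  "vectorspace.fin_dim K CC" "vectorspace.dim K CC = card (carrier G)"
  by (rule *; simp add: cx_f)+
qed

lemma co_proj: assumes x: "x \<in> carrier A" and g: "g \<in> carrier G"
 shows "co (N.proj i x) g = (if dg g = i then co x g else \<zero>\<^sub>K)"
proof (cases "dg g = i")
 case True
 have "x \<in> {v \<in> carrier A. co (N.proj i v) g = co v g}"
 proof (rule N.in_submodule_of_proj[OF x])
  fix j
  have "co (N.proj i (N.proj j x)) g = co (N.proj j x) g"
   using N.proj_hom[OF UNIV_I N.proj_in[OF x UNIV_I] UNIV_I, of i j] co_degree[OF N.proj_in[OF x UNIV_I, of j] g] g True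
   by (cases "i = j") auto
  then show "N.proj j x \<in> {v \<in> carrier A. co (N.proj i v) g = co v g}" using x by simp
 qed (use g in \<open>auto simp: N.proj_add co_add\<close>)
 then show ?thesis using True by simp
next
 case False
 then show ?thesis using co_degree[OF N.proj_in[OF x UNIV_I] g, of i] by simp
qed

definition cproj :: "nat => 'a set => 'a set" where "cproj i X = cov (N.proj i (rep X))"

lemma cx_cproj: "X \<in> carrier CC ==> g \<in> carrier G ==> cx (cproj i X) g = (if dg g = i then cx X g else \<zero>\<^sub>K)"
 using rep[of X] co_proj[of "rep X" g i] by (simp add: cproj_def cx_cov) (simp add: cx_def)

lemma cproj_closed: "X \<in> carrier CC ==> cproj i X \<in> carrier CC"
 using rep[of X] by (simp add: cproj_def)

lemma Cdeg_iff: "X \<in> Cdeg i \<longleftrightarrow> X \<in> carrier CC \<and> (\<forall>g\<in>carrier G. dg g ~= i --> cx X g = \<zero>\<^sub>K)"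
proof
 assume "X \<in> Cdeg i"
 then obtain x where x: "x \<in> Adeg i" "X = cov x" by (auto simp: covariant_deg_def)
 then have "x \<in> carrier A" using N.W_carrier by blast
 then show "X \<in> carrier CC \<and> (\<forall>g\<in>carrier G. dg g ~= i --> cx X g = \<zero>\<^sub>K)" using x co_degree[OF x(1)] by (simp add: cx_cov)
next
 assume X: "X \<in> carrier CC \<and> (\<forall>g\<in>carrier G. dg g ~= i --> cx X g = \<zero>\<^sub>K)"
 have "X = cproj i X" by (rule cx_ext) (use X cproj_closed cx_cproj in auto)
 then show "X \<in> Cdeg i" using rep[of X] X N.proj_in[of "rep X" i] unfolding covariant_deg_def cproj_def by blast
qed

lemma Cdeg_sub: "VectorSpace.subspace K (Cdeg i) CC"
proof -
 interpret C: vectorspace K CC by (rule CC_vectorspace)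
 have lin: "c \<odot>\<^sub>CC X \<oplus>\<^sub>CC Y \<in> Cdeg i" if "X \<in> Cdeg i" "Y \<in> Cdeg i" "c \<in> carrier K" for X Y c
  using that by (simp add: Cdeg_iff cx_linear)
 have z: "\<zero>\<^sub>CC \<in> Cdeg i" by (simp add: Cdeg_iff cx_zero)
 have "X \<oplus>\<^sub>CC Y \<in> Cdeg i" if "X \<in> Cdeg i" "Y \<in> Cdeg i" for X Y using lin[OF that one_closed] that by (simp add: Cdeg_iff)
 moreover have "c \<odot>\<^sub>CC X \<in> Cdeg i" if "X \<in> Cdeg i" "c \<in> carrier K" for X c using lin[OF that(1) z that(2)] that by (simp add: Cdeg_iff)
 ultimately show ?thesis using z CC_vectorspace C.module_axioms by (auto simp: subspace_def submodule_def Cdeg_iff)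
qed

lemma CC_connected: "connected_graded K CC Cdeg"
 unfolding connected_graded_def
proof (intro conjI allI ballI)
 show "k_algebra K CC" by (rule CC_algebra)
 show "\<one>\<^sub>CC ~= \<zero>\<^sub>CC" using cx_f[OF G.one_closed G.one_closed] cx_zero[OF G.one_closed] by (auto simp: f_one cov_one)
 interpret C: vectorspace K CC by (rule CC_vectorspace)
 show "internal_direct_sum K CC UNIV Cdeg"
 proof (rule ids_of_projections(1)[OF CC_vectorspace Cdeg_sub, where p = cproj])
  show "cproj i X \<in> Cdeg i" if "X \<in> carrier CC" for i X using that by (simp add: Cdeg_iff cproj_closed cx_cproj)
  show "cproj i (X \<oplus>\<^sub>CC Y) = cproj i X \<oplus>\<^sub>CC cproj i Y" if "X \<in> carrier CC" "Y \<in> carrier CC" for i X Y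
  proof (rule cx_ext)
   fix g assume g: "g \<in> carrier G"
   have a: "cx (U \<oplus>\<^sub>CC W) g = cx U g \<oplus>\<^sub>K cx W g" if "U \<in> carrier CC" "W \<in> carrier CC" for U W
    using cx_linear[OF that one_closed g] that cx_closed[OF _ g] by simp
   show "cx (cproj i (X \<oplus>\<^sub>CC Y)) g = cx (cproj i X \<oplus>\<^sub>CC cproj i Y) g"
    using that g by (simp add: a cproj_closed cx_cproj)
  qed (use that in \<open>simp_all add: cproj_closed\<close>)
  show "cproj j X = (if j = i then X else \<zero>\<^sub>CC)" if "X \<in> Cdeg i" for i j X
   using that by (intro cx_ext) (auto simp: Cdeg_iff cproj_closed cx_cproj cx_zero)
  show "finite {i \<in> UNIV. cproj i X ~= \<zero>\<^sub>CC}" if X: "X \<in> carrier CC" for X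
  proof (rule finite_subset)
   show "{i \<in> UNIV. cproj i X ~= \<zero>\<^sub>CC} \<subseteq> dg ` carrier G"
   proof
    fix i assume "i \<in> {i \<in> UNIV. cproj i X ~= \<zero>\<^sub>CC}"
    then have "\<not> (\<forall>g\<in>carrier G. dg g ~= i)" using cx_ext[OF cproj_closed[OF X] C.M.zero_closed] X by (auto simp: cx_cproj cx_zero)
    then show "i \<in> dg ` carrier G" by blast
   qed
  qed (use finG in simp)
  show "X = \<zero>\<^sub>CC" if "X \<in> carrier CC" "!!i. i \<in> UNIV ==> cproj i X = \<zero>\<^sub>CC" for X
  proof (rule cx_ext[OF that(1) C.M.zero_closed])
   fix g assume "g \<in> carrier G"
   then show "cx X g = cx \<zero>\<^sub>CC g" using cx_cproj[OF that(1), of g "dg g"] that(2)[of "dg g"] by simp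
  qed
 qed
 show "X \<otimes>\<^sub>CC Y \<in> Cdeg (i + j)" if XY: "X \<in> Cdeg i" "Y \<in> Cdeg j" for i j X Y
 proof -
  obtain x where "x \<in> Adeg i" "X = cov x" using XY(1) unfolding covariant_deg_def by blast
  moreover obtain y where "y \<in> Adeg j" "Y = cov y" using XY(2) unfolding covariant_deg_def by blast
  ultimately show ?thesis using deg_mult[of x i y j] N.W_carrier by (auto simp: covariant_deg_def cov_ops)
 qed
 show "Cdeg 0 = {c \<odot>\<^sub>CC \<one>\<^sub>CC | c. c \<in> carrier K}"
  unfolding covariant_deg_def deg_0 by (auto simp: cov_ops) (metis (mono_tags, lifting) image_eqI mem_Collect_eq cov_smult A.one_closed)
qed

lemma dim_Cdeg: "vectorspace.dim K (CC\<lparr>carrier := Cdeg i\<rparr>) = card {g \<in> carrier G. dg g = i}"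
proof (rule coordinate_basis(4)[OF subspace_vectorspace[OF CC_vectorspace Cdeg_sub], where cf = "\<lambda>g X. cx X g" and b = "\<lambda>g. cov (f g)"])
 show "finite {g \<in> carrier G. dg g = i}" using finG by simp
 fix X assume "X \<in> carrier (CC\<lparr>carrier := Cdeg i\<rparr>)" "\<forall>g\<in>{g \<in> carrier G. dg g = i}. cx X g = \<zero>\<^sub>K"
 then show "X = \<zero>\<^bsub>CC\<lparr>carrier := Cdeg i\<rparr>\<^esub>" using cov_closed[OF A.zero_closed]
  by (simp, intro cx_ext) (auto simp: Cdeg_iff cov_zero[symmetric] cx_zero)
qed (auto simp: Cdeg_iff cx_closed cx_linear cx_f f_closed)

end

section \<open>The Frobenius structure of the covariant ring\<close>

context dual_reflection_data
begin

lemma co_mult_f_right: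
 assumes x: "x \<in> carrier A" and k: "k \<in> carrier G" and g: "g \<in> carrier G"
 shows "co (x \<otimes>\<^sub>A f k) g = co x (g \<otimes>\<^sub>G inv\<^bsub>G\<^esub> k) \<otimes>\<^sub>K cc (g \<otimes>\<^sub>G inv\<^bsub>G\<^esub> k) k"
proof -
 let ?p = "g \<otimes>\<^sub>G inv\<^bsub>G\<^esub> k"
 have p: "?p \<in> carrier G" "cc ?p k \<in> carrier K" using g k by simp_all
 have "x \<in> {x \<in> carrier A. co (x \<otimes>\<^sub>A f k) g = co x ?p \<otimes>\<^sub>K cc ?p k}" (is "_ \<in> ?S")
 proof (rule mod_induct[OF x])
  show "y \<oplus>\<^sub>A z \<in> ?S" if "y \<in> ?S" "z \<in> ?S" for y z
   using that p g f_closed[OF k] by (simp add: A.l_distr co_add l_distr)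
  fix c h assume c: "c \<in> carrier K" "h \<in> carrier G"
  have e: "g = h \<otimes>\<^sub>G k \<longleftrightarrow> ?p = h" using g k c by (metis G.inv_solve_right')
  have "co (f h \<otimes>\<^sub>A f k) g = co (f h) ?p \<otimes>\<^sub>K cc ?p k"
   using co_mult_hom[OF c(2) k f_gr[OF c(2)] f_gr[OF k] g] co_f[OF c(2) p(1)] co_f[OF c(2) c(2)] co_f[OF k k] e p c(2) k by auto
  then show "c \<odot>\<^sub>A f h \<in> ?S" using c p g f_closed[OF k] f_closed[OF c(2)] by (simp add: Q.smult_assoc_l co_smult m_assoc)
 next
  fix y assume y: "y \<in> carrier A" "\<forall>g\<in>carrier G. co y g = \<zero>\<^sub>K"
  have "co (y \<otimes>\<^sub>A f k) g = \<zero>\<^sub>K" by (rule co_mult_vanish) (use y g f_closed[OF k] in auto)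
  then show "y \<in> ?S" using y p by simp
 qed auto
 then show ?thesis by simp
qed

lemma co_mult_f_left:
 assumes x: "x \<in> carrier A" and k: "k \<in> carrier G" and g: "g \<in> carrier G"
 shows "co (f k \<otimes>\<^sub>A x) g = co x (inv\<^bsub>G\<^esub> k \<otimes>\<^sub>G g) \<otimes>\<^sub>K cc k (inv\<^bsub>G\<^esub> k \<otimes>\<^sub>G g)"
proof -
 let ?p = "inv\<^bsub>G\<^esub> k \<otimes>\<^sub>G g"
 have p: "?p \<in> carrier G" "cc k ?p \<in> carrier K" using g k by simp_all
 have "x \<in> {x \<in> carrier A. co (f k \<otimes>\<^sub>A x) g = co x ?p \<otimes>\<^sub>K cc k ?p}" (is "_ \<in> ?S")
 proof (rule mod_induct[OF x])
  show "y \<oplus>\<^sub>A z \<in> ?S" if "y \<in> ?S" "z \<in> ?S" for y z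
   using that p g f_closed[OF k] by (simp add: A.r_distr co_add l_distr)
  fix c h assume c: "c \<in> carrier K" "h \<in> carrier G"
  have e: "g = k \<otimes>\<^sub>G h \<longleftrightarrow> ?p = h" using g k c by (metis G.inv_solve_left')
  have "co (f k \<otimes>\<^sub>A f h) g = co (f h) ?p \<otimes>\<^sub>K cc k ?p"
   using co_mult_hom[OF k c(2) f_gr[OF k] f_gr[OF c(2)] g] co_f[OF c(2) p(1)] co_f[OF c(2) c(2)] co_f[OF k k] e p c(2) k by auto
  then show "c \<odot>\<^sub>A f h \<in> ?S" using c p g f_closed[OF k] f_closed[OF c(2)] by (simp add: Q.smult_assoc_r co_smult m_assoc)
 next
  fix y assume y: "y \<in> carrier A" "\<forall>g\<in>carrier G. co y g = \<zero>\<^sub>K"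
  have "co (f k \<otimes>\<^sub>A y) g = \<zero>\<^sub>K" by (rule co_mult_vanish) (use y g f_closed[OF k] in auto)
  then show "y \<in> ?S" using y p by simp
 qed auto
 then show ?thesis by simp
qed

abbreviation fb :: "'g => 'a set" where "fb g \<equiv> cov (f g)"

sublocale CR: ring CC by (rule CC_ring)
sublocale CV: vectorspace K CC by (rule CC_vectorspace)

lemma fb_closed [simp]: "g \<in> carrier G ==> fb g \<in> carrier CC" by (simp add: f_closed)

lemma cx_mult_right: "X \<in> carrier CC ==> k \<in> carrier G ==> g \<in> carrier G ==>
  cx (X \<otimes>\<^sub>CC fb k) g = cx X (g \<otimes>\<^sub>G inv\<^bsub>G\<^esub> k) \<otimes>\<^sub>K cc (g \<otimes>\<^sub>G inv\<^bsub>G\<^esub> k) k"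
 by (elim CC_E) (simp add: f_closed cov_mult cx_cov co_mult_f_right)

lemma cx_mult_left: "X \<in> carrier CC ==> k \<in> carrier G ==> g \<in> carrier G ==>
  cx (fb k \<otimes>\<^sub>CC X) g = cx X (inv\<^bsub>G\<^esub> k \<otimes>\<^sub>G g) \<otimes>\<^sub>K cc k (inv\<^bsub>G\<^esub> k \<otimes>\<^sub>G g)"
 by (elim CC_E) (simp add: f_closed cov_mult cx_cov co_mult_f_left)

lemma cx_add: "X \<in> carrier CC ==> Y \<in> carrier CC ==> g \<in> carrier G ==> cx (X \<oplus>\<^sub>CC Y) g = cx X g \<oplus>\<^sub>K cx Y g"
 by (elim CC_E) (simp add: cov_add cx_cov co_add)

lemma cx_smult: "X \<in> carrier CC ==> c \<in> carrier K ==> g \<in> carrier G ==> cx (c \<odot>\<^sub>CC X) g = c \<otimes>\<^sub>K cx X g"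
 by (elim CC_E) (simp add: cov_smult cx_cov co_smult)

lemma CC_smult_assoc: "c \<in> carrier K ==> X \<in> carrier CC ==> Y \<in> carrier CC ==> (c \<odot>\<^sub>CC X) \<otimes>\<^sub>CC Y = c \<odot>\<^sub>CC (X \<otimes>\<^sub>CC Y)"
 "c \<in> carrier K ==> X \<in> carrier CC ==> Y \<in> carrier CC ==> X \<otimes>\<^sub>CC (c \<odot>\<^sub>CC Y) = c \<odot>\<^sub>CC (X \<otimes>\<^sub>CC Y)"
 using CC_algebra by (auto simp: k_algebra_def)

lemma CC_induct:
 assumes X: "X \<in> carrier CC" and S: "S \<subseteq> carrier CC" "!!X Y. X \<in> S ==> Y \<in> S ==> X \<oplus>\<^sub>CC Y \<in> S"
  and f: "!!c g. c \<in> carrier K ==> g \<in> carrier G ==> c \<odot>\<^sub>CC fb g \<in> S"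
 shows "X \<in> S"
proof -
 obtain x where x: "x \<in> carrier A" "X = cov x" using X by (rule CC_E)
 have "x \<in> {x \<in> carrier A. cov x \<in> S}"
 proof (rule mod_induct[OF x(1)])
  show "y \<oplus>\<^sub>A z \<in> {x \<in> carrier A. cov x \<in> S}" if "y \<in> {x \<in> carrier A. cov x \<in> S}" "z \<in> {x \<in> carrier A. cov x \<in> S}" for y z
   using that S(2)[of "cov y" "cov z"] by (simp add: cov_add)
  show "c \<odot>\<^sub>A f g \<in> {x \<in> carrier A. cov x \<in> S}" if "c \<in> carrier K" "g \<in> carrier G" for c g
   using f[OF that] that f_closed by (simp add: cov_smult)
  fix y assume y: "y \<in> carrier A" "\<forall>g\<in>carrier G. co y g = \<zero>\<^sub>K"
  have "cov y = \<zero>\<^sub>K \<odot>\<^sub>CC fb \<one>\<^sub>G" by (rule cx_ext) (use y in \<open>simp_all add: cx_cov cx_smult cx_closed cx_zero\<close>)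
  then show "y \<in> {x \<in> carrier A. cov x \<in> S}" using f[of "\<zero>\<^sub>K" "\<one>\<^sub>G"] y by simp
 qed auto
 then show ?thesis using x by simp
qed

lemma coordinates_surj:
 assumes u: "!!g. g \<in> carrier G ==> u g \<in> carrier K"
 shows "\<exists>X\<in>carrier CC. \<forall>g\<in>carrier G. cx X g = u g"
proof -
 have "\<exists>X\<in>carrier CC. \<forall>g\<in>carrier G. cx X g = (if g \<in> T then u g else \<zero>\<^sub>K)" if "finite T" "T \<subseteq> carrier G" for T
  using that
 proof (induction T)
  case empty
  show ?case by (intro bexI[of _ "\<zero>\<^sub>CC"]) (simp_all add: cx_zero)
 next
  case (insert h T)
  then obtain X where X: "X \<in> carrier CC" "\<forall>g\<in>carrier G. cx X g = (if g \<in> T then u g else \<zero>\<^sub>K)" by auto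
  have h: "h \<in> carrier G" "u h \<in> carrier K" using insert u by auto
  have "cx (u h \<odot>\<^sub>CC fb h \<oplus>\<^sub>CC X) g = (if g \<in> insert h T then u g else \<zero>\<^sub>K)" if g: "g \<in> carrier G" for g
   using X g h u[OF g] insert.hyps(2) by (auto simp: cx_linear cx_f)
  then show ?case using X h by (intro bexI[of _ "u h \<odot>\<^sub>CC fb h \<oplus>\<^sub>CC X"]) simp_all
 qed
 from this[OF finG subset_refl] show ?thesis by auto
qed

lemma cc_one_left: "h \<in> carrier G ==> cc \<one>\<^sub>G h = \<one>\<^sub>K" and cc_one_right: "h \<in> carrier G ==> cc h \<one>\<^sub>G = \<one>\<^sub>K"
 by (simp_all add: cc_def f_one f_closed co_f)

lemma fb_mult: assumes "g \<in> carrier G" "h \<in> carrier G" shows "fb g \<otimes>\<^sub>CC fb h = cc g h \<odot>\<^sub>CC fb (g \<otimes>\<^sub>G h)"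
proof (rule cx_ext)
 fix k assume k: "k \<in> carrier G"
 have e: "k \<otimes>\<^sub>G inv\<^bsub>G\<^esub> h = g \<longleftrightarrow> k = g \<otimes>\<^sub>G h" using k assms by (metis G.inv_solve_right')
 have "cx (fb g \<otimes>\<^sub>CC fb h) k = (if k \<otimes>\<^sub>G inv\<^bsub>G\<^esub> h = g then cc (k \<otimes>\<^sub>G inv\<^bsub>G\<^esub> h) h else \<zero>\<^sub>K)"
  using k assms by (simp add: cx_mult_right cx_f)
 also have "\<dots> = cx (cc g h \<odot>\<^sub>CC fb (g \<otimes>\<^sub>G h)) k" using k assms e by (auto simp: cx_smult cx_f)
 finally show "cx (fb g \<otimes>\<^sub>CC fb h) k = cx (cc g h \<odot>\<^sub>CC fb (g \<otimes>\<^sub>G h)) k" .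
qed (use assms in simp_all)

lemma K_cancel: "a \<in> carrier K ==> b \<in> carrier K ==> a \<otimes>\<^sub>K b = \<zero>\<^sub>K ==> b ~= \<zero>\<^sub>K ==> a = \<zero>\<^sub>K"
 using integral by blast

end

locale paired_reflection_data = dual_reflection_data K A Adeg G gr f
 for K :: "'k ring" and A :: "('k, 'a) module" and Adeg :: "nat => 'a set" and G :: "'g monoid" and gr :: "'g => 'a set"
  and f :: "'g => 'a" +
 fixes m :: 'g
 assumes m [simp]: "m \<in> carrier G" and pairing: "!!g. g \<in> carrier G ==> dg g + dg (inv\<^bsub>G\<^esub> g \<otimes>\<^sub>G m) = dg m"
begin

lemma dg_le_m: "g \<in> carrier G ==> dg g \<le> dg m" using pairing[of g] by simp

lemma dg_eq_m: assumes "g \<in> carrier G" "dg g = dg m" shows "g = m"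
proof -
 have "inv\<^bsub>G\<^esub> g \<otimes>\<^sub>G m = \<one>\<^sub>G" using pairing[OF assms(1)] assms by (intro dg_zero) simp_all
 moreover have "g \<otimes>\<^sub>G (inv\<^bsub>G\<^esub> g \<otimes>\<^sub>G m) = m" using assms(1) by (simp flip: G.m_assoc)
 ultimately show ?thesis using assms(1) by simp
qed

lemma pairing': assumes "h \<in> carrier G" shows "dg (m \<otimes>\<^sub>G inv\<^bsub>G\<^esub> h) + dg h = dg m"
 using pairing[of "m \<otimes>\<^sub>G inv\<^bsub>G\<^esub> h"] assms by (simp add: G.inv_mult_group G.m_assoc)

lemma cc_pair: assumes "h \<in> carrier G"
 shows "cc h (inv\<^bsub>G\<^esub> h \<otimes>\<^sub>G m) ~= \<zero>\<^sub>K" "cc (m \<otimes>\<^sub>G inv\<^bsub>G\<^esub> h) h ~= \<zero>\<^sub>K"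
proof -
 have e: "h \<otimes>\<^sub>G (inv\<^bsub>G\<^esub> h \<otimes>\<^sub>G m) = m" "m \<otimes>\<^sub>G inv\<^bsub>G\<^esub> h \<otimes>\<^sub>G h = m"
  using assms by (simp_all add: G.m_assoc flip: G.m_assoc[of h "inv\<^bsub>G\<^esub> h" m])
 show "cc h (inv\<^bsub>G\<^esub> h \<otimes>\<^sub>G m) ~= \<zero>\<^sub>K" "cc (m \<otimes>\<^sub>G inv\<^bsub>G\<^esub> h) h ~= \<zero>\<^sub>K"
  using assms pairing pairing' by (simp_all add: cc_nonzero_iff e)
qed

definition cj :: "'g => 'g" where "cj g = m \<otimes>\<^sub>G g \<otimes>\<^sub>G inv\<^bsub>G\<^esub> m"
definition jc :: "'g => 'g" where "jc g = inv\<^bsub>G\<^esub> m \<otimes>\<^sub>G g \<otimes>\<^sub>G m"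
text \<open>The scalar is forced by evaluating the form on the pair of basis elements at m g^-1 and g in both orders.\<close>
definition beta :: "'g => 'k" where
 "beta g = cc (m \<otimes>\<^sub>G inv\<^bsub>G\<^esub> g) g \<otimes>\<^sub>K inv\<^bsub>K\<^esub> (cc (cj g) (m \<otimes>\<^sub>G inv\<^bsub>G\<^esub> g))"
definition form :: "'a set => 'a set => 'k" where "form X Y = cx (X \<otimes>\<^sub>CC Y) m"

lemma cj_jc [simp]: "g \<in> carrier G ==> cj g \<in> carrier G" "g \<in> carrier G ==> jc g \<in> carrier G"
  "g \<in> carrier G ==> cj (jc g) = g" "g \<in> carrier G ==> jc (cj g) = g"
 by (simp_all add: cj_def jc_def G.m_assoc) (simp_all flip: G.m_assoc)

lemma dg_cj: assumes "g \<in> carrier G" shows "dg (cj g) = dg g"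
proof -
 have "cj g = m \<otimes>\<^sub>G inv\<^bsub>G\<^esub> (m \<otimes>\<^sub>G inv\<^bsub>G\<^esub> g)" using assms by (simp add: cj_def G.inv_mult_group G.m_assoc)
 then show ?thesis using pairing'[OF assms] pairing'[of "m \<otimes>\<^sub>G inv\<^bsub>G\<^esub> g"] assms by simp
qed

lemma cj_cc: assumes "g \<in> carrier G" shows "cc (cj g) (m \<otimes>\<^sub>G inv\<^bsub>G\<^esub> g) ~= \<zero>\<^sub>K"
proof -
 have "cj g = m \<otimes>\<^sub>G inv\<^bsub>G\<^esub> (m \<otimes>\<^sub>G inv\<^bsub>G\<^esub> g)" using assms by (simp add: cj_def G.inv_mult_group G.m_assoc)
 then show ?thesis using cc_pair(2)[of "m \<otimes>\<^sub>G inv\<^bsub>G\<^esub> g"] assms by simp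
qed

lemma inv_K: "a \<in> carrier K ==> a ~= \<zero>\<^sub>K ==> inv\<^bsub>K\<^esub> a \<in> carrier K \<and> inv\<^bsub>K\<^esub> a \<otimes>\<^sub>K a = \<one>\<^sub>K \<and> inv\<^bsub>K\<^esub> a ~= \<zero>\<^sub>K"
 using field_Units Units_l_inv[of a] Units_inv_closed[of a] by (cases "inv\<^bsub>K\<^esub> a = \<zero>\<^sub>K") auto

lemma beta: assumes g: "g \<in> carrier G"
 shows "beta g \<in> carrier K" "beta g ~= \<zero>\<^sub>K"
  "beta g \<otimes>\<^sub>K cc (cj g) (m \<otimes>\<^sub>G inv\<^bsub>G\<^esub> g) = cc (m \<otimes>\<^sub>G inv\<^bsub>G\<^esub> g) g"
proof -
 note i = inv_K[OF _ cj_cc[OF g]]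
 have c: "cc (cj g) (m \<otimes>\<^sub>G inv\<^bsub>G\<^esub> g) \<in> carrier K" "cc (m \<otimes>\<^sub>G inv\<^bsub>G\<^esub> g) g \<in> carrier K" using g by simp_all
 show "beta g \<in> carrier K" using i c by (simp add: beta_def)
 show "beta g ~= \<zero>\<^sub>K" using i c cc_pair(2)[OF g] integral[of "cc (m \<otimes>\<^sub>G inv\<^bsub>G\<^esub> g) g"] by (auto simp: beta_def)
 show "beta g \<otimes>\<^sub>K cc (cj g) (m \<otimes>\<^sub>G inv\<^bsub>G\<^esub> g) = cc (m \<otimes>\<^sub>G inv\<^bsub>G\<^esub> g) g"
  using i c by (simp add: beta_def m_assoc)
qed

lemma beta_cc: assumes h: "h \<in> carrier G"
 shows "beta (inv\<^bsub>G\<^esub> h \<otimes>\<^sub>G m) \<otimes>\<^sub>K cc (m \<otimes>\<^sub>G inv\<^bsub>G\<^esub> h) h = cc h (inv\<^bsub>G\<^esub> h \<otimes>\<^sub>G m)"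
proof -
 let ?g = "inv\<^bsub>G\<^esub> h \<otimes>\<^sub>G m"
 have "m \<otimes>\<^sub>G inv\<^bsub>G\<^esub> ?g = h" using h by (simp add: G.inv_mult_group) (simp flip: G.m_assoc)
 moreover have "cj ?g = m \<otimes>\<^sub>G inv\<^bsub>G\<^esub> h" using h by (simp add: cj_def G.m_assoc)
 ultimately show ?thesis using beta(3)[of ?g] h by simp
qed

lemma form_right: "X \<in> carrier CC ==> k \<in> carrier G ==> form X (fb k) = cx X (m \<otimes>\<^sub>G inv\<^bsub>G\<^esub> k) \<otimes>\<^sub>K cc (m \<otimes>\<^sub>G inv\<^bsub>G\<^esub> k) k"
 by (simp add: form_def cx_mult_right)

lemma form_left: "X \<in> carrier CC ==> k \<in> carrier G ==> form (fb k) X = cx X (inv\<^bsub>G\<^esub> k \<otimes>\<^sub>G m) \<otimes>\<^sub>K cc k (inv\<^bsub>G\<^esub> k \<otimes>\<^sub>G m)"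
 by (simp add: form_def cx_mult_left)

lemma form_ext: assumes X: "X \<in> carrier CC" "Y \<in> carrier CC" and e: "!!Z. Z \<in> carrier CC ==> form X Z = form Y Z" shows "X = Y"
proof (rule cx_ext[OF X])
 fix g assume g: "g \<in> carrier G"
 let ?k = "inv\<^bsub>G\<^esub> g \<otimes>\<^sub>G m"
 have k: "?k \<in> carrier G" "m \<otimes>\<^sub>G inv\<^bsub>G\<^esub> ?k = g" using g by (simp_all add: G.inv_mult_group) (simp flip: G.m_assoc)
 have "cx X g \<otimes>\<^sub>K cc g ?k = cx Y g \<otimes>\<^sub>K cc g ?k" using e[OF fb_closed[OF k(1)]] form_right[OF X(1) k(1)] form_right[OF X(2) k(1)] k(2) by simp
 then show "cx X g = cx Y g" using m_rcancel[OF cc_pair(1)[OF g]] X g by (simp add: cx_closed)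
qed

lemma form_closed: "X \<in> carrier CC ==> Y \<in> carrier CC ==> form X Y \<in> carrier K"
 and form_add_left: "X \<in> carrier CC ==> Y \<in> carrier CC ==> Z \<in> carrier CC ==> form (X \<oplus>\<^sub>CC Y) Z = form X Z \<oplus>\<^sub>K form Y Z"
 and form_add_right: "X \<in> carrier CC ==> Y \<in> carrier CC ==> Z \<in> carrier CC ==> form Z (X \<oplus>\<^sub>CC Y) = form Z X \<oplus>\<^sub>K form Z Y"
 and form_smult_left: "X \<in> carrier CC ==> Z \<in> carrier CC ==> c \<in> carrier K ==> form (c \<odot>\<^sub>CC X) Z = c \<otimes>\<^sub>K form X Z"
 and form_smult_right: "X \<in> carrier CC ==> Z \<in> carrier CC ==> c \<in> carrier K ==> form Z (c \<odot>\<^sub>CC X) = c \<otimes>\<^sub>K form Z X"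
 by (simp_all add: form_def CR.l_distr CR.r_distr cx_add cx_smult CC_smult_assoc cx_closed)

lemmas form_bilinear = form_closed form_add_left form_add_right form_smult_left form_smult_right

lemma form_frobenius: "frobenius_form K CC Cdeg form (int (dg m))"
 unfolding frobenius_form_def
proof (intro conjI ballI allI impI)
 show "form X \<in> LinearCombinations.module_hom K CC (regular_module K)" if "X \<in> carrier CC" for X
  using that by (simp add: LinearCombinations.module_hom_def regular_module_def form_bilinear)
 show "(\<lambda>X. form X Y) \<in> LinearCombinations.module_hom K CC (regular_module K)" if "Y \<in> carrier CC" for Y
  using that by (simp add: LinearCombinations.module_hom_def regular_module_def form_bilinear)
 show "form (X \<otimes>\<^sub>CC Y) Z = form X (Y \<otimes>\<^sub>CC Z)" if "X \<in> carrier CC" "Y \<in> carrier CC" "Z \<in> carrier CC" for X Y Z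
  using that by (simp add: form_def CR.m_assoc)
 show "X = \<zero>\<^sub>CC" if X: "X \<in> carrier CC" "\<forall>Y\<in>carrier CC. form X Y = \<zero>\<^sub>K" for X
  using X by (intro form_ext) (simp_all add: form_def cx_zero)
 show "Y = \<zero>\<^sub>CC" if Y: "Y \<in> carrier CC" "\<forall>X\<in>carrier CC. form X Y = \<zero>\<^sub>K" for Y
 proof (rule cx_ext[OF Y(1) CR.zero_closed])
  fix k assume k: "k \<in> carrier G"
  let ?h = "m \<otimes>\<^sub>G inv\<^bsub>G\<^esub> k"
  have h: "?h \<in> carrier G" "inv\<^bsub>G\<^esub> ?h \<otimes>\<^sub>G m = k" using k by (simp_all add: G.inv_mult_group G.m_assoc)
  have "cx Y k \<otimes>\<^sub>K cc ?h k = \<zero>\<^sub>K" using form_left[OF Y(1) h(1)] Y(2) fb_closed[OF h(1)] h(2) by simp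
  then show "cx Y k = cx \<zero>\<^sub>CC k" using K_cancel[OF _ _ _ cc_pair(2)[OF k]] Y k by (simp add: cx_closed cx_zero)
 qed
 show "form X Y = \<zero>\<^sub>K" if "X \<in> Cdeg i" "Y \<in> Cdeg j" "int i + int j ~= int (dg m)" for i j X Y
 proof -
  have "X \<otimes>\<^sub>CC Y \<in> Cdeg (i + j)" using CC_connected that by (simp add: connected_graded_def)
  then show ?thesis using that(3) by (auto simp: form_def Cdeg_iff)
 qed
qed

definition nak :: "'a set => 'a set" where
 "nak X = (SOME Y. Y \<in> carrier CC \<and> (\<forall>h\<in>carrier G. cx Y h = beta (jc h) \<otimes>\<^sub>K cx X (jc h)))"

lemma nak: assumes "X \<in> carrier CC" shows nak_closed: "nak X \<in> carrier CC"
  and cx_nak: "h \<in> carrier G ==> cx (nak X) h = beta (jc h) \<otimes>\<^sub>K cx X (jc h)"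
proof -
 have "\<exists>Y. Y \<in> carrier CC \<and> (\<forall>h\<in>carrier G. cx Y h = beta (jc h) \<otimes>\<^sub>K cx X (jc h))"
  using coordinates_surj[of "\<lambda>h. beta (jc h) \<otimes>\<^sub>K cx X (jc h)"] assms beta(1) cx_closed by auto
 then have "nak X \<in> carrier CC \<and> (\<forall>h\<in>carrier G. cx (nak X) h = beta (jc h) \<otimes>\<^sub>K cx X (jc h))"
  unfolding nak_def by (rule someI_ex)
 then show "nak X \<in> carrier CC" "h \<in> carrier G ==> cx (nak X) h = beta (jc h) \<otimes>\<^sub>K cx X (jc h)" by blast+
qed

text \<open>On basis elements both sides are supported on pairs that multiply to m, where the choice of beta makes them equal.\<close>
lemma form_nak: assumes Y: "Y \<in> carrier CC" and X: "X \<in> carrier CC" shows "form X Y = form (nak Y) X"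
proof -
 have "X \<in> {X \<in> carrier CC. form X Y = form (nak Y) X}"
 proof (rule CC_induct[OF X])
  fix c h assume c: "c \<in> carrier K" and h: "h \<in> carrier G"
  let ?g = "inv\<^bsub>G\<^esub> h \<otimes>\<^sub>G m" and ?h = "m \<otimes>\<^sub>G inv\<^bsub>G\<^esub> h"
  have j: "jc ?h = ?g" using h by (simp add: jc_def) (simp flip: G.m_assoc)
  have k: "beta ?g \<in> carrier K" "cx Y ?g \<in> carrier K" "cc ?h h \<in> carrier K" using h Y by (simp_all add: beta cx_closed)
  have "form (nak Y) (fb h) = beta ?g \<otimes>\<^sub>K cx Y ?g \<otimes>\<^sub>K cc ?h h"
   using form_right[OF nak_closed[OF Y] h] cx_nak[OF Y, of ?h] h j by simp
  also have "\<dots> = cx Y ?g \<otimes>\<^sub>K cc h ?g" unfolding beta_cc[OF h, symmetric] using k by (simp add: m_ac)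
  also have "\<dots> = form (fb h) Y" by (rule form_left[OF Y h, symmetric])
  finally show "c \<odot>\<^sub>CC fb h \<in> {X \<in> carrier CC. form X Y = form (nak Y) X}"
   using c h Y nak_closed[OF Y] by (simp add: form_bilinear)
 next
  fix U W assume "U \<in> {X \<in> carrier CC. form X Y = form (nak Y) X}" "W \<in> {X \<in> carrier CC. form X Y = form (nak Y) X}"
  then show "U \<oplus>\<^sub>CC W \<in> {X \<in> carrier CC. form X Y = form (nak Y) X}" using Y nak_closed[OF Y] by (simp add: form_bilinear)
 qed auto
 then show ?thesis by simp
qed

lemma nak_add: "X \<in> carrier CC ==> Y \<in> carrier CC ==> nak (X \<oplus>\<^sub>CC Y) = nak X \<oplus>\<^sub>CC nak Y"
 by (rule cx_ext) (simp_all add: nak_closed cx_nak cx_add cx_closed beta r_distr)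

lemma nak_smult: "X \<in> carrier CC ==> c \<in> carrier K ==> nak (c \<odot>\<^sub>CC X) = c \<odot>\<^sub>CC nak X"
 by (rule cx_ext) (simp_all add: nak_closed cx_nak cx_smult cx_closed beta m_lcomm)

text \<open>Associativity and nondegeneracy: both sides represent the functional Z -> form Z (X Y).\<close>
lemma nak_mult: assumes X: "X \<in> carrier CC" "Y \<in> carrier CC" shows "nak (X \<otimes>\<^sub>CC Y) = nak X \<otimes>\<^sub>CC nak Y"
proof (rule form_ext)
 fix Z assume Z: "Z \<in> carrier CC"
 note n = nak_closed[OF X(1)] nak_closed[OF X(2)] nak_closed[OF CR.m_closed[OF X]]
 have assoc: "form (U \<otimes>\<^sub>CC V) W = form U (V \<otimes>\<^sub>CC W)" if "U \<in> carrier CC" "V \<in> carrier CC" "W \<in> carrier CC" for U V W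
  using that by (simp add: form_def CR.m_assoc)
 have "form (nak (X \<otimes>\<^sub>CC Y)) Z = form Z (X \<otimes>\<^sub>CC Y)" by (rule form_nak[OF CR.m_closed[OF X] Z, symmetric])
 also have "\<dots> = form (nak Y) (Z \<otimes>\<^sub>CC X)" using X Z assoc[of Z X Y] form_nak[OF X(2), of "Z \<otimes>\<^sub>CC X"] by simp
 also have "\<dots> = form (nak X) (nak Y \<otimes>\<^sub>CC Z)" using X Z n assoc[of "nak Y" Z X] form_nak[OF X(1), of "nak Y \<otimes>\<^sub>CC Z"] by simp
 also have "\<dots> = form (nak X \<otimes>\<^sub>CC nak Y) Z" by (rule assoc[symmetric]) (use n Z in simp_all)
 finally show "form (nak (X \<otimes>\<^sub>CC Y)) Z = form (nak X \<otimes>\<^sub>CC nak Y) Z" .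
qed (use X nak_closed in simp_all)

lemma nak_one: "nak \<one>\<^sub>CC = \<one>\<^sub>CC"
proof (rule form_ext)
 fix Z assume "Z \<in> carrier CC"
 then show "form (nak \<one>\<^sub>CC) Z = form \<one>\<^sub>CC Z" using form_nak[OF CR.one_closed, of Z] by (simp add: form_def)
qed (simp_all add: nak_closed)

lemma nak_bij: "bij_betw nak (carrier CC) (carrier CC)"
 unfolding bij_betw_def
proof
 show "inj_on nak (carrier CC)"
 proof (rule inj_onI, rule cx_ext)
  fix X Y g assume h: "X \<in> carrier CC" "Y \<in> carrier CC" "nak X = nak Y" "g \<in> carrier G"
  then show "cx X g = cx Y g" using cx_nak[OF h(1), of "cj g"] cx_nak[OF h(2), of "cj g"] m_lcancel[OF beta(2,1)[OF h(4)]]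
   by (simp add: cx_closed)
 qed
 have "Y \<in> nak ` carrier CC" if Y: "Y \<in> carrier CC" for Y
 proof -
  obtain X where X: "X \<in> carrier CC" "\<forall>g\<in>carrier G. cx X g = inv\<^bsub>K\<^esub> (beta g) \<otimes>\<^sub>K cx Y (cj g)"
   using coordinates_surj[of "\<lambda>g. inv\<^bsub>K\<^esub> (beta g) \<otimes>\<^sub>K cx Y (cj g)"] Y inv_K beta by (auto simp: cx_closed)
  have "nak X = Y"
  proof (rule cx_ext)
   fix h assume h: "h \<in> carrier G"
   have j: "jc h \<in> carrier G" using h by simp
   have c: "beta (jc h) \<in> carrier K" "inv\<^bsub>K\<^esub> beta (jc h) \<in> carrier K" "inv\<^bsub>K\<^esub> beta (jc h) \<otimes>\<^sub>K beta (jc h) = \<one>\<^sub>K" "cx Y h \<in> carrier K"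
    using inv_K[OF beta(1,2)[OF j]] beta(1)[OF j] cx_closed[OF Y h] by blast+
   have "cx (nak X) h = beta (jc h) \<otimes>\<^sub>K (inv\<^bsub>K\<^esub> beta (jc h) \<otimes>\<^sub>K cx Y h)" using cx_nak[OF X(1) h] X(2)[rule_format, OF j] cj_jc(3)[OF h] by simp
   also have "\<dots> = (inv\<^bsub>K\<^esub> beta (jc h) \<otimes>\<^sub>K beta (jc h)) \<otimes>\<^sub>K cx Y h" using c(1,2,4) by (simp only: m_lcomm m_assoc)
   finally show "cx (nak X) h = cx Y h" using c by simp
  qed (use X Y nak_closed in simp_all)
  then show ?thesis using X by blast
 qed
 then show "nak ` carrier CC = carrier CC" using nak_closed by blast
qed

lemma nak_degree: "nak ` Cdeg i = Cdeg i"
proof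
 have d: "dg (jc h) = dg h" if "h \<in> carrier G" for h using dg_cj[of "jc h"] that by simp
 show "nak ` Cdeg i \<subseteq> Cdeg i"
  by (rule image_subsetI) (auto simp: Cdeg_iff nak_closed cx_nak d beta)
 show "Cdeg i \<subseteq> nak ` Cdeg i"
 proof
  fix Y assume Y: "Y \<in> Cdeg i"
  then obtain X where X: "X \<in> carrier CC" "Y = nak X" using nak_bij unfolding bij_betw_def Cdeg_iff by blast
  have "cx X g = \<zero>\<^sub>K" if g: "g \<in> carrier G" "dg g ~= i" for g
  proof -
   have "cx Y (cj g) = \<zero>\<^sub>K" using Y g dg_cj[OF g(1)] by (simp add: Cdeg_iff)
   then have "beta g \<otimes>\<^sub>K cx X g = \<zero>\<^sub>K" using cx_nak[OF X(1), of "cj g"] X(2) g(1) by simp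
   then show ?thesis using integral[of "beta g" "cx X g"] beta[OF g(1)] cx_closed[OF X(1) g(1)] by blast
  qed
  then show "Y \<in> nak ` Cdeg i" using X by (simp add: Cdeg_iff)
 qed
qed

lemma nak_nakayama: "nakayama_automorphism K CC Cdeg nak"
 unfolding nakayama_automorphism_def
proof (intro conjI allI)
 show "nak \<in> ring_iso CC CC"
  unfolding ring_iso_def using nak_bij by (auto intro!: ring_hom_memI simp: nak_closed nak_add nak_mult nak_one)
 show "nak \<in> LinearCombinations.module_hom K CC CC"
  by (simp add: LinearCombinations.module_hom_def nak_closed nak_add nak_smult)
 show "nak ` Cdeg i = Cdeg i" for i by (rule nak_degree)
 show "\<exists>B l. frobenius_form K CC Cdeg B l \<and> (\<forall>a\<in>carrier CC. \<forall>b\<in>carrier CC. B a b = B (nak b) a)"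
  using form_frobenius form_nak by blast
qed

lemma nak_fb: "g \<in> carrier G ==> nak (fb g) = beta g \<odot>\<^sub>CC fb (cj g)"
proof (rule cx_ext)
 fix h assume h: "g \<in> carrier G" "h \<in> carrier G"
 have "jc h = g \<longleftrightarrow> h = cj g" using h cj_jc by metis
 then show "cx (nak (fb g)) h = cx (beta g \<odot>\<^sub>CC fb (cj g)) h" using h by (auto simp: cx_nak cx_smult cx_f beta)
qed (simp_all add: nak_closed beta)

text \<open>No degree exceeds that of f_m, so f_m spans the socle.\<close>
lemma mult_top: assumes Y: "Y \<in> carrier CC" shows "Y \<otimes>\<^sub>CC fb m = cx Y \<one>\<^sub>G \<odot>\<^sub>CC fb m"
proof (rule cx_ext)
 fix g assume g: "g \<in> carrier G"
 let ?p = "g \<otimes>\<^sub>G inv\<^bsub>G\<^esub> m"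
 have p: "?p \<in> carrier G" "?p \<otimes>\<^sub>G m = g" using g by (simp_all add: G.m_assoc)
 have "cc ?p m = \<zero>\<^sub>K" if "g ~= m"
 proof (rule ccontr)
  assume "cc ?p m ~= \<zero>\<^sub>K"
  then have "dg g = dg ?p + dg m" using cc_nonzero_iff[OF p(1) m] p(2) by simp
  then have "dg g = dg m" using dg_le_m[OF g] by simp
  then show False using dg_eq_m[OF g] that by blast
 qed
 then show "cx (Y \<otimes>\<^sub>CC fb m) g = cx (cx Y \<one>\<^sub>G \<odot>\<^sub>CC fb m) g"
  using Y g p(1) by (cases "g = m") (simp_all add: cx_mult_right cx_smult cx_f cx_closed cc_one_left)
qed (use Y in \<open>simp_all add: cx_closed\<close>)

text \<open>A graded Frobenius form is determined by its functional, which is nonzero on the socle element f_m and hence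
vanishes outside the top degree. Every such form is thus a scalar multiple of the given one, and has the
same Nakayama automorphism.\<close>
lemma nakayama_unique:
 assumes nu: "nakayama_automorphism K CC Cdeg \<nu>" and X: "X \<in> carrier CC" shows "\<nu> X = nak X"
proof -
 have cl: "\<nu> Y \<in> carrier CC" if "Y \<in> carrier CC" for Y
 proof -
  have "\<nu> \<in> ring_iso CC CC" using nu unfolding nakayama_automorphism_def by (rule conjunct1)
  then have "\<nu> \<in> ring_hom CC CC" unfolding ring_iso_def by blast
  then show ?thesis using that by (rule ring_hom_closed)
 qed
 obtain B l where Bl: "frobenius_form K CC Cdeg B l" and Bnu: "\<forall>a\<in>carrier CC. \<forall>b\<in>carrier CC. B a b = B (\<nu> b) a"
  using nu unfolding nakayama_automorphism_def by blast
 note F = Bl[unfolded frobenius_form_def, THEN conjunct2]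
 note Bl' = F[THEN conjunct1] F[THEN conjunct2, THEN conjunct1] F[THEN conjunct2, THEN conjunct2, THEN conjunct2, THEN conjunct1]
  F[THEN conjunct2, THEN conjunct2, THEN conjunct2, THEN conjunct2]
 define t where "t Y = B Y \<one>\<^sub>CC" for Y
 have hom: "t \<in> LinearCombinations.module_hom K CC (regular_module K)" unfolding t_def using Bl'(1) by blast
 have t: "t (Y \<oplus>\<^sub>CC Z) = t Y \<oplus>\<^sub>K t Z" "t (c \<odot>\<^sub>CC Y) = c \<otimes>\<^sub>K t Y" "t Y \<in> carrier K"
  if "Y \<in> carrier CC" "Z \<in> carrier CC" "c \<in> carrier K" for Y Z c
 proof -
  have r: "add (regular_module K) = add K" "module.smult (regular_module K) = monoid.mult K" "carrier (regular_module K) = carrier K"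
   by (simp_all add: regular_module_def)
  have h: "t \<in> carrier CC \<rightarrow> carrier K" "!!Y Z. Y \<in> carrier CC ==> Z \<in> carrier CC ==> t (Y \<oplus>\<^sub>CC Z) = t Y \<oplus>\<^sub>K t Z"
   "!!c Y. c \<in> carrier K ==> Y \<in> carrier CC ==> t (c \<odot>\<^sub>CC Y) = c \<otimes>\<^sub>K t Y"
   using hom unfolding LinearCombinations.module_hom_def r by blast+
  show "t (Y \<oplus>\<^sub>CC Z) = t Y \<oplus>\<^sub>K t Z" by (rule h(2)[OF that(1,2)])
  show "t (c \<odot>\<^sub>CC Y) = c \<otimes>\<^sub>K t Y" by (rule h(3)[OF that(3,1)])
  show "t Y \<in> carrier K" by (rule funcset_mem[OF h(1) that(1)])
 qed
 have Bt: "B Y Z = t (Y \<otimes>\<^sub>CC Z)" if "Y \<in> carrier CC" "Z \<in> carrier CC" for Y Z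
  unfolding t_def Bl'(2)[rule_format, OF that CR.one_closed] CR.r_one[OF that(2)] ..
 have one0: "\<one>\<^sub>CC \<in> Cdeg 0" unfolding Cdeg_iff
 proof (intro conjI ballI impI)
  fix g assume g: "g \<in> carrier G" "dg g ~= 0"
  then have "g ~= \<one>\<^sub>G" using dg_one by auto
  then show "cx \<one>\<^sub>CC g = \<zero>\<^sub>K" using cx_f[OF G.one_closed g(1)] by (simp add: f_one cov_one)
 qed (rule CR.one_closed)
 have fbd: "fb g \<in> Cdeg (dg g)" if g: "g \<in> carrier G" for g unfolding Cdeg_iff
 proof (intro conjI ballI impI)
  fix h assume h: "h \<in> carrier G" "dg h ~= dg g"
  show "cx (fb g) h = \<zero>\<^sub>K" unfolding cx_f[OF g h(1)] by (rule if_not_P) (use h(2) in blast)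
 qed (rule fb_closed[OF g])
 have tz: "t (fb g) = \<zero>\<^sub>K" if "g \<in> carrier G" "int (dg g) ~= l" for g
  unfolding t_def by (rule Bl'(4)[rule_format, OF fbd[OF that(1)] one0]) (use that(2) in simp)
 have top: "t (fb m) ~= \<zero>\<^sub>K"
 proof
  assume z: "t (fb m) = \<zero>\<^sub>K"
  have "B Y (fb m) = \<zero>\<^sub>K" if Y: "Y \<in> carrier CC" for Y
   unfolding Bt[OF Y fb_closed[OF m]] mult_top[OF Y] t(2)[OF fb_closed[OF m] fb_closed[OF m] cx_closed[OF Y G.one_closed]] z
   by (rule r_null[OF cx_closed[OF Y G.one_closed]])
  then have "fb m = \<zero>\<^sub>CC" using Bl'(3) by simp
  then show False using cx_f[OF m m] cx_zero[OF m] by simp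
 qed
 then have l: "l = int (dg m)" using tz[OF m] by blast
 let ?\<tau> = "t (fb m)"
 have tau: "?\<tau> \<in> carrier K" using t(3)[OF fb_closed[OF m] fb_closed[OF m] one_closed] .
 have tc: "t Y = ?\<tau> \<otimes>\<^sub>K cx Y m" if Y: "Y \<in> carrier CC" for Y
 proof -
  have "Y \<in> {Y \<in> carrier CC. t Y = ?\<tau> \<otimes>\<^sub>K cx Y m}"
  proof (rule CC_induct[OF Y])
   show "U \<oplus>\<^sub>CC W \<in> {Y \<in> carrier CC. t Y = ?\<tau> \<otimes>\<^sub>K cx Y m}"
    if "U \<in> {Y \<in> carrier CC. t Y = ?\<tau> \<otimes>\<^sub>K cx Y m}" "W \<in> {Y \<in> carrier CC. t Y = ?\<tau> \<otimes>\<^sub>K cx Y m}" for U W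
   proof -
    have U: "U \<in> carrier CC" "W \<in> carrier CC" "t U = ?\<tau> \<otimes>\<^sub>K cx U m" "t W = ?\<tau> \<otimes>\<^sub>K cx W m" using that by blast+
    have "t (U \<oplus>\<^sub>CC W) = ?\<tau> \<otimes>\<^sub>K cx (U \<oplus>\<^sub>CC W) m"
     unfolding t(1)[OF U(1,2) one_closed] U(3,4) cx_add[OF U(1,2) m] by (rule r_distr[OF cx_closed[OF U(1) m] cx_closed[OF U(2) m] tau, symmetric])
    then show ?thesis using CR.a_closed[OF U(1,2)] by blast
   qed
  next
   fix c g assume c: "c \<in> carrier K" "g \<in> carrier G"
   have e: "t (c \<odot>\<^sub>CC fb g) = c \<otimes>\<^sub>K t (fb g)" using t(2)[OF fb_closed[OF c(2)] fb_closed[OF c(2)] c(1)] .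
   have "t (fb g) = ?\<tau> \<otimes>\<^sub>K cx (fb g) m"
   proof (cases "g = m")
    case True
    show ?thesis unfolding True cx_f[OF m m] simp_thms if_True by (rule r_one[OF tau, symmetric])
   next
    case False
    have n: "int (dg g) ~= l" unfolding l using dg_eq_m[OF c(2)] False by auto
    have "cx (fb g) m = \<zero>\<^sub>K" unfolding cx_f[OF c(2) m] by (rule if_not_P) (use False in blast)
    then show ?thesis unfolding tz[OF c(2) n] by (simp only: r_null[OF tau])
   qed
   then show "c \<odot>\<^sub>CC fb g \<in> {Y \<in> carrier CC. t Y = ?\<tau> \<otimes>\<^sub>K cx Y m}"
    unfolding mem_Collect_eq e cx_smult[OF fb_closed[OF c(2)] c(1) m]
    using CV.smult_closed[OF c(1) fb_closed[OF c(2)]] m_lcomm[OF tau c(1) cx_closed[OF fb_closed[OF c(2)] m]] by (simp only: simp_thms)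
  qed blast
  then show ?thesis by blast
 qed
 show ?thesis
 proof (rule form_ext[OF cl[OF X] nak_closed[OF X]])
  fix Z assume Z: "Z \<in> carrier CC"
  have "?\<tau> \<otimes>\<^sub>K form Z X = ?\<tau> \<otimes>\<^sub>K form (\<nu> X) Z"
   unfolding form_def tc[OF CR.m_closed[OF Z X], symmetric] tc[OF CR.m_closed[OF cl[OF X] Z], symmetric]
    Bt[OF Z X, symmetric] Bt[OF cl[OF X] Z, symmetric] by (rule Bnu[rule_format, OF Z X])
  then have "form Z X = form (\<nu> X) Z"
   by (rule iffD1[OF m_lcancel[OF top tau form_closed[OF Z X] form_closed[OF cl[OF X] Z]]])
  then show "form (\<nu> X) Z = form (nak X) Z" unfolding form_nak[OF X Z] by (rule sym)
 qed
qed

lemma beta_m: "beta m = \<one>\<^sub>K"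
 using inv_K[OF one_closed one_not_zero] by (simp add: beta_def cj_def G.m_assoc cc_one_left cc_one_right)

lemma beta_mult:
 assumes g: "g \<in> carrier G" and h: "h \<in> carrier G" and c: "m \<otimes>\<^sub>G g = g \<otimes>\<^sub>G m" "m \<otimes>\<^sub>G h = h \<otimes>\<^sub>G m"
  and d: "dg (g \<otimes>\<^sub>G h) = dg g + dg h"
 shows "beta (g \<otimes>\<^sub>G h) = beta g \<otimes>\<^sub>K beta h"
proof -
 let ?p = "g \<otimes>\<^sub>G h"
 have p: "?p \<in> carrier G" "m \<otimes>\<^sub>G ?p = ?p \<otimes>\<^sub>G m" using g h c by (simp_all add: G.m_assoc[symmetric]) (simp add: G.m_assoc c(2))
 have fx: "cj k = k" if "k \<in> carrier G" "m \<otimes>\<^sub>G k = k \<otimes>\<^sub>G m" for k using that by (simp add: cj_def G.m_assoc)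
 have n: "nak (fb k) = beta k \<odot>\<^sub>CC fb k" if "k \<in> carrier G" "m \<otimes>\<^sub>G k = k \<otimes>\<^sub>G m" for k using nak_fb[OF that(1)] fx[OF that] by simp
 have cl: "beta g \<in> carrier K" "beta h \<in> carrier K" "beta ?p \<in> carrier K" "cc g h \<in> carrier K" using g h p beta by simp_all
 have "nak (fb g \<otimes>\<^sub>CC fb h) = cc g h \<odot>\<^sub>CC (beta ?p \<odot>\<^sub>CC fb ?p)"
  using fb_mult[OF g h] nak_smult[OF fb_closed[OF p(1)] cl(4)] n[OF p] by simp
 moreover have "nak (fb g \<otimes>\<^sub>CC fb h) = beta h \<odot>\<^sub>CC (beta g \<odot>\<^sub>CC (cc g h \<odot>\<^sub>CC fb ?p))"
  using nak_mult[OF fb_closed[OF g] fb_closed[OF h]] n[OF g c(1)] n[OF h c(2)] fb_mult[OF g h] g h cl by (simp add: CC_smult_assoc)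
 ultimately have "cx (cc g h \<odot>\<^sub>CC (beta ?p \<odot>\<^sub>CC fb ?p)) ?p = cx (beta h \<odot>\<^sub>CC (beta g \<odot>\<^sub>CC (cc g h \<odot>\<^sub>CC fb ?p))) ?p" by simp
 then have "cc g h \<otimes>\<^sub>K beta ?p = cc g h \<otimes>\<^sub>K (beta g \<otimes>\<^sub>K beta h)" using p(1) cl g h by (simp add: cx_smult cx_f m_ac)
 then show ?thesis using m_lcancel[of "cc g h"] cc_nonzero_iff[OF g h] d cl by simp
qed

end

section \<open>Hilbert series\<close>

context dual_reflection_data
begin

lemma Bdeg_sub: "VectorSpace.subspace K (Bdeg i) A"
 using dA_sub[of "(int i, \<one>\<^sub>G)"] by (simp add: GA_simps fixed_deg_def)

lemma proj_lmult_vanish: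
 assumes x: "x \<in> carrier A" "\<forall>k<i. N.proj k x = \<zero>\<^sub>A" and a: "a \<in> carrier A" and n: "n < i"
 shows "N.proj n (a \<otimes>\<^sub>A x) = \<zero>\<^sub>A"
proof -
 have "a \<in> {a \<in> carrier A. N.proj n (a \<otimes>\<^sub>A x) = \<zero>\<^sub>A}"
 proof (rule N.in_submodule_of_proj[OF a])
  fix j
  let ?a = "N.proj j a"
  have d: "?a \<in> Adeg j" "?a \<in> carrier A" using N.proj_in[OF a UNIV_I] a by simp_all
  have "N.proj n (?a \<otimes>\<^sub>A x) = \<zero>\<^sub>A"
  proof (cases "n < j")
   case True
   then show ?thesis by (rule degree_lmult(2)[OF d(1) x(1)])
  next
   case False
   then have "N.proj n (?a \<otimes>\<^sub>A x) = ?a \<otimes>\<^sub>A N.proj (n - j) x" using degree_lmult(1)[OF d(1) x(1), of "n - j"] by simp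
   then show ?thesis using x(2) n d(2) by simp
  qed
  then show "?a \<in> {a \<in> carrier A. N.proj n (a \<otimes>\<^sub>A x) = \<zero>\<^sub>A}" using d(2) by blast
 qed (use x(1) in \<open>auto simp: A.l_distr N.proj_add\<close>)
 then show ?thesis by blast
qed

lemma proj_lmult_lowest:
 assumes x: "x \<in> carrier A" "\<forall>k<i. N.proj k x = \<zero>\<^sub>A" and a: "a \<in> carrier A"
 shows "N.proj i (a \<otimes>\<^sub>A x) = aug a \<odot>\<^sub>A N.proj i x"
proof -
 have px: "N.proj i x \<in> carrier A" using x by simp
 have "a \<in> {a \<in> carrier A. N.proj i (a \<otimes>\<^sub>A x) = aug a \<odot>\<^sub>A N.proj i x}"
 proof (rule N.in_submodule_of_proj[OF a])
  fix j
  let ?a = "N.proj j a"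
  have d: "?a \<in> Adeg j" "?a \<in> carrier A" using N.proj_in[OF a UNIV_I] a by simp_all
  have "N.proj i (?a \<otimes>\<^sub>A x) = aug ?a \<odot>\<^sub>A N.proj i x"
  proof (cases "j = 0")
   case True
   then obtain c where c: "c \<in> carrier K" "?a = c \<odot>\<^sub>A \<one>\<^sub>A" using d(1) deg_0 by auto
   show ?thesis unfolding c(2) Q.aug_scalar[OF c(1)] using c(1) x(1) by (simp add: Q.smult_assoc_l N.proj_smult)
  next
   case False
   have z: "aug ?a = \<zero>\<^sub>K" using Q.aug_pos[OF d(1)] False by simp
   have "N.proj i (?a \<otimes>\<^sub>A x) = \<zero>\<^sub>A"
   proof (cases "i < j")
    case True
    then show ?thesis by (rule degree_lmult(2)[OF d(1) x(1)])
   next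
    case h: False
    then have "N.proj i (?a \<otimes>\<^sub>A x) = ?a \<otimes>\<^sub>A N.proj (i - j) x" using degree_lmult(1)[OF d(1) x(1), of "i - j"] by simp
    then show ?thesis using x(2) False h d(2) by simp
   qed
   then show ?thesis unfolding z using px by (simp add: V.smult_l_null)
  qed
  then show "?a \<in> {a \<in> carrier A. N.proj i (a \<otimes>\<^sub>A x) = aug a \<odot>\<^sub>A N.proj i x}" using d(2) by blast
 next
  fix y z assume "y \<in> {a \<in> carrier A. N.proj i (a \<otimes>\<^sub>A x) = aug a \<odot>\<^sub>A N.proj i x}"
   "z \<in> {a \<in> carrier A. N.proj i (a \<otimes>\<^sub>A x) = aug a \<odot>\<^sub>A N.proj i x}"
  then show "y \<oplus>\<^sub>A z \<in> {a \<in> carrier A. N.proj i (a \<otimes>\<^sub>A x) = aug a \<odot>\<^sub>A N.proj i x}"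
   using x(1) px by (simp add: A.l_distr N.proj_add Q.aug_add V.smult_l_distr)
 next
  show "\<zero>\<^sub>A \<in> {a \<in> carrier A. N.proj i (a \<otimes>\<^sub>A x) = aug a \<odot>\<^sub>A N.proj i x}"
   using x(1) px by (simp add: aug_zero V.smult_l_null)
 qed blast
 then show ?thesis by blast
qed

text \<open>The left ideal of elements of degree at least i is finitely generated, and modulo higher degrees
only scalars act on it; so the components of degree i of the generators span, and the projection to the fixed ring
preserves this.\<close>
lemma Bdeg_fin:
 assumes noeth: "left_noetherian A" shows "vectorspace.fin_dim K (A\<lparr>carrier := Bdeg i\<rparr>)"
proof -
 define P where "P v = Gd.proj \<one>\<^sub>G (N.proj i v)" for v
 define I where "I = {x \<in> carrier A. \<forall>k<i. N.proj k x = \<zero>\<^sub>A}"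
 have Pc: "P v \<in> Bdeg i" "P v \<in> carrier A" if "v \<in> carrier A" for v
  using gproj_deg[OF N.proj_in[OF that UNIV_I] G.one_closed, of i] that unfolding P_def by (simp_all add: Bdeg_iff)
 have Padd: "P (u \<oplus>\<^sub>A v) = P u \<oplus>\<^sub>A P v" if "u \<in> carrier A" "v \<in> carrier A" for u v
  using that by (simp add: P_def N.proj_add Gd.proj_add)
 have Pneg: "P (\<ominus>\<^sub>A v) = (\<ominus>\<^sub>K \<one>\<^sub>K) \<odot>\<^sub>A P v" "N.proj k (\<ominus>\<^sub>A v) = (\<ominus>\<^sub>K \<one>\<^sub>K) \<odot>\<^sub>A N.proj k v" if "v \<in> carrier A" for v k
  using that N.proj_smult[of v "\<ominus>\<^sub>K \<one>\<^sub>K"] Gd.proj_smult[of "N.proj i v" "\<ominus>\<^sub>K \<one>\<^sub>K" "\<one>\<^sub>G"]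
  by (simp_all add: P_def flip: R.smult_minus_one)
 have Isub: "I \<subseteq> carrier A" by (auto simp: I_def)
 have Ineg: "\<ominus>\<^sub>A x \<in> I" if "x \<in> I" for x using that Pneg(2)[of x] by (simp add: I_def V.smult_r_null)
 have Iadd: "x \<oplus>\<^sub>A y \<in> I" if "x \<in> I" "y \<in> I" for x y using that by (simp add: I_def N.proj_add)
 have Imult: "a \<otimes>\<^sub>A x \<in> I" if "a \<in> carrier A" "x \<in> I" for a x
  using that proj_lmult_vanish[of x i a] by (simp add: I_def)
 have I0: "\<zero>\<^sub>A \<in> I" by (simp add: I_def)
 have asub: "additive_subgroup T A" if "T \<subseteq> carrier A" "\<zero>\<^sub>A \<in> T" "!!x y. x \<in> T ==> y \<in> T ==> x \<oplus>\<^sub>A y \<in> T" "!!x. x \<in> T ==> \<ominus>\<^sub>A x \<in> T" for T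
  by (intro additive_subgroup.intro subgroup.intro) (use that in \<open>auto simp flip: a_inv_def\<close>)
 have "left_ideal A I" unfolding left_ideal_def using asub[OF Isub I0 Iadd Ineg] Imult by blast
 then obtain S where S: "finite S" "S \<subseteq> carrier A" "I = \<Inter>{J. left_ideal A J \<and> S \<subseteq> J}" using noeth unfolding left_noetherian_def by blast
 have PS: "P ` S \<subseteq> carrier A" "P ` S \<subseteq> Bdeg i" "finite (P ` S)" using Pc S by blast+
 have SI: "S \<subseteq> I" unfolding S(3) by blast
 let ?U = "V.span (P ` S)"
 have U: "VectorSpace.subspace K ?U A" using PS(1) by (rule V.span_is_subspace)
 have Uc: "\<zero>\<^sub>A \<in> ?U" "!!x y. x \<in> ?U ==> y \<in> ?U ==> x \<oplus>\<^sub>A y \<in> ?U" "!!c x. c \<in> carrier K ==> x \<in> ?U ==> c \<odot>\<^sub>A x \<in> ?U"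
  using U by (auto simp: subspace_def submodule_def)
 let ?J = "{x \<in> I. P x \<in> ?U}"
 have Pz: "P \<zero>\<^sub>A = \<zero>\<^sub>A" by (simp add: P_def)
 have "left_ideal A ?J" unfolding left_ideal_def
 proof (intro conjI ballI)
  show "additive_subgroup ?J A"
  proof (rule asub)
   show "?J \<subseteq> carrier A" using Isub by blast
   show "\<zero>\<^sub>A \<in> ?J" using I0 Uc(1) Pz by simp
   show "x \<oplus>\<^sub>A y \<in> ?J" if "x \<in> ?J" "y \<in> ?J" for x y
   proof -
    have "x \<in> carrier A" "y \<in> carrier A" using that Isub by blast+
    then show ?thesis using that Iadd[of x y] Uc(2)[of "P x" "P y"] by (simp add: Padd)
   qed
   show "\<ominus>\<^sub>A x \<in> ?J" if "x \<in> ?J" for x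
   proof -
    have "x \<in> carrier A" using that Isub by blast
    then show ?thesis using that Ineg[of x] Uc(3)[of "\<ominus>\<^sub>K \<one>\<^sub>K" "P x"] by (simp add: Pneg(1))
   qed
  qed
  fix a x assume a: "a \<in> carrier A" and x: "x \<in> ?J"
  have x': "x \<in> carrier A" "\<forall>k<i. N.proj k x = \<zero>\<^sub>A" using x by (auto simp: I_def)
  have "P (a \<otimes>\<^sub>A x) = aug a \<odot>\<^sub>A P x" unfolding P_def proj_lmult_lowest[OF x' a] using x' a by (simp add: Gd.proj_smult)
  then show "a \<otimes>\<^sub>A x \<in> ?J" using Imult[OF a] x Uc(3)[of "aug a" "P x"] a by simp
 qed
 moreover have "S \<subseteq> ?J" using SI V.in_own_span[OF PS(1)] by blast
 ultimately have IJ: "I \<subseteq> ?J" unfolding S(3) by blast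
 have gen: "V.span (P ` S) = Bdeg i"
 proof
  show "V.span (P ` S) \<subseteq> Bdeg i" by (rule V.span_is_subset[OF PS(2)]) (use Bdeg_sub[of i] in \<open>simp add: subspace_def\<close>)
  show "Bdeg i \<subseteq> V.span (P ` S)"
  proof
   fix b assume "b \<in> Bdeg i"
   then have b: "b \<in> Adeg i" "b \<in> B0" by (simp_all add: Bdeg_iff)
   have "b \<in> I" using b B0_closed N.proj_hom[OF UNIV_I b(1)] by (simp add: I_def)
   moreover have "P b = b" using N.proj_hom[OF UNIV_I b(1) UNIV_I, of i] Gd.proj_hom[OF G.one_closed b(2) G.one_closed] by (simp add: P_def)
   ultimately show "b \<in> V.span (P ` S)" using IJ by auto
  qed
 qed
 interpret W: vectorspace K "A\<lparr>carrier := Bdeg i\<rparr>" by (rule subspace_vectorspace[OF V.vectorspace_axioms Bdeg_sub])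
 have "W.span (P ` S) = V.span (P ` S)" by (rule V.span_li_not_depend(1)[OF PS(2)]) (use Bdeg_sub[of i] in \<open>simp add: subspace_def\<close>)
 then show ?thesis unfolding W.fin_dim_def using PS gen by (intro exI[of _ "P ` S"]) simp
qed

lemma BB_carrier: "BB\<lparr>carrier := Bdeg i\<rparr> = A\<lparr>carrier := Bdeg i\<rparr>"
 by (simp add: fixed_ring_def)

text \<open>The products f_g b, with b in a basis of the fixed ring in the complementary degree, form a basis.\<close>
lemma dim_Adeg:
 assumes noeth: "left_noetherian A"
 shows "vectorspace.dim K (A\<lparr>carrier := Adeg i\<rparr>) =
  (\<Sum>g\<in>{g \<in> carrier G. dg g \<le> i}. vectorspace.dim K (A\<lparr>carrier := Bdeg (i - dg g)\<rparr>))"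
proof -
 let ?W = "\<lambda>j. A\<lparr>carrier := Bdeg j\<rparr>"
 have W: "vectorspace K (?W j)" for j by (rule subspace_vectorspace[OF V.vectorspace_axioms Bdeg_sub])
 let ?Q = "\<lambda>j p. finite (fst p) \<and> fst p \<subseteq> Bdeg j \<and> card (fst p) = vectorspace.dim K (?W j) \<and>
   (\<forall>s\<in>fst p. \<forall>x\<in>Bdeg j. snd p s x \<in> carrier K) \<and>
   (\<forall>s\<in>fst p. \<forall>x\<in>Bdeg j. \<forall>y\<in>Bdeg j. \<forall>c\<in>carrier K. snd p s (c \<odot>\<^sub>A x \<oplus>\<^sub>A y) = c \<otimes>\<^sub>K snd p s x \<oplus>\<^sub>K snd p s y) \<and>
   (\<forall>s\<in>fst p. \<forall>t\<in>fst p. snd p s t = (if s = t then \<one>\<^sub>K else \<zero>\<^sub>K)) \<and>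
   (\<forall>x\<in>Bdeg j. (\<forall>s\<in>fst p. snd p s x = \<zero>\<^sub>K) --> x = \<zero>\<^sub>A)"
 have "\<forall>j. \<exists>p. ?Q j p"
 proof
  fix j
  show "\<exists>p. ?Q j p"
 proof -
  obtain Bs where Bs: "finite Bs" "vectorspace.basis K (?W j) Bs"
   using vectorspace.finite_basis_exists[OF W Bdeg_fin[OF noeth]] by blast
  have sub: "Bs \<subseteq> Bdeg j" using Bs(2) vectorspace.basis_def[OF W[of j]] by simp
  have cd: "card Bs = vectorspace.dim K (?W j)" by (rule vectorspace.dim_basis[OF W Bs, symmetric])
  obtain cf where "(\<forall>s\<in>Bs. \<forall>x\<in>carrier (?W j). cf s x \<in> carrier K) \<and>
   (\<forall>s\<in>Bs. \<forall>x\<in>carrier (?W j). \<forall>y\<in>carrier (?W j). \<forall>c\<in>carrier K.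
    cf s (c \<odot>\<^bsub>?W j\<^esub> x \<oplus>\<^bsub>?W j\<^esub> y) = c \<otimes>\<^sub>K cf s x \<oplus>\<^sub>K cf s y) \<and>
   (\<forall>s\<in>Bs. \<forall>t\<in>Bs. cf s t = (if s = t then \<one>\<^sub>K else \<zero>\<^sub>K)) \<and>
   (\<forall>x\<in>carrier (?W j). (\<forall>s\<in>Bs. cf s x = \<zero>\<^sub>K) --> x = \<zero>\<^bsub>?W j\<^esub>)"
   using basis_coordinates[OF W Bs] by (rule exE)
  then show ?thesis using Bs(1) sub cd by (intro exI[of _ "(Bs, cf)"]) simp
 qed
 qed
 from choice[of ?Q, OF this] obtain p where P: "\<forall>j. ?Q j (p j)" by (rule exE)
 note c1 = P[THEN spec, THEN conjunct2] and c2 = P[THEN spec, THEN conjunct2, THEN conjunct2]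
 note c3 = c2[THEN conjunct2]
 note c4 = c3[THEN conjunct2]
 note c5 = c4[THEN conjunct2]
 note p = P[THEN spec, THEN conjunct1] c1[THEN conjunct1] c2[THEN conjunct1] c3[THEN conjunct1, rule_format]
  c4[THEN conjunct1, rule_format] c5[THEN conjunct1, rule_format] c5[THEN conjunct2, THEN bspec, THEN mp]
 define S where "S = Sigma {g \<in> carrier G. dg g \<le> i} (\<lambda>g. fst (p (i - dg g)))"
 define b where "b s = f (fst s) \<otimes>\<^sub>A snd s" for s
 define q where "q g x = ldiv g (Gd.proj g x)" for g x
 define cf where "cf s x = snd (p (i - dg (fst s))) (snd s) (q (fst s) x)" for s x
 have Wz: "\<zero>\<^sub>A \<in> Bdeg j" for j using Bdeg_sub[of j] by (simp add: subspace_def submodule_def)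
 have S: "fst s \<in> carrier G" "dg (fst s) \<le> i" "snd s \<in> fst (p (i - dg (fst s)))" "snd s \<in> Adeg (i - dg (fst s))" "snd s \<in> B0" if "s \<in> S" for s
  using that p(2)[of "i - dg (fst s)"] by (auto simp: S_def Bdeg_iff)
 have q: "q g x \<in> B0" "f g \<otimes>\<^sub>A q g x = Gd.proj g x" "q g x \<in> iA (int i - int (dg g))" if "x \<in> Adeg i" "g \<in> carrier G" for g x
 proof -
  have y: "Gd.proj g x \<in> Adeg i" "Gd.proj g x \<in> gr g" using gproj_deg[OF that] by blast+
  show "q g x \<in> B0" "f g \<otimes>\<^sub>A q g x = Gd.proj g x" unfolding q_def by (rule ldiv[OF that(2) y(2)])+
  show "q g x \<in> iA (int i - int (dg g))" unfolding q_def by (rule ldiv_degree[OF that(2) y(2)]) (simp add: y(1))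
 qed
 have qB: "q g x \<in> Bdeg (i - dg g)" if "x \<in> Adeg i" "g \<in> carrier G" "dg g \<le> i" for g x
  using q(1,3)[OF that(1,2)] that(3) by (simp add: Bdeg_iff int_grading_def nat_diff_distrib)
 have bgr: "b s \<in> gr (fst s)" "b s \<in> Adeg i" if "s \<in> S" for s
  using gr_mult[OF S(1)[OF that] G.one_closed f_gr[OF S(1)[OF that]] S(5)[OF that]] deg_mult[OF f_deg[OF S(1)[OF that]] S(4)[OF that]]
   S(1,2)[OF that] by (simp_all add: b_def)
 have "vectorspace.dim K (A\<lparr>carrier := Adeg i\<rparr>) = card S"
 proof (rule coordinate_basis(4)[where cf = cf and b = b])
  show "vectorspace K (A\<lparr>carrier := Adeg i\<rparr>)" by (rule subspace_vectorspace[OF V.vectorspace_axioms N.W_sub[OF UNIV_I]])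
  show "finite S" unfolding S_def using finG p(1) by (intro finite_SigmaI) simp_all
  show "b s \<in> carrier (A\<lparr>carrier := Adeg i\<rparr>)" if "s \<in> S" for s using bgr(2)[OF that] by simp
  show "cf s x \<in> carrier K" if "s \<in> S" "x \<in> carrier (A\<lparr>carrier := Adeg i\<rparr>)" for s x
   unfolding cf_def using that S(1,2,3)[OF that(1)] by (intro p(4) qB) simp_all
  show "cf s (c \<odot>\<^bsub>A\<lparr>carrier := Adeg i\<rparr>\<^esub> x \<oplus>\<^bsub>A\<lparr>carrier := Adeg i\<rparr>\<^esub> y) = c \<otimes>\<^sub>K cf s x \<oplus>\<^sub>K cf s y"
   if h: "s \<in> S" "x \<in> carrier (A\<lparr>carrier := Adeg i\<rparr>)" "y \<in> carrier (A\<lparr>carrier := Adeg i\<rparr>)" "c \<in> carrier K" for s x y c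
  proof -
   have xy: "x \<in> Adeg i" "y \<in> Adeg i" using h by simp_all
   have xc: "x \<in> carrier A" "y \<in> carrier A" using xy N.W_carrier by blast+
   note s = S(1,2,3)[OF h(1)]
   have "q (fst s) (c \<odot>\<^sub>A x \<oplus>\<^sub>A y) = c \<odot>\<^sub>A q (fst s) x \<oplus>\<^sub>A q (fst s) y"
    unfolding q_def Gd.proj_linear[OF xc h(4) s(1)] by (rule ldiv_linear[OF s(1) Gd.proj_in[OF xc(1) s(1)] Gd.proj_in[OF xc(2) s(1)] h(4)])
   then have "cf s (c \<odot>\<^sub>A x \<oplus>\<^sub>A y) = c \<otimes>\<^sub>K cf s x \<oplus>\<^sub>K cf s y"
    unfolding cf_def using p(5)[OF s(3) qB[OF xy(1) s(1,2)] qB[OF xy(2) s(1,2)] h(4)] by (simp only:)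
   then show ?thesis by simp
  qed
  show "cf s (b t) = (if s = t then \<one>\<^sub>K else \<zero>\<^sub>K)" if h: "s \<in> S" "t \<in> S" for s t
  proof (cases "fst s = fst t")
   case True
   have "q (fst t) (b t) = snd t" unfolding q_def using Gd.proj_hom[OF S(1)[OF h(2)] bgr(1)[OF h(2)] S(1)[OF h(2)]]
    by (simp add: ldiv_eq[OF S(1)[OF h(2)] S(5)[OF h(2)] b_def[symmetric]])
   then have "cf s (b t) = snd (p (i - dg (fst t))) (snd s) (snd t)" by (simp add: cf_def True)
   also have "\<dots> = (if snd s = snd t then \<one>\<^sub>K else \<zero>\<^sub>K)" using S(3)[OF h(1)] S(3)[OF h(2)] True by (intro p(6)) simp_all
   finally show ?thesis using True by (simp add: prod_eq_iff)
  next
   case False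
   have "q (fst s) (b t) = \<zero>\<^sub>A" unfolding q_def using Gd.proj_hom[OF S(1)[OF h(2)] bgr(1)[OF h(2)] S(1)[OF h(1)]] False
    by (simp add: ldiv_zero[OF S(1)[OF h(1)]])
   moreover have "snd (p (i - dg (fst s))) (snd s) \<zero>\<^sub>A = \<zero>\<^sub>K"
    using p(5)[OF S(3)[OF h(1)] Wz Wz, of "\<ominus>\<^sub>K \<one>\<^sub>K"] p(4)[OF S(3)[OF h(1)] Wz]
    by (simp add: V.smult_r_null l_minus l_neg)
   ultimately show ?thesis using False by (auto simp: cf_def)
  qed
  show "x = \<zero>\<^bsub>A\<lparr>carrier := Adeg i\<rparr>\<^esub>" if h: "x \<in> carrier (A\<lparr>carrier := Adeg i\<rparr>)" "\<forall>s\<in>S. cf s x = \<zero>\<^sub>K" for x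
  proof -
   have x: "x \<in> Adeg i" "x \<in> carrier A" using h(1) N.W_carrier by simp_all
   have "x = \<zero>\<^sub>A"
   proof (rule Gd.proj_ext[OF x(2) A.zero_closed])
    fix g assume g: "g \<in> carrier G"
    have "q g x = \<zero>\<^sub>A"
    proof (cases "dg g \<le> i")
     case True
     show ?thesis
     proof (rule p(7)[OF qB[OF x(1) g True]], rule ballI)
      fix s assume "s \<in> fst (p (i - dg g))"
      then have "(g, s) \<in> S" using g True by (simp add: S_def)
      then show "snd (p (i - dg g)) s (q g x) = \<zero>\<^sub>K" using h(2) by (auto simp: cf_def)
     qed
    next
     case False
     then show ?thesis using q(3)[OF x(1) g] by (simp add: int_grading_def)
    qed
    then have "Gd.proj g x = f g \<otimes>\<^sub>A \<zero>\<^sub>A" using q(2)[OF x(1) g] by (simp only:)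
    also have "\<dots> = Gd.proj g \<zero>\<^sub>A" using f_closed[OF g] g by simp
    finally show "Gd.proj g x = Gd.proj g \<zero>\<^sub>A" .
   qed
   then show ?thesis by simp
  qed
 qed
 also have "card S = (\<Sum>g\<in>{g \<in> carrier G. dg g \<le> i}. card (fst (p (i - dg g))))"
  unfolding S_def using finG p(1) by (intro card_SigmaI) simp_all
 finally show ?thesis unfolding p(3) .
qed

lemma dim_Bdeg_0: "vectorspace.dim K (A\<lparr>carrier := Bdeg 0\<rparr>) = 1"
proof -
 have B: "Bdeg 0 = {c \<odot>\<^sub>A \<one>\<^sub>A | c. c \<in> carrier K}" using Bc.deg_0 by simp
 have cl: "x \<in> carrier A" if "x \<in> Bdeg 0" for x using that B0_closed by (simp add: Bdeg_iff)
 have "vectorspace.dim K (A\<lparr>carrier := Bdeg 0\<rparr>) = card {0::nat}"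
 proof (rule coordinate_basis(4)[where cf = "\<lambda>_. aug" and b = "\<lambda>_. \<one>\<^sub>A"])
  show "vectorspace K (A\<lparr>carrier := Bdeg 0\<rparr>)" by (rule subspace_vectorspace[OF V.vectorspace_axioms Bdeg_sub])
  show "\<one>\<^sub>A \<in> carrier (A\<lparr>carrier := Bdeg 0\<rparr>)" unfolding B by (auto intro!: exI[of _ "\<one>\<^sub>K"])
  fix x assume x: "x \<in> carrier (A\<lparr>carrier := Bdeg 0\<rparr>)" "\<forall>s\<in>{0::nat}. aug x = \<zero>\<^sub>K"
  then obtain c where "c \<in> carrier K" "x = c \<odot>\<^sub>A \<one>\<^sub>A" unfolding B by auto
  then show "x = \<zero>\<^bsub>A\<lparr>carrier := Bdeg 0\<rparr>\<^esub>" using x(2) Q.aug_scalar[of c] by (simp add: V.smult_l_null)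
 qed (use cl in \<open>auto simp: Q.aug_linear\<close>)
 then show ?thesis by simp
qed

definition dpoly :: "rat poly" where "dpoly = (\<Sum>g\<in>carrier G. monom 1 (dg g))"

lemma coeff_dpoly: "coeff dpoly k = of_nat (card {g \<in> carrier G. dg g = k})"
 using finG by (simp add: dpoly_def coeff_sum sum.If_cases Int_def conj_commute)

lemma hilbert_covariant: "hilbert_series K CC Cdeg = fps_of_poly dpoly"
 by (rule fps_ext) (simp add: hilbert_series_def dim_Cdeg coeff_dpoly)

lemma hilbert_quotient:
 assumes noeth: "left_noetherian A"
 shows "fps_of_poly dpoly = hilbert_series K A Adeg * inverse (hilbert_series K BB Bdeg)"
proof -
 let ?H = "hilbert_series K BB Bdeg"
 have H: "fps_nth ?H j = of_nat (vectorspace.dim K (A\<lparr>carrier := Bdeg j\<rparr>))" for j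
  unfolding hilbert_series_def BB_carrier by simp
 have "hilbert_series K A Adeg = fps_of_poly dpoly * ?H"
 proof (rule fps_ext)
  fix i
  have "fps_nth (fps_of_poly dpoly * ?H) i = (\<Sum>g\<in>carrier G. fps_nth (fps_X ^ dg g * ?H) i)"
   by (simp add: dpoly_def fps_of_poly_sum fps_of_poly_monom sum_distrib_right fps_sum_nth)
  also have "\<dots> = (\<Sum>g\<in>carrier G. if dg g \<le> i then fps_nth ?H (i - dg g) else 0)"
   by (intro sum.cong refl) (simp add: fps_X_power_mult_nth)
  also have "\<dots> = (\<Sum>g\<in>{g \<in> carrier G. dg g \<le> i}. fps_nth ?H (i - dg g))"
   using finG by (rule sum.inter_filter[symmetric])
  also have "\<dots> = fps_nth (hilbert_series K A Adeg) i"
   unfolding H by (simp add: hilbert_series_def dim_Adeg[OF noeth])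
  finally show "fps_nth (hilbert_series K A Adeg) i = fps_nth (fps_of_poly dpoly * ?H) i" by (rule sym)
 qed
 moreover have "fps_nth ?H 0 ~= 0" unfolding H dim_Bdeg_0 by simp
 ultimately show ?thesis by (simp add: mult.assoc inverse_mult_eq_1')
qed

end

context paired_reflection_data
begin

lemma dpoly_top: "degree dpoly = dg m" "lead_coeff dpoly = 1"
proof -
 have "{g \<in> carrier G. dg g = dg m} = {m}" using dg_eq_m by auto
 then have c: "coeff dpoly (dg m) = 1" by (simp add: coeff_dpoly)
 have z: "coeff dpoly k = 0" if "k > dg m" for k
 proof -
  have "{g \<in> carrier G. dg g = k} = {}" using dg_le_m that by fastforce
  then show ?thesis by (simp only: coeff_dpoly card.empty of_nat_0)
 qed
 show d: "degree dpoly = dg m" using c z by (intro antisym degree_le le_degree) auto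
 show "lead_coeff dpoly = 1" unfolding d by (rule c)
qed

end

section \<open>Assembling the hypotheses\<close>

context group_graded_algebra
begin

text \<open>In a domain the degrees that occur are closed under products and, G being finite, under inverses. The functions that
vanish on this subgroup form a Hopf ideal that kills A: with p_x the indicator function of x, the coproduct of
a function u is the sum of the p_x with second factor y -> u(x y).\<close>
lemma inner_faithful_support:
 assumes dom: "nc_domain A" and ifa: "inner_faithful K A G gr" and g: "g \<in> carrier G"
 shows "\<exists>x\<in>gr g. x ~= \<zero>\<^sub>A"
proof (rule ccontr)
 define S where "S = {g \<in> carrier G. \<exists>x\<in>gr g. x ~= \<zero>\<^sub>A}"
 assume "\<not> (\<exists>x\<in>gr g. x ~= \<zero>\<^sub>A)"
 then have gS: "g \<notin> S" by (auto simp: S_def)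
 have SG: "S \<subseteq> carrier G" "finite S" using finG by (auto simp: S_def)
 have S1: "\<one>\<^sub>G \<in> S" using one_gr A_nontrivial by (auto simp: S_def)
 have Sm: "x \<otimes>\<^sub>G y \<in> S" if xy: "x \<in> S" "y \<in> S" for x y
 proof -
  obtain u v where u: "u \<in> gr x" "u ~= \<zero>\<^sub>A" "v \<in> gr y" "v ~= \<zero>\<^sub>A" using xy by (auto simp: S_def)
  have c: "x \<in> carrier G" "y \<in> carrier G" using xy SG by auto
  have "u \<otimes>\<^sub>A v ~= \<zero>\<^sub>A" using dom u Gd.W_carrier[OF c(1)] Gd.W_carrier[OF c(2)] unfolding nc_domain_def by blast
  then show ?thesis using gr_mult[OF c u(1,3)] c by (auto simp: S_def)
 qed
 have Si: "inv\<^bsub>G\<^esub> x \<in> S" if x: "x \<in> S" for x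
 proof -
  have xG: "x \<in> carrier G" using x SG by blast
  have "(\<lambda>h. x \<otimes>\<^sub>G h) ` S = S"
  proof (rule endo_inj_surj[OF SG(2)])
   show "(\<lambda>h. x \<otimes>\<^sub>G h) ` S \<subseteq> S" using Sm x by blast
   show "inj_on (\<lambda>h. x \<otimes>\<^sub>G h) S" using SG xG by (auto intro!: inj_onI simp: subset_eq)
  qed
  then obtain h where h: "h \<in> S" "x \<otimes>\<^sub>G h = \<one>\<^sub>G" using S1 by (metis imageE)
  then have "inv\<^bsub>G\<^esub> x = h" using G.inv_equality[of h x] G.inv_unique'[of x h] SG xG G.inv_comm[of x h] by (metis subsetD)
  then show ?thesis using h(1) by simp
 qed
 let ?D = "dual_group_algebra K G"
 define J where "J = {ph \<in> ?D. \<forall>x\<in>S. ph x = \<zero>\<^sub>K}"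
 have Jv: "ph x \<in> carrier K" if "ph \<in> ?D" "x \<in> carrier G" for ph x using that by (auto simp: dual_group_algebra_def)
 have res: "(\<lambda>x\<in>carrier G. u x) \<in> ?D" if "!!x. x \<in> carrier G ==> u x \<in> carrier K" for u using that by (auto simp: dual_group_algebra_def)
 have JI: "(\<lambda>x\<in>carrier G. u x) \<in> J" if "!!x. x \<in> carrier G ==> u x \<in> carrier K" "!!x. x \<in> S ==> u x = \<zero>\<^sub>K" for u
  using res[of u] that SG by (auto simp: J_def)
 have J0: "ph x = \<zero>\<^sub>K" if "ph \<in> J" "x \<in> S" for ph x using that by (simp add: J_def)
 have JD: "ph \<in> ?D" if "ph \<in> J" for ph using that by (simp add: J_def)
 have "hopf_ideal K G J" unfolding hopf_ideal_def
 proof (intro conjI ballI)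
  show "J \<subseteq> ?D" using JD by blast
  show "(\<lambda>_\<in>carrier G. \<zero>\<^sub>K) \<in> J" by (rule JI) simp_all
  show "(\<lambda>x\<in>carrier G. ph x \<oplus>\<^sub>K ps x) \<in> J" if "ph \<in> J" "ps \<in> J" for ph ps
   using that by (intro JI) (simp_all add: Jv JD J0)
  show "(\<lambda>x\<in>carrier G. ps x \<otimes>\<^sub>K ph x) \<in> J" if h: "ph \<in> J" "ps \<in> ?D" for ph ps
  proof (rule JI)
   show "ps x \<otimes>\<^sub>K ph x \<in> carrier K" if "x \<in> carrier G" for x using h that by (simp add: Jv JD)
   show "ps x \<otimes>\<^sub>K ph x = \<zero>\<^sub>K" if "x \<in> S" for x using J0[OF h(1) that] Jv[OF h(2), of x] SG that by auto
  qed
  show "ph \<one>\<^sub>G = \<zero>\<^sub>K" if "ph \<in> J" for ph using J0[OF that S1] .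
  show "(\<lambda>x\<in>carrier G. ph (inv\<^bsub>G\<^esub> x)) \<in> J" if "ph \<in> J" for ph using that by (intro JI) (simp_all add: Jv JD J0 Si)
  fix ph assume ph: "ph \<in> J"
  obtain e where e: "bij_betw e {0..<card (carrier G)} (carrier G)" using ex_bij_betw_nat_finite[OF finG] by blast
  have eG: "e i \<in> carrier G" if "i < card (carrier G)" for i using bij_betwE[OF e] that by simp
  define a where "a i = (\<lambda>x\<in>carrier G. if x = e i then \<one>\<^sub>K else \<zero>\<^sub>K)" for i
  define b where "b i = (\<lambda>y\<in>carrier G. ph (e i \<otimes>\<^sub>G y))" for i
  show "\<exists>(n::nat) a b. (\<forall>i<n. a i \<in> ?D \<and> b i \<in> ?D \<and> (a i \<in> J \<or> b i \<in> J)) \<and>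
    (\<forall>x\<in>carrier G. \<forall>y\<in>carrier G. ph (x \<otimes>\<^sub>G y) = (\<Oplus>\<^sub>K i\<in>{..<n}. a i x \<otimes>\<^sub>K b i y))"
  proof (rule exI[of _ "card (carrier G)"], rule exI[of _ a], rule exI[of _ b], intro conjI allI impI ballI)
   fix i assume i: "i < card (carrier G)"
   show "a i \<in> ?D" unfolding a_def by (rule res) simp
   show "b i \<in> ?D" unfolding b_def by (rule res) (simp add: Jv JD ph eG i)
   show "a i \<in> J \<or> b i \<in> J"
   proof (cases "e i \<in> S")
    case True
    have "b i \<in> J" unfolding b_def by (rule JI) (simp_all add: Jv JD ph eG i J0 Sm True)
    then show ?thesis by (rule disjI2)
   next
    case False
    have "a i \<in> J" unfolding a_def by (rule JI) (use False in auto)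
    then show ?thesis by (rule disjI1)
   qed
  next
   fix x y assume xy: "x \<in> carrier G" "y \<in> carrier G"
   have "x \<in> e ` {0..<card (carrier G)}" using e xy(1) unfolding bij_betw_def by simp
   then obtain j where j: "j < card (carrier G)" "e j = x" by (elim imageE) simp
   have c: "ph (x \<otimes>\<^sub>G y) \<in> carrier K" using xy by (simp add: Jv JD ph)
   have inj: "e i = x \<longleftrightarrow> i = j" if "i < card (carrier G)" for i
    using e that j by (auto simp: bij_betw_def inj_on_def)
   have "(\<Oplus>\<^sub>K i\<in>{..<card (carrier G)}. a i x \<otimes>\<^sub>K b i y) = (\<Oplus>\<^sub>K i\<in>{..<card (carrier G)}. if j = i then ph (x \<otimes>\<^sub>G y) else \<zero>\<^sub>K)"
    using c xy inj j by (intro finsum_cong') (auto simp: a_def b_def Jv JD ph eG)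
   also have "\<dots> = ph (x \<otimes>\<^sub>G y)" using finsum_singleton[of j "{..<card (carrier G)}" "\<lambda>_. ph (x \<otimes>\<^sub>G y)"] j(1) c by simp
   finally show "ph (x \<otimes>\<^sub>G y) = (\<Oplus>\<^sub>K i\<in>{..<card (carrier G)}. a i x \<otimes>\<^sub>K b i y)" by (rule sym)
  qed
 qed
 moreover have "dual_action A G gr ph x = \<zero>\<^sub>A" if ph: "ph \<in> J" and x: "x \<in> carrier A" for ph x
 proof -
  have "ph h \<odot>\<^sub>A Gd.proj h x = \<zero>\<^sub>A" if h: "h \<in> carrier G" for h
  proof (cases "h \<in> S")
   case True
   then show ?thesis using J0[OF ph True] x h by (simp add: V.smult_l_null)
  next
   case False
   then have "Gd.proj h x = \<zero>\<^sub>A" using Gd.proj_in[OF x h] h by (auto simp: S_def)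
   then show ?thesis using Jv[OF JD[OF ph] h] by (simp add: V.smult_r_null)
  qed
  then have "dual_action A G gr ph x = (\<Oplus>\<^sub>A h\<in>carrier G. \<zero>\<^sub>A)"
   unfolding dual_action_def Gd.proj_def[symmetric] by (intro A.finsum_cong') simp_all
  then show ?thesis by simp
 qed
 ultimately have "J = {\<lambda>_\<in>carrier G. \<zero>\<^sub>K}" using ifa unfolding inner_faithful_def by blast
 moreover have "(\<lambda>x\<in>carrier G. if x = g then \<one>\<^sub>K else \<zero>\<^sub>K) \<in> J" by (rule JI) (use gS in auto)
 ultimately have "(\<lambda>x\<in>carrier G. if x = g then \<one>\<^sub>K else \<zero>\<^sub>K) g = (\<lambda>_\<in>carrier G. \<zero>\<^sub>K) g" by simp
 then show False using g by simp
qed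

end

context coarsened
begin

lemma Bsp_lift: assumes "b \<in> Bsp n k" shows "\<exists>H. mlin n H \<and> b = lift n H"
proof (cases n)
 case 0
 then show ?thesis using assms mlin_zero[of 0] unfolding Bsp_def 0 zero_cochain_lift by auto
next
 case (Suc i)
 then obtain \<Psi> where \<Psi>: "\<Psi> \<in> bar_cochains K A triv reg i" "b = bar_differential A triv reg i \<Psi>"
  using assms by (auto simp: Bsp_def homogeneous_cochains_def)
 let ?H = "\<lambda>as. \<Psi> (as, \<one>\<^sub>K)"
 have H: "mlin i ?H" by (rule cochain_mlin[OF \<Psi>(1)]) simp
 have "b = bar_differential A triv reg i (lift i ?H)" unfolding cochain_lift[OF \<Psi>(1), symmetric] by (rule \<Psi>(2))
 then have "b = lift (Suc i) (ldiff ?H)" unfolding bar_differential_lift[OF H] .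
 then show ?thesis unfolding Suc using mlin_ldiff[OF H] by blast
qed

lemma add_zero_cochain: "mlin n H ==> cadd n (lift n H) (zero_cochain A triv reg n) = lift n H"
 unfolding zero_cochain_lift cadd_def
 by (subst lift_add[OF _ mlin_zero], assumption, rule lift_cong) (simp add: mlin_closed)

text \<open>An isomorphism of Ext with a zero space is only known as a bijection, so the zero class has to be exhibited.\<close>
lemma Ext_trivial_if_subsingleton:
 assumes u: "u \<in> carrier GG" and eq: "!!X Y. X \<in> carrier (ExtM n (q u)) ==> Y \<in> carrier (ExtM n (q u)) ==> X = Y"
 shows "carrier (ExtM n (q u)) = {zero (ExtM n (q u))}"
proof -
 let ?z = "zero_cochain A triv reg n"
 have c: "T.cochain (\<lambda>_. u) n (\<lambda>_ _. \<zero>\<^sub>A)" using T.cochain_zero[OF T_weight[OF u]] .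
 have l: "lift n (ext (\<lambda>_ _. \<zero>\<^sub>A)) = lift n (\<lambda>_. \<zero>\<^sub>A)" by (rule lift_cong) (simp add: ext_zero)
 have "?z \<in> homogeneous_cochains K A GG' dA' triv mdeg reg dA' n (q u)"
  using lift_ext_homogeneous[OF c u] unfolding zero_cochain_lift l .
 moreover have "bar_differential A triv reg n ?z = zero_cochain A triv reg (Suc n)"
  unfolding zero_cochain_lift bar_differential_lift[OF mlin_zero] by (rule lift_cong) (rule ldiff_zero)
 ultimately have "?z \<in> Zsp n (q u)" by (simp add: Zsp_def)
 then have "(\<lambda>b. cadd n b ?z) ` Bsp n (q u) \<in> carrier (ExtM n (q u))" unfolding Ext_carrier by (intro CollectI exI[of _ ?z] conjI refl)
 moreover have "(\<lambda>b. cadd n b ?z) ` Bsp n (q u) = (\<lambda>b. b) ` Bsp n (q u)"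
 proof (rule image_cong[OF refl])
  fix b assume "b \<in> Bsp n (q u)"
  then obtain H where "mlin n H" "b = lift n H" using Bsp_lift by blast
  then show "cadd n b ?z = b" by (simp only: add_zero_cochain)
 qed
 ultimately have "zero (ExtM n (q u)) \<in> carrier (ExtM n (q u))" unfolding Ext_zero by simp
 then show ?thesis using eq by blast
qed

end

context dual_reflection_data
begin

lemma Ext_fixed_trivial:
 assumes "!!X Y. X \<in> carrier (Ext_trivial K BB Bdeg d j) ==> Y \<in> carrier (Ext_trivial K BB Bdeg d j) ==> X = Y"
 shows "carrier (Ext_trivial K BB Bdeg d j) = {zero (Ext_trivial K BB Bdeg d j)}"
proof -
 interpret CB: coarsened K BB Bdeg integer_group Bc.iA integer_group Bc.iA id by (rule BI.coarsened_id)
 have e: "Ext_trivial K BB Bdeg d j = CB.ExtM d (id j)" by (simp add: Ext_trivial_def)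
 show ?thesis unfolding e by (rule CB.Ext_trivial_if_subsingleton) (use assms in \<open>simp_all add: e\<close>)
qed

end

context paired_reflection_data
begin

lemma covariant_ring_structure:
 assumes noeth: "left_noetherian A" and gen1: "generated_in_degree_1 K A Adeg" and S: "S \<subseteq> carrier G"
  and S_A1: "internal_direct_sum K (A\<lparr>carrier := Adeg 1\<rparr>) (insert None (Some ` S))
   (\<lambda>i. case i of None => Adeg 1 \<inter> gr \<one>\<^sub>G | Some g => {c \<odot>\<^sub>A f g | c. c \<in> carrier K})"
 shows "(frobenius_algebra K CC Cdeg \<and> vectorspace.dim K CC = card (carrier G)) \<and>
   (\<exists>p :: rat poly.
    fps_of_poly p = hilbert_series K A Adeg * inverse (hilbert_series K BB Bdeg) \<and>
    hilbert_series K CC Cdeg = fps_of_poly p \<and> (\<forall>i\<le>degree p. coeff p i > 0) \<and> lead_coeff p = 1) \<and>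
   inj_on fb (carrier G) \<and> vectorspace.basis K CC (fb ` carrier G) \<and>
   (\<exists>\<mu> \<beta>. nakayama_automorphism K CC Cdeg \<mu> \<and>
    (\<forall>\<nu>. nakayama_automorphism K CC Cdeg \<nu> --> (\<forall>x\<in>carrier CC. \<nu> x = \<mu> x)) \<and>
    (\<forall>g\<in>carrier G. \<beta> g \<in> carrier K \<and> \<beta> g ~= \<zero>\<^sub>K \<and>
      \<mu> (fb g) = \<beta> g \<odot>\<^sub>CC fb (m \<otimes>\<^sub>G g \<otimes>\<^sub>G inv\<^bsub>G\<^esub> m)) \<and>
    \<beta> m = \<one>\<^sub>K \<and>
    (\<forall>g\<in>carrier G. \<forall>h\<in>carrier G.
      m \<otimes>\<^sub>G g = g \<otimes>\<^sub>G m \<and> m \<otimes>\<^sub>G h = h \<otimes>\<^sub>G m \<and>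
      word_length G S (g \<otimes>\<^sub>G h) = word_length G S g + word_length G S h -->
      \<beta> (g \<otimes>\<^sub>G h) = \<beta> g \<otimes>\<^sub>K \<beta> h))"
proof (intro conjI)
 show "frobenius_algebra K CC Cdeg"
  unfolding frobenius_algebra_def using CC_connected CC_basis(3) form_frobenius by blast
 show "vectorspace.dim K CC = card (carrier G)" by (rule CC_basis(4))
 show "inj_on fb (carrier G)" by (rule CC_basis(1))
 show "vectorspace.basis K CC (fb ` carrier G)" by (rule CC_basis(2))
 have "coeff dpoly i > 0" if "i \<le> degree dpoly" for i
 proof -
  obtain h where "h \<in> carrier G" "dg h = i" using dg_levels[OF S S_A1 gen1 m, of i] \<open>i \<le> degree dpoly\<close> dpoly_top(1) by auto
  then have "card {g \<in> carrier G. dg g = i} > 0" using finG by (auto simp: card_gt_0_iff)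
  then show ?thesis by (simp add: coeff_dpoly)
 qed
 then show "\<exists>p :: rat poly. fps_of_poly p = hilbert_series K A Adeg * inverse (hilbert_series K BB Bdeg) \<and>
    hilbert_series K CC Cdeg = fps_of_poly p \<and> (\<forall>i\<le>degree p. coeff p i > 0) \<and> lead_coeff p = 1"
  using hilbert_quotient[OF noeth] hilbert_covariant dpoly_top(2) by (intro exI[of _ dpoly] conjI allI impI)
 have b: "beta (g \<otimes>\<^sub>G h) = beta g \<otimes>\<^sub>K beta h"
  if g: "g \<in> carrier G" and h: "h \<in> carrier G" and c: "m \<otimes>\<^sub>G g = g \<otimes>\<^sub>G m \<and> m \<otimes>\<^sub>G h = h \<otimes>\<^sub>G m \<and>
      word_length G S (g \<otimes>\<^sub>G h) = word_length G S g + word_length G S h" for g h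
  using c word_length_dg[OF S S_A1 gen1] g h by (intro beta_mult) simp_all
 show "\<exists>\<mu> \<beta>. nakayama_automorphism K CC Cdeg \<mu> \<and>
    (\<forall>\<nu>. nakayama_automorphism K CC Cdeg \<nu> --> (\<forall>x\<in>carrier CC. \<nu> x = \<mu> x)) \<and>
    (\<forall>g\<in>carrier G. \<beta> g \<in> carrier K \<and> \<beta> g ~= \<zero>\<^sub>K \<and>
      \<mu> (fb g) = \<beta> g \<odot>\<^sub>CC fb (m \<otimes>\<^sub>G g \<otimes>\<^sub>G inv\<^bsub>G\<^esub> m)) \<and>
    \<beta> m = \<one>\<^sub>K \<and>
    (\<forall>g\<in>carrier G. \<forall>h\<in>carrier G.
      m \<otimes>\<^sub>G g = g \<otimes>\<^sub>G m \<and> m \<otimes>\<^sub>G h = h \<otimes>\<^sub>G m \<and>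
      word_length G S (g \<otimes>\<^sub>G h) = word_length G S g + word_length G S h -->
      \<beta> (g \<otimes>\<^sub>G h) = \<beta> g \<otimes>\<^sub>K \<beta> h)"
 proof (rule exI[of _ nak], rule exI[of _ beta], intro conjI allI ballI impI)
  show "nakayama_automorphism K CC Cdeg nak" by (rule nak_nakayama)
  show "\<nu> x = nak x" if "nakayama_automorphism K CC Cdeg \<nu>" "x \<in> carrier CC" for \<nu> x by (rule nakayama_unique[OF that])
  show "beta g \<in> carrier K" "beta g ~= \<zero>\<^sub>K" if "g \<in> carrier G" for g by (rule beta[OF that])+
  show "nak (fb g) = beta g \<odot>\<^sub>CC fb (m \<otimes>\<^sub>G g \<otimes>\<^sub>G inv\<^bsub>G\<^esub> m)" if "g \<in> carrier G" for g
   using nak_fb[OF that] unfolding cj_def .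
  show "beta m = \<one>\<^sub>K" by (rule beta_m)
 qed (rule b)
qed

end

theorem theorem0p4:
  fixes K :: "'k ring" and A :: "('k, 'a) module" and Adeg :: "nat \<Rightarrow> 'a set"
    and G :: "'g monoid" and gr :: "'g \<Rightarrow> 'a set"
    and f :: "'g \<Rightarrow> 'a" and R :: "'g set" and D m :: 'g
  defines "C \<equiv> covariant_ring A Adeg G gr"
    and "Cdeg \<equiv> covariant_deg A Adeg G gr"
    and "fbar \<equiv> (\<lambda>g. covariant_image A Adeg G gr (f g))"
  assumes "field K"
    and char_0: "\<forall>n::nat. n > 0 \<longrightarrow> [n] \<cdot>\<^bsub>K\<^esub> \<one>\<^bsub>K\<^esub> \<noteq> \<zero>\<^bsub>K\<^esub>"
    and "group G" and "finite (carrier G)"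
    and "dual_reflection_group K A Adeg G gr"
    and "homological_codeterminant K A Adeg G gr D" and "m = inv\<^bsub>G\<^esub> D"
    and f_hom: "\<forall>g\<in>carrier G. \<exists>i. f g \<in> Adeg i" and f_one: "f \<one>\<^bsub>G\<^esub> = \<one>\<^bsub>A\<^esub>"
    and f_gr: "\<forall>g\<in>carrier G. gr g = {f g \<otimes>\<^bsub>A\<^esub> x | x. x \<in> gr \<one>\<^bsub>G\<^esub>} \<and>
                               gr g = {x \<otimes>\<^bsub>A\<^esub> f g | x. x \<in> gr \<one>\<^bsub>G\<^esub>}"
    and R_gen: "R \<subseteq> carrier G" "\<one>\<^bsub>G\<^esub> \<notin> R" "generate G R = carrier G"
    and R_A1: "internal_direct_sum K (A\<lparr>carrier := Adeg 1\<rparr>) (insert None (Some ` R))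
                 (\<lambda>i. case i of None \<Rightarrow> Adeg 1 \<inter> gr \<one>\<^bsub>G\<^esub>
                            | Some g \<Rightarrow> {c \<odot>\<^bsub>A\<^esub> f g | c. c \<in> carrier K})"
  shows
    "(frobenius_algebra K C Cdeg \<and> vectorspace.dim K C = card (carrier G)) \<and>
     (\<exists>p :: rat poly.
       fps_of_poly p =
         hilbert_series K A Adeg *
         inverse (hilbert_series K (fixed_ring A G gr) (fixed_deg Adeg G gr)) \<and>
       hilbert_series K C Cdeg = fps_of_poly p \<and>
       (\<forall>i\<le>degree p. coeff p i > 0) \<and> lead_coeff p = 1) \<and>
     inj_on fbar (carrier G) \<and> vectorspace.basis K C (fbar ` carrier G) \<and>
     (\<exists>\<mu> \<beta>. nakayama_automorphism K C Cdeg \<mu> \<and>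
        (\<forall>\<nu>. nakayama_automorphism K C Cdeg \<nu> \<longrightarrow> (\<forall>x\<in>carrier C. \<nu> x = \<mu> x)) \<and>
        (\<forall>g\<in>carrier G. \<beta> g \<in> carrier K \<and> \<beta> g \<noteq> \<zero>\<^bsub>K\<^esub> \<and>
           \<mu> (fbar g) = \<beta> g \<odot>\<^bsub>C\<^esub> fbar (m \<otimes>\<^bsub>G\<^esub> g \<otimes>\<^bsub>G\<^esub> inv\<^bsub>G\<^esub> m)) \<and>
        \<beta> m = \<one>\<^bsub>K\<^esub> \<and>
        (\<forall>g\<in>carrier G. \<forall>h\<in>carrier G.
           m \<otimes>\<^bsub>G\<^esub> g = g \<otimes>\<^bsub>G\<^esub> m \<and> m \<otimes>\<^bsub>G\<^esub> h = h \<otimes>\<^bsub>G\<^esub> m \<and>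
           word_length G R (g \<otimes>\<^bsub>G\<^esub> h) = word_length G R g + word_length G R h \<longrightarrow>
           \<beta> (g \<otimes>\<^bsub>G\<^esub> h) = \<beta> g \<otimes>\<^bsub>K\<^esub> \<beta> h))"
proof -
 obtain d l dB lB where GA: "AS_Gorenstein K A Adeg d l"
  and GB: "AS_Gorenstein K (fixed_ring A G gr) (fixed_deg Adeg G gr) dB lB"
  using \<open>dual_reflection_group K A Adeg G gr\<close> unfolding dual_reflection_group_def AS_regular_def by blast
 have props: "nc_noetherian A" "nc_domain A" "generated_in_degree_1 K A Adeg" "homogeneous_coaction K A Adeg G gr" "inner_faithful K A G gr"
  using \<open>dual_reflection_group K A Adeg G gr\<close> unfolding dual_reflection_group_def by blast+
 have cA: "connected_graded K A Adeg" using GA unfolding AS_Gorenstein_def by (rule conjunct1)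
 have cB: "connected_graded K (fixed_ring A G gr) (fixed_deg Adeg G gr)" using GB unfolding AS_Gorenstein_def by (rule conjunct1)
 interpret CA: connected_graded_algebra K A Adeg by (rule connected_graded_algebra.intro[OF \<open>field K\<close> cA])
 have "fixed_deg Adeg G gr 0 = {c \<odot>\<^sub>A \<one>\<^sub>A | c. c \<in> carrier K}"
  using cB unfolding connected_graded_def fixed_ring_def by simp
 moreover have "\<one>\<^sub>A = \<one>\<^sub>K \<odot>\<^sub>A \<one>\<^sub>A" by simp
 ultimately have one_gr: "\<one>\<^sub>A \<in> gr \<one>\<^sub>G" unfolding fixed_deg_def using CA.one_closed by blast
 interpret GG: group_graded_algebra K A Adeg G gr
  by (intro group_graded_algebra.intro group_graded_algebra_axioms.intro CA.connected_graded_algebra_axioms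
    \<open>group G\<close> \<open>finite (carrier G)\<close> props(4) one_gr)
 have f_nz: "f g ~= \<zero>\<^sub>A" if g: "g \<in> carrier G" for g
 proof
  assume z: "f g = \<zero>\<^sub>A"
  obtain x where x: "x \<in> gr g" "x ~= \<zero>\<^sub>A" using GG.inner_faithful_support[OF props(2,5) g] by blast
  then obtain y where "y \<in> gr \<one>\<^sub>G" "x = f g \<otimes>\<^sub>A y" using f_gr g by blast
  then show False using x(2) GG.Gd.W_carrier[OF GG.G.one_closed] by (simp add: z)
 qed
 interpret DR: dual_reflection_data K A Adeg G gr f
 proof (intro dual_reflection_data.intro dual_reflection_data_axioms.intro)
  show "group_graded_algebra K A Adeg G gr" by (rule GG.group_graded_algebra_axioms)
  show "f g ~= \<zero>\<^sub>A" if "g \<in> carrier G" for g by (rule f_nz[OF that])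
  show "\<exists>i. f g \<in> Adeg i" if "g \<in> carrier G" for g using f_hom that by blast
  show "gr g = {f g \<otimes>\<^sub>A x | x. x \<in> gr \<one>\<^sub>G}" if "g \<in> carrier G" for g using f_gr that by blast
  show "gr g = {x \<otimes>\<^sub>A f g | x. x \<in> gr \<one>\<^sub>G}" if "g \<in> carrier G" for g using f_gr that by blast
 qed (rule props(2) f_one cB)+
 obtain d' a u where dau: "inj_dim A (regular_module A) = enat d'" "u \<in> carrier (Ext_trivial_G K A Adeg G gr d' (a, m))"
   "u ~= zero (Ext_trivial_G K A Adeg G gr d' (a, m))" and D: "D \<in> carrier G"
  using \<open>homological_codeterminant K A Adeg G gr D\<close> unfolding homological_codeterminant_def Let_def \<open>m = inv\<^bsub>G\<^esub> D\<close> by blast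
 have "inj_dim A (regular_module A) = enat d" using GA unfolding AS_Gorenstein_def by blast
 then have dd: "d' = d" using dau(1) by simp
 have mG: "m \<in> carrier G" using D \<open>m = inv\<^bsub>G\<^esub> D\<close> by simp
 have ExtA: "carrier (Ext_trivial K A Adeg i j) = {zero (Ext_trivial K A Adeg i j)}" if "i ~= d" for i j
  using GA that unfolding AS_Gorenstein_def by blast
 \<comment> \<open>If the injective dimensions of A and B differed, Ext^d(K,B) would vanish in all degrees, and then s may be any integer.\<close>
 define s where "s = (if d = dB then - lB else 0)"
 have ExtB: "carrier (Ext_trivial K DR.BB DR.Bdeg d j) = {zero (Ext_trivial K DR.BB DR.Bdeg d j)}" if j: "j ~= s" for j
 proof (cases "d = dB")
  case False
  then show ?thesis using GB unfolding AS_Gorenstein_def by blast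
 next
  case True
  have "vs_iso K (Ext_trivial K DR.BB DR.Bdeg d j) (shifted_field K lB j)" using GB unfolding True AS_Gorenstein_def by blast
  then obtain h where h: "bij_betw h (carrier (Ext_trivial K DR.BB DR.Bdeg d j)) (carrier (shifted_field K lB j))" unfolding vs_iso_def by blast
  have "lB + j ~= 0" using j True by (simp add: s_def)
  then have "carrier (shifted_field K lB j) = {\<zero>\<^sub>K}" by (simp add: shifted_field_def concentrated_def)
  then show ?thesis using h unfolding bij_betw_def inj_on_def by (intro DR.Ext_fixed_trivial) (metis imageI singletonD)
 qed
 have pair: "a - int (DR.dg g) - int (DR.dg (inv\<^bsub>G\<^esub> g \<otimes>\<^sub>G m)) = s" if "g \<in> carrier G" for g
  by (rule DR.degree_pairing[OF ExtA ExtB mG _ that]) (use dau(2,3) in \<open>auto simp: dd\<close>)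
 interpret PR: paired_reflection_data K A Adeg G gr f m
 proof (intro paired_reflection_data.intro paired_reflection_data_axioms.intro)
  show "DR.dg g + DR.dg (inv\<^bsub>G\<^esub> g \<otimes>\<^sub>G m) = DR.dg m" if "g \<in> carrier G" for g
   using pair[OF that] pair[OF GG.G.one_closed] mG by (simp add: DR.dg_one)
 qed (rule DR.dual_reflection_data_axioms mG)+
 have "left_noetherian A" using props(1) unfolding nc_noetherian_def by (rule conjunct1)
 from PR.covariant_ring_structure[OF this props(3) R_gen(1) R_A1] show ?thesis unfolding C_def Cdeg_def fbar_def .
qed

end
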